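(* Let $n\ge2$ and $\boldsymbol\lambda\in\mathbb C^n$ with $\sum_l\lambda_l=0$. For all $z\in\mathbb U$, $$H^\pm(z;\boldsymbol\lambda)=n^{-\frac12}(\pm2\pi i)^{\frac{n-1}2}J(z;\boldsymbol\lambda;\pm1),$$ and $B_m(\boldsymbol\lambda;\pm1)=(\pm i)^{-m}B_m(\boldsymbol\lambda)$ for all $m\ge0$.
   Context: Notation: $e(w)=e^{2\pi iw}$, $\mathbb N=\{0,1,\dots\}$, $(\pm2\pi i)^a=(2\pi)^ae^{\pm\frac12\pi ia}$. $\mathbb U$ is the universal cover of $\mathbb C\smallsetminus\{0\}$, with elements $z=|z|e^{i\arg z}$, $\arg z\in\mathbb R$, $z^a=e^{a\log z}$; $\mathbb R_+\subset\mathbb U$ is $\{\arg z=0\}$. Here $\arg1=0$, $\arg(-1)=\pi$. Upper and lower signs are read simultaneously. $H$-Bessel functions: for $x>0$, $H^\pm(x;\boldsymbol\lambda)=\frac1{2\pi i}\int_{\mathcal C}\prod_{l=1}^n\Gamma(s-\lambda_l)e\big(\pm\frac{s-\lambda_l}4\big)x^{-ns}ds$, where $\mathcal C$ is any contour going upward from $\sigma-i\infty$ to $\sigma+i\infty$ with $\sigma<\frac12+\frac1n(\mathrm{Re}\sum_l\lambda_l-1)$, with all the sets $\lambda_l-\mathbb N$ on its left and $\mathrm{Re}\,s=\sigma$ for $|\mathrm{Im}\,s|$ large on $\mathcal C$. $H^\pm(z;\boldsymbol\lambda)$ denotes the analytic continuation to $\mathbb U$. Bessel equation of index $\boldsymbol\lambda$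 and sign $\varsigma$: $$\sum_{j=1}^nV_{n,j}(\boldsymbol\lambda)z^jw^{(j)}+\big(V_{n,0}(\boldsymbol\lambda)-\varsigma(in)^nz^n\big)w=0,\qquad V_{n,j}(\boldsymbol\lambda)=\sum_{m=0}^{n-j}A_{j,n-j-m}\,n^m\sigma_m(\boldsymbol\lambda),$$ $\sigma_m$ the $m$-th elementary symmetric polynomial, $A_{0,0}=1$, $A_{0,m}=0$ ($m\ge1$), $A_{j,m}=\sum_{r=1}^j\frac{(-1)^{j-r}r^{m+j}}{r!(j-r)!}$ ($j\ge1,m\ge0$). For $\xi=\pm1$ there is a unique sequence of symmetric polynomials $B_m(\boldsymbol\lambda;\xi)$ with $B_0=1$ such that $\widehat J(z;\boldsymbol\lambda;\xi)=e^{in\xi z}z^{-\frac{n-1}2}\sum_{m\ge0}B_m(\boldsymbol\lambda;\xi)z^{-m}$ is a formal solution of the Bessel equation of sign $\xi^n$. $J(z;\boldsymbol\lambda;\xi)$ is the unique solution of that equation on $\mathbb U$ having $\widehat J(z;\boldsymbol\lambda;\xi)$ as its asymptotic expansion on $\{z\in\mathbb U:|\arg z-(\frac\pi2-\arg\xi)|<\frac\pi n\}$, i.e. on $|\arg z\mp\frac\pi2|<\frac\pi n$ for $\xi=\pm1$. The polynomials $B_m(\boldsymbol\lambda)$: put $d=n-1$, $\nu_l=\lambda_l-\lambda_{d+1}$, $\boldsymbol t_0=(1,\dots,1)\in\mathbb R^d$, $p_{\boldsymbol\nu}(\boldsymbol t)=\prod_{l=1}^dt_l^{\nu_l-1}$,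 $$G(\boldsymbol t)=t_1\cdots t_d+\sum_{l=1}^d\big(-t_l^2+(d+1)t_l+t_l^{-1}\big)-\sum_{1\le l<k\le d}t_lt_k-\frac{(d+1)(d+2)}2,\quad \mathcal L=d\sum_{l=1}^d\partial_l^2-2\sum_{1\le l<k\le d}\partial_l\partial_k,$$ $$B_m(\boldsymbol\lambda)=\sum_{r=0}^{2m}\frac{(-1)^{m+r}\mathcal L^{m+r}(G^rp_{\boldsymbol\nu})(\boldsymbol t_0)}{(2(d+1))^{m+r}(m+r)!\,r!}.$$ *)

theory Defs
  imports "HOL-Complex_Analysis.Complex_Analysis"
begin

text \<open>
  Vectors of length \<open>n\<close> are functions on \<open>nat\<close> of which only the values at \<open>1, \<dots>, n\<close> are used.
  The sign in \<open>H\<^sup>\<plusminus>\<close>, \<open>(\<plusminus>2\<pi>i)\<^sup>a\<close>, \<dots> is a complex number \<open>\<xi> \<in> {1, -1}\<close>.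

  The universal cover \<open>U\<close> of \<open>\<complex> - {0}\<close> is realised as the complex plane with covering map \<open>exp\<close>:
  a point \<open>z\<close> of \<open>U\<close> is given by its logarithm \<open>\<zeta> = log z = ln |z| + i arg z\<close>.
\<close>

type_synonym ucover = complex

definition cover_proj :: "ucover \<Rightarrow> complex" where
  "cover_proj \<zeta> = exp \<zeta>"

definition uabs :: "ucover \<Rightarrow> real" where
  "uabs \<zeta> = exp (Re \<zeta>)"

definition uarg :: "ucover \<Rightarrow> real" where
  "uarg \<zeta> = Im \<zeta>"

definition upow :: "ucover \<Rightarrow> complex \<Rightarrow> complex" where
  "upow \<zeta> a = exp (a * \<zeta>)"

definition ureal :: "real \<Rightarrow> ucover" where
  "ureal x = of_real (ln x)"

text \<open>\<open>d/dz = (1/z) d/d\<zeta>\<close>.\<close>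

definition uderiv :: "(ucover \<Rightarrow> complex) \<Rightarrow> ucover \<Rightarrow> complex" where
  "uderiv w \<zeta> = deriv w \<zeta> / cover_proj \<zeta>"

definition e :: "complex \<Rightarrow> complex" where
  "e w = exp (2 * of_real pi * \<i> * w)"

definition two_pi_i_pow :: "complex \<Rightarrow> real \<Rightarrow> complex" where
  "two_pi_i_pow \<xi> a = of_real ((2 * pi) powr a) * exp (\<xi> * of_real (pi * a / 2) * \<i>)"


subsection \<open>The H-Bessel functions\<close>

text \<open>
  A contour consists of the two vertical rays \<open>Re s = \<sigma>\<close>, \<open>|Im s| \<ge> T\<close>, and a simple piecewise
  \<open>C\<^sup>1\<close> path \<open>g\<close> joining \<open>\<sigma> - iT\<close> to \<open>\<sigma> + iT\<close> that meets the rays only in its end points.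
\<close>

definition vertical_rays :: "real \<Rightarrow> real \<Rightarrow> complex set" where
  "vertical_rays \<sigma> T = {s. Re s = \<sigma> \<and> \<bar>Im s\<bar> \<ge> T}"

text \<open>The component to the left of an upward contour \<open>C\<close> contains the far end of the negative real axis.\<close>

definition left_of :: "complex set \<Rightarrow> complex \<Rightarrow> bool" where
  "left_of C p \<longleftrightarrow> (\<exists>R. \<forall>r<R. connected_component (- C) p (of_real r))"

definition H_contour :: "nat \<Rightarrow> (nat \<Rightarrow> complex) \<Rightarrow> real \<Rightarrow> real \<Rightarrow> (real \<Rightarrow> complex) \<Rightarrow> bool" where
  "H_contour n lam \<sigma> T g \<longleftrightarrow>
     \<sigma> < 1 / 2 + (Re (\<Sum>l=1..n. lam l) - 1) / real n \<and> T > 0 \<and>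
     valid_path g \<and> arc g \<and> pathstart g = Complex \<sigma> (- T) \<and> pathfinish g = Complex \<sigma> T \<and>
     path_image g \<inter> vertical_rays \<sigma> T = {pathstart g, pathfinish g} \<and>
     (\<forall>l\<in>{1..n}. \<forall>k::nat. left_of (path_image g \<union> vertical_rays \<sigma> T) (lam l - of_nat k))"

definition H_integrand :: "complex \<Rightarrow> nat \<Rightarrow> (nat \<Rightarrow> complex) \<Rightarrow> real \<Rightarrow> complex \<Rightarrow> complex" where
  "H_integrand \<xi> n lam x s =
     (\<Prod>l=1..n. Gamma (s - lam l) * e (\<xi> * ((s - lam l) / 4))) * of_real x powr (- (of_nat n * s))"

definition contour_line_integral ::
    "real \<Rightarrow> real \<Rightarrow> (real \<Rightarrow> complex) \<Rightarrow> (complex \<Rightarrow> complex) \<Rightarrow> complex" where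
  "contour_line_integral \<sigma> T g f =
     set_lebesgue_integral lborel {..- T} (\<lambda>t. f (Complex \<sigma> t) * \<i>)
     + contour_integral g f
     + set_lebesgue_integral lborel {T..} (\<lambda>t. f (Complex \<sigma> t) * \<i>)"

definition H_Bessel_pos :: "complex \<Rightarrow> nat \<Rightarrow> (nat \<Rightarrow> complex) \<Rightarrow> real \<Rightarrow> complex" where
  "H_Bessel_pos \<xi> n lam x =
     (THE h. \<forall>\<sigma> T g. H_contour n lam \<sigma> T g \<longrightarrow>
        h = 1 / (2 * of_real pi * \<i>) * contour_line_integral \<sigma> T g (H_integrand \<xi> n lam x))"

definition H_Bessel :: "complex \<Rightarrow> nat \<Rightarrow> (nat \<Rightarrow> complex) \<Rightarrow> ucover \<Rightarrow> complex" where
  "H_Bessel \<xi> n lam =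
     (THE F. F holomorphic_on UNIV \<and> (\<forall>x>0. F (ureal x) = H_Bessel_pos \<xi> n lam x))"


subsection \<open>The Bessel equation\<close>

definition elem_sym :: "nat \<Rightarrow> nat \<Rightarrow> (nat \<Rightarrow> complex) \<Rightarrow> complex" where
  "elem_sym n m lam = (\<Sum>S | S \<subseteq> {1..n} \<and> card S = m. \<Prod>l\<in>S. lam l)"

definition A_coeff :: "nat \<Rightarrow> nat \<Rightarrow> complex" where
  "A_coeff j m =
     (if j = 0 then (if m = 0 then 1 else 0)
      else (\<Sum>r=1..j. (-1) ^ (j - r) * of_nat r ^ (m + j) / (fact r * fact (j - r))))"

definition V_coeff :: "nat \<Rightarrow> nat \<Rightarrow> (nat \<Rightarrow> complex) \<Rightarrow> complex" where
  "V_coeff n j lam = (\<Sum>m=0..n - j. A_coeff j (n - j - m) * of_nat n ^ m * elem_sym n m lam)"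

definition Bessel_solution :: "nat \<Rightarrow> complex \<Rightarrow> (nat \<Rightarrow> complex) \<Rightarrow> (ucover \<Rightarrow> complex) \<Rightarrow> bool" where
  "Bessel_solution n \<sigma> lam w \<longleftrightarrow> w holomorphic_on UNIV \<and>
     (\<forall>\<zeta>. (\<Sum>j=1..n. V_coeff n j lam * cover_proj \<zeta> ^ j * (uderiv ^^ j) w \<zeta>)
          + (V_coeff n 0 lam - \<sigma> * (\<i> * of_nat n) ^ n * cover_proj \<zeta> ^ n) * w \<zeta> = 0)"

text \<open>
  A Laurent series \<open>f\<close> in the variable \<open>X = 1/z\<close> stands for the formal expression
  \<open>exp(cz) z\<^sup>\<alpha> f(1/z)\<close>. Since \<open>d/dz = -X\<^sup>2 d/dX\<close>, its \<open>z\<close>-derivative is represented by the following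
  series; multiplication by \<open>z\<close> is multiplication by \<open>fls_X_inv\<close>.
\<close>

definition formal_deriv :: "complex \<Rightarrow> complex \<Rightarrow> complex fls \<Rightarrow> complex fls" where
  "formal_deriv c \<alpha> f = fls_const c * f + fls_const \<alpha> * fls_X * f - fls_X ^ 2 * fls_deriv f"

definition formal_Bessel_solution ::
    "nat \<Rightarrow> complex \<Rightarrow> (nat \<Rightarrow> complex) \<Rightarrow> complex \<Rightarrow> complex \<Rightarrow> complex fls \<Rightarrow> bool" where
  "formal_Bessel_solution n \<sigma> lam c \<alpha> f \<longleftrightarrow>
     (\<Sum>j=1..n. fls_const (V_coeff n j lam) * fls_X_inv ^ j * (formal_deriv c \<alpha> ^^ j) f)
     + (fls_const (V_coeff n 0 lam) - fls_const (\<sigma> * (\<i> * of_nat n) ^ n) * fls_X_inv ^ n) * f = 0"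

inductive polynomial_fun :: "nat \<Rightarrow> ((nat \<Rightarrow> complex) \<Rightarrow> complex) \<Rightarrow> bool" for n where
  const: "polynomial_fun n (\<lambda>lam. c)"
| var: "l \<in> {1..n} \<Longrightarrow> polynomial_fun n (\<lambda>lam. lam l)"
| add: "polynomial_fun n p \<Longrightarrow> polynomial_fun n q \<Longrightarrow> polynomial_fun n (\<lambda>lam. p lam + q lam)"
| mult: "polynomial_fun n p \<Longrightarrow> polynomial_fun n q \<Longrightarrow> polynomial_fun n (\<lambda>lam. p lam * q lam)"

definition symmetric_polynomial :: "nat \<Rightarrow> ((nat \<Rightarrow> complex) \<Rightarrow> complex) \<Rightarrow> bool" where
  "symmetric_polynomial n p \<longleftrightarrow> polynomial_fun n p \<and>
     (\<forall>\<pi> lam. \<pi> permutes {1..n} \<longrightarrow> p (lam \<circ> \<pi>) = p lam)"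

text \<open>
  Here \<open>\<lambda>\<close> ranges over the hyperplane \<open>\<lambda>\<^sub>1 + \<dots> + \<lambda>\<^sub>n = 0\<close> (off it the exponent \<open>-(n-1)/2\<close> is not
  the right one), so the polynomials are unique only as functions on that hyperplane. Hence the
  description determines the sequence of values at \<open>\<lambda>\<close> rather than polynomials on \<open>\<complex>\<^sup>n\<close>.
\<close>

definition B_sequence :: "nat \<Rightarrow> complex \<Rightarrow> (nat \<Rightarrow> (nat \<Rightarrow> complex) \<Rightarrow> complex) \<Rightarrow> bool" where
  "B_sequence n \<xi> B \<longleftrightarrow>
     (\<forall>m. symmetric_polynomial n (B m)) \<and> B 0 = (\<lambda>lam. 1) \<and>
     (\<forall>lam. (\<Sum>l=1..n. lam l) = 0 \<longrightarrow>
        formal_Bessel_solution n (\<xi> ^ n) lam (\<i> * of_nat n * \<xi>) (- (of_nat n - 1) / 2)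
          (fps_to_fls (Abs_fps (\<lambda>m. B m lam))))"

definition B_asym :: "nat \<Rightarrow> (nat \<Rightarrow> complex) \<Rightarrow> complex \<Rightarrow> nat \<Rightarrow> complex" where
  "B_asym n lam \<xi> = (THE b. \<exists>B. B_sequence n \<xi> B \<and> b = (\<lambda>m. B m lam))"

text \<open>
  \<open>w\<close> has the asymptotic expansion \<open>exp(cz) z\<^sup>\<alpha> \<Sum> b\<^sub>m z\<^bsup>-m\<^esup>\<close> on the open sector
  \<open>|arg z - \<theta>| < \<rho>\<close>, i.e. as \<open>|z| \<rightarrow> \<infinity>\<close>, uniformly on each closed subsector.
\<close>

definition has_asymptotic_expansion ::
    "(ucover \<Rightarrow> complex) \<Rightarrow> complex \<Rightarrow> complex \<Rightarrow> (nat \<Rightarrow> complex) \<Rightarrow> real \<Rightarrow> real \<Rightarrow> bool" where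
  "has_asymptotic_expansion w c \<alpha> b \<theta> \<rho> \<longleftrightarrow>
     (\<forall>M \<rho>'. 0 < \<rho>' \<and> \<rho>' < \<rho> \<longrightarrow>
       (\<exists>K R. \<forall>\<zeta>. \<bar>uarg \<zeta> - \<theta>\<bar> \<le> \<rho>' \<and> uabs \<zeta> \<ge> R \<longrightarrow>
          cmod (w \<zeta> / (exp (c * cover_proj \<zeta>) * upow \<zeta> \<alpha>) - (\<Sum>m<M. b m * upow \<zeta> (- of_nat m)))
            \<le> K * uabs \<zeta> powr (- real M)))"

definition J_Bessel :: "nat \<Rightarrow> (nat \<Rightarrow> complex) \<Rightarrow> complex \<Rightarrow> ucover \<Rightarrow> complex" where
  "J_Bessel n lam \<xi> =
     (THE w. Bessel_solution n (\<xi> ^ n) lam w \<and>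
        has_asymptotic_expansion w (\<i> * of_nat n * \<xi>) (- (of_nat n - 1) / 2) (B_asym n lam \<xi>)
          (pi / 2 - Arg \<xi>) (pi / real n))"


subsection \<open>The explicit polynomials\<close>

definition partial_deriv :: "nat \<Rightarrow> ((nat \<Rightarrow> real) \<Rightarrow> complex) \<Rightarrow> (nat \<Rightarrow> real) \<Rightarrow> complex" where
  "partial_deriv l f t = vector_derivative (\<lambda>x. f (t(l := x))) (at (t l))"

definition G_fun :: "nat \<Rightarrow> (nat \<Rightarrow> real) \<Rightarrow> real" where
  "G_fun d t = (\<Prod>l=1..d. t l) + (\<Sum>l=1..d. - (t l)\<^sup>2 + (real d + 1) * t l + inverse (t l))
     - (\<Sum>k=1..d. \<Sum>l\<in>{1..<k}. t l * t k) - (real d + 1) * (real d + 2) / 2"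

definition p_fun :: "nat \<Rightarrow> (nat \<Rightarrow> complex) \<Rightarrow> (nat \<Rightarrow> real) \<Rightarrow> complex" where
  "p_fun d \<nu> t = (\<Prod>l=1..d. of_real (t l) powr (\<nu> l - 1))"

definition L_op :: "nat \<Rightarrow> ((nat \<Rightarrow> real) \<Rightarrow> complex) \<Rightarrow> (nat \<Rightarrow> real) \<Rightarrow> complex" where
  "L_op d f t = of_nat d * (\<Sum>l=1..d. partial_deriv l (partial_deriv l f) t)
     - 2 * (\<Sum>k=1..d. \<Sum>l\<in>{1..<k}. partial_deriv l (partial_deriv k f) t)"

definition B_poly :: "nat \<Rightarrow> (nat \<Rightarrow> complex) \<Rightarrow> nat \<Rightarrow> complex" where
  "B_poly n lam m =
     (let d = n - 1; \<nu> = (\<lambda>l. lam l - lam (d + 1)) in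
      \<Sum>r=0..2 * m. (-1) ^ (m + r)
          * (L_op d ^^ (m + r)) (\<lambda>t. of_real (G_fun d t) ^ r * p_fun d \<nu> t) (\<lambda>_. 1)
          / ((2 * (of_nat d + 1)) ^ (m + r) * fact (m + r) * fact r))"

end

theory Submission
  imports Defs "HOL-Probability.Probability" "HOL-Real_Asymp.Real_Asymp"
begin

text \<open>
  In the coordinate \<open>\<omega> = log (z / (\<plusminus>i))\<close> the function \<open>H\<^sup>\<plusminus>\<close> is the Mellin--Barnes integral
  \<open>K(\<omega>) = 1/(2\<pi>i) \<integral> \<Prod> \<Gamma>(s - \<lambda>\<^sub>l) exp(-ns\<omega>) ds\<close>. For \<open>|Im \<omega>| < \<pi>/2\<close> the integrand decays exponentially,
  so the contour may be moved to a vertical line to the right of all poles, and the functional equation of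
  \<open>\<Gamma>\<close> becomes the Bessel equation for \<open>K\<close>. This equation extends \<open>K\<close> to an entire function of \<open>\<omega>\<close>; the values
  on \<open>|Im \<omega>| = \<pi>/2\<close>, where \<open>z\<close> is real, are obtained by continuity.
  The Cahen--Mellin integral writes \<open>K\<close> as an iterated convolution of functions \<open>exp(-exp \<eta> - \<lambda>\<eta>)\<close>. Rescaled at the
  saddle point, the convolution factors are dominated by \<open>exp(-|y|/2)\<close> and tend to Gaussians; this bounds
  \<open>K(\<omega>) exp(n exp \<omega>) exp((n-1)\<omega>/2)\<close> on closed substrips and gives its limit on the real axis, which is the
  constant of the theorem. By Cauchy's estimates a bounded solution with a limit automatically has the full
  expansion prescribed by the recursion of the formal solution, and an energy estimate along the ray where
  the exponential factor is most recessive shows that the expansion determines the solution.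
  Finally, \<open>B\<^sub>m(\<lambda>)\<close> is the \<open>m\<close>-th coefficient of the formal Laplace expansion of
  \<open>\<integral> exp(-x(t\<^sub>1 \<cdots> t\<^sub>d + \<Sum> 1/t\<^sub>l)) p\<^sub>\<nu>(t) dt\<close> at \<open>(1, \<dots>, 1)\<close>; formal integration by parts
  shows that this series satisfies the Bessel equation, hence the same recursion.
\<close>

section \<open>Vertical decay of products of Gamma functions\<close>

text \<open>Where z is real, the growth of \<open>exp (- (s * (of_nat n * \<omega>)))\<close> on one
  ray cancels the decay of the Gamma product, and only the power |t|^(n(sigma - 1/2)) is left. The
  condition on sigma makes it integrable but leaves no room to differentiate under the integral,
  hence the detour through limits of an entire function. The sector |arg z -+ pi/2| < pi/n becomes
  |Im omega| < pi/n, and n >= 2 puts it inside the strip |Im omega| < pi/2 of exponential decay.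
  Origin of the constant: n copies of sqrt(2 pi) N(0,1) convolve to (2 pi)^(n/2) N(0,n), whose value
  at 0 is (2 pi)^((n-1)/2) n^(-1/2); the phase of (+-2 pi i)^((n-1)/2) is what z^(-(n-1)/2) picks up
  under the rotation by +-pi/2. Operators are written as polynomials in z d/dz, where the Bessel
  operator splits into the factors z d/dz + n lambda_l. Expanding these against e^(cz) z^alpha gives
  one family, \<open>Q_poly\<close>, that governs formal series, actual functions and remainders
  alike. The zero sum of the lambda_l and alpha = -(n-1)/2 make its index 1 member vanish at 0, so
  each coefficient follows from the earlier ones.\<close>

text \<open>\<open>x / (x\<^sup>2 + t\<^sup>2)\<close> is the derivative of
  \<open>ln (x\<^sup>2 + t\<^sup>2) / 2\<close>, so this is the error of one Riemann step. A mean
  value point turns it into a difference of two values of the derivative. Along x, x + 1, ... the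
  errors are summable, uniformly in |t| >= 1.\<close>

lemma log_sum_step:
  fixes x t :: real
  assumes "x \<ge> 0" "t \<noteq> 0"
  shows "\<bar>ln ((x + 1)\<^sup>2 + t\<^sup>2) / 2 - ln (x\<^sup>2 + t\<^sup>2) / 2 - x / (x\<^sup>2 + t\<^sup>2)\<bar> \<le> 1 / (x\<^sup>2 + t\<^sup>2)"
proof -
  have pos: "y\<^sup>2 + t\<^sup>2 > 0" for y :: real
    using assms by (simp add: sum_power2_gt_zero_iff)
  have ne: "y\<^sup>2 + t\<^sup>2 \<noteq> 0" for y :: real
    using pos[of y] by (metis less_irrefl)
  have der: "((\<lambda>y. ln (y\<^sup>2 + t\<^sup>2) / 2) has_real_derivative y / (y\<^sup>2 + t\<^sup>2)) (at y)" for y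
  proof -
    have 1: "((\<lambda>y. y\<^sup>2 + t\<^sup>2) has_real_derivative 2 * y) (at y)"
      by (auto intro!: derivative_eq_intros)
    have 2: "1 / D * (2 * y) / 2 = y / D" for D :: real by simp
    show ?thesis
      using DERIV_cdivide[OF DERIV_chain2[where f = ln and g = "\<lambda>y. y\<^sup>2 + t\<^sup>2" and x = y, OF DERIV_ln_divide[OF pos] 1], of 2]
      unfolding 2 .
  qed
  obtain y where y: "x < y" "y < x + 1"
    "ln ((x + 1)\<^sup>2 + t\<^sup>2) / 2 - ln (x\<^sup>2 + t\<^sup>2) / 2 = (x + 1 - x) * (y / (y\<^sup>2 + t\<^sup>2))"
    using MVT2[of x "x + 1" "\<lambda>y. ln (y\<^sup>2 + t\<^sup>2) / 2" "\<lambda>y. y / (y\<^sup>2 + t\<^sup>2)"] der by auto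
  have "y / (y\<^sup>2 + t\<^sup>2) - x / (x\<^sup>2 + t\<^sup>2) = (y - x) * (t\<^sup>2 - x * y) / ((y\<^sup>2 + t\<^sup>2) * (x\<^sup>2 + t\<^sup>2))"
    using ne[of x] ne[of y] by (simp add: divide_simps del: sum_power2_eq_zero_iff) (simp add: algebra_simps power2_eq_square)
  also have "\<bar>\<dots>\<bar> = (y - x) * \<bar>t\<^sup>2 - x * y\<bar> / ((y\<^sup>2 + t\<^sup>2) * (x\<^sup>2 + t\<^sup>2))"
    using pos[of x] pos[of y] y by (simp add: abs_mult)
  also have "\<dots> \<le> 1 * (y\<^sup>2 + t\<^sup>2) / ((y\<^sup>2 + t\<^sup>2) * (x\<^sup>2 + t\<^sup>2))"
  proof (intro divide_right_mono mult_mono)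
    have "x * y \<le> y\<^sup>2" "0 \<le> x * y"
      using y assms by (auto simp: power2_eq_square intro!: mult_right_mono)
    then show "\<bar>t\<^sup>2 - x * y\<bar> \<le> y\<^sup>2 + t\<^sup>2" by (auto simp: abs_le_iff) (smt (verit) zero_le_power2)+
  qed (use y pos[of x] pos[of y] in auto)
  finally show ?thesis using y ne[of x] ne[of y] by (simp del: sum_power2_eq_zero_iff)
qed

definition inv_sq_sum :: real where "inv_sq_sum = (\<Sum>k. 1 / ((real k)\<^sup>2 + 1))"

lemma summable_inv_sq: "summable (\<lambda>k. 1 / ((real k)\<^sup>2 + 1))"
proof (rule summable_comparison_test_ev)
  show "summable (\<lambda>k. 1 / real k ^ 2)"
    using inverse_power_summable[of 2, where ?'a = real] by (simp add: inverse_eq_divide)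
  show "\<forall>\<^sub>F k in sequentially. norm (1 / ((real k)\<^sup>2 + 1)) \<le> 1 / real k ^ 2"
    using eventually_gt_at_top[of "0::nat"] by eventually_elim (auto simp: frac_le)
qed

text \<open>The real part of the limit formula for \<open>Digamma\<close> is a logarithm minus a sum
  of the terms in \<open>log_sum_step\<close>. Comparison with a telescoping sum leaves ln |z| with
  a bounded error, and (Re z)^2 pays for replacing |z| by |Im z|.\<close>

lemma Re_Digamma_bound:
  assumes "0 \<le> Re z" "\<bar>Im z\<bar> \<ge> 1"
  shows "\<bar>Re (Digamma z) - ln \<bar>Im z\<bar>\<bar> \<le> inv_sq_sum + (Re z)\<^sup>2"
proof -
  define x t where "x = Re z" and "t = Im z"
  have x: "x \<ge> 0" and t: "\<bar>t\<bar> \<ge> 1" using assms by (auto simp: x_def t_def)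
  hence t2: "t\<^sup>2 \<ge> 1" using abs_le_square_iff[of 1 t] by simp
  have z0: "z \<noteq> 0" using assms by auto
  define g where "g = (\<lambda>y::real. ln ((x + y)\<^sup>2 + t\<^sup>2) / 2)"
  define u where "u = (\<lambda>m. ln (real m) - (\<Sum>k<m. (x + real k) / ((x + real k)\<^sup>2 + t\<^sup>2)))"
  have "(\<lambda>m. Re (of_real (ln (real m)) - (\<Sum>n<m. inverse (z + of_nat n)))) \<longlonglongrightarrow> Re (Digamma z)"
    by (intro tendsto_Re Digamma_LIMSEQ z0)
  moreover have "Re (inverse (z + of_nat n)) = (x + real n) / ((x + real n)\<^sup>2 + t\<^sup>2)" for n
    by (simp add: x_def t_def)
  ultimately have lim1: "u \<longlonglongrightarrow> Re (Digamma z)" by (simp add: u_def)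
  have est: "\<bar>u m - (ln (real m) - g (real m)) - g 0\<bar> \<le> inv_sq_sum" for m
  proof -
    have tel: "g (real m) - g 0 = (\<Sum>k<m. g (real (Suc k)) - g (real k))"
      by (subst sum_lessThan_telescope) simp
    have "u m - (ln (real m) - g (real m)) - g 0
        = (\<Sum>k<m. (g (real (Suc k)) - g (real k)) - (x + real k) / ((x + real k)\<^sup>2 + t\<^sup>2))"
      using tel by (simp add: u_def sum_subtractf)
    also have "\<bar>\<dots>\<bar> \<le> (\<Sum>k<m. 1 / ((real k)\<^sup>2 + 1))"
    proof (rule order_trans[OF sum_abs], rule sum_mono)
      fix k
      have "\<bar>(g (real (Suc k)) - g (real k)) - (x + real k) / ((x + real k)\<^sup>2 + t\<^sup>2)\<bar>
          \<le> 1 / ((x + real k)\<^sup>2 + t\<^sup>2)"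
        using log_sum_step[of "x + real k" t] x t by (simp add: g_def add_ac)
      also have "\<dots> \<le> 1 / ((real k)\<^sup>2 + 1)"
        using x t2 by (intro frac_le add_mono power_mono) (auto intro: add_nonneg_pos)
      finally show "\<bar>(g (real (Suc k)) - g (real k)) - (x + real k) / ((x + real k)\<^sup>2 + t\<^sup>2)\<bar>
          \<le> 1 / ((real k)\<^sup>2 + 1)" .
    qed
    also have "\<dots> \<le> inv_sq_sum"
      unfolding inv_sq_sum_def by (intro sum_le_suminf summable_inv_sq) auto
    finally show ?thesis .
  qed
  have "((\<lambda>y::real. ln y - ln ((x + y)\<^sup>2 + t\<^sup>2) / 2) \<longlongrightarrow> 0) at_top"
    by real_asymp
  hence "(\<lambda>m. ln (real m) - g (real m)) \<longlonglongrightarrow> 0"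
    unfolding g_def by (rule filterlim_compose[OF _ filterlim_real_sequentially])
  hence "(\<lambda>m. \<bar>u m - (ln (real m) - g (real m)) - g 0\<bar>) \<longlonglongrightarrow> \<bar>Re (Digamma z) - 0 - g 0\<bar>"
    by (intro tendsto_intros lim1)
  hence A: "\<bar>Re (Digamma z) - g 0\<bar> \<le> inv_sq_sum"
    using est by (intro tendsto_upperbound[of _ _ sequentially]) auto
  have "t\<^sup>2 * (1 + x\<^sup>2 / t\<^sup>2) = x\<^sup>2 + t\<^sup>2" using t by (auto simp: distrib_left)
  hence "g 0 = ln (t\<^sup>2 * (1 + x\<^sup>2 / t\<^sup>2)) / 2" by (simp add: g_def)
  also have "\<dots> = ln (t\<^sup>2) / 2 + ln (1 + x\<^sup>2 / t\<^sup>2) / 2" using t2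
    by (subst ln_mult_pos) (auto simp: add_pos_nonneg add_divide_distrib)
  also have "ln (t\<^sup>2) / 2 = ln \<bar>t\<bar>" using t by (subst power2_abs[symmetric], subst ln_realpow) auto
  finally have "g 0 - ln \<bar>t\<bar> = ln (1 + x\<^sup>2 / t\<^sup>2) / 2" by simp
  moreover have "ln (1 + x\<^sup>2 / t\<^sup>2) \<le> x\<^sup>2" "ln (1 + x\<^sup>2 / t\<^sup>2) \<ge> 0"
  proof -
    have "ln (1 + x\<^sup>2 / t\<^sup>2) \<le> x\<^sup>2 / t\<^sup>2" by (rule ln_add_one_self_le_self) simp
    also have "\<dots> \<le> x\<^sup>2 / 1" using t2 by (intro divide_left_mono) auto
    also have "\<dots> = x\<^sup>2" by simp
    finally show "ln (1 + x\<^sup>2 / t\<^sup>2) \<le> x\<^sup>2" .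
  qed auto
  ultimately have "\<bar>g 0 - ln \<bar>t\<bar>\<bar> \<le> x\<^sup>2" by (smt (verit) field_sum_of_halves)
  with A show ?thesis unfolding x_def t_def by linarith
qed

text \<open>On Re z = 1/2 one has 1 - z = cnj z, so the reflection formula gives |Gamma z|^2 = pi /
  cosh(pi t) exactly.\<close>

lemma Gamma_half_line_bound:
  "cmod (Gamma (Complex (1/2) t)) \<le> sqrt (2 * pi) * exp (- pi * \<bar>t\<bar> / 2)"
proof -
  define z where "z = Complex (1/2) t"
  have cz: "1 - z = cnj z" by (simp add: z_def complex_eq_iff)
  have "cmod (Gamma z) ^ 2 = cmod (Gamma z * Gamma (1 - z))"
    by (simp add: cz norm_mult power2_eq_square flip: cnj_Gamma)
  also have "\<dots> = cmod (of_real pi / sin (of_real pi * z))" by (simp add: Gamma_reflection_complex)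
  also have "of_real pi * z = of_real (pi / 2) + \<i> * of_real (pi * t)"
    by (simp add: z_def complex_eq_iff)
  also have "sin (of_real (pi / 2) + \<i> * of_real (pi * t)) = cos (\<i> * of_real (pi * t))"
    by (simp add: sin_add flip: sin_of_real cos_of_real)
  also have "cos (\<i> * of_real (pi * t)) = of_real (cosh (pi * t))"
    by (simp add: cos_conv_cosh cosh_def exp_minus scaleR_conv_of_real flip: exp_of_real of_real_minus)
  finally have eq: "cmod (Gamma z) ^ 2 = pi / cosh (pi * t)" by (simp add: norm_divide)
  have "exp (pi * \<bar>t\<bar>) \<le> 2 * cosh (pi * t)"
    by (cases "t \<ge> 0") (auto simp: cosh_def)
  hence "pi / cosh (pi * t) \<le> 2 * pi * exp (- (pi * \<bar>t\<bar>))"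
    by (simp add: field_simps exp_minus cosh_real_pos)
  also have "\<dots> = (sqrt (2 * pi) * exp (- pi * \<bar>t\<bar> / 2)) ^ 2"
    by (simp add: power_mult_distrib flip: exp_double)
  finally have "cmod (Gamma z) ^ 2 \<le> (sqrt (2 * pi) * exp (- pi * \<bar>t\<bar> / 2)) ^ 2" using eq by simp
  thus ?thesis unfolding z_def by (rule power2_le_imp_le) simp
qed

text \<open>Horizontal transport from Re s = 1/2: the x-derivative of ln |Gamma(x + it)| - (x - 1/2)
  ln |t| is Re Digamma - ln |t|, bounded uniformly in t, so over a bounded strip only a constant
  factor is lost.\<close>

lemma Gamma_right_strip_bound:
  assumes "0 \<le> b"
  shows "\<exists>C>0. \<forall>s. 0 \<le> Re s \<and> Re s \<le> b \<and> \<bar>Im s\<bar> \<ge> 1 \<longrightarrow>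
           cmod (Gamma s) \<le> C * \<bar>Im s\<bar> powr (Re s - 1/2) * exp (- pi * \<bar>Im s\<bar> / 2)"
proof (intro exI conjI allI impI)
  define D where "D = inv_sq_sum + (b + 1)\<^sup>2"
  define C where "C = sqrt (2 * pi) * exp (D * (b + 1))"
  show "C > 0" by (simp add: C_def)
  have "inv_sq_sum \<ge> 0" unfolding inv_sq_sum_def by (intro suminf_nonneg summable_inv_sq) auto
  hence D0: "D \<ge> 0" by (simp add: D_def)
  fix s assume s: "0 \<le> Re s \<and> Re s \<le> b \<and> \<bar>Im s\<bar> \<ge> 1"
  define t where "t = Im s"
  define f where "f = (\<lambda>x. Re (ln_Gamma (Complex x t)) - (x - 1/2) * ln \<bar>t\<bar>)"
  have t: "t \<noteq> 0" "\<bar>t\<bar> \<ge> 1" using s by (auto simp: t_def)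
  have nn: "Complex x t \<notin> \<real>\<^sub>\<le>\<^sub>0" "Complex x t \<notin> \<int>\<^sub>\<le>\<^sub>0" for x
    using t by (auto simp: complex_nonpos_Reals_iff elim!: nonpos_Ints_cases simp: complex_eq_iff)
  have der: "(f has_real_derivative (Re (Digamma (Complex x t)) - ln \<bar>t\<bar>)) (at x)" for x
  proof -
    have "((\<lambda>z. ln_Gamma (z + \<i> * of_real t)) has_field_derivative Digamma (of_real x + \<i> * of_real t)) (at (of_real x))"
      using nn[of x] by (auto intro!: derivative_eq_intros simp: Complex_eq)
    from bounded_linear.has_vector_derivative[OF bounded_linear_Re has_vector_derivative_real_field[OF this]]
    have "((\<lambda>x. Re (ln_Gamma (Complex x t))) has_real_derivative Re (Digamma (Complex x t))) (at x)"
      unfolding has_real_derivative_iff_has_vector_derivative Complex_eq .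
    thus ?thesis unfolding f_def by (rule DERIV_diff) (auto intro!: derivative_eq_intros)
  qed
  have dbound: "\<bar>Re (Digamma (Complex x t)) - ln \<bar>t\<bar>\<bar> \<le> D" if "0 \<le> x" "x \<le> b + 1" for x
  proof -
    have "x\<^sup>2 \<le> (b + 1)\<^sup>2" using that by (intro power_mono) auto
    with Re_Digamma_bound[of "Complex x t"] that t show ?thesis unfolding D_def complex.sel by linarith
  qed
  have "norm (f (Re s) - f (1/2)) \<le> D * norm (Re s - 1/2)"
  proof (rule field_differentiable_bound[of "{0..b+1}"])
    show "(f has_field_derivative (Re (Digamma (Complex x t)) - ln \<bar>t\<bar>)) (at x within {0..b+1})" for x
      using der[of x] by (rule has_field_derivative_at_within)
  qed (use dbound s assms in auto)
  also have "\<dots> \<le> D * (b + 1)" using s D0 by (intro mult_left_mono) auto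
  finally have fle: "f (Re s) \<le> f (1/2) + D * (b + 1)" by (simp add: abs_le_iff)
  have Gexp: "cmod (Gamma (Complex x t)) = exp (Re (ln_Gamma (Complex x t)))" for x
    using nn[of x] by (simp add: Gamma_complex_altdef)
  have "cmod (Gamma s) = exp (f (Re s) + (Re s - 1/2) * ln \<bar>t\<bar>)"
    using Gexp[of "Re s"] by (simp add: f_def t_def)
  also have "\<dots> \<le> exp (f (1/2) + D * (b + 1) + (Re s - 1/2) * ln \<bar>t\<bar>)" using fle by simp
  also have "\<dots> = cmod (Gamma (Complex (1/2) t)) * exp (D * (b+1)) * \<bar>t\<bar> powr (Re s - 1/2)"
    using t unfolding Gexp by (simp add: f_def exp_add powr_def)
  also have "\<dots> \<le> (sqrt (2 * pi) * exp (- pi * \<bar>t\<bar> / 2)) * exp (D * (b+1)) * \<bar>t\<bar> powr (Re s - 1/2)"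
    by (intro mult_right_mono Gamma_half_line_bound) auto
  finally show "cmod (Gamma s) \<le> C * \<bar>Im s\<bar> powr (Re s - 1/2) * exp (- pi * \<bar>Im s\<bar> / 2)"
    by (simp add: C_def t_def mult_ac)
qed

text \<open>The functional equation moves the strip one unit to the left. Dividing by s gains a
  factor 1/|Im s|, which is exactly the change in the exponent Re s - 1/2.\<close>

lemma Gamma_strip_bound:
  "\<exists>C>0. \<forall>s. - real k \<le> Re s \<and> Re s \<le> b \<and> \<bar>Im s\<bar> \<ge> 1 \<longrightarrow>
           cmod (Gamma s) \<le> C * \<bar>Im s\<bar> powr (Re s - 1/2) * exp (- pi * \<bar>Im s\<bar> / 2)"
proof (induction k arbitrary: b)
  case 0
  from Gamma_right_strip_bound[of "max b 0"] show ?case by auto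
next
  case (Suc k)
  obtain C where C: "C > 0" "\<And>s. - real k \<le> Re s \<and> Re s \<le> b + 1 \<and> \<bar>Im s\<bar> \<ge> 1 \<Longrightarrow>
           cmod (Gamma s) \<le> C * \<bar>Im s\<bar> powr (Re s - 1/2) * exp (- pi * \<bar>Im s\<bar> / 2)"
    using Suc[of "b + 1"] by metis
  show ?case
  proof (intro exI[of _ C] conjI allI impI)
    fix s assume s: "- real (Suc k) \<le> Re s \<and> Re s \<le> b \<and> \<bar>Im s\<bar> \<ge> 1"
    have nn: "s \<notin> \<int>\<^sub>\<le>\<^sub>0" using s by (auto elim!: nonpos_Ints_cases)
    have s0: "s \<noteq> 0" using s by auto
    have "Gamma s = Gamma (s + 1) / s" using nn s0 by (simp add: Gamma_plus1)
    hence "cmod (Gamma s) = cmod (Gamma (s + 1)) / cmod s" by (simp add: norm_divide)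
    also have "\<dots> \<le> cmod (Gamma (s + 1)) / \<bar>Im s\<bar>" using s abs_Im_le_cmod[of s]
      by (intro divide_left_mono mult_pos_pos) (auto simp: s0)
    also have "\<dots> \<le> (C * \<bar>Im s\<bar> powr (Re s + 1 - 1/2) * exp (- pi * \<bar>Im s\<bar> / 2)) / \<bar>Im s\<bar>"
      using C(2)[of "s + 1"] s by (intro divide_right_mono) auto
    also have "\<bar>Im s\<bar> powr (Re s + 1 - 1/2) = \<bar>Im s\<bar> powr (Re s - 1/2) * \<bar>Im s\<bar>"
      using s powr_mult_base[of "\<bar>Im s\<bar>" "Re s - 1/2"] by (simp add: algebra_simps)
    finally show "cmod (Gamma s) \<le> C * \<bar>Im s\<bar> powr (Re s - 1/2) * exp (- pi * \<bar>Im s\<bar> / 2)"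
      using s by (auto simp: mult.assoc split: if_splits)
  qed (fact C(1))
qed

text \<open>Beyond 2 |Im a| + 2 the quantities |Im s - Im a| and |Im s| agree up to a factor 2, so
  the power and the exponential each change by a bounded factor.\<close>

lemma Gamma_shift_bound:
  "\<exists>C>0. \<forall>s. \<bar>Re s\<bar> \<le> B \<and> \<bar>Im s\<bar> \<ge> 2 * \<bar>Im a\<bar> + 2 \<longrightarrow>
           cmod (Gamma (s - a)) \<le> C * \<bar>Im s\<bar> powr (Re s - Re a - 1/2) * exp (- pi * \<bar>Im s\<bar> / 2)"
proof -
  define B' where "B' = B + \<bar>Re a\<bar> + 1"
  obtain k :: nat where k: "B' \<le> real k" using real_arch_simple by blast
  obtain C where C: "C > 0" "\<And>s. - real k \<le> Re s \<and> Re s \<le> B' \<and> \<bar>Im s\<bar> \<ge> 1 \<Longrightarrow>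
           cmod (Gamma s) \<le> C * \<bar>Im s\<bar> powr (Re s - 1/2) * exp (- pi * \<bar>Im s\<bar> / 2)"
    using Gamma_strip_bound[of k B'] by metis
  define C' where "C' = C * 2 powr B' * exp (pi * \<bar>Im a\<bar> / 2)"
  show ?thesis
  proof (intro exI[of _ C'] conjI allI impI)
    show "C' > 0" using C(1) by (simp add: C'_def)
    fix s assume s: "\<bar>Re s\<bar> \<le> B \<and> \<bar>Im s\<bar> \<ge> 2 * \<bar>Im a\<bar> + 2"
    define p where "p = Re s - Re a - 1/2"
    have p: "\<bar>p\<bar> \<le> B'" using s by (auto simp: p_def B'_def)
    have r: "\<bar>Im s - Im a\<bar> \<ge> \<bar>Im s\<bar> / 2" "\<bar>Im s - Im a\<bar> \<le> 2 * \<bar>Im s\<bar>" "\<bar>Im s\<bar> \<ge> 2" "\<bar>Im s - Im a\<bar> \<ge> 1"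
      using s by linarith+
    have "\<bar>Im s - Im a\<bar> powr p \<le> 2 powr B' * \<bar>Im s\<bar> powr p"
    proof (cases "p \<ge> 0")
      case True
      have "\<bar>Im s - Im a\<bar> powr p \<le> (2 * \<bar>Im s\<bar>) powr p" using r True by (intro powr_mono2) auto
      also have "\<dots> = 2 powr p * \<bar>Im s\<bar> powr p" by (simp add: powr_mult)
      also have "\<dots> \<le> 2 powr B' * \<bar>Im s\<bar> powr p" using p by (intro mult_right_mono powr_mono) auto
      finally show ?thesis .
    next
      case False
      have "\<bar>Im s - Im a\<bar> powr p \<le> (\<bar>Im s\<bar> / 2) powr p" using r False by (intro powr_mono2') auto
      also have "\<dots> = 2 powr (-p) * \<bar>Im s\<bar> powr p" by (simp add: powr_divide powr_minus divide_simps)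
      also have "\<dots> \<le> 2 powr B' * \<bar>Im s\<bar> powr p" using p by (intro mult_right_mono powr_mono) auto
      finally show ?thesis .
    qed
    moreover have "exp (- pi * \<bar>Im s - Im a\<bar> / 2) \<le> exp (pi * \<bar>Im a\<bar> / 2) * exp (- pi * \<bar>Im s\<bar> / 2)"
    proof -
      have "\<bar>Im s\<bar> \<le> \<bar>Im a\<bar> + \<bar>Im s - Im a\<bar>" by linarith
      hence "pi * \<bar>Im s\<bar> \<le> pi * (\<bar>Im a\<bar> + \<bar>Im s - Im a\<bar>)" by (intro mult_left_mono) auto
      thus ?thesis by (simp add: algebra_simps flip: exp_add)
    qed
    moreover have "cmod (Gamma (s - a)) \<le> C * \<bar>Im (s - a)\<bar> powr (Re (s - a) - 1/2) * exp (- pi * \<bar>Im (s - a)\<bar> / 2)"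
    proof (intro C(2) conjI)
      show "- real k \<le> Re (s - a)" "Re (s - a) \<le> B'"
        using s k unfolding B'_def minus_complex.sel by linarith+
      show "1 \<le> \<bar>Im (s - a)\<bar>" using r by simp
    qed
    ultimately have "cmod (Gamma (s - a)) \<le> C * (2 powr B' * \<bar>Im s\<bar> powr p) * (exp (pi * \<bar>Im a\<bar> / 2) * exp (- pi * \<bar>Im s\<bar> / 2))"
      using C(1) r unfolding p_def by (elim order_trans) (intro mult_mono, auto)
    thus "cmod (Gamma (s - a)) \<le> C' * \<bar>Im s\<bar> powr (Re s - Re a - 1/2) * exp (- pi * \<bar>Im s\<bar> / 2)"
      by (simp add: C'_def p_def mult_ac)
  qed
qed

text \<open>The exponents add up to m(Re s - 1/2) minus the sum of the Re lambda_l. On the line Re s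
  = sigma this is the power that decides convergence at the edge of the strip.\<close>

lemma Gamma_prod_bound:
  "\<exists>C>0. \<exists>T\<ge>1. \<forall>s. \<bar>Re s\<bar> \<le> B \<and> \<bar>Im s\<bar> \<ge> T \<longrightarrow>
     cmod (\<Prod>l=1..m. Gamma (s - lam l)) \<le>
       C * \<bar>Im s\<bar> powr (real m * (Re s - 1/2) - (\<Sum>l=1..m. Re (lam l))) * exp (- real m * pi * \<bar>Im s\<bar> / 2)"
proof (induction m)
  case 0
  show ?case by (intro exI[of _ 1] conjI) auto
next
  case (Suc m)
  obtain C T where C: "C > 0" "T \<ge> 1" "\<And>s. \<bar>Re s\<bar> \<le> B \<and> \<bar>Im s\<bar> \<ge> T \<Longrightarrow>
     cmod (\<Prod>l=1..m. Gamma (s - lam l)) \<le>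
       C * \<bar>Im s\<bar> powr (real m * (Re s - 1/2) - (\<Sum>l=1..m. Re (lam l))) * exp (- real m * pi * \<bar>Im s\<bar> / 2)"
    using Suc by blast
  define a where "a = lam (Suc m)"
  obtain D where D: "D > 0" "\<And>s. \<bar>Re s\<bar> \<le> B \<and> \<bar>Im s\<bar> \<ge> 2 * \<bar>Im a\<bar> + 2 \<Longrightarrow>
           cmod (Gamma (s - a)) \<le> D * \<bar>Im s\<bar> powr (Re s - Re a - 1/2) * exp (- pi * \<bar>Im s\<bar> / 2)"
    using Gamma_shift_bound[of B a] by blast
  show ?case
  proof (rule exI[of _ "C * D"], intro conjI, use C D in simp, rule exI[of _ "max T (2 * \<bar>Im a\<bar> + 2)"], intro conjI allI impI)
    show "1 \<le> max T (2 * \<bar>Im a\<bar> + 2)" using C by auto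
    fix s assume s: "\<bar>Re s\<bar> \<le> B \<and> max T (2 * \<bar>Im a\<bar> + 2) \<le> \<bar>Im s\<bar>"
    have "cmod (\<Prod>l=1..Suc m. Gamma (s - lam l)) = cmod (\<Prod>l=1..m. Gamma (s - lam l)) * cmod (Gamma (s - a))"
      by (simp add: norm_mult a_def)
    also have "\<dots> \<le> (C * \<bar>Im s\<bar> powr (real m * (Re s - 1/2) - (\<Sum>l=1..m. Re (lam l))) * exp (- real m * pi * \<bar>Im s\<bar> / 2)) *
        (D * \<bar>Im s\<bar> powr (Re s - Re a - 1/2) * exp (- pi * \<bar>Im s\<bar> / 2))"
      using s C D by (intro mult_mono C(3) D(2)) auto
    also have "\<dots> = C * D * (\<bar>Im s\<bar> powr (real m * (Re s - 1/2) - (\<Sum>l=1..m. Re (lam l))) * \<bar>Im s\<bar> powr (Re s - Re a - 1/2)) *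
        (exp (- real m * pi * \<bar>Im s\<bar> / 2) * exp (- pi * \<bar>Im s\<bar> / 2))"
      by (simp add: mult_ac)
    also have "\<dots> = C * D * \<bar>Im s\<bar> powr (real (Suc m) * (Re s - 1/2) - (\<Sum>l=1..Suc m. Re (lam l))) * exp (- real (Suc m) * pi * \<bar>Im s\<bar> / 2)"
      by (simp add: a_def algebra_simps add_divide_distrib flip: powr_add exp_add)
    finally show "cmod (\<Prod>l=1..Suc m. Gamma (s - lam l)) \<le> C * D * \<bar>Im s\<bar> powr (real (Suc m) * (Re s - 1/2) - (\<Sum>l=1..Suc m. Re (lam l))) * exp (- real (Suc m) * pi * \<bar>Im s\<bar> / 2)" .
  qed
qed

section \<open>The Bessel equation in the coordinate log z\<close>

text \<open>T is left abstract so that the same algebra serves \<open>deriv\<close> on functions of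
  log z and \<open>laurent_theta\<close> on coefficient sequences.\<close>

definition DP :: "(('a \<Rightarrow> complex) \<Rightarrow> 'a \<Rightarrow> complex) \<Rightarrow> complex poly \<Rightarrow> ('a \<Rightarrow> complex) \<Rightarrow> 'a \<Rightarrow> complex" where
  "DP T p f x = (\<Sum>i\<le>degree p. coeff p i * (T ^^ i) f x)"

lemma DP_bound: "degree p \<le> N \<Longrightarrow> DP T p f x = (\<Sum>i\<le>N. coeff p i * (T ^^ i) f x)"
  unfolding DP_def by (rule sum.mono_neutral_left) (auto simp: coeff_eq_0)

lemma DP_0 [simp]: "DP T 0 f x = 0" and DP_1 [simp]: "DP T 1 f x = f x"
  by (simp_all add: DP_def)

lemma DP_add: "DP T (p + q) f x = DP T p f x + DP T q f x"
proof -
  define N where "N = max (degree p) (degree q)"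
  have "DP T (p + q) f x = (\<Sum>i\<le>N. coeff (p + q) i * (T ^^ i) f x)"
    by (rule DP_bound) (auto simp: N_def intro: degree_add_le)
  also have "\<dots> = (\<Sum>i\<le>N. coeff p i * (T ^^ i) f x) + (\<Sum>i\<le>N. coeff q i * (T ^^ i) f x)"
    by (simp add: distrib_right sum.distrib)
  also have "\<dots> = DP T p f x + DP T q f x"
    by (simp add: DP_bound[of p N] DP_bound[of q N] N_def)
  finally show ?thesis .
qed

lemma DP_smult: "DP T (smult a p) f x = a * DP T p f x"
  using DP_bound[of "smult a p" "degree p"] by (simp add: DP_def degree_smult_le sum_distrib_left mult_ac)

lemma DP_sum: "DP T (\<Sum>i\<in>A. p i) f x = (\<Sum>i\<in>A. DP T (p i) f x)"
  by (induction A rule: infinite_finite_induct) (simp_all add: DP_add)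

lemma DP_pCons: "DP T (pCons a p) f x = a * f x + DP T p (T f) x"
proof -
  have "DP T (pCons a p) f x = (\<Sum>i\<le>Suc (degree p). coeff (pCons a p) i * (T ^^ i) f x)"
    by (rule DP_bound) (rule degree_pCons_le)
  also have "\<dots> = a * f x + (\<Sum>i\<le>degree p. coeff p i * (T ^^ Suc i) f x)"
    by (subst sum.atMost_Suc_shift) simp
  also have "(\<Sum>i\<le>degree p. coeff p i * (T ^^ Suc i) f x) = DP T p (T f) x"
    unfolding DP_def by (simp add: funpow_swap1)
  finally show ?thesis .
qed

lemma DP_linear_factor: "DP T ([:b, 1:] * p) f x = b * DP T p f x + DP T p (T f) x"
  by (simp add: mult_pCons_left DP_add DP_smult DP_pCons)

section \<open>Falling factorials, Stirling numbers and the factored Bessel operator\<close>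

text \<open>z^j (d/dz)^j is this polynomial in z d/dz.\<close>

definition ffact_poly :: "nat \<Rightarrow> complex poly" where
  "ffact_poly j = (\<Prod>i<j. [:- of_nat i, 1:])"

lemma ffact_poly_0 [simp]: "ffact_poly 0 = 1"
  and ffact_poly_Suc: "ffact_poly (Suc j) = [:- of_nat j, 1:] * ffact_poly j"
  by (simp_all add: ffact_poly_def mult.commute)

text \<open>Stirling numbers of the second kind by their alternating sum; the coefficients
  \<open>A_coeff j m\<close> are S(m + j, j).\<close>

definition stirling2 :: "nat \<Rightarrow> nat \<Rightarrow> complex" where
  "stirling2 k j = (\<Sum>r\<le>j. (-1) ^ (j - r) * of_nat r ^ k / (fact r * fact (j - r)))"

lemma smult_sum_right: "smult a (\<Sum>i\<in>A. p i) = (\<Sum>i\<in>A. smult a (p i))"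
  by (induction A rule: infinite_finite_induct) (simp_all add: smult_add_right)

lemma stirling2_0_left: "stirling2 0 j = (if j = 0 then 1 else 0)"
proof -
  have "stirling2 0 j = (\<Sum>r\<le>j. of_nat (j choose r) * (1::complex) ^ r * (-1) ^ (j - r)) / fact j"
    by (simp add: stirling2_def binomial_fact sum_divide_distrib)
  also have "\<dots> = (1 + (-1)) ^ j / fact j" by (subst binomial_ring) simp
  finally show ?thesis by simp
qed

lemma stirling2_Suc_0: "stirling2 (Suc k) 0 = 0"
  by (simp add: stirling2_def)

text \<open>In (j+1) S(k,j+1) - S(k+1,j+1) the summand r = j + 1 vanishes, and in the others the
  factor j + 1 - r cancels against the factorial.\<close>

lemma stirling2_Suc_Suc: "stirling2 (Suc k) (Suc j) = of_nat (Suc j) * stirling2 k (Suc j) + stirling2 k j"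
proof -
  have "of_nat (Suc j) * stirling2 k (Suc j) - stirling2 (Suc k) (Suc j)
     = (\<Sum>r\<le>Suc j. (of_nat (Suc j) - of_nat r) * ((-1) ^ (Suc j - r) * of_nat r ^ k / (fact r * fact (Suc j - r))))"
    unfolding stirling2_def sum_distrib_left sum_subtractf[symmetric]
    by (intro sum.cong refl) (simp add: algebra_simps diff_divide_distrib)
  also have "\<dots> = (\<Sum>r\<le>j. (of_nat (Suc j) - of_nat r) * ((-1) ^ (Suc j - r) * of_nat r ^ k / (fact r * fact (Suc j - r))))"
    by simp
  also have "\<dots> = (\<Sum>r\<le>j. - ((-1) ^ (j - r) * of_nat r ^ k / (fact r * fact (j - r))))"
  proof (rule sum.cong[OF refl])
    fix r assume r: "r \<in> {..j}"
    hence s: "Suc j - r = Suc (j - r)" "(of_nat (Suc j) - of_nat r :: complex) = of_nat (Suc (j - r))"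
      by (auto simp: Suc_diff_le of_nat_diff)
    show "(of_nat (Suc j) - of_nat r) * ((-1) ^ (Suc j - r) * of_nat r ^ k / (fact r * fact (Suc j - r)))
      = - ((-1) ^ (j - r) * of_nat r ^ k / (fact r * fact (j - r)) :: complex)"
      unfolding s fact_Suc by (simp add: divide_simps del: of_nat_Suc)
  qed
  finally show ?thesis by (simp add: stirling2_def sum_negf algebra_simps)
qed

lemma stirling2_eq_0: "k < j \<Longrightarrow> stirling2 k j = 0"
proof (induction k arbitrary: j)
  case 0 thus ?case by (simp add: stirling2_0_left)
next
  case (Suc k)
  then obtain i where i: "j = Suc i" "k < i" by (cases j) auto
  thus ?case using Suc.IH[of i] Suc.IH[of "Suc i"] by (simp add: stirling2_Suc_Suc)
qed

lemma power_eq_stirling2_sum: "[:0, 1:] ^ k = (\<Sum>j\<le>k. smult (stirling2 k j) (ffact_poly j))"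
proof (induction k)
  case 0 show ?case by (simp add: stirling2_0_left)
next
  case (Suc k)
  have ff: "smult s ([:0, 1:] * ffact_poly j) = smult s (ffact_poly (Suc j)) + smult (of_nat j * s) (ffact_poly j)" for j s
  proof -
    have "[:0, 1:] * ffact_poly j = ffact_poly (Suc j) + smult (of_nat j) (ffact_poly j)"
      by (simp add: ffact_poly_Suc)
    thus ?thesis by (simp only: smult_add_right smult_smult mult.commute)
  qed
  have "[:0, 1:] ^ Suc k = (\<Sum>j\<le>k. smult (stirling2 k j) ([:0, 1:] * ffact_poly j))"
    by (simp only: power_Suc Suc.IH sum_distrib_left mult_smult_right)
  also have "\<dots> = (\<Sum>j\<le>k. smult (stirling2 k j) (ffact_poly (Suc j))) + (\<Sum>j\<le>Suc k. smult (of_nat j * stirling2 k j) (ffact_poly j))"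
    by (simp only: ff sum.distrib) (simp add: stirling2_eq_0)
  also have "(\<Sum>j\<le>Suc k. smult (of_nat j * stirling2 k j) (ffact_poly j)) =
      (\<Sum>j\<le>k. smult (of_nat (Suc j) * stirling2 k (Suc j)) (ffact_poly (Suc j)))"
    by (subst sum.atMost_Suc_shift) simp
  also have "(\<Sum>j\<le>k. smult (stirling2 k j) (ffact_poly (Suc j))) + \<dots> =
      (\<Sum>j\<le>k. smult (stirling2 (Suc k) (Suc j)) (ffact_poly (Suc j)))"
    unfolding sum.distrib[symmetric] stirling2_Suc_Suc smult_add_left by (simp add: add_ac)
  also have "\<dots> = (\<Sum>j\<le>Suc k. smult (stirling2 (Suc k) j) (ffact_poly j))"
    by (subst sum.atMost_Suc_shift) (simp add: stirling2_Suc_0)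
  finally show ?case .
qed

lemma A_coeff_eq_stirling2: "A_coeff j m = stirling2 (m + j) j"
proof (cases "j = 0")
  case True
  thus ?thesis by (cases m) (auto simp: A_coeff_def stirling2_0_left stirling2_Suc_0)
next
  case False
  have "{..j} = insert 0 {1..j}" by auto
  thus ?thesis using False by (simp add: A_coeff_def stirling2_def)
qed

text \<open>The Bessel operator as a polynomial in z d/dz. At -n s it is a multiple of the product
  of the s - lambda_l, the factor in the functional equation of the Gamma product.\<close>

definition char_poly :: "nat \<Rightarrow> (nat \<Rightarrow> complex) \<Rightarrow> complex poly" where
  "char_poly n lam = (\<Prod>l=1..n. [:of_nat n * lam l, 1:])"

lemma char_poly_eq_elem_sym:
  "char_poly n lam = (\<Sum>m\<le>n. smult (of_nat n ^ m * elem_sym n m lam) ([:0, 1:] ^ (n - m)))"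
proof -
  let ?c = "of_nat n :: complex"
  have "char_poly n lam = (\<Prod>l=1..n. [:?c * lam l:] + [:0, 1:])"
    by (simp add: char_poly_def)
  also have "\<dots> = (\<Sum>S\<in>Pow {1..n}. (\<Prod>l\<in>S. [:?c * lam l:]) * (\<Prod>l\<in>{1..n} - S. [:0, 1:]))"
    by (rule prod_add) simp
  also have "\<dots> = (\<Sum>S\<in>Pow {1..n}. smult (?c ^ card S * (\<Prod>l\<in>S. lam l)) ([:0, 1:] ^ (n - card S)))"
  proof (rule sum.cong[OF refl])
    fix S assume "S \<in> Pow {1..n}"
    hence S: "finite S" "S \<subseteq> {1..n}" by (auto intro: finite_subset)
    have "(\<Prod>l\<in>S. [:?c * lam l:]) = [:\<Prod>l\<in>S. ?c * lam l:]"
      by (induction S rule: infinite_finite_induct) (auto simp: one_pCons)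
    moreover have "(\<Prod>l\<in>S. ?c * lam l) = ?c ^ card S * (\<Prod>l\<in>S. lam l)"
      by (simp add: prod.distrib)
    moreover have "card ({1..n} - S) = n - card S" using S by (simp add: card_Diff_subset)
    ultimately show "(\<Prod>l\<in>S. [:?c * lam l:]) * (\<Prod>l\<in>{1..n} - S. [:0, 1:]) =
        smult (?c ^ card S * (\<Prod>l\<in>S. lam l)) ([:0, 1:] ^ (n - card S))" by simp
  qed
  also have "\<dots> = (\<Sum>m\<le>n. \<Sum>S\<in>{S \<in> Pow {1..n}. card S = m}.
      smult (?c ^ card S * (\<Prod>l\<in>S. lam l)) ([:0, 1:] ^ (n - card S)))"
  proof (rule sum.group[symmetric])
    show "card ` Pow {1..n} \<subseteq> {..n}" using card_mono[of "{1..n}"] by fastforce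
  qed auto
  also have "\<dots> = (\<Sum>m\<le>n. \<Sum>S | S \<subseteq> {1..n} \<and> card S = m. smult (?c ^ m * (\<Prod>l\<in>S. lam l)) ([:0, 1:] ^ (n - m)))"
    by (intro sum.cong) auto
  also have "\<dots> = (\<Sum>m\<le>n. smult (?c ^ m * elem_sym n m lam) ([:0, 1:] ^ (n - m)))"
    by (simp add: elem_sym_def sum_distrib_left smult_sum)
  finally show ?thesis .
qed

lemma V_coeff_eq: "j \<le> n \<Longrightarrow> V_coeff n j lam = (\<Sum>m\<le>n. stirling2 (n - m) j * of_nat n ^ m * elem_sym n m lam)"
proof -
  assume j: "j \<le> n"
  have "V_coeff n j lam = (\<Sum>m=0..n - j. stirling2 (n - m) j * of_nat n ^ m * elem_sym n m lam)"
    unfolding V_coeff_def A_coeff_eq_stirling2 using j by (intro sum.cong) auto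
  also have "\<dots> = (\<Sum>m\<le>n. stirling2 (n - m) j * of_nat n ^ m * elem_sym n m lam)"
    using j by (intro sum.mono_neutral_left) (auto simp: stirling2_eq_0)
  finally show ?thesis .
qed

text \<open>Expanding the product by elementary symmetric functions and then each power by Stirling
  numbers shows that the \<open>V_coeff\<close> are the coefficients of the factored operator in the
  basis of falling factorials.\<close>

lemma char_poly_eq_V_sum: "char_poly n lam = (\<Sum>j\<le>n. smult (V_coeff n j lam) (ffact_poly j))"
proof -
  have "(\<Sum>j\<le>n. smult (V_coeff n j lam) (ffact_poly j)) =
     (\<Sum>j\<le>n. \<Sum>m\<le>n. smult (stirling2 (n - m) j * of_nat n ^ m * elem_sym n m lam) (ffact_poly j))"
    by (intro sum.cong) (auto simp: V_coeff_eq smult_sum)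
  also have "\<dots> = (\<Sum>m\<le>n. \<Sum>j\<le>n. smult (of_nat n ^ m * elem_sym n m lam) (smult (stirling2 (n - m) j) (ffact_poly j)))"
    by (subst sum.swap) (simp add: mult_ac)
  also have "\<dots> = (\<Sum>m\<le>n. smult (of_nat n ^ m * elem_sym n m lam) (\<Sum>j\<le>n. smult (stirling2 (n - m) j) (ffact_poly j)))"
    by (simp add: smult_sum_right)
  also have "\<dots> = (\<Sum>m\<le>n. smult (of_nat n ^ m * elem_sym n m lam) ([:0, 1:] ^ (n - m)))"
  proof (intro sum.cong refl arg_cong2[of _ _ _ _ smult])
    fix m assume "m \<in> {..n}"
    show "(\<Sum>j\<le>n. smult (stirling2 (n - m) j) (ffact_poly j)) = [:0, 1:] ^ (n - m)"
      unfolding power_eq_stirling2_sum by (rule sum.mono_neutral_right) (auto simp: stirling2_eq_0)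
  qed
  finally show ?thesis by (simp add: char_poly_eq_elem_sym)
qed

lemma degree_ffact_poly: "degree (ffact_poly j) = j" "coeff (ffact_poly j) j = 1"
proof -
  have "lead_coeff (ffact_poly j) = 1" unfolding ffact_poly_def lead_coeff_prod by simp
  moreover show d: "degree (ffact_poly j) = j"
    unfolding ffact_poly_def by (subst degree_prod_eq_sum_degree) auto
  ultimately show "coeff (ffact_poly j) j = 1" by simp
qed

lemma degree_char_poly: "degree (char_poly n lam) = n" "coeff (char_poly n lam) n = 1"
proof -
  have "lead_coeff (char_poly n lam) = 1" unfolding char_poly_def lead_coeff_prod by simp
  moreover show "degree (char_poly n lam) = n"
    unfolding char_poly_def by (subst degree_prod_eq_sum_degree) auto
  ultimately show "coeff (char_poly n lam) n = 1" by simp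
qed

lemma V_coeff_leading: "V_coeff n n lam = 1"
proof -
  have "coeff (\<Sum>j\<le>n. smult (V_coeff n j lam) (ffact_poly j)) n = (\<Sum>j\<le>n. if j = n then V_coeff n n lam else 0)"
    unfolding coeff_sum by (intro sum.cong refl) (auto simp: degree_ffact_poly coeff_eq_0)
  thus ?thesis using degree_char_poly(2)[of n lam] by (simp add: char_poly_eq_V_sum)
qed

lemma DP_deriv_holomorphic:
  assumes "f holomorphic_on S" "open S"
  shows "DP deriv p f holomorphic_on S"
  unfolding DP_def[abs_def] by (intro holomorphic_intros holomorphic_higher_deriv assms)

lemma deriv_DP:
  assumes "f holomorphic_on S" "open S" "x \<in> S"
  shows "deriv (DP deriv p f) x = DP deriv p (deriv f) x"
    "DP deriv p f field_differentiable (at x)"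
proof -
  have fd: "(deriv ^^ i) f field_differentiable (at x)" for i
    using holomorphic_higher_deriv[OF assms(1,2), of i] assms holomorphic_on_imp_differentiable_at by blast
  show "deriv (DP deriv p f) x = DP deriv p (deriv f) x"
    unfolding DP_def[abs_def] using fd
    by (subst deriv_sum) (auto intro!: derivative_intros sum.cong simp: funpow_swap1)
  show "DP deriv p f field_differentiable (at x)"
    using DP_deriv_holomorphic[OF assms(1,2), of p] assms holomorphic_on_imp_differentiable_at by blast
qed

text \<open>Moving d/dz = e^(-zeta) d/dzeta past e^(-j zeta) replaces d/dzeta by d/dzeta - j, which
  supplies the next falling factor.\<close>

lemma uderiv_funpow:
  assumes "w holomorphic_on UNIV"
  shows "(uderiv ^^ j) w = (\<lambda>\<zeta>. exp (- (of_nat j * \<zeta>)) * DP deriv (ffact_poly j) w \<zeta>)"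
proof (induction j)
  case (Suc j)
  show ?case
  proof
    fix \<zeta>
    have fd: "DP deriv (ffact_poly j) w field_differentiable (at \<zeta>)"
      and dd: "deriv (DP deriv (ffact_poly j) w) \<zeta> = DP deriv (ffact_poly j) (deriv w) \<zeta>"
      using deriv_DP[OF assms] by auto
    have "((\<lambda>\<zeta>. exp (- (of_nat j * \<zeta>)) * DP deriv (ffact_poly j) w \<zeta>) has_field_derivative
        (exp (- (of_nat j * \<zeta>)) * DP deriv (ffact_poly (Suc j)) w \<zeta>)) (at \<zeta>)"
      using fd unfolding ffact_poly_Suc DP_linear_factor dd[symmetric]
      by (auto intro!: derivative_eq_intros simp: field_differentiable_derivI algebra_simps)
    note d = DERIV_imp_deriv[OF this]
    have "exp (- (of_nat (Suc j) * \<zeta>)) = exp (- (of_nat j * \<zeta>)) / exp \<zeta>"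
      unfolding exp_diff[symmetric] by (rule arg_cong[of _ _ exp]) (simp add: algebra_simps)
    thus "(uderiv ^^ Suc j) w \<zeta> = exp (- (of_nat (Suc j) * \<zeta>)) * DP deriv (ffact_poly (Suc j)) w \<zeta>"
      by (simp only: funpow.simps o_apply Suc.IH uderiv_def d cover_proj_def) simp
  qed
qed simp

lemma Bessel_solution_iff:
  "Bessel_solution n \<sigma> lam w \<longleftrightarrow> w holomorphic_on UNIV \<and>
     (\<forall>\<zeta>. DP deriv (char_poly n lam) w \<zeta> = \<sigma> * (\<i> * of_nat n) ^ n * exp (of_nat n * \<zeta>) * w \<zeta>)"
proof (cases "w holomorphic_on UNIV")
  case True
  have 1: "cover_proj \<zeta> ^ j * (uderiv ^^ j) w \<zeta> = DP deriv (ffact_poly j) w \<zeta>" for j \<zeta>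
    by (simp add: uderiv_funpow[OF True] cover_proj_def exp_minus flip: exp_of_nat_mult)
  have 2: "{..n} = insert 0 {1..n}" by auto
  have "(\<Sum>j=1..n. V_coeff n j lam * cover_proj \<zeta> ^ j * (uderiv ^^ j) w \<zeta>)
          + (V_coeff n 0 lam - \<sigma> * (\<i> * of_nat n) ^ n * cover_proj \<zeta> ^ n) * w \<zeta>
        = DP deriv (char_poly n lam) w \<zeta> - \<sigma> * (\<i> * of_nat n) ^ n * exp (of_nat n * \<zeta>) * w \<zeta>" for \<zeta>
    unfolding char_poly_eq_V_sum DP_sum DP_smult 2
    by (simp add: mult.assoc 1) (simp add: cover_proj_def left_diff_distrib mult.assoc flip: exp_of_nat_mult)
  thus ?thesis unfolding Bessel_solution_def by simp
qed (simp add: Bessel_solution_def)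

section \<open>The operator z d/dz on formal series\<close>

definition laurent_theta :: "complex \<Rightarrow> complex \<Rightarrow> (int \<Rightarrow> complex) \<Rightarrow> int \<Rightarrow> complex" where
  "laurent_theta c \<alpha> f j = (\<alpha> - of_int j) * f j + c * f (j + 1)"

lemma DP_laurent_theta:
  "DP (laurent_theta c \<alpha>) p (laurent_theta c \<alpha> f) j = laurent_theta c \<alpha> (DP (laurent_theta c \<alpha>) p f) j"
proof -
  have 1: "(laurent_theta c \<alpha> ^^ i) (laurent_theta c \<alpha> f) k = laurent_theta c \<alpha> ((laurent_theta c \<alpha> ^^ i) f) k" for i k
    by (simp flip: funpow_swap1)
  show ?thesis
    unfolding DP_def[abs_def] 1 by (simp add: laurent_theta_def sum_distrib_left sum.distrib sum_subtractf algebra_simps)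
qed

lemma formal_deriv_nth:
  "fls_nth (formal_deriv c \<alpha> g) k = c * fls_nth g k + (\<alpha> - of_int (k - 1)) * fls_nth g (k - 1)"
proof -
  have "fls_nth (fls_X ^ 2 * fls_deriv g) k = of_int (k - 1) * fls_nth g (k - 1)"
    by (simp add: fls_X_power_times_conv_shift)
  moreover have "fls_nth (fls_const \<alpha> * fls_X * g) k = \<alpha> * fls_nth g (k - 1)"
    by (simp only: mult.assoc fls_X_times_conv_shift(1)) simp
  ultimately show ?thesis by (simp add: formal_deriv_def algebra_simps)
qed

text \<open>Multiplication by z^j moves the coefficient at k + j to k; what is read off is therefore
  z^j (d/dz)^j, a falling factorial in z d/dz.\<close>

lemma formal_deriv_funpow_nth:
  "fls_nth ((formal_deriv c \<alpha> ^^ j) g) (k + int j) = DP (laurent_theta c \<alpha>) (ffact_poly j) (fls_nth g) k"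
proof (induction j arbitrary: k)
  case (Suc j)
  have "fls_nth ((formal_deriv c \<alpha> ^^ Suc j) g) (k + int (Suc j))
    = c * fls_nth ((formal_deriv c \<alpha> ^^ j) g) ((k + 1) + int j) + (\<alpha> - of_int (k + int j)) * fls_nth ((formal_deriv c \<alpha> ^^ j) g) (k + int j)"
    by (simp add: formal_deriv_nth add_ac)
  thus ?case unfolding Suc.IH ffact_poly_Suc DP_linear_factor DP_laurent_theta
    by (simp add: laurent_theta_def algebra_simps)
qed simp

lemma formal_Bessel_solution_iff:
  "formal_Bessel_solution n \<sigma> lam c \<alpha> g \<longleftrightarrow>
    (\<forall>k. DP (laurent_theta c \<alpha>) (char_poly n lam) (fls_nth g) k = \<sigma> * (\<i> * of_nat n) ^ n * fls_nth g (k + int n))"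
proof -
  have 1: "fls_nth (fls_X_inv ^ j * h) k = fls_nth h (k + int j)" for j k and h :: "complex fls"
    by (simp add: fls_X_inv_power_times_conv_shift)
  have 2: "{..n} = insert 0 {1..n}" by auto
  have "fls_nth ((\<Sum>j=1..n. fls_const (V_coeff n j lam) * fls_X_inv ^ j * (formal_deriv c \<alpha> ^^ j) g)
     + (fls_const (V_coeff n 0 lam) - fls_const (\<sigma> * (\<i> * of_nat n) ^ n) * fls_X_inv ^ n) * g) k
    = DP (laurent_theta c \<alpha>) (char_poly n lam) (fls_nth g) k - \<sigma> * (\<i> * of_nat n) ^ n * fls_nth g (k + int n)" for k
    unfolding char_poly_eq_V_sum DP_sum DP_smult 2
    by (simp add: mult.assoc fls_nth_sum 1 left_diff_distrib flip: formal_deriv_funpow_nth)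
  thus ?thesis unfolding formal_Bessel_solution_def fls_eq_iff by simp
qed

section \<open>The formal solution\<close>

text \<open>
  \<open>Q_poly c \<beta> m k\<close> is the coefficient of \<open>X\<^bsup>k-m\<^esup>\<close> in \<open>\<Prod>\<^bsub>l\<le>m\<^esub> (D + \<beta>\<^sub>l + c/X)\<close>, as a polynomial in \<open>D = -X d/dX\<close>.
\<close>

fun Q_poly :: "complex \<Rightarrow> (nat \<Rightarrow> complex) \<Rightarrow> nat \<Rightarrow> nat \<Rightarrow> complex poly" where
  "Q_poly c \<beta> 0 k = (if k = 0 then 1 else 0)"
| "Q_poly c \<beta> (Suc m) 0 = smult c (Q_poly c \<beta> m 0)"
| "Q_poly c \<beta> (Suc m) (Suc k) =
     smult c (Q_poly c \<beta> m (Suc k)) + [:\<beta> (Suc m) + of_nat m - of_nat k, 1:] * Q_poly c \<beta> m k"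

lemma Q_poly_eq_0: "m < k \<Longrightarrow> Q_poly c \<beta> m k = 0"
proof (induction m arbitrary: k)
  case (Suc m)
  then obtain i where i: "k = Suc i" "m < i" by (cases k) auto
  thus ?case using Suc.IH[of i] Suc.IH[of "Suc i"] by simp
qed auto

lemma poly_Q_poly_0: "Q_poly c \<beta> m 0 = [:c ^ m:]"
  by (induction m) (auto simp: one_pCons)

text \<open>The summand l - 1 is what D = -X d/dX contributes when it passes the power (c/X)^(l-1)
  of the earlier factors.\<close>

lemma poly_Q_poly_1:
  "poly (Q_poly c \<beta> m 1) x = c ^ (m - 1) * (of_nat m * x + (\<Sum>l=1..m. \<beta> l + of_nat (l - 1)))"
proof (induction m)
  case (Suc m)
  have 1: "poly (Q_poly c \<beta> (Suc m) 1) x = c * poly (Q_poly c \<beta> m 1) x + (\<beta> (Suc m) + of_nat m + x) * c ^ m"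
    by (simp add: poly_Q_poly_0 algebra_simps)
  show ?case
  proof (cases m)
    case (Suc k)
    show ?thesis unfolding 1 Suc.IH by (simp add: Suc algebra_simps)
  qed (use 1 in simp)
qed simp

lemma sum_Q_poly_Suc:
  fixes F :: "nat \<Rightarrow> complex"
  shows "(\<Sum>k\<le>Suc m. poly (Q_poly c \<beta> (Suc m) k) (x k) * F k) =
     c * (\<Sum>k\<le>m. poly (Q_poly c \<beta> m k) (x k) * F k) +
     (\<Sum>k\<le>m. (\<beta> (Suc m) + of_nat m - of_nat k + x (Suc k)) * poly (Q_poly c \<beta> m k) (x (Suc k)) * F (Suc k))"
proof -
  have "(\<Sum>k\<le>Suc m. poly (Q_poly c \<beta> (Suc m) k) (x k) * F k) =
    c * poly (Q_poly c \<beta> m 0) (x 0) * F 0 +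
    (\<Sum>k\<le>m. c * (poly (Q_poly c \<beta> m (Suc k)) (x (Suc k)) * F (Suc k)) +
       (\<beta> (Suc m) + of_nat m - of_nat k + x (Suc k)) * poly (Q_poly c \<beta> m k) (x (Suc k)) * F (Suc k))"
    by (subst sum.atMost_Suc_shift) (simp add: algebra_simps)
  also have "\<dots> = c * (\<Sum>k\<le>Suc m. poly (Q_poly c \<beta> m k) (x k) * F k) +
    (\<Sum>k\<le>m. (\<beta> (Suc m) + of_nat m - of_nat k + x (Suc k)) * poly (Q_poly c \<beta> m k) (x (Suc k)) * F (Suc k))"
    by (subst sum.atMost_Suc_shift) (simp add: sum.distrib sum_distrib_left distrib_left mult.assoc)
  finally show ?thesis by (simp add: Q_poly_eq_0)
qed

text \<open>In the k-th term the coefficient at index j + m - k is hit by X^(k-m), and D acts on X^i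
  as -i; this is where the argument of the polynomial comes from.\<close>

lemma DP_laurent_theta_prod:
  "DP (laurent_theta c \<alpha>) (\<Prod>l=1..m. [:b l, 1:]) f j =
     (\<Sum>k\<le>m. poly (Q_poly c (\<lambda>l. b l + \<alpha>) m k) (- of_int (j + int m - int k)) * f (j + int m - int k))"
proof (induction m arbitrary: j)
  case (Suc m)
  let ?D = "DP (laurent_theta c \<alpha>) (\<Prod>l=1..m. [:b l, 1:]) f"
  let ?Q = "Q_poly c (\<lambda>l. b l + \<alpha>) m"
  have fac: "(\<Prod>l=1..Suc m. [:b l, 1:]) = [:b (Suc m), 1:] * (\<Prod>l=1..m. [:b l, 1:])"
    by (simp del: mult_pCons_left mult_pCons_right add: mult.commute)
  have "DP (laurent_theta c \<alpha>) (\<Prod>l=1..Suc m. [:b l, 1:]) f j = (b (Suc m) + \<alpha> - of_int j) * ?D j + c * ?D (j + 1)"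
    unfolding fac DP_linear_factor DP_laurent_theta by (simp add: laurent_theta_def algebra_simps)
  also have "c * ?D (j + 1) = c * (\<Sum>k\<le>m. poly (?Q k) (- of_int (j + int (Suc m) - int k)) * f (j + int (Suc m) - int k))"
    unfolding Suc.IH by (simp add: add_ac)
  also have "(b (Suc m) + \<alpha> - of_int j) * ?D j =
     (\<Sum>k\<le>m. ((b (Suc m) + \<alpha>) + of_nat m - of_nat k + (- of_int (j + int (Suc m) - int (Suc k))))
        * poly (?Q k) (- of_int (j + int (Suc m) - int (Suc k))) * f (j + int (Suc m) - int (Suc k)))"
    unfolding Suc.IH sum_distrib_left by (intro sum.cong refl) (simp add: algebra_simps)
  finally show ?case by (simp only: sum_Q_poly_Suc) (simp only: add.commute)
qed simp

definition Bessel_alpha :: "nat \<Rightarrow> complex" where "Bessel_alpha n = - (of_nat n - 1) / 2"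

definition Q_Bessel :: "nat \<Rightarrow> complex \<Rightarrow> (nat \<Rightarrow> complex) \<Rightarrow> nat \<Rightarrow> complex poly" where
  "Q_Bessel n c lam = Q_poly c (\<lambda>l. of_nat n * lam l + Bessel_alpha n) n"

lemma Q_Bessel_0: "Q_Bessel n c lam 0 = [:c ^ n:]"
  by (simp add: Q_Bessel_def poly_Q_poly_0)

text \<open>The constant term is n times the sum of the lambda_l, plus n alpha, plus n(n-1)/2. It
  vanishes because the first sum is 0 and alpha = -(n-1)/2; this is what singles out the exponent
  alpha.\<close>

lemma Q_Bessel_1:
  assumes "(\<Sum>l=1..n. lam l) = 0"
  shows "poly (Q_Bessel n c lam 1) x = c ^ (n - 1) * of_nat n * x"
proof -
  have "(\<Sum>l=1..n. (of_nat (l - 1) :: complex)) = of_nat n * (of_nat n - 1) / 2"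
  proof (induction n)
    case (Suc n)
    thus ?case by (simp add: field_simps)
  qed simp
  moreover have "(\<Sum>l=1..n. (of_nat n * lam l + Bessel_alpha n) + of_nat (l - 1)) =
      of_nat n * (\<Sum>l=1..n. lam l) + of_nat n * Bessel_alpha n + (\<Sum>l=1..n. of_nat (l - 1))"
    by (simp add: sum.distrib sum_distrib_left)
  ultimately have "(\<Sum>l=1..n. (of_nat n * lam l + Bessel_alpha n) + of_nat (l - 1)) = 0"
    by (simp only: assms) (simp add: Bessel_alpha_def field_simps)
  thus ?thesis unfolding Q_Bessel_def poly_Q_poly_1 by simp
qed

text \<open>The coefficient recursion solved for its last member; the divisor is minus the value at
  -m of the index 1 polynomial \<open>Q_Bessel_1\<close>.\<close>

function B_rec :: "nat \<Rightarrow> complex \<Rightarrow> nat \<Rightarrow> (nat \<Rightarrow> complex) \<Rightarrow> complex" where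
  "B_rec n c m lam = (if m = 0 then 1 else
     (\<Sum>i<m. poly (Q_Bessel n c lam (m + 1 - i)) (- of_nat i) * B_rec n c i lam) / (of_nat n * c ^ (n - 1) * of_nat m))"
  by pat_completeness auto
termination by (relation "Wellfounded.measure (\<lambda>(n, c, m, lam). m)") auto

declare B_rec.simps [simp del]

lemma B_rec_0 [simp]: "B_rec n c 0 lam = 1"
  by (simp add: B_rec.simps)

lemma formal_Bessel_solution_recurrence:
  assumes "n \<ge> 1" "(\<Sum>l=1..n. lam l) = 0" "\<sigma> * (\<i> * of_nat n) ^ n = c ^ n" "c \<noteq> 0"
  shows "formal_Bessel_solution n \<sigma> lam c (Bessel_alpha n) (fps_to_fls (Abs_fps b)) \<longleftrightarrow>
    (\<forall>m\<ge>1. of_nat n * c ^ (n - 1) * of_nat m * b m =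
       (\<Sum>i<m. poly (Q_Bessel n c lam (m + 1 - i)) (- of_nat i) * b i))"
proof -
  define f where "f = (\<lambda>j::int. if j < 0 then 0 else b (nat j))"
  define Q where "Q = Q_Bessel n c lam"
  \<comment> \<open>The coefficient equation with the leading terms c^n already cancelled, indexed
    so that k = 1 carries the coefficient j and larger k carry earlier ones.\<close>
  define E where "E = (\<lambda>j. \<Sum>k\<in>{1..n}. poly (Q k) (- of_int (j + 1 - int k)) * f (j + 1 - int k))"
  have nth: "fls_nth (fps_to_fls (Abs_fps b)) = f" by (auto simp: f_def)
  have 2: "{..n} = insert 0 {1..n}" by auto
  have D: "DP (laurent_theta c (Bessel_alpha n)) (char_poly n lam) f j - c ^ n * f (j + int n) = E (j + int n - 1)" for j
    unfolding char_poly_def DP_laurent_theta_prod Q_Bessel_def[symmetric] Q_def[symmetric] 2 E_def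
    by (simp add: Q_def Q_Bessel_0)
  have "formal_Bessel_solution n \<sigma> lam c (Bessel_alpha n) (fps_to_fls (Abs_fps b)) \<longleftrightarrow> (\<forall>j. E (j + int n - 1) = 0)"
    unfolding formal_Bessel_solution_iff nth assms(3) D[symmetric] by simp
  also have "\<dots> \<longleftrightarrow> (\<forall>j. E j = 0)" (is "?l \<longleftrightarrow> ?r")
  proof
    assume ?l
    show ?r
    proof
      fix j show "E j = 0" using \<open>?l\<close>[rule_format, of "j - int n + 1"] by simp
    qed
  qed simp
  \<comment> \<open>For j <= 0 every summand vanishes: its index is negative, except for j = 0 and k
    = 1, where the polynomial has its zero.\<close>
  also have "\<dots> \<longleftrightarrow> (\<forall>m\<ge>1. E (int m) = 0)"
  proof
    assume r: "\<forall>m\<ge>1. E (int m) = 0"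
    show "\<forall>j. E j = 0"
    proof
      fix j
      show "E j = 0"
      proof (cases "j \<ge> 1")
        case True thus ?thesis using r[rule_format, of "nat j"] by simp
      next
        case False
        have "poly (Q k) (- of_int (j + 1 - int k)) * f (j + 1 - int k) = 0" if k: "k \<in> {1..n}" for k
        proof (cases "k = 1 \<and> j = 0")
          case True
          thus ?thesis using Q_Bessel_1[OF assms(2), of c] by (simp add: Q_def)
        next
          case False
          hence "j + 1 - int k < 0" using \<open>\<not> j \<ge> 1\<close> k by auto
          thus ?thesis by (simp add: f_def)
        qed
        thus ?thesis unfolding E_def by (rule sum.neutral[OF ballI])
      qed
    qed
  qed simp
  also have "\<dots> \<longleftrightarrow> (\<forall>m\<ge>1. of_nat n * c ^ (n - 1) * of_nat m * b m = (\<Sum>i<m. poly (Q (m + 1 - i)) (- of_nat i) * b i))"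
  proof (intro all_cong1 imp_cong refl)
    fix m :: nat assume m: "m \<ge> 1"
    define g where "g = (\<lambda>k. poly (Q k) (- of_int (int m + 1 - int k)) * f (int m + 1 - int k))"
    \<comment> \<open>Beyond n the polynomials vanish and beyond m + 1 the coefficients do, so the
      range of k may be enlarged to the maximum and then cut at m + 1.\<close>
    have "E (int m) = (\<Sum>k\<in>{1..max n (m + 1)}. g k)"
      unfolding E_def g_def by (rule sum.mono_neutral_left) (auto simp: Q_def Q_Bessel_def Q_poly_eq_0)
    also have "\<dots> = (\<Sum>k\<in>{1..m + 1}. g k)"
      by (rule sum.mono_neutral_right) (auto simp: f_def g_def)
    also have "{1..m + 1} = insert 1 {2..m + 1}" by auto
    also have "(\<Sum>k\<in>insert 1 {2..m + 1}. g k) = g 1 + (\<Sum>k\<in>{2..m + 1}. g k)" by simp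
    also have "g 1 = - (of_nat n * c ^ (n - 1) * of_nat m * b m)"
      using Q_Bessel_1[OF assms(2), of c] by (simp add: Q_def f_def g_def mult_ac)
    also have "(\<Sum>k\<in>{2..m + 1}. g k) = (\<Sum>i<m. g (m + 1 - i))"
      by (rule sum.reindex_bij_witness[of _ "\<lambda>i. m + 1 - i" "\<lambda>k. m + 1 - k"]) auto
    also have "\<dots> = (\<Sum>i<m. poly (Q (m + 1 - i)) (- of_nat i) * b i)"
    proof (rule sum.cong[OF refl])
      fix i assume "i \<in> {..<m}"
      hence i: "int m + 1 - int (m + 1 - i) = int i" by simp
      show "g (m + 1 - i) = poly (Q (m + 1 - i)) (- of_nat i) * b i" unfolding g_def i by (simp add: f_def)
    qed
    finally have "E (int m) = - (of_nat n * c ^ (n - 1) * of_nat m * b m) + (\<Sum>i<m. poly (Q (m + 1 - i)) (- of_nat i) * b i)" .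
    moreover have "u = - x + y \<Longrightarrow> u = 0 \<longleftrightarrow> x = y" for u x y :: complex by auto
    ultimately show "E (int m) = 0 \<longleftrightarrow> of_nat n * c ^ (n - 1) * of_nat m * b m = (\<Sum>i<m. poly (Q (m + 1 - i)) (- of_nat i) * b i)"
      by blast
  qed
  finally show ?thesis by (simp add: Q_def)
qed

lemma formal_Bessel_solution_unique:
  assumes "n \<ge> 1" "(\<Sum>l=1..n. lam l) = 0" "\<sigma> * (\<i> * of_nat n) ^ n = c ^ n" "c \<noteq> 0"
    and "formal_Bessel_solution n \<sigma> lam c (Bessel_alpha n) (fps_to_fls (Abs_fps b))" "b 0 = 1"
  shows "b m = B_rec n c m lam"
proof (induction m rule: less_induct)
  case (less m)
  show ?case
  proof (cases "m = 0")
    case False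
    hence "of_nat n * c ^ (n - 1) * of_nat m * b m = (\<Sum>i<m. poly (Q_Bessel n c lam (m + 1 - i)) (- of_nat i) * b i)"
      using assms(5) formal_Bessel_solution_recurrence[OF assms(1-4), of b] by auto
    also have "\<dots> = (\<Sum>i<m. poly (Q_Bessel n c lam (m + 1 - i)) (- of_nat i) * B_rec n c i lam)"
      using less by (intro sum.cong) auto
    finally show ?thesis using False assms by (subst B_rec.simps) (auto simp: field_simps)
  qed (simp add: assms)
qed

lemma formal_Bessel_solution_B_rec:
  assumes "n \<ge> 1" "(\<Sum>l=1..n. lam l) = 0" "\<sigma> * (\<i> * of_nat n) ^ n = c ^ n" "c \<noteq> 0"
  shows "formal_Bessel_solution n \<sigma> lam c (Bessel_alpha n) (fps_to_fls (Abs_fps (\<lambda>m. B_rec n c m lam)))"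
  unfolding formal_Bessel_solution_recurrence[OF assms]
proof (intro allI impI)
  fix m :: nat assume "1 \<le> m"
  thus "of_nat n * c ^ (n - 1) * of_nat m * B_rec n c m lam =
         (\<Sum>i<m. poly (Q_Bessel n c lam (m + 1 - i)) (- of_nat i) * B_rec n c i lam)"
    using assms by (subst B_rec.simps) (auto simp: field_simps)
qed

lemma polynomial_fun_sum:
  "(\<And>i. i \<in> A \<Longrightarrow> polynomial_fun n (p i)) \<Longrightarrow> polynomial_fun n (\<lambda>lam. \<Sum>i\<in>A. p i lam)"
  by (induction A rule: infinite_finite_induct) (auto intro: polynomial_fun.intros)

lemma polynomial_fun_Q_poly:
  assumes "m \<le> n"
  shows "polynomial_fun n (\<lambda>lam. poly (Q_poly c (\<lambda>l. a * lam l + b) m k) x)"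
  using assms
proof (induction m arbitrary: k)
  case 0 show ?case by (cases "k = 0") (auto intro: polynomial_fun.intros)
next
  case (Suc m)
  show ?case
  proof (cases k)
    case 0
    thus ?thesis using Suc by (auto intro!: polynomial_fun.intros)
  next
    case (Suc k')
    have "polynomial_fun n (\<lambda>lam. c * poly (Q_poly c (\<lambda>l. a * lam l + b) m (Suc k')) x +
       (a * lam (Suc m) + (b + of_nat m - of_nat k' + x)) * poly (Q_poly c (\<lambda>l. a * lam l + b) m k') x)"
      using Suc.prems Suc.IH by (intro polynomial_fun.intros) auto
    thus ?thesis by (simp add: Suc algebra_simps)
  qed
qed

text \<open>The recursion of \<open>Q_poly\<close> treats the factors in a fixed order, which hides
  the symmetry. Applied to the unit sequence at index i, the symmetric operator
  \<open>char_poly\<close> has exactly these numbers as entries.\<close>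

lemma poly_Q_Bessel_permute:
  assumes "\<pi> permutes {1..n}"
  shows "poly (Q_Bessel n c (lam \<circ> \<pi>) k) (- of_nat i) = poly (Q_Bessel n c lam k) (- of_nat i)"
proof (cases "k \<le> n")
  case True
  define f where "f = (\<lambda>j. if j = int i then 1 else 0 :: complex)"
  have "DP (laurent_theta c (Bessel_alpha n)) (char_poly n lam) f (int i + int k - int n) = poly (Q_Bessel n c lam k) (- of_nat i)" for lam
  proof -
    have "DP (laurent_theta c (Bessel_alpha n)) (char_poly n lam) f (int i + int k - int n) =
       (\<Sum>r\<le>n. if r = k then poly (Q_Bessel n c lam k) (- of_nat i) else 0)"
      unfolding char_poly_def DP_laurent_theta_prod Q_Bessel_def by (intro sum.cong) (auto simp: f_def)
    thus ?thesis using True by simp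
  qed
  moreover have "char_poly n (lam \<circ> \<pi>) = char_poly n lam"
    unfolding char_poly_def using prod.permute[OF assms, of "\<lambda>l. [:of_nat n * lam l, 1:]"] by (simp add: o_def)
  ultimately show ?thesis by metis
qed (simp add: Q_Bessel_def Q_poly_eq_0)

lemma symmetric_polynomial_B_rec: "symmetric_polynomial n (B_rec n c m)"
proof (induction m rule: less_induct)
  case (less m)
  show ?case
  proof (cases "m = 0")
    case True
    hence "B_rec n c m = (\<lambda>lam. 1)" by auto
    thus ?thesis by (auto simp: symmetric_polynomial_def intro: polynomial_fun.intros)
  next
    case False
    have eq: "B_rec n c m = (\<lambda>lam. (\<Sum>i<m. poly (Q_Bessel n c lam (m + 1 - i)) (- of_nat i) * B_rec n c i lam) * inverse (of_nat n * c ^ (n - 1) * of_nat m))"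
      (is "_ = (\<lambda>lam. ?R lam)")
    proof
      fix lam show "B_rec n c m lam = ?R lam"
        using False by (subst B_rec.simps) (auto simp: divide_inverse)
    qed
    show ?thesis unfolding symmetric_polynomial_def
    proof (intro conjI allI impI)
      show "polynomial_fun n (B_rec n c m)"
        unfolding eq Q_Bessel_def using less
        by (intro polynomial_fun.intros polynomial_fun_sum polynomial_fun_Q_poly) (auto simp: symmetric_polynomial_def)
      fix \<pi> and lam :: "nat \<Rightarrow> complex" assume "\<pi> permutes {1..n}"
      thus "B_rec n c m (lam \<circ> \<pi>) = B_rec n c m lam"
        unfolding eq using less by (auto simp: poly_Q_Bessel_permute symmetric_polynomial_def)
    qed
  qed
qed

text \<open>The description is resolved by the recursion: every admissible sequence of polynomials
  takes the values \<open>B_rec\<close> at lam, and \<open>B_rec\<close> is itself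
  admissible.\<close>

lemma B_asym_eq_B_rec:
  assumes "n \<ge> 1" "(\<Sum>l=1..n. lam l) = 0" "\<xi> \<in> {1, - 1}"
  shows "B_asym n lam \<xi> = (\<lambda>m. B_rec n (\<i> * of_nat n * \<xi>) m lam)"
  unfolding B_asym_def
proof (rule the_equality)
  have *: "\<xi> ^ n * (\<i> * of_nat n) ^ n = (\<i> * of_nat n * \<xi>) ^ n" "\<i> * of_nat n * \<xi> \<noteq> 0"
    using assms by (auto simp: power_mult_distrib)
  let ?B = "B_rec n (\<i> * of_nat n * \<xi>)"
  show "\<exists>B. B_sequence n \<xi> B \<and> (\<lambda>m. ?B m lam) = (\<lambda>m. B m lam)"
    unfolding B_sequence_def
    using formal_Bessel_solution_B_rec[OF assms(1) _ *] symmetric_polynomial_B_rec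
    by (intro exI[of _ ?B]) (auto simp: Bessel_alpha_def)
  fix b assume "\<exists>B. B_sequence n \<xi> B \<and> b = (\<lambda>m. B m lam)"
  then obtain B where B: "B_sequence n \<xi> B" "b = (\<lambda>m. B m lam)" by blast
  show "b = (\<lambda>m. ?B m lam)"
  proof
    fix m
    have "formal_Bessel_solution n (\<xi> ^ n) lam (\<i> * of_nat n * \<xi>) (Bessel_alpha n) (fps_to_fls (Abs_fps b))" "b 0 = 1"
      using B assms(2) by (auto simp: B_sequence_def Bessel_alpha_def)
    from formal_Bessel_solution_unique[OF assms(1,2) * this] show "b m = ?B m lam" .
  qed
qed

section \<open>The explicit polynomials as a formal Laplace expansion\<close>

lemma sum_sum_symmetric:
  fixes a :: "nat \<Rightarrow> nat \<Rightarrow> complex"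
  assumes "\<And>l k. l \<in> {1..d} \<Longrightarrow> k \<in> {1..d} \<Longrightarrow> a l k = a k l"
  shows "(\<Sum>l=1..d. \<Sum>k=1..d. a l k) = (\<Sum>l=1..d. a l l) + 2 * (\<Sum>k=1..d. \<Sum>l\<in>{1..<k}. a l k)"
  using assms
proof (induction d)
  case (Suc d)
  have 1: "(\<Sum>k=1..d. a (Suc d) k) = (\<Sum>k=1..d. a k (Suc d))"
    by (intro sum.cong) (auto intro: Suc.prems)
  have 2: "{Suc 0..<Suc d} = {Suc 0..d}" by auto
  show ?case using Suc.IH Suc.prems 1 by (simp add: sum.distrib 2)
qed simp

section \<open>Generalised Laurent polynomials and their partial derivatives\<close>

context
  fixes d :: nat
begin

definition orthant :: "(nat \<Rightarrow> real) set" where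
  "orthant = {t. \<forall>l\<in>{1..d}. 0 < t l}"

text \<open>
  All functions are cut off outside the positive orthant, so that the identities between generalised Laurent
  polynomials below hold everywhere.
\<close>

definition gmono :: "(nat \<Rightarrow> complex) \<Rightarrow> (nat \<Rightarrow> real) \<Rightarrow> complex" where
  "gmono \<mu> t = (if t \<in> orthant then \<Prod>l=1..d. of_real (t l) powr \<mu> l else 0)"

text \<open>Finite combinations of monomials with complex exponents. The class is closed under
  products and partial derivatives, so identities between operators can be checked on monomials by
  induction.\<close>

inductive gen_laurent :: "((nat \<Rightarrow> real) \<Rightarrow> complex) \<Rightarrow> bool" where
  zero: "gen_laurent (\<lambda>t. 0)"
| add_gmono: "gen_laurent F \<Longrightarrow> gen_laurent (\<lambda>t. a * gmono \<mu> t + F t)"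

definition PD :: "nat \<Rightarrow> ((nat \<Rightarrow> real) \<Rightarrow> complex) \<Rightarrow> (nat \<Rightarrow> real) \<Rightarrow> complex" where
  "PD l F t = (if t \<in> orthant then partial_deriv l F t else 0)"

definition idx :: "nat \<Rightarrow> nat \<Rightarrow> complex" where "idx l k = (if k = l then 1 else 0)"

lemma orthant_upd: "t \<in> orthant \<Longrightarrow> x > 0 \<Longrightarrow> t(l := x) \<in> orthant"
  by (auto simp: orthant_def)

lemma one_orthant [simp]: "(\<lambda>_. 1) \<in> orthant" by (simp add: orthant_def)

lemma gmono_one [simp]: "gmono \<mu> (\<lambda>_. 1) = 1" by (simp add: gmono_def)

lemma gmono_mult: "gmono \<mu> t * gmono \<mu>' t = gmono (\<lambda>l. \<mu> l + \<mu>' l) t"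
  by (simp add: gmono_def powr_add prod.distrib)

lemma gmono_outside: "t \<notin> orthant \<Longrightarrow> gmono \<mu> t = 0" by (simp add: gmono_def)

lemma gen_laurent_outside: "gen_laurent F \<Longrightarrow> t \<notin> orthant \<Longrightarrow> F t = 0"
  by (induction rule: gen_laurent.induct) (auto simp: gmono_outside)

lemma gen_laurent_gmono [simp, intro]: "gen_laurent (gmono \<mu>)"
  using gen_laurent.add_gmono[OF gen_laurent.zero, of 1 \<mu>] by simp

lemma gen_laurent_cmult [simp, intro]: "gen_laurent F \<Longrightarrow> gen_laurent (\<lambda>t. b * F t)"
proof (induction rule: gen_laurent.induct)
  case (add_gmono F a \<mu>)
  from gen_laurent.add_gmono[OF this(2), of "b * a" \<mu>] show ?case by (simp add: algebra_simps)
qed (auto intro: gen_laurent.zero)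

lemma gen_laurent_add [simp, intro]: "gen_laurent F \<Longrightarrow> gen_laurent H \<Longrightarrow> gen_laurent (\<lambda>t. F t + H t)"
proof (induction rule: gen_laurent.induct)
  case (add_gmono F a \<mu>)
  from gen_laurent.add_gmono[OF add_gmono.IH[OF add_gmono.prems], of a \<mu>] show ?case by (simp add: add_ac)
qed auto

lemma gen_laurent_diff [simp, intro]: "gen_laurent F \<Longrightarrow> gen_laurent H \<Longrightarrow> gen_laurent (\<lambda>t. F t - H t)"
  using gen_laurent_add[of F "\<lambda>t. (-1) * H t"] gen_laurent_cmult[of H "-1"] by simp

lemma gen_laurent_sum [simp, intro]: "(\<And>i. i \<in> A \<Longrightarrow> gen_laurent (F i)) \<Longrightarrow> gen_laurent (\<lambda>t. \<Sum>i\<in>A. F i t)"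
  by (induction A rule: infinite_finite_induct) (auto intro: gen_laurent.zero)

lemma gen_laurent_mult [simp, intro]:
  assumes "gen_laurent F" "gen_laurent H"
  shows "gen_laurent (\<lambda>t. F t * H t)"
proof -
  have *: "gen_laurent (\<lambda>t. gmono \<mu> t * H t)" for \<mu>
    using assms(2)
  proof (induction rule: gen_laurent.induct)
    case (add_gmono F a \<mu>')
    from gen_laurent.add_gmono[OF add_gmono.IH, of a "\<lambda>l. \<mu> l + \<mu>' l"]
    show ?case by (simp add: algebra_simps flip: gmono_mult)
  qed (auto intro: gen_laurent.zero)
  show ?thesis using assms(1)
  proof (induction rule: gen_laurent.induct)
    case (add_gmono F a \<mu>)
    from gen_laurent_add[OF gen_laurent_cmult[OF *, of a \<mu>] add_gmono.IH] show ?case by (simp add: algebra_simps)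
  qed (auto intro: gen_laurent.zero)
qed

lemma gmono_has_derivative:
  assumes "l \<in> {1..d}" "t \<in> orthant"
  shows "((\<lambda>x. gmono \<mu> (t(l := x))) has_vector_derivative \<mu> l * gmono (\<lambda>k. \<mu> k - idx l k) t) (at (t l))"
proof -
  have tl: "t l > 0" using assms by (auto simp: orthant_def)
  define R where "R = (\<Prod>k\<in>{1..d} - {l}. of_real (t k) powr \<mu> k :: complex)"
  have "((\<lambda>z. z powr \<mu> l) has_field_derivative \<mu> l * of_real (t l) powr (\<mu> l - 1)) (at (of_real (t l)))"
    using tl by (intro has_field_derivative_powr) auto
  from has_vector_derivative_mult_left[OF has_vector_derivative_real_field[OF this], of R]
  have 1: "((\<lambda>x. of_real x powr \<mu> l * R) has_vector_derivative \<mu> l * of_real (t l) powr (\<mu> l - 1) * R) (at (t l))" .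
  have 2: "\<mu> l * of_real (t l) powr (\<mu> l - 1) * R = \<mu> l * gmono (\<lambda>k. \<mu> k - idx l k) t"
  proof -
    have "(\<Prod>k=1..d. of_real (t k) powr (\<mu> k - idx l k)) = of_real (t l) powr (\<mu> l - 1) * (\<Prod>k\<in>{1..d} - {l}. of_real (t k) powr (\<mu> k - idx l k))"
      using assms by (subst prod.remove[of _ l]) (auto simp: idx_def)
    also have "(\<Prod>k\<in>{1..d} - {l}. of_real (t k) powr (\<mu> k - idx l k)) = R"
      unfolding R_def by (intro prod.cong) (auto simp: idx_def)
    finally show ?thesis using assms by (simp add: gmono_def)
  qed
  have 3: "eventually (\<lambda>x. of_real x powr \<mu> l * R = gmono \<mu> (t(l := x))) (nhds (t l))"
    using eventually_nhds_in_open[OF open_greaterThan, of "t l" "0::real"] tl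
  proof (simp, elim eventually_mono)
    fix x :: real assume x: "x > 0"
    have "(\<Prod>k=1..d. of_real ((t(l := x)) k) powr \<mu> k) = of_real x powr \<mu> l * (\<Prod>k\<in>{1..d} - {l}. of_real ((t(l := x)) k) powr \<mu> k)"
      using assms by (subst prod.remove[of _ l]) auto
    also have "(\<Prod>k\<in>{1..d} - {l}. of_real ((t(l := x)) k) powr \<mu> k) = R"
      unfolding R_def by (intro prod.cong) auto
    finally show "of_real x powr \<mu> l * R = gmono \<mu> (t(l := x))"
      using orthant_upd[OF assms(2) x, of l] by (simp add: gmono_def)
  qed
  show ?thesis
    using 1 unfolding 2 by (subst (asm) has_vector_derivative_cong_ev[OF eventually_mono[OF 3]]) (use eventually_nhds_x_imp_x[OF 3] in auto)
qed

lemma gen_laurent_has_PD: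
  assumes "gen_laurent F" "l \<in> {1..d}"
  shows "gen_laurent (PD l F) \<and> (\<forall>t\<in>orthant. ((\<lambda>x. F (t(l := x))) has_vector_derivative PD l F t) (at (t l)))"
  using assms(1)
proof (induction rule: gen_laurent.induct)
  case zero
  have "PD l (\<lambda>t. 0) = (\<lambda>t. 0)" by (auto simp: PD_def partial_deriv_def)
  thus ?case by (auto intro: gen_laurent.zero)
next
  case (add_gmono F a \<mu>)
  have *: "((\<lambda>x. a * gmono \<mu> (t(l := x)) + F (t(l := x))) has_vector_derivative
      a * (\<mu> l * gmono (\<lambda>k. \<mu> k - idx l k) t) + PD l F t) (at (t l))" if "t \<in> orthant" for t
    using add_gmono.IH[THEN conjunct2, rule_format, OF that]
    by (intro has_vector_derivative_add has_vector_derivative_mult_right gmono_has_derivative that assms(2))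
  have eq: "PD l (\<lambda>t. a * gmono \<mu> t + F t) = (\<lambda>t. (a * \<mu> l) * gmono (\<lambda>k. \<mu> k - idx l k) t + PD l F t)"
  proof
    fix t show "PD l (\<lambda>t. a * gmono \<mu> t + F t) t = (a * \<mu> l) * gmono (\<lambda>k. \<mu> k - idx l k) t + PD l F t"
      using vector_derivative_at[OF *, of t]
      by (cases "t \<in> orthant") (auto simp: PD_def partial_deriv_def gmono_outside mult.assoc)
  qed
  show ?case unfolding eq
  proof (intro conjI ballI)
    show "gen_laurent (\<lambda>t. a * \<mu> l * gmono (\<lambda>k. \<mu> k - idx l k) t + PD l F t)"
      using add_gmono by (auto intro: gen_laurent.add_gmono)
    fix t assume "t \<in> orthant"
    from *[OF this] show "((\<lambda>x. a * gmono \<mu> (t(l := x)) + F (t(l := x))) has_vector_derivative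
      a * \<mu> l * gmono (\<lambda>k. \<mu> k - idx l k) t + PD l F t) (at (t l))" by (simp only: mult.assoc)
  qed
qed

lemma gen_laurent_PD [simp, intro]: "gen_laurent F \<Longrightarrow> l \<in> {1..d} \<Longrightarrow> gen_laurent (PD l F)"
  using gen_laurent_has_PD by blast

lemma PD_eqI:
  assumes "\<And>t. t \<in> orthant \<Longrightarrow> ((\<lambda>x. F (t(l := x))) has_vector_derivative H t) (at (t l))"
    and "\<And>t. t \<notin> orthant \<Longrightarrow> H t = 0"
  shows "PD l F = H"
  using assms vector_derivative_at[OF assms(1)] by (auto simp: PD_def partial_deriv_def)

lemma PD_outside: "t \<notin> orthant \<Longrightarrow> PD l F t = 0" by (simp add: PD_def)

lemma has_PD: "gen_laurent F \<Longrightarrow> l \<in> {1..d} \<Longrightarrow> t \<in> orthant \<Longrightarrow>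
    ((\<lambda>x. F (t(l := x))) has_vector_derivative PD l F t) (at (t l))"
  using gen_laurent_has_PD by blast

lemma PD_gmono: "l \<in> {1..d} \<Longrightarrow> PD l (gmono \<mu>) = (\<lambda>t. \<mu> l * gmono (\<lambda>k. \<mu> k - idx l k) t)"
  by (rule PD_eqI) (auto simp: gmono_has_derivative gmono_outside)

lemma PD_zero: "PD l (\<lambda>t. 0) = (\<lambda>t. 0)"
  by (rule PD_eqI) auto

lemma PD_add: "gen_laurent F \<Longrightarrow> gen_laurent H \<Longrightarrow> l \<in> {1..d} \<Longrightarrow>
    PD l (\<lambda>t. F t + H t) = (\<lambda>t. PD l F t + PD l H t)"
  by (rule PD_eqI) (auto intro!: has_vector_derivative_add has_PD simp: PD_outside)

lemma PD_diff: "gen_laurent F \<Longrightarrow> gen_laurent H \<Longrightarrow> l \<in> {1..d} \<Longrightarrow>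
    PD l (\<lambda>t. F t - H t) = (\<lambda>t. PD l F t - PD l H t)"
  by (rule PD_eqI) (auto intro!: has_vector_derivative_diff has_PD simp: PD_outside)

lemma PD_cmult: "gen_laurent F \<Longrightarrow> l \<in> {1..d} \<Longrightarrow> PD l (\<lambda>t. b * F t) = (\<lambda>t. b * PD l F t)"
  by (rule PD_eqI) (auto intro!: has_vector_derivative_mult_right has_PD simp: PD_outside)

lemma PD_sum: "(\<And>i. i \<in> A \<Longrightarrow> gen_laurent (F i)) \<Longrightarrow> l \<in> {1..d} \<Longrightarrow>
    PD l (\<lambda>t. \<Sum>i\<in>A. F i t) = (\<lambda>t. \<Sum>i\<in>A. PD l (F i) t)"
  by (rule PD_eqI) (auto intro!: has_vector_derivative_sum has_PD sum.neutral simp: PD_outside)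

lemma PD_mult: "gen_laurent F \<Longrightarrow> gen_laurent H \<Longrightarrow> l \<in> {1..d} \<Longrightarrow>
    PD l (\<lambda>t. F t * H t) = (\<lambda>t. PD l F t * H t + F t * PD l H t)"
  apply (rule PD_eqI)
  subgoal for t using has_vector_derivative_mult[OF has_PD[of F l t] has_PD[of H l t]] by (simp add: add.commute)
  by (auto simp: PD_outside)

text \<open>On a monomial both orders give the same product of exponents and the same lowered
  exponents; linearity does the rest.\<close>

lemma PD_commute:
  assumes "gen_laurent F" "l \<in> {1..d}" "k \<in> {1..d}"
  shows "PD l (PD k F) = PD k (PD l F)"
  using assms(1)
proof (induction rule: gen_laurent.induct)
  case (add_gmono F a \<mu>)
  have "\<mu> k * (\<mu> l - idx k l) = \<mu> l * (\<mu> k - idx l k)" by (auto simp: idx_def)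
  moreover have "(\<lambda>m. \<mu> m - idx k m - idx l m) = (\<lambda>m. \<mu> m - idx l m - idx k m)" by (auto simp: algebra_simps)
  ultimately have "PD l (PD k (gmono \<mu>)) = PD k (PD l (gmono \<mu>))"
    using assms by (simp add: PD_gmono PD_cmult flip: mult.assoc)
  thus ?case using add_gmono assms by (simp add: PD_add PD_cmult)
qed (simp add: PD_zero)

section \<open>The Gaussian at the critical point\<close>

text \<open>The indicator of the orthant, which acts as the constant 1 on this algebra.\<close>

definition unit_fun :: "(nat \<Rightarrow> real) \<Rightarrow> complex" where "unit_fun = gmono (\<lambda>_. 0)"

definition yc :: "nat \<Rightarrow> (nat \<Rightarrow> real) \<Rightarrow> complex" where
  "yc l t = gmono (idx l) t - unit_fun t"

text \<open>Row l of the Hessian I + E, with E the all-ones matrix, applied to the coordinates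
  \<open>yc\<close>.\<close>

definition zc :: "nat \<Rightarrow> (nat \<Rightarrow> real) \<Rightarrow> complex" where
  "zc l t = yc l t + (\<Sum>k=1..d. yc k t)"

lemma gen_laurent_unit [simp, intro]: "gen_laurent unit_fun"
  and gen_laurent_yc [simp, intro]: "gen_laurent (yc l)"
  and gen_laurent_zc [simp, intro]: "gen_laurent (zc l)"
  unfolding unit_fun_def yc_def[abs_def] zc_def[abs_def] by auto

lemma unit_mult: "gen_laurent F \<Longrightarrow> unit_fun t * F t = F t"
  by (cases "t \<in> orthant") (auto simp: unit_fun_def gmono_def gen_laurent_outside orthant_def intro!: prod.neutral)

lemma PD_unit: "l \<in> {1..d} \<Longrightarrow> PD l unit_fun = (\<lambda>t. 0)"
  by (simp add: unit_fun_def PD_gmono)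

lemma PD_yc: "m \<in> {1..d} \<Longrightarrow> PD m (yc k) = (\<lambda>t. idx k m * unit_fun t)"
  unfolding yc_def[abs_def] by (subst PD_diff) (auto simp: PD_gmono PD_unit idx_def unit_fun_def fun_eq_iff)

lemma PD_yc_mult:
  assumes "gen_laurent P" "m \<in> {1..d}"
  shows "PD m (\<lambda>t. yc k t * P t) = (\<lambda>t. idx k m * P t + yc k t * PD m P t)"
  using assms by (subst PD_mult) (auto simp: PD_yc mult.assoc unit_mult)

text \<open>On this class it is \<open>L_op d\<close> divided by 2(d + 1), with the mixed
  derivatives summed over ordered pairs.\<close>

definition LN :: "((nat \<Rightarrow> real) \<Rightarrow> complex) \<Rightarrow> (nat \<Rightarrow> real) \<Rightarrow> complex" where
  "LN F t = (\<Sum>l=1..d. PD l (PD l F) t) / 2 - (\<Sum>l=1..d. \<Sum>k=1..d. PD l (PD k F) t) / (2 * (of_nat d + 1))"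

lemma gen_laurent_LN [simp, intro]: "gen_laurent F \<Longrightarrow> gen_laurent (LN F)"
proof -
  assume F: "gen_laurent F"
  have "gen_laurent (\<lambda>t. 1 / 2 * (\<Sum>l=1..d. PD l (PD l F) t) - 1 / (2 * (of_nat d + 1)) * (\<Sum>l=1..d. \<Sum>k=1..d. PD l (PD k F) t))"
    using F by (intro gen_laurent_diff gen_laurent_cmult gen_laurent_sum gen_laurent_PD)
  thus ?thesis by (simp add: LN_def[abs_def])
qed

lemma gen_laurent_LN_pow [simp, intro]: "gen_laurent F \<Longrightarrow> gen_laurent ((LN ^^ j) F)"
  by (induction j) auto

lemma LN_zero: "LN (\<lambda>t. 0) = (\<lambda>t. 0)"
  by (simp add: LN_def[abs_def] PD_zero)

lemma LN_add: "gen_laurent F \<Longrightarrow> gen_laurent H \<Longrightarrow> LN (\<lambda>t. F t + H t) = (\<lambda>t. LN F t + LN H t)"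
  by (rule ext) (simp add: LN_def PD_add sum.distrib add_divide_distrib)

lemma LN_cmult: "gen_laurent F \<Longrightarrow> LN (\<lambda>t. b * F t) = (\<lambda>t. b * LN F t)"
  by (rule ext) (simp add: LN_def PD_cmult sum_distrib_left right_diff_distrib)

lemma LN_sum: "(\<And>i. i \<in> A \<Longrightarrow> gen_laurent (F i)) \<Longrightarrow> LN (\<lambda>t. \<Sum>i\<in>A. F i t) = (\<lambda>t. \<Sum>i\<in>A. LN (F i) t)"
  by (induction A rule: infinite_finite_induct) (simp_all add: LN_zero LN_add)

lemma PD_LN:
  assumes "gen_laurent F" "m \<in> {1..d}"
  shows "PD m (LN F) = LN (PD m F)"
proof -
  have c: "PD m (PD l (PD k F)) = PD l (PD k (PD m F))" if "l \<in> {1..d}" "k \<in> {1..d}" for l k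
    using that assms by (simp add: PD_commute[of "PD k F" m l] PD_commute[of F m k])
  have e: "LN F = (\<lambda>t. 1 / 2 * (\<Sum>l=1..d. PD l (PD l F) t) - 1 / (2 * (of_nat d + 1)) * (\<Sum>l=1..d. \<Sum>k=1..d. PD l (PD k F) t))"
    by (simp add: LN_def[abs_def])
  have "PD m (LN F) = (\<lambda>t. 1 / 2 * (\<Sum>l=1..d. PD m (PD l (PD l F)) t) - 1 / (2 * (of_nat d + 1)) * (\<Sum>l=1..d. \<Sum>k=1..d. PD m (PD l (PD k F)) t))"
    unfolding e using assms
    by (simp only: PD_diff PD_cmult PD_sum gen_laurent_diff gen_laurent_cmult gen_laurent_sum gen_laurent_PD cong: sum.cong)
  also have "\<dots> = LN (PD m F)" unfolding LN_def[abs_def] using c by simp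
  finally show ?thesis .
qed

lemma PD_LN_pow: "gen_laurent F \<Longrightarrow> m \<in> {1..d} \<Longrightarrow> PD m ((LN ^^ j) F) = (LN ^^ j) (PD m F)"
  by (induction j) (auto simp: PD_LN)

lemma sum_idx: "k \<in> {1..d} \<Longrightarrow> (\<Sum>l=1..d. idx k l * f l) = f k"
  by (simp add: idx_def if_distrib[of "\<lambda>x. x * _"] sum.delta cong: if_cong)

text \<open>The commutator of a second-order operator with a coordinate is a row of its matrix
  applied to the gradient, here row k of I - E/(d+1).\<close>

lemma LN_yc_mult:
  assumes "gen_laurent P" "k \<in> {1..d}"
  shows "LN (\<lambda>t. yc k t * P t) = (\<lambda>t. yc k t * LN P t + PD k P t - (\<Sum>l=1..d. PD l P t) / (of_nat d + 1))"
proof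
  fix t
  have 1: "PD l (PD m (\<lambda>t. yc k t * P t)) t = idx k m * PD l P t + idx k l * PD m P t + yc k t * PD l (PD m P) t"
    if "l \<in> {1..d}" "m \<in> {1..d}" for l m
    using that assms by (simp add: PD_yc_mult PD_add PD_cmult)
  have 2: "(\<Sum>l=1..d. PD l (PD l (\<lambda>t. yc k t * P t)) t) = 2 * PD k P t + yc k t * (\<Sum>l=1..d. PD l (PD l P) t)"
    using assms sum_idx[OF assms(2), of "\<lambda>l. PD l P t"] by (simp add: 1 sum.distrib flip: sum_distrib_left)
  have "(\<Sum>l=1..d. \<Sum>m=1..d. PD l (PD m (\<lambda>t. yc k t * P t)) t) =
     (\<Sum>l=1..d. \<Sum>m=1..d. idx k m * PD l P t) + (\<Sum>l=1..d. \<Sum>m=1..d. idx k l * PD m P t) + yc k t * (\<Sum>l=1..d. \<Sum>m=1..d. PD l (PD m P) t)"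
    by (simp add: 1 sum.distrib sum_distrib_left)
  also have "(\<Sum>l=1..d. \<Sum>m=1..d. idx k m * PD l P t) = (\<Sum>l=1..d. PD l P t)"
    using sum_idx[OF assms(2), of "\<lambda>_. PD l P t" for l] by simp
  also have "(\<Sum>l=1..d. \<Sum>m=1..d. idx k l * PD m P t) = (\<Sum>m=1..d. PD m P t)"
    using sum_idx[OF assms(2), of "\<lambda>_. \<Sum>m=1..d. PD m P t"] by (simp add: sum_distrib_left)
  finally have 3: "(\<Sum>l=1..d. \<Sum>m=1..d. PD l (PD m (\<lambda>t. yc k t * P t)) t) =
     2 * (\<Sum>l=1..d. PD l P t) + yc k t * (\<Sum>l=1..d. \<Sum>m=1..d. PD l (PD m P) t)" by simp
  show "LN (\<lambda>t. yc k t * P t) t = yc k t * LN P t + PD k P t - (\<Sum>l=1..d. PD l P t) / (of_nat d + 1)"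
    unfolding LN_def 2 3 add_divide_distrib right_diff_distrib mult_divide_mult_cancel_left[OF zero_neq_numeral[symmetric]] by simp
qed

text \<open>\<open>zc\<close> is the Hessian applied to the coordinates and \<open>LN\<close>
  carries the inverse Hessian, so the two matrices cancel and the commutator is a single partial
  derivative.\<close>

lemma LN_zc_mult:
  assumes "gen_laurent P" "k \<in> {1..d}"
  shows "LN (\<lambda>t. zc k t * P t) = (\<lambda>t. zc k t * LN P t + PD k P t)"
proof
  fix t
  let ?S = "\<Sum>l=1..d. PD l P t"
  have "(\<lambda>t. zc k t * P t) = (\<lambda>t. yc k t * P t + (\<Sum>l=1..d. yc l t * P t))"
    by (simp add: zc_def distrib_right sum_distrib_right)
  hence "LN (\<lambda>t. zc k t * P t) t = LN (\<lambda>t. yc k t * P t) t + (\<Sum>l=1..d. LN (\<lambda>t. yc l t * P t) t)"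
    using assms by (simp add: LN_add LN_sum)
  also have "\<dots> = (yc k t * LN P t + PD k P t - ?S / (of_nat d + 1)) +
      ((\<Sum>l=1..d. yc l t * LN P t) + ?S - of_nat d * (?S / (of_nat d + 1)))"
    using assms by (simp add: LN_yc_mult sum.distrib sum_subtractf)
  also have "\<dots> = zc k t * LN P t + PD k P t + (?S - (?S / (of_nat d + 1) + of_nat d * (?S / (of_nat d + 1))))"
    by (simp add: zc_def distrib_right sum_distrib_right)
  also have "?S / (of_nat d + 1) + of_nat d * (?S / (of_nat d + 1)) = (of_nat d + 1) * (?S / (of_nat d + 1))"

    unfolding distrib_right by simp
  also have "\<dots> = ?S" using of_nat_neq_0[of d, where ?'a = complex] by (simp add: add.commute)
  finally show "LN (\<lambda>t. zc k t * P t) t = zc k t * LN P t + PD k P t" by simp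
qed

text \<open>\<open>LN\<close> commutes with partial derivatives, so each further power adds one copy
  of the commutator.\<close>

lemma LN_pow_zc_mult:
  assumes "gen_laurent P" "k \<in> {1..d}"
  shows "(LN ^^ Suc j) (\<lambda>t. zc k t * P t) = (\<lambda>t. zc k t * (LN ^^ Suc j) P t + of_nat (Suc j) * (LN ^^ j) (PD k P) t)"
proof (induction j)
  case 0 show ?case using LN_zc_mult[OF assms] by simp
next
  case (Suc j)
  have "(LN ^^ Suc (Suc j)) (\<lambda>t. zc k t * P t) = LN (\<lambda>t. zc k t * (LN ^^ Suc j) P t + of_nat (Suc j) * (LN ^^ j) (PD k P) t)"
    using Suc.IH by simp
  also have "\<dots> = (\<lambda>t. LN (\<lambda>t. zc k t * (LN ^^ Suc j) P t) t + of_nat (Suc j) * LN ((LN ^^ j) (PD k P)) t)"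
    using assms by (subst LN_add) (auto simp: LN_cmult)
  also have "LN (\<lambda>t. zc k t * (LN ^^ Suc j) P t) = (\<lambda>t. zc k t * LN ((LN ^^ Suc j) P) t + PD k ((LN ^^ Suc j) P) t)"
    using assms by (intro LN_zc_mult gen_laurent_LN_pow)
  also have "PD k ((LN ^^ Suc j) P) = (LN ^^ Suc j) (PD k P)" using assms by (intro PD_LN_pow)
  finally show ?case by (simp add: algebra_simps)
qed

text \<open>
  The phase \<open>t\<^sub>1 \<cdots> t\<^sub>d + \<Sum> 1/t\<^sub>l\<close> has Hessian \<open>I + E\<close> at its critical point \<open>(1, \<dots>, 1)\<close>, where \<open>E\<close> is the all-ones
  matrix; \<open>LN\<close> is half the Laplacian of the inverse \<open>I - E/(d+1)\<close>. Hence \<open>EV j F\<close> is the coefficient of \<open>x\<^bsup>-j\<^esup>\<close> in the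
  mean of \<open>F\<close> under the Gaussian with density proportional to \<open>exp(-x quad)\<close>.
\<close>

definition EV :: "nat \<Rightarrow> ((nat \<Rightarrow> real) \<Rightarrow> complex) \<Rightarrow> complex" where
  "EV j F = (LN ^^ j) F (\<lambda>_. 1) / fact j"

lemma yc_one [simp]: "yc l (\<lambda>_. 1) = 0" by (simp add: yc_def unit_fun_def)
lemma zc_one [simp]: "zc l (\<lambda>_. 1) = 0" by (simp add: zc_def)

lemma LN_pow_add: "gen_laurent F \<Longrightarrow> gen_laurent H \<Longrightarrow> (LN ^^ j) (\<lambda>t. F t + H t) = (\<lambda>t. (LN ^^ j) F t + (LN ^^ j) H t)"
  by (induction j) (auto simp: LN_add)

lemma LN_pow_cmult: "gen_laurent F \<Longrightarrow> (LN ^^ j) (\<lambda>t. b * F t) = (\<lambda>t. b * (LN ^^ j) F t)"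
  by (induction j) (auto simp: LN_cmult)

lemma EV_add: "gen_laurent F \<Longrightarrow> gen_laurent H \<Longrightarrow> EV j (\<lambda>t. F t + H t) = EV j F + EV j H"
  by (simp add: EV_def LN_pow_add add_divide_distrib)

lemma EV_cmult: "gen_laurent F \<Longrightarrow> EV j (\<lambda>t. b * F t) = b * EV j F"
  by (simp add: EV_def LN_pow_cmult)

lemma EV_zero: "EV j (\<lambda>t. 0) = 0"
  using EV_cmult[OF gen_laurent.zero, of j 0] by simp

lemma EV_diff: "gen_laurent F \<Longrightarrow> gen_laurent H \<Longrightarrow> EV j (\<lambda>t. F t - H t) = EV j F - EV j H"
  using EV_add[OF _ gen_laurent_cmult[of H "-1"], of F j] EV_cmult[of H j "-1"] by simp

lemma EV_sum: "(\<And>i. i \<in> A \<Longrightarrow> gen_laurent (F i)) \<Longrightarrow> EV j (\<lambda>t. \<Sum>i\<in>A. F i t) = (\<Sum>i\<in>A. EV j (F i))"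
  by (induction A rule: infinite_finite_induct) (simp_all add: EV_zero EV_add)

text \<open>
  Integration by parts: \<open>zc k\<close> is the \<open>k\<close>-th partial derivative of \<open>quad\<close>.
\<close>

lemma EV_Suc_zc: "gen_laurent P \<Longrightarrow> k \<in> {1..d} \<Longrightarrow> EV (Suc j) (\<lambda>t. zc k t * P t) = EV j (PD k P)"
  unfolding EV_def LN_pow_zc_mult by (simp del: funpow.simps of_nat_Suc)

definition euler_op :: "((nat \<Rightarrow> real) \<Rightarrow> complex) \<Rightarrow> (nat \<Rightarrow> real) \<Rightarrow> complex" where
  "euler_op P t = (\<Sum>l=1..d. yc l t * PD l P t)"

lemma gen_laurent_euler_op [simp, intro]: "gen_laurent P \<Longrightarrow> gen_laurent (euler_op P)"
  unfolding euler_op_def[abs_def] by auto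

text \<open>\<open>LN\<close> lowers the degree in the coordinates \<open>yc\<close> by 2, hence its
  commutator with the Euler operator is twice itself.\<close>

lemma LN_euler_op:
  assumes "gen_laurent P"
  shows "LN (euler_op P) = (\<lambda>t. euler_op (LN P) t + 2 * LN P t)"
proof
  fix t
  have "LN (euler_op P) t = (\<Sum>l=1..d. LN (\<lambda>t. yc l t * PD l P t) t)"
    unfolding euler_op_def[abs_def] using assms by (subst LN_sum) auto
  also have "\<dots> = (\<Sum>l=1..d. yc l t * LN (PD l P) t + PD l (PD l P) t - (\<Sum>m=1..d. PD m (PD l P) t) / (of_nat d + 1))"
    using assms by (intro sum.cong) (auto simp: LN_yc_mult)
  also have "\<dots> = euler_op (LN P) t + (\<Sum>l=1..d. PD l (PD l P) t) - (\<Sum>l=1..d. \<Sum>m=1..d. PD m (PD l P) t) / (of_nat d + 1)"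
    using assms by (simp add: sum.distrib sum_subtractf sum_divide_distrib euler_op_def PD_LN)
  also have "(\<Sum>l=1..d. \<Sum>m=1..d. PD m (PD l P) t) = (\<Sum>l=1..d. \<Sum>m=1..d. PD l (PD m P) t)" by (rule sum.swap)
  finally have "LN (euler_op P) t = euler_op (LN P) t + (\<Sum>l=1..d. PD l (PD l P) t) -
    (\<Sum>l=1..d. \<Sum>m=1..d. PD l (PD m P) t) / (of_nat d + 1)" .
  moreover have "2 * LN P t = (\<Sum>l=1..d. PD l (PD l P) t) - (\<Sum>l=1..d. \<Sum>m=1..d. PD l (PD m P) t) / (of_nat d + 1)"
    unfolding LN_def right_diff_distrib times_divide_eq_right mult_divide_mult_cancel_left[OF zero_neq_numeral[symmetric]] by simp
  ultimately show "LN (euler_op P) t = euler_op (LN P) t + 2 * LN P t" by simp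
qed

lemma LN_pow_euler_op:
  assumes "gen_laurent P"
  shows "(LN ^^ j) (euler_op P) = (\<lambda>t. euler_op ((LN ^^ j) P) t + 2 * of_nat j * (LN ^^ j) P t)"
proof (induction j)
  case (Suc j)
  thus ?case using assms
    by (simp add: LN_add LN_cmult LN_euler_op algebra_simps)
qed simp

definition quad :: "(nat \<Rightarrow> real) \<Rightarrow> complex" where
  "quad t = 1 / 2 * (\<Sum>l=1..d. yc l t * zc l t)"

lemma gen_laurent_quad [simp, intro]: "gen_laurent quad"
  unfolding quad_def[abs_def] by (intro gen_laurent_cmult) auto

text \<open>Write \<open>quad\<close> as half the sum of the products of \<open>yc\<close> and
  \<open>zc\<close> and integrate by parts: this leaves d/2 plus half the Euler operator. At (1,
  ..., 1) the Euler operator itself vanishes, and only the factor 2j from its commutator with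
  \<open>LN ^^ j\<close> remains.\<close>

lemma EV_quad:
  assumes "gen_laurent P"
  shows "EV (Suc j) (\<lambda>t. quad t * P t) = (of_nat j + of_nat d / 2) * EV j P"
proof -
  have "EV (Suc j) (\<lambda>t. quad t * P t) = EV (Suc j) (\<lambda>t. 1 / 2 * (\<Sum>l=1..d. zc l t * (yc l t * P t)))"
    by (simp add: quad_def sum_distrib_left sum_distrib_right mult_ac)
  also have "\<dots> = 1 / 2 * (\<Sum>l=1..d. EV (Suc j) (\<lambda>t. zc l t * (yc l t * P t)))"
    using assms by (subst EV_cmult) (auto simp: EV_sum)
  also have "(\<Sum>l=1..d. EV (Suc j) (\<lambda>t. zc l t * (yc l t * P t))) = (\<Sum>l=1..d. EV j (PD l (\<lambda>t. yc l t * P t)))"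
    using assms by (intro sum.cong EV_Suc_zc) auto
  also have "\<dots> = EV j (\<lambda>t. \<Sum>l=1..d. PD l (\<lambda>t. yc l t * P t) t)"
    using assms by (subst EV_sum) auto
  also have "(\<lambda>t. \<Sum>l=1..d. PD l (\<lambda>t. yc l t * P t) t) = (\<lambda>t. of_nat d * P t + euler_op P t)"
    using assms by (auto simp: PD_yc_mult sum.distrib euler_op_def idx_def)
  also have "EV j \<dots> = of_nat d * EV j P + 2 * of_nat j * EV j P"
    using assms by (simp add: EV_add EV_cmult) (simp add: EV_def LN_pow_euler_op euler_op_def)
  finally show ?thesis by (simp add: field_simps)
qed

text \<open>A zero of order at least q at (1, ..., 1), phrased through iterated partial derivatives;
  membership in the class is carried along at every level.\<close>

primrec vanishes :: "nat \<Rightarrow> ((nat \<Rightarrow> real) \<Rightarrow> complex) \<Rightarrow> bool" where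
  "vanishes 0 F = gen_laurent F"
| "vanishes (Suc q) F = (gen_laurent F \<and> F (\<lambda>_. 1) = 0 \<and> (\<forall>l\<in>{1..d}. vanishes q (PD l F)))"

lemma vanishes_gen_laurent: "vanishes q F \<Longrightarrow> gen_laurent F"
  by (cases q) auto

lemma vanishes_SucD: "vanishes (Suc q) F \<Longrightarrow> vanishes q F"
  by (induction q arbitrary: F) auto

lemma vanishes_add: "vanishes q F \<Longrightarrow> vanishes q H \<Longrightarrow> vanishes q (\<lambda>t. F t + H t)"
  by (induction q arbitrary: F H) (auto simp: PD_add)

lemma vanishes_cmult: "vanishes q F \<Longrightarrow> vanishes q (\<lambda>t. b * F t)"
  by (induction q arbitrary: F) (auto simp: PD_cmult)

lemma vanishes_zero: "vanishes q (\<lambda>t. 0)"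
  by (induction q) (auto simp: PD_zero intro: gen_laurent.zero)

lemma vanishes_sum: "(\<And>i. i \<in> A \<Longrightarrow> vanishes q (F i)) \<Longrightarrow> vanishes q (\<lambda>t. \<Sum>i\<in>A. F i t)"
  by (induction A rule: infinite_finite_induct) (auto simp: vanishes_zero vanishes_add)

text \<open>Induction on the total order: a derivative lowers one of the two orders, and where that
  order is already 0 the other factor is first weakened by one.\<close>

lemma vanishes_mult: "vanishes a F \<Longrightarrow> vanishes b H \<Longrightarrow> vanishes (a + b) (\<lambda>t. F t * H t)"
proof (induction "a + b" arbitrary: a b F H)
  case 0
  thus ?case by auto
next
  case (Suc N)
  have g: "gen_laurent F" "gen_laurent H" using Suc.prems vanishes_gen_laurent by blast+
  have "F (\<lambda>_. 1) * H (\<lambda>_. 1) = 0"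
    using Suc.hyps Suc.prems by (cases a; cases b) auto
  moreover have "vanishes N (\<lambda>t. PD l F t * H t + F t * PD l H t)" if l: "l \<in> {1..d}" for l
  proof (rule vanishes_add)
    show "vanishes N (\<lambda>t. PD l F t * H t)"
    proof (cases a)
      case 0
      hence "vanishes N H" using Suc.hyps(2) Suc.prems(2) vanishes_SucD[of N H] by (simp del: vanishes.simps)
      thus ?thesis using Suc.hyps(1)[of 0 N "PD l F" H] g l by simp
    next
      case (Suc a')
      thus ?thesis using Suc.hyps(1)[of a' b "PD l F" H] Suc.hyps(2) Suc.prems l by simp
    qed
    show "vanishes N (\<lambda>t. F t * PD l H t)"
    proof (cases b)
      case 0
      hence "vanishes N F" using Suc.hyps(2) Suc.prems(1) vanishes_SucD[of N F] by (simp del: vanishes.simps)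
      thus ?thesis using Suc.hyps(1)[of N 0 F "PD l H"] g l by simp
    next
      case (Suc b')
      thus ?thesis using Suc.hyps(1)[of a b' F "PD l H"] Suc.hyps(2) Suc.prems l by simp
    qed
  qed
  ultimately show ?case using g unfolding Suc.hyps(2)[symmetric] by (simp add: PD_mult)
qed

lemma vanishes_LN:
  assumes "vanishes (Suc (Suc q)) F"
  shows "vanishes q (LN F)"
proof -
  have v: "vanishes q (PD l (PD k F))" if "l \<in> {1..d}" "k \<in> {1..d}" for l k using assms that by auto
  have "vanishes q (\<lambda>t. 1 / 2 * (\<Sum>l=1..d. PD l (PD l F) t) + (- 1 / (2 * (of_nat d + 1))) * (\<Sum>l=1..d. \<Sum>k=1..d. PD l (PD k F) t))"
    using v by (intro vanishes_add vanishes_cmult vanishes_sum) auto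
  thus ?thesis by (simp add: LN_def[abs_def])
qed

text \<open>\<open>LN ^^ j\<close> consumes 2j derivatives, so a zero of higher order survives at
  the base point.\<close>

lemma EV_vanishes:
  assumes "vanishes q F" "2 * j < q"
  shows "EV j F = 0"
proof -
  have "2 * j \<le> q \<Longrightarrow> vanishes (q - 2 * j) ((LN ^^ j) F)"
  proof (induction j)
    case (Suc j)
    hence "q - 2 * j = Suc (Suc (q - 2 * Suc j))" by simp
    with Suc show ?case using vanishes_LN[of "q - 2 * Suc j" "(LN ^^ j) F"] by simp
  qed (use assms in simp)
  moreover obtain r where "q - 2 * j = Suc r" using assms(2) by (metis Suc_diff_Suc)
  ultimately have "vanishes (Suc r) ((LN ^^ j) F)" using assms(2) by simp
  thus ?thesis by (simp add: EV_def)
qed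

section \<open>The phase and its remainder of third order\<close>

lemma idx_commute: "idx k l = idx l k" by (simp add: idx_def)

lemma sum_idx': "l \<in> {1..d} \<Longrightarrow> (\<Sum>k=1..d. idx k l * h k) = h l"
  using sum_idx[of l h] by (simp add: idx_commute[of _ l])

lemma gmono_cong: "(\<And>k. k \<in> {1..d} \<Longrightarrow> \<mu> k = \<mu>' k) \<Longrightarrow> gmono \<mu> = gmono \<mu>'"
  by (auto simp: gmono_def fun_eq_iff intro!: prod.cong)

definition phase :: "(nat \<Rightarrow> real) \<Rightarrow> complex" where
  "phase t = gmono (\<lambda>_. 1) t + (\<Sum>l=1..d. gmono (\<lambda>k. - idx l k) t)"

definition phase_rem :: "(nat \<Rightarrow> real) \<Rightarrow> complex" where
  "phase_rem t = phase t - (of_nat d + 1) * unit_fun t - quad t"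

lemma gen_laurent_phase [simp, intro]: "gen_laurent phase"
  unfolding phase_def[abs_def] by auto

lemma gen_laurent_phase_rem [simp, intro]: "gen_laurent phase_rem"
  unfolding phase_rem_def[abs_def] by auto

lemma PD_zc: "l \<in> {1..d} \<Longrightarrow> PD l (zc k) = (\<lambda>t. (idx k l + 1) * unit_fun t)"
proof -
  assume l: "l \<in> {1..d}"
  have "PD l (zc k) = (\<lambda>t. PD l (yc k) t + (\<Sum>j=1..d. PD l (yc j) t))"
    unfolding zc_def[abs_def] using l by (subst PD_add) (auto simp: PD_sum)
  also have "\<dots> = (\<lambda>t. (idx k l + 1) * unit_fun t)"
    using l sum_idx'[OF l, of "\<lambda>_. unit_fun t" for t] by (simp add: PD_yc distrib_right)
  finally show ?thesis .
qed

lemma PD_quad: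
  assumes l: "l \<in> {1..d}"
  shows "PD l quad = zc l"
proof
  fix t
  have "PD l quad t = 1 / 2 * (\<Sum>k=1..d. PD l (\<lambda>t. yc k t * zc k t) t)"
    unfolding quad_def[abs_def] using l by (subst PD_cmult) (auto simp: PD_sum)
  also have "(\<Sum>k=1..d. PD l (\<lambda>t. yc k t * zc k t) t) = (\<Sum>k=1..d. idx k l * zc k t + (idx k l * yc k t + yc k t))"
    using l by (intro sum.cong) (auto simp: PD_yc_mult PD_zc algebra_simps unit_mult mult.commute[of _ "unit_fun t"])
  also have "\<dots> = zc l t + (yc l t + (\<Sum>k=1..d. yc k t))"
    by (simp only: sum.distrib sum_idx'[OF l])
  finally show "PD l quad t = zc l t" by (simp only: zc_def[symmetric]) simp
qed

lemma PD_phase: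
  assumes l: "l \<in> {1..d}"
  shows "PD l phase = (\<lambda>t. gmono (\<lambda>k. 1 - idx l k) t - gmono (\<lambda>k. - idx l k - idx l k) t)"
proof
  fix t
  have "PD l phase t = PD l (gmono (\<lambda>_. 1)) t + (\<Sum>j=1..d. PD l (gmono (\<lambda>k. - idx j k)) t)"
    unfolding phase_def[abs_def] using l by (subst PD_add) (auto simp: PD_sum)
  also have "\<dots> = gmono (\<lambda>k. 1 - idx l k) t - (\<Sum>j=1..d. idx j l * gmono (\<lambda>k. - idx j k - idx l k) t)"
    using l by (simp add: PD_gmono sum_negf)
  also have "(\<Sum>j=1..d. idx j l * gmono (\<lambda>k. - idx j k - idx l k) t) = gmono (\<lambda>k. - idx l k - idx l k) t"
    by (rule sum_idx'[OF l])
  finally show "PD l phase t = gmono (\<lambda>k. 1 - idx l k) t - gmono (\<lambda>k. - idx l k - idx l k) t" .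
qed

lemma PD_phase_rem:
  assumes "l \<in> {1..d}"
  shows "PD l phase_rem = (\<lambda>t. PD l phase t - zc l t)"
  unfolding phase_rem_def[abs_def] using assms
  by (simp add: PD_diff PD_cmult PD_unit PD_quad gen_laurent_diff gen_laurent_cmult)

text \<open>At (1, ..., 1) the phase has value d + 1, gradient 0 and Hessian I + E; the constant and
  \<open>quad\<close> subtracted in \<open>phase_rem\<close> match all three.\<close>

lemma vanishes_phase_rem: "vanishes 3 phase_rem"
proof -
  have 0: "phase_rem (\<lambda>_. 1) = 0"
    by (simp add: phase_rem_def phase_def unit_fun_def quad_def)
  have 1: "PD l phase_rem (\<lambda>_. 1) = 0" if "l \<in> {1..d}" for l
    using that by (simp add: PD_phase_rem PD_phase)
  have 2: "PD k (PD l phase_rem) (\<lambda>_. 1) = 0" if "l \<in> {1..d}" "k \<in> {1..d}" for k l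
  proof -
    have "PD k (PD l phase) = (\<lambda>t. PD k (gmono (\<lambda>k. 1 - idx l k)) t - PD k (gmono (\<lambda>k. - idx l k - idx l k)) t)"
      unfolding PD_phase[OF that(1)] using that by (intro PD_diff) auto
    thus ?thesis using that
      by (simp add: PD_phase_rem PD_diff PD_zc PD_gmono unit_fun_def)
  qed
  show ?thesis using 0 1 2 by (simp add: numeral_3_eq_3)
qed

lemma gen_laurent_rem_pow [simp, intro]: "gen_laurent \<phi> \<Longrightarrow> gen_laurent (\<lambda>t. phase_rem t ^ r * \<phi> t)"
proof (induction r)
  case (Suc r)
  from gen_laurent_mult[OF gen_laurent_phase_rem Suc.IH[OF Suc.prems]] show ?case by (simp add: mult.assoc)
qed auto

lemma vanishes_rem_pow: "vanishes q \<phi> \<Longrightarrow> vanishes (3 * r + q) (\<lambda>t. phase_rem t ^ r * \<phi> t)"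
proof (induction r)
  case (Suc r)
  from vanishes_mult[OF vanishes_phase_rem Suc.IH[OF Suc.prems]] show ?case by (simp add: mult.assoc add_ac)
qed auto

lemma PD_rem_pow:
  assumes "gen_laurent \<phi>" "l \<in> {1..d}"
  shows "PD l (\<lambda>t. phase_rem t ^ r * \<phi> t) =
    (\<lambda>t. phase_rem t ^ r * PD l \<phi> t + of_nat r * (phase_rem t ^ (r - 1) * (PD l phase_rem t * \<phi> t)))"
proof (induction r)
  case (Suc r)
  have "PD l (\<lambda>t. phase_rem t ^ Suc r * \<phi> t) = PD l (\<lambda>t. phase_rem t * (phase_rem t ^ r * \<phi> t))"
    by (simp add: mult.assoc)
  also have "\<dots> = (\<lambda>t. PD l phase_rem t * (phase_rem t ^ r * \<phi> t) + phase_rem t * PD l (\<lambda>t. phase_rem t ^ r * \<phi> t) t)"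
    using assms by (intro PD_mult) auto
  also have "\<dots> = (\<lambda>t. phase_rem t ^ Suc r * PD l \<phi> t + of_nat (Suc r) * (phase_rem t ^ r * (PD l phase_rem t * \<phi> t)))"
    unfolding Suc.IH by (cases r) (auto simp: algebra_simps)
  finally show ?case by simp
qed simp

text \<open>
  The coefficient of \<open>x\<^bsup>-m\<^esup>\<close> in the Laplace expansion of \<open>\<integral> exp(-x phase) \<phi>\<close>, with \<open>exp(-x phase_rem)\<close> expanded.
  Since \<open>phase_rem\<close> vanishes to third order at \<open>(1, \<dots>, 1)\<close>, the value does not depend on the truncation \<open>N \<ge> 2m\<close>.
\<close>

definition formal_int :: "nat \<Rightarrow> nat \<Rightarrow> ((nat \<Rightarrow> real) \<Rightarrow> complex) \<Rightarrow> complex" where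
  "formal_int m N \<phi> = (\<Sum>r\<le>N. (-1) ^ r / fact r * EV (m + r) (\<lambda>t. phase_rem t ^ r * \<phi> t))"

text \<open>The r-th summand has a zero of order 3r under m + r powers of \<open>LN\<close>, so it
  vanishes once 3r > 2(m + r), that is r > 2m. This explains the upper limit 2m in
  \<open>B_poly\<close>.\<close>

lemma formal_int_stable:
  assumes "gen_laurent \<phi>" "2 * m \<le> N"
  shows "formal_int m N \<phi> = formal_int m (2 * m) \<phi>"
  unfolding formal_int_def
proof (rule sum.mono_neutral_right)
  show "\<forall>r\<in>{..N} - {..2 * m}. (- 1) ^ r / fact r * EV (m + r) (\<lambda>t. phase_rem t ^ r * \<phi> t) = 0"
    using EV_vanishes[OF vanishes_rem_pow[of 0 \<phi>]] assms by auto
qed (use assms in auto)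

lemma formal_int_add: "gen_laurent \<phi> \<Longrightarrow> gen_laurent \<psi> \<Longrightarrow>
    formal_int m N (\<lambda>t. \<phi> t + \<psi> t) = formal_int m N \<phi> + formal_int m N \<psi>"
  unfolding formal_int_def by (simp add: distrib_left EV_add sum.distrib)

lemma formal_int_diff: "gen_laurent \<phi> \<Longrightarrow> gen_laurent \<psi> \<Longrightarrow>
    formal_int m N (\<lambda>t. \<phi> t - \<psi> t) = formal_int m N \<phi> - formal_int m N \<psi>"
  unfolding formal_int_def by (simp add: right_diff_distrib EV_diff sum_subtractf)

lemma formal_int_cmult:
  assumes "gen_laurent \<phi>"
  shows "formal_int m N (\<lambda>t. b * \<phi> t) = b * formal_int m N \<phi>"
proof -
  have "EV (m + r) (\<lambda>t. phase_rem t ^ r * (b * \<phi> t)) = b * EV (m + r) (\<lambda>t. phase_rem t ^ r * \<phi> t)" for r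
    using EV_cmult[OF gen_laurent_rem_pow[OF assms], of "m + r" b r] by (simp add: mult_ac)
  thus ?thesis by (simp add: formal_int_def sum_distrib_left mult_ac)
qed

lemma formal_int_zero: "formal_int m N (\<lambda>t. 0) = 0"
  using formal_int_cmult[OF gen_laurent.zero, of m N 0] by simp

lemma formal_int_sum: "(\<And>i. i \<in> A \<Longrightarrow> gen_laurent (F i)) \<Longrightarrow> formal_int m N (\<lambda>t. \<Sum>i\<in>A. F i t) = (\<Sum>i\<in>A. formal_int m N (F i))"
  by (induction A rule: infinite_finite_induct) (simp_all add: formal_int_zero formal_int_add)

text \<open>The index shift behind (e^(-xR))' = -x R' e^(-xR) for a truncated exponential series:
  the r-th term of the first sum cancels the one before it in the second, and \<open>b N = 0\<close>
  removes the term left over.\<close>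

lemma alternating_shift:
  fixes b c :: "nat \<Rightarrow> complex"
  assumes "\<And>r. c (Suc r) = b r" "b N = 0"
  shows "(\<Sum>r\<le>N. (-1) ^ r / fact r * (of_nat r * c r)) + (\<Sum>r\<le>N. (-1) ^ r / fact r * b r) = 0"
proof -
  have "(\<Sum>r\<le>N. (-1) ^ r / fact r * (of_nat r * c r)) = (\<Sum>r<N. (-1) ^ Suc r / fact (Suc r) * (of_nat (Suc r) * b r))"
    by (subst sum.atMost_shift) (simp only: assms of_nat_0 mult_zero_left mult_zero_right add_0)
  also have "\<dots> = (\<Sum>r<N. - ((-1) ^ r / fact r * b r))"
    by (intro sum.cong refl) (simp add: divide_simps del: of_nat_Suc)
  also have "\<dots> = - (\<Sum>r\<le>N. (-1) ^ r / fact r * b r)"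
    using assms(2) by (simp add: sum_negf flip: lessThan_Suc_atMost)
  finally show ?thesis by simp
qed

text \<open>Formal counterpart of integrating (d_l phase) phi e^(-x phase) by parts. The gradient is
  \<open>zc l\<close> plus that of \<open>phase_rem\<close>: the first part is integrated by parts
  against the Gaussian, and the derivatives falling on powers of \<open>phase_rem\<close> cancel the
  second.\<close>

lemma formal_int_by_parts:
  assumes "gen_laurent \<phi>" "l \<in> {1..d}" "2 * m + 3 \<le> N"
  shows "formal_int (Suc m) N (\<lambda>t. PD l phase t * \<phi> t) = formal_int m N (PD l \<phi>)"
proof -
  define b where "b = (\<lambda>r. EV (Suc m + r) (\<lambda>t. phase_rem t ^ r * (PD l phase_rem t * \<phi> t)))"
  define c where "c = (\<lambda>r. EV (m + r) (\<lambda>t. phase_rem t ^ (r - 1) * (PD l phase_rem t * \<phi> t)))"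
  have g: "gen_laurent (\<lambda>t. PD l phase_rem t * \<phi> t)" using assms by auto
  have t: "EV (Suc m + r) (\<lambda>t. phase_rem t ^ r * (PD l phase t * \<phi> t)) =
      EV (m + r) (\<lambda>t. phase_rem t ^ r * PD l \<phi> t) + (of_nat r * c r + b r)" for r
  proof -
    have "(\<lambda>t. phase_rem t ^ r * (PD l phase t * \<phi> t)) =
        (\<lambda>t. zc l t * (phase_rem t ^ r * \<phi> t) + phase_rem t ^ r * (PD l phase_rem t * \<phi> t))"
      using assms(2) by (simp add: PD_phase_rem algebra_simps)
    hence "EV (Suc m + r) (\<lambda>t. phase_rem t ^ r * (PD l phase t * \<phi> t)) =
       EV (Suc (m + r)) (\<lambda>t. zc l t * (phase_rem t ^ r * \<phi> t)) + b r"
      using assms g by (simp add: EV_add b_def gen_laurent_mult)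
    also have "EV (Suc (m + r)) (\<lambda>t. zc l t * (phase_rem t ^ r * \<phi> t)) = EV (m + r) (PD l (\<lambda>t. phase_rem t ^ r * \<phi> t))"
      using assms by (intro EV_Suc_zc) auto
    also have "\<dots> = EV (m + r) (\<lambda>t. phase_rem t ^ r * PD l \<phi> t) + of_nat r * c r"
      unfolding PD_rem_pow[OF assms(1,2)] c_def using assms g
      by (simp add: EV_add EV_cmult gen_laurent_cmult gen_laurent_rem_pow)
    finally show ?thesis by simp
  qed
  have "b N = 0"
  proof -
    \<comment> \<open>A first derivative of the remainder still has a zero of order 2. The last term
      thus has order 3N + 2, which exceeds the 2(m + 1 + N) derivatives taken by \<open>EV\<close>
      once N > 2m.\<close>
    have "vanishes (2 + 0) (\<lambda>t. PD l phase_rem t * \<phi> t)"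
      using vanishes_phase_rem assms by (intro vanishes_mult) (simp_all add: numeral_3_eq_3 numeral_2_eq_2)
    hence "vanishes (3 * N + 2) (\<lambda>t. phase_rem t ^ N * (PD l phase_rem t * \<phi> t))"
      by (intro vanishes_rem_pow) simp
    from EV_vanishes[OF this] show ?thesis unfolding b_def using assms(3) by simp
  qed
  hence "(\<Sum>r\<le>N. (-1) ^ r / fact r * (of_nat r * c r)) + (\<Sum>r\<le>N. (-1) ^ r / fact r * b r) = 0"
    by (intro alternating_shift) (simp_all add: b_def c_def)
  thus ?thesis unfolding formal_int_def t by (simp add: distrib_left sum.distrib)
qed

text \<open>Formal counterpart of differentiating in x. The expansion stands for e^(-(d+1)x)
  x^(-d/2) times a series in 1/x, so -d/dx multiplies its m-th term by d + 1 + (m + d/2)/x, while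
  under the integral sign it inserts the phase.\<close>

lemma formal_int_phase:
  assumes "gen_laurent \<phi>" "2 * m + 3 \<le> N"
  shows "formal_int (Suc m) N (\<lambda>t. phase t * \<phi> t) =
     (of_nat m + of_nat d / 2) * formal_int m N \<phi> + (of_nat d + 1) * formal_int (Suc m) N \<phi>"
proof -
  define c where "c = (\<lambda>r. EV (m + r) (\<lambda>t. phase_rem t ^ r * \<phi> t))"
  define b where "b = (\<lambda>r. EV (Suc m + r) (\<lambda>t. phase_rem t ^ Suc r * \<phi> t))"
  have t: "EV (Suc m + r) (\<lambda>t. phase_rem t ^ r * (phase t * \<phi> t)) =
      (of_nat m + of_nat d / 2) * c r + (of_nat r * c r + b r)
      + (of_nat d + 1) * EV (Suc m + r) (\<lambda>t. phase_rem t ^ r * \<phi> t)" for r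
  proof -
    have "phase_rem t ^ r * (phase t * \<phi> t) = phase_rem t ^ Suc r * \<phi> t + quad t * (phase_rem t ^ r * \<phi> t)
         + (of_nat d + 1) * (unit_fun t * (phase_rem t ^ r * \<phi> t))" for t
      by (simp add: phase_rem_def[of t] algebra_simps)
    hence "(\<lambda>t. phase_rem t ^ r * (phase t * \<phi> t)) = (\<lambda>t. phase_rem t ^ Suc r * \<phi> t + quad t * (phase_rem t ^ r * \<phi> t)
         + (of_nat d + 1) * (phase_rem t ^ r * \<phi> t))"
      by (simp add: unit_mult[OF gen_laurent_rem_pow[OF assms(1)]] del: power_Suc)
    hence "EV (Suc m + r) (\<lambda>t. phase_rem t ^ r * (phase t * \<phi> t)) =
       b r + EV (Suc (m + r)) (\<lambda>t. quad t * (phase_rem t ^ r * \<phi> t)) + (of_nat d + 1) * EV (Suc m + r) (\<lambda>t. phase_rem t ^ r * \<phi> t)"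
      using assms(1) by (simp add: EV_add EV_cmult b_def gen_laurent_add gen_laurent_mult gen_laurent_cmult gen_laurent_rem_pow del: power_Suc)
    also have "EV (Suc (m + r)) (\<lambda>t. quad t * (phase_rem t ^ r * \<phi> t)) = (of_nat (m + r) + of_nat d / 2) * c r"
      using assms(1) unfolding c_def by (intro EV_quad) auto
    finally show ?thesis by (simp add: algebra_simps)
  qed
  have "b N = 0"
    unfolding b_def using vanishes_rem_pow[of 0 \<phi> "Suc N"] assms
    by (intro EV_vanishes[of "3 * Suc N"]) (auto simp del: power_Suc)
  hence "(\<Sum>r\<le>N. (-1) ^ r / fact r * (of_nat r * c r)) + (\<Sum>r\<le>N. (-1) ^ r / fact r * b r) = 0"
    by (intro alternating_shift) (simp_all add: b_def c_def)
  moreover have fc: "formal_int m N \<phi> = (\<Sum>r\<le>N. (-1) ^ r / fact r * c r)"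
    by (simp only: formal_int_def c_def)
  ultimately show ?thesis unfolding formal_int_def[of "Suc m"] t fc
    by (simp add: distrib_left sum.distrib sum_distrib_left mult.left_commute)
qed

section \<open>Comparison with the explicit formula\<close>

text \<open>The functions in \<open>B_poly\<close> are not cut off. The orthant is open in each
  coordinate, so agreement there carries over to derivatives.\<close>

lemma partial_deriv_eq_PD:
  assumes "gen_laurent F0" "\<And>t. t \<in> orthant \<Longrightarrow> F t = F0 t" "l \<in> {1..d}" "t \<in> orthant"
  shows "partial_deriv l F t = PD l F0 t"
proof -
  have "((\<lambda>x. F (t(l := x))) has_vector_derivative PD l F0 t) (at (t l))"
  proof (rule has_vector_derivative_transform_within_open[OF has_PD[OF assms(1,3,4)] open_greaterThan[of 0]])
    show "t l \<in> {0<..}" using assms by (auto simp: orthant_def)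
    show "F0 (t(l := x)) = F (t(l := x))" if "x \<in> {0<..}" for x
      using assms(2)[OF orthant_upd[OF assms(4)], of x l] that by simp
  qed
  thus ?thesis by (simp add: partial_deriv_def vector_derivative_at)
qed

text \<open>Mixed derivatives occur once per unordered pair in \<open>L_op\<close> and once per
  ordered pair in \<open>LN\<close>; symmetry of second derivatives on the class reconciles the
  two.\<close>

lemma L_op_eq_LN:
  assumes "gen_laurent F0" "\<And>t. t \<in> orthant \<Longrightarrow> F t = F0 t" "t \<in> orthant"
  shows "L_op d F t = 2 * (of_nat d + 1) * LN F0 t"
proof -
  have gen: "2 * D * (A / 2 - B / (2 * D)) = D * A - B" if "D \<noteq> 0" for D A B :: complex
    using that by (simp add: field_simps)
  define a where "a = (\<lambda>l k. PD l (PD k F0) t)"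
  have eq: "partial_deriv l (partial_deriv k F) t = a l k" if "l \<in> {1..d}" "k \<in> {1..d}" for l k
    unfolding a_def using that assms by (intro partial_deriv_eq_PD) auto
  have "(\<Sum>k=1..d. \<Sum>l\<in>{1..<k}. partial_deriv l (partial_deriv k F) t) = (\<Sum>k=1..d. \<Sum>l\<in>{1..<k}. a l k)"
    by (intro sum.cong eq) auto
  moreover have "(\<Sum>l=1..d. partial_deriv l (partial_deriv l F) t) = (\<Sum>l=1..d. a l l)"
    by (intro sum.cong eq) auto
  moreover have "(\<Sum>l=1..d. \<Sum>k=1..d. a l k) = (\<Sum>l=1..d. a l l) + 2 * (\<Sum>k=1..d. \<Sum>l\<in>{1..<k}. a l k)"
    using assms(1) by (intro sum_sum_symmetric) (auto simp: a_def PD_commute)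
  ultimately have "L_op d F t = (of_nat d + 1) * (\<Sum>l=1..d. a l l) - (\<Sum>l=1..d. \<Sum>k=1..d. a l k)"
    by (simp add: L_op_def algebra_simps)
  moreover have "of_nat d + 1 \<noteq> (0::complex)" using of_nat_neq_0[of d, where ?'a = complex] by (simp add: add.commute)
  hence "2 * (of_nat d + 1) * LN F0 t = (of_nat d + 1) * (\<Sum>l=1..d. a l l) - (\<Sum>l=1..d. \<Sum>k=1..d. a l k)"
    unfolding LN_def a_def by (rule gen)
  ultimately show ?thesis by simp
qed

lemma L_op_pow_eq_LN:
  assumes "gen_laurent F0" "\<And>t. t \<in> orthant \<Longrightarrow> F t = F0 t" "t \<in> orthant"
  shows "(L_op d ^^ j) F t = (2 * (of_nat d + 1)) ^ j * (LN ^^ j) F0 t"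
  using assms(3)
proof (induction j arbitrary: t)
  case (Suc j)
  let ?c = "(2 * (of_nat d + 1)) ^ j :: complex"
  have "(L_op d ^^ Suc j) F t = L_op d ((L_op d ^^ j) F) t" by simp
  also have "\<dots> = 2 * (of_nat d + 1) * LN (\<lambda>t. ?c * (LN ^^ j) F0 t) t"
    using Suc assms(1) by (intro L_op_eq_LN) auto
  finally show ?case using assms(1) by (simp add: LN_cmult)
qed (simp add: assms)

lemma gmono_idx: "l \<in> {1..d} \<Longrightarrow> t \<in> orthant \<Longrightarrow> gmono (\<lambda>k. a * idx l k) t = of_real (t l) powr a"
proof -
  assume l: "l \<in> {1..d}" and t: "t \<in> orthant"
  have "(\<Prod>k=1..d. of_real (t k) powr (a * idx l k)) = of_real (t l) powr a * (\<Prod>k\<in>{1..d} - {l}. of_real (t k) powr (a * idx l k))"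
    using l by (subst prod.remove[of _ l]) (auto simp: idx_def)
  also have "(\<Prod>k\<in>{1..d} - {l}. of_real (t k) powr (a * idx l k)) = (1 :: complex)"
    using t by (intro prod.neutral) (auto simp: idx_def orthant_def)
  finally show ?thesis using t by (simp add: gmono_def)
qed

text \<open>The squares and mixed products of \<open>G_fun\<close> are the expansion of
  \<open>quad\<close> in the t_l, once the sum over pairs l < k is expressed through the square of
  the sum.\<close>

lemma G_fun_eq_phase_rem:
  assumes t: "t \<in> orthant"
  shows "of_real (G_fun d t) = phase_rem t"
proof -
  define u where "u = (\<lambda>l. of_real (t l) :: complex)"
  define X XX where "X = (\<Sum>l=1..d. u l)" and "XX = (\<Sum>l=1..d. (u l)\<^sup>2)"
  define P where "P = (\<Sum>k=1..d. \<Sum>l\<in>{1..<k}. u l * u k)"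
  have unit: "unit_fun t = 1"
    using t by (auto simp: unit_fun_def gmono_def orthant_def intro!: prod.neutral)
  have y: "yc l t = u l - 1" if "l \<in> {1..d}" for l
    using gmono_idx[OF that t, of 1] that t unit by (simp add: yc_def u_def)
  have Y: "(\<Sum>l=1..d. yc l t) = X - of_nat d" by (simp add: y X_def sum_subtractf)
  have "(\<Sum>l=1..d. yc l t * zc l t) = (\<Sum>l=1..d. (u l)\<^sup>2 - 2 * u l + 1 + (u l * (X - of_nat d) - (X - of_nat d)))"
    unfolding zc_def Y by (intro sum.cong refl) (simp add: y power2_eq_square algebra_simps)
  also have "\<dots> = XX - 2 * X + of_nat d + (X * (X - of_nat d) - of_nat d * (X - of_nat d))"
    by (simp add: sum.distrib sum_subtractf X_def XX_def sum_distrib_left sum_distrib_right)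
  finally have q: "quad t = 1 / 2 * (XX - 2 * X + of_nat d + (X * (X - of_nat d) - of_nat d * (X - of_nat d)))"
    by (simp add: quad_def)
  have "(\<Sum>l=1..d. \<Sum>k=1..d. u l * u k) = (\<Sum>l=1..d. u l * u l) + 2 * P"
    unfolding P_def by (rule sum_sum_symmetric) simp
  hence XP: "X * X = XX + 2 * P" by (simp add: X_def XX_def sum_product power2_eq_square)
  have T: "gmono (\<lambda>_. 1) t = (\<Prod>l=1..d. u l)"
    using t by (simp add: gmono_def u_def orthant_def)
  have I: "gmono (\<lambda>k. - idx l k) t = inverse (u l)" if "l \<in> {1..d}" for l
    using gmono_idx[OF that t, of "-1"] that t by (simp add: u_def powr_minus)
  have "of_real (G_fun d t) = (\<Prod>l=1..d. u l) + (- XX + (of_nat d + 1) * X + (\<Sum>l=1..d. inverse (u l))) - P - (of_nat d + 1) * (of_nat d + 2) / 2"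
    by (simp add: G_fun_def u_def X_def XX_def P_def sum.distrib sum_negf sum_subtractf sum_distrib_left)
  also have "\<dots> = phase_rem t"
  proof -
    have P: "P = (X * X - XX) / 2" using XP by simp
    show ?thesis unfolding phase_rem_def phase_def unit q T P by (simp add: I field_simps)
  qed
  finally show ?thesis .
qed

lemma B_poly_eq_formal_int:
  assumes "n = Suc d"
  shows "B_poly n lam m = (-1) ^ m * formal_int m (2 * m) (gmono (\<lambda>l. lam l - lam (Suc d) - 1))"
proof -
  let ?\<phi> = "gmono (\<lambda>l. lam l - lam (Suc d) - 1)"
  have p: "p_fun d (\<lambda>l. lam l - lam (Suc d)) t = ?\<phi> t" if "t \<in> orthant" for t
    using that by (simp add: p_fun_def gmono_def)
  have c0: "(2 * (of_nat d + 1)) ^ j \<noteq> (0::complex)" for j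
  proof -
    have "of_nat d + 1 \<noteq> (0::complex)" using of_nat_neq_0[of d, where ?'a = complex] by (simp add: add.commute)
    thus ?thesis by (intro power_not_zero) (metis mult_eq_0_iff zero_neq_numeral)
  qed
  have *: "(-1) ^ (m + r) * (L_op d ^^ (m + r)) (\<lambda>t. of_real (G_fun d t) ^ r * p_fun d (\<lambda>l. lam l - lam (d + 1)) t) (\<lambda>_. 1)
          / ((2 * (of_nat d + 1)) ^ (m + r) * fact (m + r) * fact r)
       = (-1) ^ m * ((-1) ^ r / fact r * EV (m + r) (\<lambda>t. phase_rem t ^ r * ?\<phi> t))" for r
  proof -
    have "(L_op d ^^ (m + r)) (\<lambda>t. of_real (G_fun d t) ^ r * p_fun d (\<lambda>l. lam l - lam (d + 1)) t) (\<lambda>_. 1)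
      = (2 * (of_nat d + 1)) ^ (m + r) * (LN ^^ (m + r)) (\<lambda>t. phase_rem t ^ r * ?\<phi> t) (\<lambda>_. 1)"
      by (intro L_op_pow_eq_LN) (auto simp: p G_fun_eq_phase_rem)
    thus ?thesis using c0[of "m + r"] by (simp only: EV_def) (simp add: power_add mult_ac)
  qed
  show ?thesis
    unfolding B_poly_def Let_def assms diff_Suc_1 * formal_int_def sum_distrib_left
    by (intro sum.cong) auto
qed

section \<open>Contiguity relations for the formal series\<close>

text \<open>With x = z/kappa and kappa^2 = -1, x^(-m) becomes kappa^m z^(-m) and e^(-(d+1)x) becomes
  e^((d+1) kappa z). The exponent mu - 1 is that of a Mellin transform, t^mu dt/t.\<close>

definition formal_series :: "complex \<Rightarrow> (nat \<Rightarrow> complex) \<Rightarrow> int \<Rightarrow> complex" where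
  "formal_series \<kappa> \<mu> j =
     (if j < 0 then 0 else \<kappa> ^ nat j * formal_int (nat j) (2 * nat j) (gmono (\<lambda>k. \<mu> k - 1)))"

lemma formal_int_0: "formal_int 0 0 (gmono \<mu>) = 1"
  by (simp add: formal_int_def EV_def)

text \<open>Integration by parts for t_l times the monomial: differentiating t_l t^(mu-1) brings
  down mu_l, and t_l times the l-th derivative of the phase is t_1...t_d minus 1/t_l.\<close>

lemma formal_series_by_parts:
  assumes "\<kappa> * \<kappa> = - 1" "l \<in> {1..d}"
  shows "\<mu> l * formal_series \<kappa> \<mu> j =
     - \<kappa> * (formal_series \<kappa> (\<lambda>k. \<mu> k + 1) (j + 1) - formal_series \<kappa> (\<lambda>k. \<mu> k - idx l k) (j + 1))"
proof -
  \<comment> \<open>The case j = -1 compares the leading coefficients of the two shifted series,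
    both equal to 1.\<close>
  consider "j < - 1" | "j = - 1" | "j \<ge> 0" by linarith
  thus ?thesis
  proof cases
    case 3
    define m N where "m = nat j" and "N = 2 * m + 3"
    have j: "nat (j + 1) = Suc m" "\<not> j < 0" "\<not> j + 1 < 0" using 3 by (auto simp: m_def)
    define \<phi> where "\<phi> = gmono (\<lambda>k. \<mu> k - 1 + idx l k)"
    have g: "gen_laurent \<phi>" by (simp add: \<phi>_def)
    have "PD l \<phi> = (\<lambda>t. \<mu> l * gmono (\<lambda>k. \<mu> k - 1) t)"
      unfolding \<phi>_def PD_gmono[OF assms(2)] by (simp add: idx_def)
    moreover have "(\<lambda>t. PD l phase t * \<phi> t) = (\<lambda>t. gmono (\<lambda>k. \<mu> k + 1 - 1) t - gmono (\<lambda>k. \<mu> k - idx l k - 1) t)"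
      unfolding PD_phase[OF assms(2)] \<phi>_def left_diff_distrib gmono_mult
      by (intro ext arg_cong2[of _ _ _ _ minus] fun_cong[OF gmono_cong]) (simp_all add: algebra_simps)
    ultimately have "formal_int (Suc m) N (gmono (\<lambda>k. \<mu> k + 1 - 1)) - formal_int (Suc m) N (gmono (\<lambda>k. \<mu> k - idx l k - 1))
       = \<mu> l * formal_int m N (gmono (\<lambda>k. \<mu> k - 1))"
      using formal_int_by_parts[OF g assms(2), of m N]
      by (simp add: N_def formal_int_diff[OF gen_laurent_gmono gen_laurent_gmono] formal_int_cmult del: add_diff_cancel_right')
    hence *: "formal_int (Suc m) (2 * Suc m) (gmono (\<lambda>k. \<mu> k + 1 - 1)) - formal_int (Suc m) (2 * Suc m) (gmono (\<lambda>k. \<mu> k - idx l k - 1))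
       = \<mu> l * formal_int m (2 * m) (gmono (\<lambda>k. \<mu> k - 1))"
      using formal_int_stable[OF gen_laurent_gmono, of "Suc m" N] formal_int_stable[OF gen_laurent_gmono, of m N]
      by (simp only: N_def) simp
    have "- \<kappa> * (formal_series \<kappa> (\<lambda>k. \<mu> k + 1) (j + 1) - formal_series \<kappa> (\<lambda>k. \<mu> k - idx l k) (j + 1))
      = - (\<kappa> * \<kappa>) * \<kappa> ^ m * (formal_int (Suc m) (2 * Suc m) (gmono (\<lambda>k. \<mu> k + 1 - 1)) - formal_int (Suc m) (2 * Suc m) (gmono (\<lambda>k. \<mu> k - idx l k - 1)))"
      unfolding formal_series_def using j by (simp add: algebra_simps)
    also have "\<dots> = \<mu> l * formal_series \<kappa> \<mu> j"
      unfolding * assms(1) formal_series_def using j by (simp add: m_def mult_ac)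
    finally show ?thesis by simp
  qed (simp_all add: formal_series_def formal_int_0)
qed

lemma formal_series_theta:
  assumes "\<kappa> * \<kappa> = - 1"
  shows "laurent_theta ((of_nat d + 1) * \<kappa>) (- of_nat d / 2) (formal_series \<kappa> \<mu>) j =
     \<kappa> * (formal_series \<kappa> (\<lambda>k. \<mu> k + 1) (j + 1) + (\<Sum>l=1..d. formal_series \<kappa> (\<lambda>k. \<mu> k - idx l k) (j + 1)))"
proof -
  consider "j < - 1" | "j = - 1" | "j \<ge> 0" by linarith
  thus ?thesis
  proof cases
    case 3
    define m N where "m = nat j" and "N = 2 * m + 3"
    have j: "nat (j + 1) = Suc m" "\<not> j < 0" "\<not> j + 1 < 0" "of_int j = (of_nat m :: complex)" using 3 by (auto simp: m_def)
    let ?\<phi> = "gmono (\<lambda>k. \<mu> k - 1)"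
    have "(\<lambda>t. phase t * ?\<phi> t) = (\<lambda>t. gmono (\<lambda>k. \<mu> k + 1 - 1) t + (\<Sum>l=1..d. gmono (\<lambda>k. \<mu> k - idx l k - 1) t))"
      unfolding phase_def distrib_right sum_distrib_right gmono_mult
      by (intro ext arg_cong2[of _ _ _ _ plus] sum.cong refl fun_cong[OF gmono_cong]) (simp_all add: algebra_simps)
    hence "formal_int (Suc m) N (gmono (\<lambda>k. \<mu> k + 1 - 1)) + (\<Sum>l=1..d. formal_int (Suc m) N (gmono (\<lambda>k. \<mu> k - idx l k - 1)))
       = (of_nat m + of_nat d / 2) * formal_int m N ?\<phi> + (of_nat d + 1) * formal_int (Suc m) N ?\<phi>"
      using formal_int_phase[OF gen_laurent_gmono, of m N "\<lambda>k. \<mu> k - 1"]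
      by (simp add: N_def formal_int_add[OF gen_laurent_gmono gen_laurent_sum] formal_int_sum del: add_diff_cancel_right')
    hence *: "formal_int (Suc m) (2 * Suc m) (gmono (\<lambda>k. \<mu> k + 1 - 1)) + (\<Sum>l=1..d. formal_int (Suc m) (2 * Suc m) (gmono (\<lambda>k. \<mu> k - idx l k - 1)))
       = (of_nat m + of_nat d / 2) * formal_int m (2 * m) ?\<phi> + (of_nat d + 1) * formal_int (Suc m) (2 * Suc m) ?\<phi>"
      using formal_int_stable[OF gen_laurent_gmono, of "Suc m" N] formal_int_stable[OF gen_laurent_gmono, of m N]
      by (simp only: N_def) simp
    have "\<kappa> * (formal_series \<kappa> (\<lambda>k. \<mu> k + 1) (j + 1) + (\<Sum>l=1..d. formal_series \<kappa> (\<lambda>k. \<mu> k - idx l k) (j + 1)))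
      = (\<kappa> * \<kappa>) * \<kappa> ^ m * (formal_int (Suc m) (2 * Suc m) (gmono (\<lambda>k. \<mu> k + 1 - 1)) + (\<Sum>l=1..d. formal_int (Suc m) (2 * Suc m) (gmono (\<lambda>k. \<mu> k - idx l k - 1))))"
      unfolding formal_series_def using j by (simp add: algebra_simps sum_distrib_left)
    also have "\<dots> = - (\<kappa> ^ m) * ((of_nat m + of_nat d / 2) * formal_int m (2 * m) ?\<phi>) + (\<kappa> * \<kappa>) * \<kappa> ^ m * ((of_nat d + 1) * formal_int (Suc m) (2 * Suc m) ?\<phi>)"
      unfolding * by (simp add: assms algebra_simps)
    also have "\<dots> = laurent_theta ((of_nat d + 1) * \<kappa>) (- of_nat d / 2) (formal_series \<kappa> \<mu>) j"
      unfolding formal_series_def laurent_theta_def using j by (simp add: m_def algebra_simps)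
    finally show ?thesis by simp
  qed (simp_all add: formal_series_def laurent_theta_def formal_int_0 algebra_simps)
qed

text \<open>The d integrations by parts and the insertion of the phase are d + 1 linear relations
  between d + 1 shifted series. Solving them writes each exponent shift as a first-order operator in
  z d/dz.\<close>

lemma formal_series_shift:
  assumes k: "\<kappa> * \<kappa> = - 1" and c: "c = (of_nat d + 1) * \<kappa>"
  defines "\<Theta> \<equiv> laurent_theta c (- of_nat d / 2)"
  shows "c * formal_series \<kappa> (\<lambda>k. \<mu> k + 1) (j + 1) = \<Theta> (formal_series \<kappa> \<mu>) j - (\<Sum>l=1..d. \<mu> l) * formal_series \<kappa> \<mu> j"
    and "l \<in> {1..d} \<Longrightarrow> c * formal_series \<kappa> (\<lambda>k. \<mu> k - idx l k) (j + 1) =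
      \<Theta> (formal_series \<kappa> \<mu>) j + ((of_nat d + 1) * \<mu> l - (\<Sum>l=1..d. \<mu> l)) * formal_series \<kappa> \<mu> j"
proof -
  define s sT sD where "s = formal_series \<kappa> \<mu> j" and "sT = formal_series \<kappa> (\<lambda>k. \<mu> k + 1) (j + 1)"
    and "sD = (\<lambda>l. formal_series \<kappa> (\<lambda>k. \<mu> k - idx l k) (j + 1))"
  have B: "\<mu> l * s = - \<kappa> * (sT - sD l)" if "l \<in> {1..d}" for l
    using formal_series_by_parts[OF k that] by (simp add: s_def sT_def sD_def)
  have A: "\<Theta> (formal_series \<kappa> \<mu>) j = \<kappa> * (sT + (\<Sum>l=1..d. sD l))"
    using formal_series_theta[OF k] by (simp add: \<Theta>_def c sT_def sD_def)
  have "(\<Sum>l=1..d. \<mu> l) * s = (\<Sum>l=1..d. - \<kappa> * (sT - sD l))"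
    unfolding sum_distrib_right by (intro sum.cong B) auto
  also have "\<dots> = \<kappa> * (\<Sum>l=1..d. sD l) - of_nat d * (\<kappa> * sT)"
    by (simp add: algebra_simps sum.distrib sum_subtractf sum_negf sum_distrib_left)
  finally have S: "(\<Sum>l=1..d. \<mu> l) * s = \<kappa> * (\<Sum>l=1..d. sD l) - of_nat d * (\<kappa> * sT)" .
  have 1: "c * sT = \<Theta> (formal_series \<kappa> \<mu>) j - (\<Sum>l=1..d. \<mu> l) * s"
    unfolding A S c by (simp add: algebra_simps)
  show "c * formal_series \<kappa> (\<lambda>k. \<mu> k + 1) (j + 1) = \<Theta> (formal_series \<kappa> \<mu>) j - (\<Sum>l=1..d. \<mu> l) * formal_series \<kappa> \<mu> j"
    using 1 by (simp add: s_def sT_def)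
  assume l: "l \<in> {1..d}"
  have "c * sD l = c * sT + (of_nat d + 1) * (\<mu> l * s)"
    unfolding B[OF l] c by (simp add: algebra_simps)
  thus "c * formal_series \<kappa> (\<lambda>k. \<mu> k - idx l k) (j + 1) =
      \<Theta> (formal_series \<kappa> \<mu>) j + ((of_nat d + 1) * \<mu> l - (\<Sum>l=1..d. \<mu> l)) * formal_series \<kappa> \<mu> j"
    unfolding 1 by (simp add: s_def sD_def algebra_simps)
qed

text \<open>A cycle of exponent shifts: the first d factors lower the exponents of t_1, ..., t_d one
  after another, and the last factor raises all of them together and returns to nu. The n shifts
  leave the factor c^n z^n.\<close>

lemma formal_series_char_poly:
  assumes k: "\<kappa> * \<kappa> = - 1" and c: "c = of_nat (Suc d) * \<kappa>" and lam: "(\<Sum>l=1..Suc d. lam l) = 0"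
  defines "\<nu> \<equiv> (\<lambda>l. lam l - lam (Suc d))"
  shows "DP (laurent_theta c (- of_nat d / 2)) (char_poly (Suc d) lam) (formal_series \<kappa> \<nu>) j =
     c ^ Suc d * formal_series \<kappa> \<nu> (j + int (Suc d))"
proof -
  let ?n = "of_nat (Suc d) :: complex"
  let ?\<Theta> = "laurent_theta c (- of_nat d / 2)"
  \<comment> \<open>The exponents after the first r lowerings.\<close>
  define \<mu> where "\<mu> = (\<lambda>r i. \<nu> i - (if 1 \<le> i \<and> i \<le> r then 1 else 0))"
  define P where "P = (\<lambda>r. \<Prod>l=1..r. [:?n * lam l, 1:])"
  have c': "c = (of_nat d + 1) * \<kappa>" by (simp add: c add.commute)
  have P_Suc: "P (Suc r) = [:?n * lam (Suc r), 1:] * P r" for r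
    unfolding P_def by (simp del: mult_pCons_left mult_pCons_right of_nat_Suc add: mult.commute)
  have sum\<mu>: "(\<Sum>l=1..d. \<mu> r l) = - (?n * lam (Suc d)) - of_nat r" if "r \<le> d" for r
  proof -
    have "(\<Sum>l=1..d. \<mu> r l) = (\<Sum>l=1..d. lam l) - of_nat d * lam (Suc d) - (\<Sum>l=1..d. if 1 \<le> l \<and> l \<le> r then 1 else 0)"
      by (simp add: \<mu>_def \<nu>_def sum_subtractf)
    also have "(\<Sum>l=1..d. if 1 \<le> l \<and> l \<le> r then 1 else 0 :: complex) = (\<Sum>l\<in>{1..r}. 1)"
      using that by (intro sum.mono_neutral_cong_right) auto
    also have "(\<Sum>l=1..d. lam l) = - lam (Suc d)" using lam by (simp add: add_eq_0_iff2)
    finally show ?thesis by (simp add: algebra_simps)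
  qed
  \<comment> \<open>Moving z d/dz past the index shift by r adds r; the sum of the exponents, lower
    by r as well, compensates for it.\<close>
  have shift: "?\<Theta> (\<lambda>j. b * f (j + int r)) i = b * (?\<Theta> f (i + int r) + of_nat r * f (i + int r))" for b f r i
    by (simp add: laurent_theta_def algebra_simps)
  have main: "DP ?\<Theta> (P r) (formal_series \<kappa> \<nu>) j = c ^ r * formal_series \<kappa> (\<mu> r) (j + int r)" if "r \<le> d" for r j
    using that
  proof (induction r arbitrary: j)
    case 0
    have "\<mu> 0 = \<nu>" by (auto simp: \<mu>_def)
    thus ?case by (simp add: P_def)
  next
    case (Suc r)
    have D: "DP ?\<Theta> (P r) (formal_series \<kappa> \<nu>) = (\<lambda>j. c ^ r * formal_series \<kappa> (\<mu> r) (j + int r))"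
      using Suc by auto
    have \<mu>: "(\<lambda>k. \<mu> r k - idx (Suc r) k) = \<mu> (Suc r)" by (auto simp: \<mu>_def idx_def)
    have e: "?n * \<mu> r (Suc r) - (\<Sum>l=1..d. \<mu> r l) = ?n * lam (Suc r) + of_nat r"
      using Suc.prems by (subst sum\<mu>) (auto simp: \<mu>_def \<nu>_def algebra_simps)
    have "DP ?\<Theta> (P (Suc r)) (formal_series \<kappa> \<nu>) j =
       c ^ r * (?\<Theta> (formal_series \<kappa> (\<mu> r)) (j + int r) + (?n * lam (Suc r) + of_nat r) * formal_series \<kappa> (\<mu> r) (j + int r))"
      unfolding P_Suc DP_linear_factor DP_laurent_theta D shift by (simp add: algebra_simps)
    also have "\<dots> = c ^ r * (c * formal_series \<kappa> (\<lambda>k. \<mu> r k - idx (Suc r) k) (j + int r + 1))"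
      using formal_series_shift(2)[OF k c', of "Suc r" "\<mu> r" "j + int r"] Suc.prems e by (simp add: add.commute)
    finally show ?case unfolding \<mu> by (simp add: add_ac mult_ac)
  qed
  have D: "DP ?\<Theta> (P d) (formal_series \<kappa> \<nu>) = (\<lambda>j. c ^ d * formal_series \<kappa> (\<mu> d) (j + int d))"
    using main by auto
  have "DP ?\<Theta> (char_poly (Suc d) lam) (formal_series \<kappa> \<nu>) j = DP ?\<Theta> (P (Suc d)) (formal_series \<kappa> \<nu>) j"
    by (simp add: char_poly_def P_def del: of_nat_Suc)
  also have "\<dots> = c ^ d * (?\<Theta> (formal_series \<kappa> (\<mu> d)) (j + int d) + (?n * lam (Suc d) + of_nat d) * formal_series \<kappa> (\<mu> d) (j + int d))"
    unfolding P_Suc DP_linear_factor DP_laurent_theta D shift by (simp add: algebra_simps)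
  also have "\<dots> = c ^ d * (c * formal_series \<kappa> (\<lambda>k. \<mu> d k + 1) (j + int d + 1))"
    unfolding formal_series_shift(1)[OF k c'] sum\<mu>[OF order_refl] by (simp add: algebra_simps)
  also have "formal_series \<kappa> (\<lambda>k. \<mu> d k + 1) = formal_series \<kappa> \<nu>"
  proof -
    have "gmono (\<lambda>k. \<mu> d k + 1 - 1) = gmono (\<lambda>k. \<nu> k - 1)" by (rule gmono_cong) (auto simp: \<mu>_def)
    thus ?thesis by (simp only: formal_series_def[abs_def])
  qed
  finally show ?thesis by (simp add: add_ac mult_ac)
qed

end

lemma B_rec_eq_B_poly:
  assumes "n \<ge> 2" "(\<Sum>l=1..n. lam l) = 0" "\<kappa> * \<kappa> = - 1"
  shows "B_rec n (of_nat n * \<kappa>) m lam = (- \<kappa>) ^ m * B_poly n lam m"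
proof -
  obtain d where d: "n = Suc d" using assms by (cases n) auto
  define c where "c = of_nat n * \<kappa>"
  define b where "b = (\<lambda>m. (- \<kappa>) ^ m * B_poly n lam m)"
  have bs: "b m = formal_series d \<kappa> (\<lambda>l. lam l - lam (Suc d)) (int m)" for m
    by (simp add: b_def formal_series_def B_poly_eq_formal_int[OF d] mult_ac flip: power_mult_distrib)
  have "fls_nth (fps_to_fls (Abs_fps b)) = formal_series d \<kappa> (\<lambda>l. lam l - lam (Suc d))"
    by (auto simp: fun_eq_iff bs) (simp add: formal_series_def)
  moreover have "Bessel_alpha n = - of_nat d / 2" by (simp add: Bessel_alpha_def d)
  \<comment> \<open>The sign is set to whatever makes c^n the constant on the right-hand side; the
    recursion sees only c.\<close>
  moreover define \<sigma> where "\<sigma> = (c / (\<i> * of_nat n)) ^ n"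
  have "\<sigma> * (\<i> * of_nat n) ^ n = c ^ n" using assms by (simp add: \<sigma>_def power_divide)
  moreover have "DP (laurent_theta c (- of_nat d / 2)) (char_poly n lam) (formal_series d \<kappa> (\<lambda>l. lam l - lam (Suc d))) k =
      c ^ n * formal_series d \<kappa> (\<lambda>l. lam l - lam (Suc d)) (k + int n)" for k
    unfolding d using formal_series_char_poly[OF assms(3)] assms(2) unfolding c_def d by blast
  ultimately have *: "formal_Bessel_solution n \<sigma> lam c (Bessel_alpha n) (fps_to_fls (Abs_fps b))"
    unfolding formal_Bessel_solution_iff by (simp only:) blast
  have c0: "c \<noteq> 0" using assms by (auto simp: c_def)
  have b0: "b 0 = 1" unfolding bs by (simp add: formal_series_def formal_int_0)
  have "b m = B_rec n c m lam"
    using assms(1) by (intro formal_Bessel_solution_unique[OF _ assms(2) \<open>\<sigma> * (\<i> * of_nat n) ^ n = c ^ n\<close> c0 * b0]) auto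
  thus ?thesis by (simp add: b_def c_def)
qed

section \<open>Asymptotic expansions from a priori bounds\<close>

text \<open>
  With \<open>\<zeta> = log z\<close> this says that \<open>h = O(|z|\<^bsup>-M\<^esup>)\<close> on closed subsectors of \<open>|arg z - \<theta>| < \<rho>\<close>.
\<close>

definition strip_bound :: "real \<Rightarrow> real \<Rightarrow> real \<Rightarrow> (complex \<Rightarrow> complex) \<Rightarrow> bool" where
  "strip_bound \<theta> \<rho> M h \<longleftrightarrow> (\<forall>\<rho>'. 0 < \<rho>' \<and> \<rho>' < \<rho> \<longrightarrow>
     (\<exists>K R. \<forall>\<zeta>. \<bar>Im \<zeta> - \<theta>\<bar> \<le> \<rho>' \<and> Re \<zeta> \<ge> R \<longrightarrow> cmod (h \<zeta>) \<le> K * exp (- M * Re \<zeta>)))"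

lemma strip_boundD:
  assumes "strip_bound \<theta> \<rho> M h" "0 < \<rho>'" "\<rho>' < \<rho>"
  obtains K R where "K \<ge> 0" "\<And>\<zeta>. \<bar>Im \<zeta> - \<theta>\<bar> \<le> \<rho>' \<Longrightarrow> Re \<zeta> \<ge> R \<Longrightarrow> cmod (h \<zeta>) \<le> K * exp (- M * Re \<zeta>)"
proof -
  have "\<exists>K R. \<forall>\<zeta>. \<bar>Im \<zeta> - \<theta>\<bar> \<le> \<rho>' \<and> Re \<zeta> \<ge> R \<longrightarrow> cmod (h \<zeta>) \<le> K * exp (- M * Re \<zeta>)"
    by (rule assms(1)[unfolded strip_bound_def, THEN spec, THEN mp, OF conjI[OF assms(2,3)]])
  then obtain K R where "\<forall>\<zeta>. \<bar>Im \<zeta> - \<theta>\<bar> \<le> \<rho>' \<and> Re \<zeta> \<ge> R \<longrightarrow> cmod (h \<zeta>) \<le> K * exp (- M * Re \<zeta>)"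
    by (elim exE)
  hence *: "\<And>\<zeta>. \<bar>Im \<zeta> - \<theta>\<bar> \<le> \<rho>' \<Longrightarrow> Re \<zeta> \<ge> R \<Longrightarrow> cmod (h \<zeta>) \<le> K * exp (- M * Re \<zeta>)"
    by blast
  have "0 \<le> cmod (h (Complex R \<theta>))" by simp
  also have "\<dots> \<le> K * exp (- M * R)" using *[of "Complex R \<theta>"] assms(2) by simp
  finally have "0 \<le> K * exp (- M * R)" .
  hence "K \<ge> 0" by (simp add: zero_le_mult_iff)
  from that[OF this *] show thesis .
qed

lemma strip_boundI:
  assumes "\<And>\<rho>'. 0 < \<rho>' \<Longrightarrow> \<rho>' < \<rho> \<Longrightarrow>
     \<exists>K R. \<forall>\<zeta>. \<bar>Im \<zeta> - \<theta>\<bar> \<le> \<rho>' \<and> Re \<zeta> \<ge> R \<longrightarrow> cmod (h \<zeta>) \<le> K * exp (- M * Re \<zeta>)"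
  shows "strip_bound \<theta> \<rho> M h"
  using assms unfolding strip_bound_def by blast

lemma strip_bound_add:
  assumes "strip_bound \<theta> \<rho> M f" "strip_bound \<theta> \<rho> M g"
  shows "strip_bound \<theta> \<rho> M (\<lambda>\<zeta>. f \<zeta> + g \<zeta>)"
proof (rule strip_boundI)
  fix \<rho>' assume r: "0 < \<rho>'" "\<rho>' < \<rho>"
  obtain K R where 1: "\<And>\<zeta>. \<bar>Im \<zeta> - \<theta>\<bar> \<le> \<rho>' \<Longrightarrow> Re \<zeta> \<ge> R \<Longrightarrow> cmod (f \<zeta>) \<le> K * exp (- M * Re \<zeta>)"
    using strip_boundD[OF assms(1) r] by metis
  obtain L S where 2: "\<And>\<zeta>. \<bar>Im \<zeta> - \<theta>\<bar> \<le> \<rho>' \<Longrightarrow> Re \<zeta> \<ge> S \<Longrightarrow> cmod (g \<zeta>) \<le> L * exp (- M * Re \<zeta>)"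
    using strip_boundD[OF assms(2) r] by metis
  have "cmod (f \<zeta> + g \<zeta>) \<le> (K + L) * exp (- M * Re \<zeta>)"
    if "\<bar>Im \<zeta> - \<theta>\<bar> \<le> \<rho>'" "Re \<zeta> \<ge> max R S" for \<zeta>
    using norm_triangle_ineq[of "f \<zeta>" "g \<zeta>"] 1[of \<zeta>] 2[of \<zeta>] that unfolding distrib_right by linarith
  thus "\<exists>K R. \<forall>\<zeta>. \<bar>Im \<zeta> - \<theta>\<bar> \<le> \<rho>' \<and> Re \<zeta> \<ge> R \<longrightarrow> cmod (f \<zeta> + g \<zeta>) \<le> K * exp (- M * Re \<zeta>)"
    by blast
qed

lemma strip_bound_exp_mult:
  assumes "strip_bound \<theta> \<rho> M f"
  shows "strip_bound \<theta> \<rho> (M + k) (\<lambda>\<zeta>. exp (- of_real k * \<zeta>) * f \<zeta>)"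
proof (rule strip_boundI)
  fix \<rho>' assume r: "0 < \<rho>'" "\<rho>' < \<rho>"
  obtain K R where 1: "K \<ge> 0" "\<And>\<zeta>. \<bar>Im \<zeta> - \<theta>\<bar> \<le> \<rho>' \<Longrightarrow> Re \<zeta> \<ge> R \<Longrightarrow> cmod (f \<zeta>) \<le> K * exp (- M * Re \<zeta>)"
    using strip_boundD[OF assms(1) r] by metis
  have "cmod (exp (- of_real k * \<zeta>) * f \<zeta>) \<le> K * exp (- (M + k) * Re \<zeta>)"
    if "\<bar>Im \<zeta> - \<theta>\<bar> \<le> \<rho>'" "Re \<zeta> \<ge> R" for \<zeta>
  proof -
    have "cmod (exp (- of_real k * \<zeta>) * f \<zeta>) \<le> exp (- k * Re \<zeta>) * (K * exp (- M * Re \<zeta>))"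
      unfolding norm_mult using 1(2)[of \<zeta>] that by (intro mult_mono) auto
    thus ?thesis by (simp add: algebra_simps flip: exp_add)
  qed
  thus "\<exists>K R. \<forall>\<zeta>. \<bar>Im \<zeta> - \<theta>\<bar> \<le> \<rho>' \<and> Re \<zeta> \<ge> R \<longrightarrow> cmod (exp (- of_real k * \<zeta>) * f \<zeta>) \<le> K * exp (- (M + k) * Re \<zeta>)"
    by blast
qed

lemma strip_bound_weaken:
  assumes "strip_bound \<theta> \<rho> M f" "M' \<le> M"
  shows "strip_bound \<theta> \<rho> M' f"
proof (rule strip_boundI)
  fix \<rho>' assume r: "0 < \<rho>'" "\<rho>' < \<rho>"
  obtain K R where 1: "K \<ge> 0" "\<And>\<zeta>. \<bar>Im \<zeta> - \<theta>\<bar> \<le> \<rho>' \<Longrightarrow> Re \<zeta> \<ge> R \<Longrightarrow> cmod (f \<zeta>) \<le> K * exp (- M * Re \<zeta>)"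
    using strip_boundD[OF assms(1) r] by metis
  have "cmod (f \<zeta>) \<le> K * exp (- M' * Re \<zeta>)"
    if "\<bar>Im \<zeta> - \<theta>\<bar> \<le> \<rho>'" "Re \<zeta> \<ge> max R 0" for \<zeta>
  proof -
    have "M' * Re \<zeta> \<le> M * Re \<zeta>" using assms(2) that by (intro mult_right_mono) auto
    hence "K * exp (- M * Re \<zeta>) \<le> K * exp (- M' * Re \<zeta>)" using 1(1) by (intro mult_left_mono) auto
    with 1(2)[of \<zeta>] that show ?thesis by auto
  qed
  thus "\<exists>K R. \<forall>\<zeta>. \<bar>Im \<zeta> - \<theta>\<bar> \<le> \<rho>' \<and> Re \<zeta> \<ge> R \<longrightarrow> cmod (f \<zeta>) \<le> K * exp (- M' * Re \<zeta>)"
    by blast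
qed

lemma strip_bound_const: "strip_bound \<theta> \<rho> 0 (\<lambda>\<zeta>. a)"
  unfolding strip_bound_def by (intro allI impI exI[of _ "cmod a"]) auto

lemma strip_bound_exp: "strip_bound \<theta> \<rho> k (\<lambda>\<zeta>. a * exp (- of_real k * \<zeta>))"
  using strip_bound_exp_mult[OF strip_bound_const, of \<theta> \<rho> k a] by (simp add: mult.commute)

lemma strip_bound_zero: "strip_bound \<theta> \<rho> M (\<lambda>\<zeta>. 0)"
  unfolding strip_bound_def by (intro allI impI exI[of _ 0]) auto

lemma strip_bound_cmult:
  assumes "strip_bound \<theta> \<rho> M f"
  shows "strip_bound \<theta> \<rho> M (\<lambda>\<zeta>. a * f \<zeta>)"
proof (rule strip_boundI)
  fix \<rho>' assume r: "0 < \<rho>'" "\<rho>' < \<rho>"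
  obtain K R where 1: "K \<ge> 0" "\<And>\<zeta>. \<bar>Im \<zeta> - \<theta>\<bar> \<le> \<rho>' \<Longrightarrow> Re \<zeta> \<ge> R \<Longrightarrow> cmod (f \<zeta>) \<le> K * exp (- M * Re \<zeta>)"
    using strip_boundD[OF assms(1) r] by metis
  hence "cmod (a * f \<zeta>) \<le> (cmod a * K) * exp (- M * Re \<zeta>)" if "\<bar>Im \<zeta> - \<theta>\<bar> \<le> \<rho>'" "Re \<zeta> \<ge> R" for \<zeta>
    unfolding norm_mult mult.assoc using that by (intro mult_left_mono) auto
  thus "\<exists>K R. \<forall>\<zeta>. \<bar>Im \<zeta> - \<theta>\<bar> \<le> \<rho>' \<and> Re \<zeta> \<ge> R \<longrightarrow> cmod (a * f \<zeta>) \<le> K * exp (- M * Re \<zeta>)"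
    by blast
qed

lemma strip_bound_sum:
  "(\<And>i. i \<in> A \<Longrightarrow> strip_bound \<theta> \<rho> M (f i)) \<Longrightarrow> strip_bound \<theta> \<rho> M (\<lambda>\<zeta>. \<Sum>i\<in>A. f i \<zeta>)"
  by (induction A rule: infinite_finite_induct) (auto simp: strip_bound_zero strip_bound_add)

text \<open>In the variable log z a disc of fixed radius changes e^(-M Re zeta) by a bounded factor
  only, so Cauchy's estimate costs no power of z, merely a narrower strip.\<close>

lemma strip_bound_deriv:
  assumes "strip_bound \<theta> \<rho> M f" "f holomorphic_on UNIV"
  shows "strip_bound \<theta> \<rho> M (deriv f)"
proof (rule strip_boundI)
  fix \<rho>' assume r: "0 < \<rho>'" "\<rho>' < \<rho>"
  define d where "d = (\<rho> - \<rho>') / 2"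
  have d: "d > 0" "\<rho>' + d < \<rho>" "0 < \<rho>' + d" using r by (auto simp: d_def field_simps)
  obtain K R where 1: "K \<ge> 0" "\<And>\<zeta>. \<bar>Im \<zeta> - \<theta>\<bar> \<le> \<rho>' + d \<Longrightarrow> Re \<zeta> \<ge> R \<Longrightarrow> cmod (f \<zeta>) \<le> K * exp (- M * Re \<zeta>)"
    using strip_boundD[OF assms(1) d(3,2)] by metis
  have "cmod (deriv f \<zeta>) \<le> (K * exp (\<bar>M\<bar> * d) / d) * exp (- M * Re \<zeta>)"
    if z: "\<bar>Im \<zeta> - \<theta>\<bar> \<le> \<rho>'" "Re \<zeta> \<ge> R + d" for \<zeta>
  proof -
    have "cmod ((deriv ^^ 1) f \<zeta>) \<le> fact 1 * (K * exp (\<bar>M\<bar> * d) * exp (- M * Re \<zeta>)) / d ^ 1"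
    proof (rule Cauchy_inequality)
      show "f holomorphic_on ball \<zeta> d" "continuous_on (cball \<zeta> d) f"
        using assms(2) holomorphic_on_subset holomorphic_on_imp_continuous_on continuous_on_subset by blast+
      fix x assume x: "cmod (\<zeta> - x) = d"
      have re: "\<bar>Re \<zeta> - Re x\<bar> \<le> d" "\<bar>Im \<zeta> - Im x\<bar> \<le> d"
        using abs_Re_le_cmod[of "\<zeta> - x"] abs_Im_le_cmod[of "\<zeta> - x"] x by auto
      have "\<bar>M * (Re \<zeta> - Re x)\<bar> \<le> \<bar>M\<bar> * d" unfolding abs_mult using re by (intro mult_left_mono) auto
      hence "- M * Re x \<le> \<bar>M\<bar> * d + - M * Re \<zeta>" by (simp add: right_diff_distrib abs_le_iff)
      hence "exp (- M * Re x) \<le> exp (\<bar>M\<bar> * d) * exp (- M * Re \<zeta>)" by (simp flip: exp_add)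
      moreover have "cmod (f x) \<le> K * exp (- M * Re x)" using re z by (intro 1) auto
      ultimately show "cmod (f x) \<le> K * exp (\<bar>M\<bar> * d) * exp (- M * Re \<zeta>)"
        using 1(1) by (smt (verit) mult.assoc mult_left_mono)
    qed (use d in auto)
    thus ?thesis by simp
  qed
  thus "\<exists>K R. \<forall>\<zeta>. \<bar>Im \<zeta> - \<theta>\<bar> \<le> \<rho>' \<and> Re \<zeta> \<ge> R \<longrightarrow> cmod (deriv f \<zeta>) \<le> K * exp (- M * Re \<zeta>)"
    by blast
qed

lemma strip_bound_DP:
  assumes "strip_bound \<theta> \<rho> M f" "f holomorphic_on UNIV"
  shows "strip_bound \<theta> \<rho> M (DP deriv p f)"
proof -
  have "strip_bound \<theta> \<rho> M ((deriv ^^ i) f)" for i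
    by (induction i) (auto intro!: strip_bound_deriv holomorphic_higher_deriv assms)
  thus ?thesis unfolding DP_def[abs_def] by (intro strip_bound_sum strip_bound_cmult)
qed

text \<open>The bound on \<open>deriv h\<close> carries the limit 0 from the centre line to every
  horizontal line, and integrating back from infinity along such a line gives the bound for h; M > 0
  makes the tail integrable.\<close>

lemma strip_bound_integrate:
  assumes "strip_bound \<theta> \<rho> M (deriv h)" "h holomorphic_on UNIV" "M > 0" "\<rho> > 0"
    and lim: "((\<lambda>x. h (Complex x \<theta>)) \<longlongrightarrow> 0) at_top"
  shows "strip_bound \<theta> \<rho> M h"
proof (rule strip_boundI)
  fix \<rho>' assume r: "0 < \<rho>'" "\<rho>' < \<rho>"
  obtain K R where 1: "K \<ge> 0" "\<And>\<zeta>. \<bar>Im \<zeta> - \<theta>\<bar> \<le> \<rho>' \<Longrightarrow> Re \<zeta> \<ge> R \<Longrightarrow> cmod (deriv h \<zeta>) \<le> K * exp (- M * Re \<zeta>)"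
    using strip_boundD[OF assms(1) r] by metis
  have der: "(h has_field_derivative deriv h z) (at z)" for z
    using assms(2) holomorphic_derivI[of h UNIV z] by auto
  have "cmod (h \<zeta>) \<le> (K / M) * exp (- M * Re \<zeta>)" if z: "\<bar>Im \<zeta> - \<theta>\<bar> \<le> \<rho>'" "Re \<zeta> \<ge> R" for \<zeta>
  proof -
    define y where "y = Im \<zeta>"
    have lim2: "((\<lambda>x. h (Complex x y)) \<longlongrightarrow> 0) at_top"
    proof -
      have "((\<lambda>x. h (Complex x y) - h (Complex x \<theta>)) \<longlongrightarrow> 0) at_top"
      proof (rule Lim_null_comparison)
        show "((\<lambda>x. K * \<rho>' * exp (- M * x)) \<longlongrightarrow> 0) at_top" using assms(3) by real_asymp
        show "\<forall>\<^sub>F x in at_top. cmod (h (Complex x y) - h (Complex x \<theta>)) \<le> K * \<rho>' * exp (- M * x)"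
          using eventually_ge_at_top[of R]
        proof eventually_elim
          case (elim x)
          have "cmod (h (Complex x y) - h (Complex x \<theta>)) \<le> (K * exp (- M * x)) * cmod (Complex x y - Complex x \<theta>)"
          proof (rule field_differentiable_bound[of "closed_segment (Complex x \<theta>) (Complex x y)"])
            fix w assume w: "w \<in> closed_segment (Complex x \<theta>) (Complex x y)"
            have "Re w = x" "\<bar>Im w - \<theta>\<bar> \<le> \<rho>'"
            proof -
              obtain u where u: "0 \<le> u" "u \<le> 1" "w = (1 - u) *\<^sub>R Complex x \<theta> + u *\<^sub>R Complex x y"
                using w by (auto simp: closed_segment_def)
              show "Re w = x" unfolding u(3) by (simp add: algebra_simps)
              have "Im w - \<theta> = u * (y - \<theta>)" unfolding u(3) by (simp add: algebra_simps)
              hence "\<bar>Im w - \<theta>\<bar> = u * \<bar>y - \<theta>\<bar>" using u by (simp add: abs_mult)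
              also have "\<dots> \<le> 1 * \<bar>y - \<theta>\<bar>" using u by (intro mult_right_mono) auto
              finally show "\<bar>Im w - \<theta>\<bar> \<le> \<rho>'" using z by (simp add: y_def)
            qed
            thus "cmod (deriv h w) \<le> K * exp (- M * x)" using 1(2)[of w] elim by auto
          qed (auto intro: der has_field_derivative_at_within)
          also have "cmod (Complex x y - Complex x \<theta>) = \<bar>y - \<theta>\<bar>"
            by (simp add: cmod_def)
          also have "K * exp (- M * x) * \<bar>y - \<theta>\<bar> \<le> K * exp (- M * x) * \<rho>'"
            using z 1(1) by (intro mult_left_mono) (auto simp: y_def)
          finally show ?case by (simp add: mult_ac)
        qed
      qed
      from tendsto_add[OF this lim] show ?thesis by simp
    qed
    have "eventually (\<lambda>X. cmod (h (Complex X y) - h \<zeta>) \<le> (K / M) * exp (- M * Re \<zeta>)) at_top"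
      using eventually_gt_at_top[of "Re \<zeta>"]
    proof eventually_elim
      case (elim X)
      have vd: "((\<lambda>x. h (Complex x y)) has_vector_derivative deriv h (Complex x y)) (at x)" for x
      proof -
        have i: "((\<lambda>w. w + \<i> * of_real y) has_field_derivative 1) (at (of_real x))"
          by (auto intro!: derivative_eq_intros)
        have "((\<lambda>w. h (w + \<i> * of_real y)) has_field_derivative deriv h (of_real x + \<i> * of_real y)) (at (of_real x))"
          using DERIV_chain2[where f = h and g = "\<lambda>w. w + \<i> * of_real y" and x = "of_real x" and s = UNIV, OF der i] by simp
        from has_vector_derivative_real_field[OF this] show ?thesis unfolding Complex_eq .
      qed
      have "norm (h (Complex X y) - h (Complex (Re \<zeta>) y)) \<le> (- (K / M) * exp (- M * X)) - (- (K / M) * exp (- M * Re \<zeta>))"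
      proof (rule differentiable_bound_general[where f' = "\<lambda>x. deriv h (Complex x y)" and \<phi>' = "\<lambda>x. K * exp (- M * x)"])
        show "Re \<zeta> < X" by fact
        show "continuous_on {Re \<zeta>..X} (\<lambda>x. h (Complex x y))"
          using vd by (intro continuous_at_imp_continuous_on ballI has_vector_derivative_continuous) blast
        show "continuous_on {Re \<zeta>..X} (\<lambda>x. - (K / M) * exp (- M * x))" by (intro continuous_intros)
        fix x assume x: "Re \<zeta> < x" "x < X"
        show "((\<lambda>x. h (Complex x y)) has_vector_derivative deriv h (Complex x y)) (at x)" by (rule vd)
        show "((\<lambda>x. - (K / M) * exp (- M * x)) has_vector_derivative K * exp (- M * x)) (at x)"
          using assms(3) by (auto intro!: derivative_eq_intros simp flip: has_real_derivative_iff_has_vector_derivative)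
        show "norm (deriv h (Complex x y)) \<le> K * exp (- M * x)"
          using 1(2)[of "Complex x y"] x z by (auto simp: y_def)
      qed
      also have "\<dots> \<le> (K / M) * exp (- M * Re \<zeta>)" using 1(1) assms(3) by simp
      finally show ?case by (simp add: y_def)
    qed
    moreover have "((\<lambda>X. cmod (h (Complex X y) - h \<zeta>)) \<longlongrightarrow> cmod (0 - h \<zeta>)) at_top"
      by (intro tendsto_intros lim2)
    ultimately have "cmod (0 - h \<zeta>) \<le> (K / M) * exp (- M * Re \<zeta>)"
      by (intro tendsto_upperbound[of _ _ at_top]) auto
    thus ?thesis by simp
  qed
  thus "\<exists>K R. \<forall>\<zeta>. \<bar>Im \<zeta> - \<theta>\<bar> \<le> \<rho>' \<and> Re \<zeta> \<ge> R \<longrightarrow> cmod (h \<zeta>) \<le> K * exp (- M * Re \<zeta>)"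
    by blast
qed

lemma DP_deriv_add:
  assumes "f holomorphic_on UNIV" "g holomorphic_on UNIV"
  shows "DP deriv p (\<lambda>x. f x + b * g x) x = DP deriv p f x + b * DP deriv p g x"
proof -
  have "(deriv ^^ i) (\<lambda>x. f x + b * g x) x = (deriv ^^ i) f x + b * (deriv ^^ i) g x" for i x
    by (subst higher_deriv_add[of _ UNIV]) (auto intro!: holomorphic_intros assms higher_deriv_cmult[of _ UNIV])
  thus ?thesis unfolding DP_def by (simp add: distrib_left sum.distrib sum_distrib_left mult_ac)
qed

lemma DP_deriv_exp: "DP deriv p (\<lambda>x. exp (a * x)) x = poly p a * exp (a * x)"
proof -
  have "(deriv ^^ i) (\<lambda>x. exp (a * x)) = (\<lambda>x. a ^ i * exp (a * x))" for i
  proof (induction i)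
    case (Suc i)
    have "deriv (\<lambda>x. a ^ i * exp (a * x)) x = a ^ Suc i * exp (a * x)" for x
      by (rule DERIV_imp_deriv) (auto intro!: derivative_eq_intros)
    with Suc show ?case by auto
  qed simp
  thus ?thesis unfolding DP_def poly_altdef sum_distrib_right by (simp add: mult.assoc)
qed

text \<open>Analytic twin of \<open>DP_laurent_theta_prod\<close>: conjugation turns each factor D +
  b_l into D + b_l + alpha + c e^zeta, and the same \<open>Q_poly\<close> arise with 1/X =
  e^zeta.\<close>

lemma DP_deriv_prod_conj:
  assumes h: "h holomorphic_on UNIV"
  shows "DP deriv (\<Prod>l=1..m. [:b l, 1:]) (\<lambda>\<zeta>. exp (c * exp \<zeta> + \<alpha> * \<zeta>) * h \<zeta>) x =
    exp (c * exp x + \<alpha> * x) * (\<Sum>k\<le>m. exp (of_nat (m - k) * x) * DP deriv (Q_poly c (\<lambda>l. b l + \<alpha>) m k) h x)"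
proof (induction m arbitrary: x)
  case (Suc m)
  let ?E = "\<lambda>\<zeta>. exp (c * exp \<zeta> + \<alpha> * \<zeta>)"
  let ?Q = "Q_poly c (\<lambda>l. b l + \<alpha>)"
  let ?D = "DP deriv (\<Prod>l=1..m. [:b l, 1:]) (\<lambda>\<zeta>. ?E \<zeta> * h \<zeta>)"
  have fac: "(\<Prod>l=1..Suc m. [:b l, 1:]) = [:b (Suc m), 1:] * (\<Prod>l=1..m. [:b l, 1:])"
    by (simp del: mult_pCons_left mult_pCons_right add: mult.commute)
  have hol: "(\<lambda>\<zeta>. ?E \<zeta> * h \<zeta>) holomorphic_on UNIV" by (intro holomorphic_intros h)
  have dh: "(DP deriv p h has_field_derivative DP deriv p (deriv h) x) (at x)" for p
    using deriv_DP[OF h open_UNIV, of x p] by (metis UNIV_I field_differentiable_derivI)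
  have "(?D has_field_derivative
     (c * exp x + \<alpha>) * ?E x * (\<Sum>k\<le>m. exp (of_nat (m - k) * x) * DP deriv (?Q m k) h x) +
     ?E x * (\<Sum>k\<le>m. of_nat (m - k) * exp (of_nat (m - k) * x) * DP deriv (?Q m k) h x + exp (of_nat (m - k) * x) * DP deriv (?Q m k) (deriv h) x)) (at x)"
    unfolding Suc.IH[abs_def]
    by (rule derivative_eq_intros refl dh)+ (auto simp: algebra_simps sum_distrib_left sum.distrib)
  hence "deriv ?D x = (c * exp x + \<alpha>) * ?E x * (\<Sum>k\<le>m. exp (of_nat (m - k) * x) * DP deriv (?Q m k) h x) +
     ?E x * (\<Sum>k\<le>m. of_nat (m - k) * exp (of_nat (m - k) * x) * DP deriv (?Q m k) h x + exp (of_nat (m - k) * x) * DP deriv (?Q m k) (deriv h) x)"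
    by (rule DERIV_imp_deriv)
  note d = this
  let ?s = "\<lambda>k. exp (of_nat (m - k) * x) * DP deriv (?Q m k) h x"
  let ?s' = "\<lambda>k. exp (of_nat (m - k) * x) * DP deriv (?Q m k) (deriv h) x"
  have "(\<Sum>k\<le>m. (b (Suc m) + \<alpha> + of_nat (m - k)) * ?s k + ?s' k) =
     (b (Suc m) + \<alpha>) * (\<Sum>k\<le>m. ?s k) + (\<Sum>k\<le>m. of_nat (m - k) * exp (of_nat (m - k) * x) * DP deriv (?Q m k) h x + ?s' k)"
    by (simp add: sum.distrib sum_distrib_left distrib_right mult.assoc)
  hence "DP deriv (\<Prod>l=1..Suc m. [:b l, 1:]) (\<lambda>\<zeta>. ?E \<zeta> * h \<zeta>) x = ?E x * (
     c * exp x * (\<Sum>k\<le>m. ?s k) + (\<Sum>k\<le>m. (b (Suc m) + \<alpha> + of_nat (m - k)) * ?s k + ?s' k))"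
    unfolding fac DP_linear_factor deriv_DP(1)[OF hol open_UNIV UNIV_I, symmetric] Suc.IH d
    by (simp only: distrib_left distrib_right mult.assoc mult.left_commute add.assoc add.left_commute)
  also have "c * exp x * (\<Sum>k\<le>m. exp (of_nat (m - k) * x) * DP deriv (?Q m k) h x) =
     (\<Sum>k\<le>Suc m. c * exp (of_nat (Suc m - k) * x) * DP deriv (?Q m k) h x)"
  proof -
    have "exp x * exp (of_nat (m - k) * x) = exp (of_nat (Suc m - k) * x)" if "k \<le> m" for k
      using that by (simp add: Suc_diff_le algebra_simps flip: exp_add)
    thus ?thesis by (simp add: sum_distrib_left Q_poly_eq_0 mult.assoc) (intro sum.cong, auto simp: mult_ac)
  qed
  also have "\<dots> = c * exp (of_nat (Suc m) * x) * DP deriv (?Q m 0) h x + (\<Sum>k\<le>m. c * exp (of_nat (m - k) * x) * DP deriv (?Q m (Suc k)) h x)"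
    by (subst sum.atMost_Suc_shift) simp
  also have "\<dots> + (\<Sum>k\<le>m. (b (Suc m) + \<alpha> + of_nat (m - k)) * (exp (of_nat (m - k) * x) * DP deriv (?Q m k) h x) + exp (of_nat (m - k) * x) * DP deriv (?Q m k) (deriv h) x)
     = exp (of_nat (Suc m) * x) * DP deriv (?Q (Suc m) 0) h x + (\<Sum>k\<le>m. exp (of_nat (m - k) * x) * DP deriv (?Q (Suc m) (Suc k)) h x)"
    unfolding add.assoc sum.distrib[symmetric] Q_poly.simps DP_smult DP_add DP_linear_factor
    by (intro arg_cong2[of _ _ _ _ plus] sum.cong refl) (auto simp: algebra_simps of_nat_diff)
  also have "\<dots> = (\<Sum>k\<le>Suc m. exp (of_nat (Suc m - k) * x) * DP deriv (?Q (Suc m) k) h x)"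
    by (subst sum.atMost_Suc_shift) (simp del: Q_poly.simps)
  finally show ?case .
qed simp

text \<open>After division by e^((n-1) zeta) the term k = 0 cancels the right-hand side, k = 1 is a
  multiple of h', and all others carry a negative power of z. So h' is controlled by derivatives of
  h with at least one power of z gained.\<close>

lemma bessel_exponent_expansion:
  assumes "n \<ge> 1" and lam: "(\<Sum>l=1..n. lam l) = 0"
    and h: "h holomorphic_on UNIV"
    and sol: "\<And>\<zeta>. DP deriv (char_poly n lam) (\<lambda>\<zeta>. exp (c * exp \<zeta> + Bessel_alpha n * \<zeta>) * h \<zeta>) \<zeta>
      = c ^ n * exp (of_nat n * \<zeta>) * (exp (c * exp \<zeta> + Bessel_alpha n * \<zeta>) * h \<zeta>)"
  shows "of_nat n * c ^ (n - 1) * deriv h \<zeta> + (\<Sum>k=2..n. exp (- of_real (real (k - 1)) * \<zeta>) * DP deriv (Q_Bessel n c lam k) h \<zeta>) = 0"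
proof -
  let ?E = "exp (c * exp \<zeta> + Bessel_alpha n * \<zeta>)"
  let ?D = "\<lambda>k. DP deriv (Q_Bessel n c lam k) h \<zeta>"
  have "?E * (\<Sum>k\<le>n. exp (of_nat (n - k) * \<zeta>) * ?D k) = ?E * (c ^ n * exp (of_nat n * \<zeta>) * h \<zeta>)"
    using sol[of \<zeta>] unfolding char_poly_def DP_deriv_prod_conj[OF h] Q_Bessel_def by (simp add: mult_ac)
  hence 1: "(\<Sum>k\<le>n. exp (of_nat (n - k) * \<zeta>) * ?D k) = c ^ n * exp (of_nat n * \<zeta>) * h \<zeta>" by simp
  have 0: "?D 0 = c ^ n * h \<zeta>" by (simp add: Q_Bessel_0 DP_pCons)
  have "poly (Q_Bessel n c lam 1) = poly [:0, c ^ (n - 1) * of_nat n:]"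
    using Q_Bessel_1[OF lam, of c] by (auto simp: mult_ac)
  hence "Q_Bessel n c lam 1 = [:0, c ^ (n - 1) * of_nat n:]" by (simp only: poly_eq_poly_eq_iff)
  hence D1: "?D 1 = of_nat n * c ^ (n - 1) * deriv h \<zeta>" by (simp add: DP_pCons mult_ac)
  have "{..n} = insert 0 (insert 1 {2..n})" using assms(1) by auto
  hence "exp (of_nat n * \<zeta>) * ?D 0 + (exp (of_nat (n - 1) * \<zeta>) * ?D 1 + (\<Sum>k=2..n. exp (of_nat (n - k) * \<zeta>) * ?D k)) = c ^ n * exp (of_nat n * \<zeta>) * h \<zeta>"
    using 1 by simp
  hence "exp (of_nat (n - 1) * \<zeta>) * ?D 1 + (\<Sum>k=2..n. exp (of_nat (n - k) * \<zeta>) * ?D k) = 0"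
    unfolding 0 by (simp add: mult_ac)
  also have "(\<Sum>k=2..n. exp (of_nat (n - k) * \<zeta>) * ?D k) = exp (of_nat (n - 1) * \<zeta>) * (\<Sum>k=2..n. exp (- of_real (real (k - 1)) * \<zeta>) * ?D k)"
    unfolding sum_distrib_left
  proof (rule sum.cong[OF refl])
    fix k assume "k \<in> {2..n}"
    hence "(of_nat (n - k) :: complex) = of_nat (n - 1) - of_nat (k - 1)" by (auto simp: of_nat_diff)
    hence "of_nat (n - k) * \<zeta> = of_nat (n - 1) * \<zeta> + (- of_real (real (k - 1)) * \<zeta>)"
      by (simp only: left_diff_distrib) simp
    hence "exp (of_nat (n - k) * \<zeta>) = exp (of_nat (n - 1) * \<zeta>) * exp (- of_real (real (k - 1)) * \<zeta>)"
      by (simp only: exp_add)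
    thus "exp (of_nat (n - k) * \<zeta>) * ?D k = exp (of_nat (n - 1) * \<zeta>) * (exp (- of_real (real (k - 1)) * \<zeta>) * ?D k)" by simp
  qed
  also have "exp (of_nat (n - 1) * \<zeta>) * ?D 1 + \<dots> = exp (of_nat (n - 1) * \<zeta>) * (?D 1 + (\<Sum>k=2..n. exp (- of_real (real (k - 1)) * \<zeta>) * ?D k))"
    by (simp only: distrib_left)
  finally show ?thesis using D1 by simp
qed

text \<open>Substitution k = m + 1 - i, that is m = i + k - 1; the condition i < m becomes k >=
  2.\<close>

lemma sum_triangle_swap:
  "(\<Sum>m\<le>(M::nat). \<Sum>i<m. f i (m + 1 - i) m) = (\<Sum>i\<le>M. \<Sum>k=2..M + 1 - i. (f i k (i + k - 1) :: complex))"
proof -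
  have "(\<Sum>m\<le>M. \<Sum>i<m. f i (m + 1 - i) m) = (\<Sum>(m, i)\<in>(SIGMA m:{..M}. {..<m}). f i (m + 1 - i) m)"
    by (rule sum.Sigma) auto
  also have "\<dots> = (\<Sum>(i, k)\<in>(SIGMA i:{..M}. {2..M + 1 - i}). f i k (i + k - 1))"
    by (rule sum.reindex_bij_witness[of _ "\<lambda>(i, k). (i + k - 1, i)" "\<lambda>(m, i). (i, m + 1 - i)"]) auto
  also have "\<dots> = (\<Sum>i\<le>M. \<Sum>k=2..M + 1 - i. f i k (i + k - 1))"
    by (rule sum.Sigma[symmetric]) auto
  finally show ?thesis .
qed

text \<open>All orders up to M cancel by the recursion for \<open>B_rec\<close>; what is left are
  the pairs with i + k - 1 > M.\<close>

lemma bessel_operator_partial_sum: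
  fixes lam :: "nat \<Rightarrow> complex"
  assumes "n \<ge> 1" "c \<noteq> 0"
  defines "\<sigma> \<equiv> (\<lambda>M \<zeta>. \<Sum>m\<le>M. B_rec n c m lam * exp (- of_real (real m) * \<zeta>))"
  shows "strip_bound \<theta> \<rho> (real (Suc M)) (\<lambda>\<zeta>. of_nat n * c ^ (n - 1) * deriv (\<sigma> M) \<zeta>
     + (\<Sum>k=2..n. exp (- of_real (real (k - 1)) * \<zeta>) * DP deriv (Q_Bessel n c lam k) (\<sigma> M) \<zeta>))"
proof -
  let ?B = "\<lambda>m. B_rec n c m lam" and ?Q = "Q_Bessel n c lam"
  let ?x = "\<lambda>m \<zeta>. exp (- of_real (real m) * \<zeta>) :: complex"
  have hol: "?x m holomorphic_on UNIV" for m by (intro holomorphic_intros)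
  have DPs: "DP deriv p (\<sigma> M) \<zeta> = (\<Sum>m\<le>M. ?B m * (poly p (- of_nat m) * ?x m \<zeta>))" for p M \<zeta>
  proof (induction M)
    case 0
    have "\<sigma> 0 = (\<lambda>\<zeta>. exp (0 * \<zeta>))" by (simp add: \<sigma>_def)
    thus ?case by (simp only: DP_deriv_exp) simp
  next
    case (Suc M)
    have es: "\<sigma> (Suc M) = (\<lambda>\<zeta>. \<sigma> M \<zeta> + ?B (Suc M) * ?x (Suc M) \<zeta>)" by (simp only: \<sigma>_def sum.atMost_Suc)
    have hs: "\<sigma> M holomorphic_on UNIV" unfolding \<sigma>_def by (intro holomorphic_intros)
    have "DP deriv p (\<sigma> (Suc M)) \<zeta> = DP deriv p (\<sigma> M) \<zeta> + ?B (Suc M) * DP deriv p (?x (Suc M)) \<zeta>"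
      unfolding es by (rule DP_deriv_add[OF hs hol])
    also have "DP deriv p (?x (Suc M)) \<zeta> = poly p (- of_nat (Suc M)) * ?x (Suc M) \<zeta>"
      unfolding DP_deriv_exp of_real_of_nat_eq by (rule refl)
    finally show ?case by (simp only: Suc.IH sum.atMost_Suc)
  qed
  have "deriv (\<sigma> M) \<zeta> = DP deriv [:0, 1:] (\<sigma> M) \<zeta>" for \<zeta> by (simp add: DP_pCons)
  hence d: "deriv (\<sigma> M) \<zeta> = (\<Sum>m\<le>M. ?B m * (- of_nat m * ?x m \<zeta>))" for \<zeta> by (simp add: DPs)
  have rec: "of_nat n * c ^ (n - 1) * (?B m * of_nat m) = (\<Sum>i<m. poly (?Q (m + 1 - i)) (- of_nat i) * ?B i)" for m
  proof (cases "m = 0")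
    case False
    thus ?thesis using assms(1,2) by (subst (1) B_rec.simps) (simp add: field_simps)
  qed simp
  define f where "f = (\<lambda>\<zeta> i k j. poly (?Q k) (- of_nat i) * ?B i * ?x j \<zeta>)"
  have A: "of_nat n * c ^ (n - 1) * deriv (\<sigma> M) \<zeta> = - (\<Sum>i\<le>M. \<Sum>k=2..M + 1 - i. f \<zeta> i k (i + k - 1))" for \<zeta>
  proof -
    have "of_nat n * c ^ (n - 1) * deriv (\<sigma> M) \<zeta> = - (\<Sum>m\<le>M. (of_nat n * c ^ (n - 1) * (?B m * of_nat m)) * ?x m \<zeta>)"
      unfolding d by (simp add: sum_distrib_left sum_negf mult_ac)
    also have "\<dots> = - (\<Sum>m\<le>M. \<Sum>i<m. f \<zeta> i (m + 1 - i) m)"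
      unfolding rec by (simp add: f_def sum_distrib_right)
    finally show ?thesis unfolding sum_triangle_swap .
  qed
  have Bq: "(\<Sum>k=2..n. exp (- of_real (real (k - 1)) * \<zeta>) * DP deriv (?Q k) (\<sigma> M) \<zeta>) = (\<Sum>i\<le>M. \<Sum>k=2..n. f \<zeta> i k (i + k - 1))" for \<zeta>
  proof -
    have "(\<Sum>k=2..n. exp (- of_real (real (k - 1)) * \<zeta>) * DP deriv (?Q k) (\<sigma> M) \<zeta>) = (\<Sum>k=2..n. \<Sum>i\<le>M. f \<zeta> i k (i + k - 1))"
      unfolding DPs sum_distrib_left
    proof (intro sum.cong refl)
      fix k i assume k: "k \<in> {2..n}"
      hence "real (i + k - 1) = real (k - 1) + real i" by auto
      hence "exp (- of_real (real (k - 1)) * \<zeta>) * ?x i \<zeta> = ?x (i + k - 1) \<zeta>"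
        by (simp only: of_real_add) (simp add: algebra_simps flip: exp_add)
      thus "exp (- of_real (real (k - 1)) * \<zeta>) * (?B i * (poly (?Q k) (- of_nat i) * ?x i \<zeta>)) = f \<zeta> i k (i + k - 1)"
        by (simp add: f_def mult_ac)
    qed
    thus ?thesis by (subst sum.swap) simp
  qed
  have "of_nat n * c ^ (n - 1) * deriv (\<sigma> M) \<zeta> + (\<Sum>k=2..n. exp (- of_real (real (k - 1)) * \<zeta>) * DP deriv (?Q k) (\<sigma> M) \<zeta>)
     = (\<Sum>i\<le>M. \<Sum>k\<in>{2..n} - {2..M + 1 - i}. f \<zeta> i k (i + k - 1))" for \<zeta>
  proof -
    have "(\<Sum>k=2..n. f \<zeta> i k (i + k - 1)) - (\<Sum>k=2..M + 1 - i. f \<zeta> i k (i + k - 1)) = (\<Sum>k\<in>{2..n} - {2..M + 1 - i}. f \<zeta> i k (i + k - 1))" for i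
    proof -
      have "(\<Sum>k=2..M + 1 - i. f \<zeta> i k (i + k - 1)) = (\<Sum>k\<in>{2..n} \<inter> {2..M + 1 - i}. f \<zeta> i k (i + k - 1))"
        by (rule sum.mono_neutral_right) (auto simp: f_def Q_Bessel_def Q_poly_eq_0)
      moreover have "(\<Sum>k=2..n. f \<zeta> i k (i + k - 1)) = (\<Sum>k\<in>{2..n} \<inter> {2..M + 1 - i}. f \<zeta> i k (i + k - 1)) + (\<Sum>k\<in>{2..n} - {2..M + 1 - i}. f \<zeta> i k (i + k - 1))"
        by (rule sum.Int_Diff) simp
      ultimately show ?thesis by simp
    qed
    thus ?thesis unfolding A Bq by (simp add: sum_subtractf[symmetric])
  qed
  moreover have "strip_bound \<theta> \<rho> (real (Suc M)) (\<lambda>\<zeta>. \<Sum>i\<le>M. \<Sum>k\<in>{2..n} - {2..M + 1 - i}. f \<zeta> i k (i + k - 1))"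
    unfolding f_def
    by (intro strip_bound_sum strip_bound_weaken[OF strip_bound_exp]) auto
  ultimately show ?thesis by presburger
qed

text \<open>One round: if h minus the partial sum through index M is of order z^(-M), then every
  term with k >= 2 is of order z^(-M-1). The partial sum solves the equation up to that order too,
  so the derivative of the remainder gains a power; integrating from infinity, where the remainder
  tends to 0, keeps it.\<close>

theorem bessel_asymptotic_bootstrap:
  assumes n: "n \<ge> 1" and c: "c \<noteq> 0" and lam: "(\<Sum>l=1..n. lam l) = 0"
    and h: "h holomorphic_on UNIV"
    and sol: "\<And>\<zeta>. DP deriv (char_poly n lam) (\<lambda>\<zeta>. exp (c * exp \<zeta> + Bessel_alpha n * \<zeta>) * h \<zeta>) \<zeta>
      = c ^ n * exp (of_nat n * \<zeta>) * (exp (c * exp \<zeta> + Bessel_alpha n * \<zeta>) * h \<zeta>)"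
    and bnd: "strip_bound \<theta> \<rho> 0 h" "\<rho> > 0"
    and lim: "((\<lambda>x. h (Complex x \<theta>)) \<longlongrightarrow> 1) at_top"
  shows "strip_bound \<theta> \<rho> (real M) (\<lambda>\<zeta>. h \<zeta> - (\<Sum>m<M. B_rec n c m lam * exp (- of_real (real m) * \<zeta>)))"
proof (induction M)
  case 0 show ?case using bnd by simp
next
  case (Suc M)
  let ?Q = "Q_Bessel n c lam"
  define \<sigma> where "\<sigma> = (\<lambda>M \<zeta>. \<Sum>m\<le>M. B_rec n c m lam * exp (- of_real (real m) * \<zeta>))"
  define r where "r = (\<lambda>\<zeta>. h \<zeta> - \<sigma> M \<zeta>)"
  have hs: "\<sigma> M holomorphic_on UNIV" unfolding \<sigma>_def by (intro holomorphic_intros)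
  have hr: "r holomorphic_on UNIV" unfolding r_def by (intro holomorphic_intros h hs)
  have r_eq: "r = (\<lambda>\<zeta>. (h \<zeta> - (\<Sum>m<M. B_rec n c m lam * exp (- of_real (real m) * \<zeta>))) + (- B_rec n c M lam) * exp (- of_real (real M) * \<zeta>))"
    by (simp add: r_def \<sigma>_def fun_eq_iff flip: lessThan_Suc_atMost)
  have br: "strip_bound \<theta> \<rho> (real M) r"
    unfolding r_eq by (rule strip_bound_add[OF Suc.IH strip_bound_exp])
  have DPr: "DP deriv p r \<zeta> = DP deriv p h \<zeta> - DP deriv p (\<sigma> M) \<zeta>" for p \<zeta>
    using DP_deriv_add[OF h hs, of p "-1" \<zeta>] by (simp add: r_def)
  have dr: "deriv r \<zeta> = deriv h \<zeta> - deriv (\<sigma> M) \<zeta>" for \<zeta>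
    using DPr[of "[:0, 1:]" \<zeta>] by (simp add: DP_pCons)
  define g where "g = (\<lambda>\<zeta>. of_nat n * c ^ (n - 1) * deriv (\<sigma> M) \<zeta>
     + (\<Sum>k=2..n. exp (- of_real (real (k - 1)) * \<zeta>) * DP deriv (?Q k) (\<sigma> M) \<zeta>))"
  have bg: "strip_bound \<theta> \<rho> (real (Suc M)) g"
    unfolding g_def \<sigma>_def by (rule bessel_operator_partial_sum[OF n c])
  have "of_nat n * c ^ (n - 1) * deriv r \<zeta> + (\<Sum>k=2..n. exp (- of_real (real (k - 1)) * \<zeta>) * DP deriv (?Q k) r \<zeta>) = - g \<zeta>" for \<zeta>
    using bessel_exponent_expansion[OF n lam h sol, of \<zeta>]
    unfolding DPr dr g_def by (simp add: right_diff_distrib sum_subtractf algebra_simps add_eq_0_iff)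
  hence "of_nat n * c ^ (n - 1) * deriv r \<zeta> = - g \<zeta> - (\<Sum>k=2..n. exp (- of_real (real (k - 1)) * \<zeta>) * DP deriv (?Q k) r \<zeta>)" for \<zeta>
    by (simp only: eq_diff_eq)
  hence dr': "deriv r = (\<lambda>\<zeta>. (- 1 / (of_nat n * c ^ (n - 1))) * (g \<zeta> + (\<Sum>k=2..n. exp (- of_real (real (k - 1)) * \<zeta>) * DP deriv (?Q k) r \<zeta>)))"
    using n c by (auto simp: fun_eq_iff field_simps)
  have "strip_bound \<theta> \<rho> (real (Suc M)) (\<lambda>\<zeta>. exp (- of_real (real (k - 1)) * \<zeta>) * DP deriv (?Q k) r \<zeta>)" if "k \<in> {2..n}" for k
    using that by (intro strip_bound_weaken[OF strip_bound_exp_mult[OF strip_bound_DP[OF br hr]]]) auto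
  hence bdr: "strip_bound \<theta> \<rho> (real (Suc M)) (deriv r)"
    unfolding dr' by (intro strip_bound_cmult strip_bound_add bg strip_bound_sum)
  have limr: "((\<lambda>x. r (Complex x \<theta>)) \<longlongrightarrow> 0) at_top"
  proof -
    have "((\<lambda>x. \<sigma> M (Complex x \<theta>)) \<longlongrightarrow> (\<Sum>m\<le>M. if m = 0 then 1 else 0)) at_top"
      unfolding \<sigma>_def
    proof (rule tendsto_sum)
      fix m
      have dec: "((\<lambda>x. a * exp (- b * x)) \<longlongrightarrow> 0) at_top" if "b > 0" for a b :: real
        using that by real_asymp
      have "((\<lambda>x. B_rec n c m lam * exp (- of_real (real m) * Complex x \<theta>)) \<longlongrightarrow> 0) at_top" if "m \<noteq> 0"
      proof (rule Lim_null_comparison)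
        show "\<forall>\<^sub>F x in at_top. norm (B_rec n c m lam * exp (- of_real (real m) * Complex x \<theta>)) \<le> cmod (B_rec n c m lam) * exp (- real m * x)"
          by (simp add: norm_mult)
        show "((\<lambda>x. cmod (B_rec n c m lam) * exp (- real m * x)) \<longlongrightarrow> 0) at_top" using that by (intro dec) auto
      qed
      thus "((\<lambda>x. B_rec n c m lam * exp (- of_real (real m) * Complex x \<theta>)) \<longlongrightarrow> (if m = 0 then 1 else 0)) at_top"
        by (cases "m = 0") auto
    qed
    from tendsto_diff[OF lim this] show ?thesis by (simp add: r_def)
  qed
  have "strip_bound \<theta> \<rho> (real (Suc M)) r"
    by (rule strip_bound_integrate[OF bdr hr _ bnd(2) limr]) simp
  thus ?case by (simp add: r_def[abs_def] \<sigma>_def lessThan_Suc_atMost)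
qed

section \<open>Uniqueness of recessive solutions\<close>

text \<open>2ab <= a^2 + b^2 around a cycle that closes only up to an error E. The constant 1 in
  front is essential: it yields the sharp rate 2n for the energy below.\<close>

lemma cyclic_sum_bound:
  fixes a :: "nat \<Rightarrow> real"
  assumes "\<And>j. a j \<ge> 0" "E \<ge> 0" "a (Suc m) \<le> a 0 + E * (\<Sum>j<Suc m. a j)"
  shows "(\<Sum>j<Suc m. a j * a (Suc j)) \<le> (1 + real (Suc m) * E) * (\<Sum>j<Suc m. (a j)\<^sup>2)"
proof -
  define S where "S = (\<Sum>j<Suc m. (a j)\<^sup>2)"
  have am: "x * y \<le> (x\<^sup>2 + y\<^sup>2) / 2" for x y :: real
    using sum_squares_bound[of x y] by simp
  have le: "(a j)\<^sup>2 \<le> S" if "j < Suc m" for j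
    unfolding S_def using that by (intro member_le_sum) auto
  have "(\<Sum>j<Suc m. a j * a (Suc j)) = (\<Sum>j<m. a j * a (Suc j)) + a m * a (Suc m)" by simp
  also have "(\<Sum>j<m. a j * a (Suc j)) \<le> (\<Sum>j<m. ((a j)\<^sup>2 + (a (Suc j))\<^sup>2) / 2)"
    by (intro sum_mono am)
  also have "\<dots> = ((\<Sum>j<m. (a j)\<^sup>2) + (\<Sum>j<m. (a (Suc j))\<^sup>2)) / 2"
    by (simp add: sum.distrib flip: sum_divide_distrib)
  also have "(\<Sum>j<m. (a j)\<^sup>2) = S - (a m)\<^sup>2" by (simp add: S_def)
  also have "(\<Sum>j<m. (a (Suc j))\<^sup>2) = S - (a 0)\<^sup>2" unfolding S_def by (subst sum.lessThan_Suc_shift) simp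
  also have "a m * a (Suc m) \<le> a m * (a 0 + E * (\<Sum>j<Suc m. a j))"
    using assms by (intro mult_left_mono)
  also have "\<dots> = a m * a 0 + E * (\<Sum>j<Suc m. a m * a j)"
    by (simp add: algebra_simps sum_distrib_left)
  also have "a m * a 0 \<le> ((a m)\<^sup>2 + (a 0)\<^sup>2) / 2" by (rule am)
  also have "(\<Sum>j<Suc m. a m * a j) \<le> (\<Sum>j<Suc m. S)"
  proof (intro sum_mono)
    fix j assume "j \<in> {..<Suc m}"
    thus "a m * a j \<le> S" using am[of "a m" "a j"] le[of j] le[of m] by auto
  qed
  also have "E * (\<Sum>j<Suc m. S) = real (Suc m) * E * S" by simp
  finally have "(\<Sum>j<Suc m. a j * a (Suc j)) \<le> (S - (a m)\<^sup>2 + (S - (a 0)\<^sup>2)) / 2 + (((a m)\<^sup>2 + (a 0)\<^sup>2) / 2 + real (Suc m) * E * S)"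
    using assms(2) by (simp add: mult_left_mono)
  also have "\<dots> = (1 + real (Suc m) * E) * S" by (simp add: field_simps)
  finally show ?thesis by (simp add: S_def)
qed

section \<open>An energy estimate along the most recessive ray\<close>

context
  fixes n :: nat and lam :: "nat \<Rightarrow> complex" and \<xi> :: complex and u :: "complex \<Rightarrow> complex" and \<theta> \<rho> :: real
  assumes n: "n \<ge> 1" and xi: "\<xi> \<in> {1, - 1}"
    and sol: "Bessel_solution n (\<xi> ^ n) lam u"
    and theta: "exp (\<i> * of_real \<theta>) = \<i> * \<xi>" and rho: "\<rho> > 0"
    and small: "\<And>M::nat. strip_bound \<theta> \<rho> (real M) (\<lambda>\<zeta>. u \<zeta> * exp (- (\<i> * of_nat n * \<xi> * exp \<zeta> + Bessel_alpha n * \<zeta>)))"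
begin

text \<open>On this ray z = i xi x, so e^(i n xi z) = e^(-n x).\<close>

definition ray :: "real \<Rightarrow> complex" where "ray x = Complex (ln x) \<theta>"

definition gder :: "nat \<Rightarrow> real \<Rightarrow> complex" where "gder j x = (uderiv ^^ j) u (ray x)"

lemma u_hol: "u holomorphic_on UNIV" using sol by (simp add: Bessel_solution_def)

lemma exp_ray: "x > 0 \<Longrightarrow> exp (ray x) = of_real x * (\<i> * \<xi>)"
  unfolding theta[symmetric] ray_def Complex_eq exp_add by (simp add: exp_of_real)

lemma gder_derivative:
  assumes "x > 0"
  shows "(gder j has_vector_derivative \<i> * \<xi> * gder (Suc j) x) (at x)"
proof -
  let ?U = "(uderiv ^^ j) u"
  have "?U holomorphic_on UNIV"
    unfolding uderiv_funpow[OF u_hol] by (intro holomorphic_intros DP_deriv_holomorphic u_hol) auto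
  hence d: "(?U has_field_derivative deriv ?U (ray x)) (at (ray x))" by (rule holomorphic_derivI) auto
  have "(ray has_vector_derivative of_real (1 / x)) (at x)"
    unfolding ray_def[abs_def] Complex_eq using assms
    by (auto intro!: derivative_eq_intros simp: has_vector_derivative_def scaleR_conv_of_real divide_inverse)
  from field_vector_diff_chain_at[OF this d]
  have "(gder j has_vector_derivative of_real (1 / x) * deriv ?U (ray x)) (at x)"
    by (simp add: o_def gder_def[abs_def])
  also have "of_real (1 / x) * deriv ?U (ray x) = \<i> * \<xi> * gder (Suc j) x"
    using exp_ray[OF assms] assms xi by (auto simp: gder_def uderiv_def cover_proj_def)
  finally show ?thesis .
qed

text \<open>Conjugation writes each derivative as the exponential factor times operators applied to
  the small function h. The power z^alpha is at most 1 in modulus for x >= 1 because alpha <=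
  0.\<close>

lemma gder_decay: "\<exists>K R. K \<ge> 0 \<and> R \<ge> 1 \<and> (\<forall>x\<ge>R. cmod (gder j x) \<le> K * exp (- real n * x) * x powr (- real M))"
proof -
  let ?c = "\<i> * of_nat n * \<xi>" and ?a = "Bessel_alpha n"
  define h where "h = (\<lambda>\<zeta>. u \<zeta> * exp (- (?c * exp \<zeta> + ?a * \<zeta>)))"
  have hh: "h holomorphic_on UNIV" unfolding h_def by (intro holomorphic_intros u_hol)
  have u: "u = (\<lambda>\<zeta>. exp (?c * exp \<zeta> + ?a * \<zeta>) * h \<zeta>)" by (auto simp: h_def simp flip: exp_add)
  \<comment> \<open>Brings \<open>ffact_poly j\<close> into the form that
    \<open>DP_deriv_prod_conj\<close> expects, with factors numbered from 1.\<close>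
  define b where "b = (\<lambda>l. - of_nat (l - 1) :: complex)"
  have ff: "ffact_poly j = (\<Prod>l=1..j. [:b l, 1:])"
    unfolding ffact_poly_def b_def
    by (rule prod.reindex_bij_witness[of _ "\<lambda>l. l - 1" Suc]) auto
  define q where "q = (\<lambda>\<zeta>. \<Sum>k\<le>j. exp (- of_real (real k) * \<zeta>) * DP deriv (Q_poly ?c (\<lambda>l. b l + ?a) j k) h \<zeta>)"
  have U: "(uderiv ^^ j) u \<zeta> = exp (?c * exp \<zeta> + ?a * \<zeta>) * q \<zeta>" for \<zeta>
  proof -
    have "(uderiv ^^ j) u \<zeta> = exp (- (of_nat j * \<zeta>)) * DP deriv (ffact_poly j) u \<zeta>" by (simp add: uderiv_funpow[OF u_hol])
    also have "DP deriv (ffact_poly j) u \<zeta> = exp (?c * exp \<zeta> + ?a * \<zeta>) * (\<Sum>k\<le>j. exp (of_nat (j - k) * \<zeta>) * DP deriv (Q_poly ?c (\<lambda>l. b l + ?a) j k) h \<zeta>)"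
      unfolding ff u by (rule DP_deriv_prod_conj[OF hh])
    also have "exp (- (of_nat j * \<zeta>)) * \<dots> = exp (?c * exp \<zeta> + ?a * \<zeta>) * (\<Sum>k\<le>j. (exp (- (of_nat j * \<zeta>)) * exp (of_nat (j - k) * \<zeta>)) * DP deriv (Q_poly ?c (\<lambda>l. b l + ?a) j k) h \<zeta>)"
      by (simp add: sum_distrib_left mult_ac)
    also have "(\<Sum>k\<le>j. (exp (- (of_nat j * \<zeta>)) * exp (of_nat (j - k) * \<zeta>)) * DP deriv (Q_poly ?c (\<lambda>l. b l + ?a) j k) h \<zeta>) = q \<zeta>"
      unfolding q_def by (intro sum.cong refl arg_cong2[of _ _ _ _ times]) (auto simp: of_nat_diff algebra_simps simp flip: exp_add)
    finally show ?thesis .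
  qed
  have "strip_bound \<theta> \<rho> (real M) q"
    unfolding q_def
    by (intro strip_bound_sum strip_bound_weaken[OF strip_bound_exp_mult[OF strip_bound_DP[OF small[of M, folded h_def] hh]]]) auto
  then obtain K R where K: "K \<ge> 0" "\<And>\<zeta>. \<bar>Im \<zeta> - \<theta>\<bar> \<le> \<rho> / 2 \<Longrightarrow> Re \<zeta> \<ge> R \<Longrightarrow> cmod (q \<zeta>) \<le> K * exp (- real M * Re \<zeta>)"
    using strip_boundD[of \<theta> \<rho> "real M" q "\<rho> / 2"] rho by (metis field_sum_of_halves less_add_same_cancel2 half_gt_zero)
  show ?thesis
  proof (rule exI[of _ K], rule exI[of _ "max 1 (exp R)"], intro conjI allI impI)
    fix x assume x: "max 1 (exp R) \<le> x"
    hence x1: "x \<ge> 1" and xR: "ln x \<ge> R" by (auto simp: ln_ge_iff)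
    have "?c * exp (ray x) = - of_real (real n * x)"
      using exp_ray[of x] x1 xi by (auto simp: complex_eq_iff)
    hence "Re (?c * exp (ray x) + ?a * ray x) = - real n * x + - (real n - 1) / 2 * ln x"
      by (simp add: ray_def Bessel_alpha_def)
    moreover have "(real n - 1) / 2 * ln x \<ge> 0" using x1 n by simp
    ultimately have 1: "cmod (exp (?c * exp (ray x) + ?a * ray x)) \<le> exp (- real n * x)"
      by (simp only: norm_exp_eq_Re) (simp add: algebra_simps)
    have 2: "cmod (q (ray x)) \<le> K * exp (- real M * ln x)"
      using K(2)[of "ray x"] xR rho by (simp add: ray_def)
    have "cmod (gder j x) \<le> exp (- real n * x) * (K * exp (- real M * ln x))"
      unfolding gder_def U norm_mult using 1 2 by (intro mult_mono) auto
    also have "exp (- real M * ln x) = x powr (- real M)" using x1 by (simp add: powr_def)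
    finally show "cmod (gder j x) \<le> K * exp (- real n * x) * x powr (- real M)" by (simp add: mult_ac)
  qed (use K in auto)
qed

definition Venergy :: real where "Venergy = (\<Sum>j<n. cmod (V_coeff n j lam))"

text \<open>The equation divided by z^n: the top coefficient is 1, the main term has constant n^n
  and the rest is O(1/x). The weights n^(-j) match the growth of the derivatives of e^(i n xi z), so
  the weighted top derivative returns to the zeroth one up to O(1/x).\<close>

lemma gder_n_bound:
  assumes x: "x \<ge> 1"
  shows "cmod (gder n x) / real n ^ n \<le> cmod (gder 0 x) / real n ^ 0 + (Venergy / x) * (\<Sum>j<n. cmod (gder j x) / real n ^ j)"
proof -
  define Z where "Z = of_real x * (\<i> * \<xi>)"
  let ?g = "\<lambda>j. gder j x" and ?V = "\<lambda>j. V_coeff n j lam"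
  have z: "cmod Z = x" using x xi by (auto simp: norm_mult Z_def)
  have n0: "real n > 0" using n by simp
  have S: "{1..n} = insert n {1..<n}" "{..<n} = insert 0 {1..<n}" using n by auto
  have "(\<Sum>j=1..n. ?V j * cover_proj (ray x) ^ j * ?g j) + (?V 0 - \<xi> ^ n * (\<i> * of_nat n) ^ n * cover_proj (ray x) ^ n) * u (ray x) = 0"
    using sol unfolding Bessel_solution_def gder_def by blast
  moreover have "cover_proj (ray x) = Z" using exp_ray[of x] x by (simp add: cover_proj_def Z_def)
  moreover have "u (ray x) = ?g 0" by (simp add: gder_def)
  ultimately have e0: "(\<Sum>j=1..n. ?V j * Z ^ j * ?g j) + (?V 0 - \<xi> ^ n * (\<i> * of_nat n) ^ n * Z ^ n) * ?g 0 = 0"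
    by (simp only:)
  have e1: "(\<Sum>j=1..n. ?V j * Z ^ j * ?g j) = Z ^ n * ?g n + (\<Sum>j\<in>{1..<n}. ?V j * Z ^ j * ?g j)"
    unfolding S(1) by (subst sum.insert) (simp_all add: V_coeff_leading)
  have e2: "(\<Sum>j<n. ?V j * Z ^ j * ?g j) = ?V 0 * ?g 0 + (\<Sum>j\<in>{1..<n}. ?V j * Z ^ j * ?g j)"
    unfolding S(2) by (subst sum.insert) simp_all
  have "X + A + (v - q) * g = 0 \<Longrightarrow> X = q * g - (v * g + A)" for X A v q g :: complex by algebra
  from this[OF e0[unfolded e1]]
  have "Z ^ n * ?g n = \<xi> ^ n * (\<i> * of_nat n) ^ n * Z ^ n * ?g 0 - (\<Sum>j<n. ?V j * Z ^ j * ?g j)"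
    unfolding e2 .
  note zg = this
  have "cmod (Z ^ n * ?g n) \<le> cmod (\<xi> ^ n * (\<i> * of_nat n) ^ n * Z ^ n * ?g 0) + cmod (\<Sum>j<n. ?V j * Z ^ j * ?g j)"
    unfolding zg by (rule norm_triangle_ineq4)
  also have "cmod (\<Sum>j<n. ?V j * Z ^ j * ?g j) \<le> (\<Sum>j<n. cmod (?V j * Z ^ j * ?g j))" by (rule norm_sum)
  also have "\<dots> \<le> (\<Sum>j<n. cmod (?V j) * x ^ (n - 1) * cmod (?g j))"
    unfolding norm_mult norm_power z using x by (intro sum_mono mult_right_mono mult_left_mono power_increasing) auto
  also have "\<dots> \<le> (\<Sum>j<n. Venergy * x ^ (n - 1) * (real n ^ n * (cmod (?g j) / real n ^ j)))"
  proof (intro sum_mono mult_mono mult_right_mono)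
    fix j assume j: "j \<in> {..<n}"
    show "cmod (?V j) \<le> Venergy" unfolding Venergy_def using j by (intro member_le_sum) auto
    have "real n ^ j \<le> real n ^ n" using j n by (intro power_increasing) auto
    hence "cmod (?g j) * real n ^ j \<le> cmod (?g j) * real n ^ n" by (intro mult_left_mono) auto
    thus "cmod (?g j) \<le> real n ^ n * (cmod (?g j) / real n ^ j)" using n0 by (simp add: field_simps)
  qed (use x in \<open>auto simp: Venergy_def intro!: sum_nonneg mult_nonneg_nonneg\<close>)
  also have "\<dots> = Venergy * x ^ (n - 1) * real n ^ n * (\<Sum>j<n. cmod (?g j) / real n ^ j)"
    by (simp add: sum_distrib_left mult_ac)
  also have "cmod (\<xi> ^ n * (\<i> * of_nat n) ^ n * Z ^ n * ?g 0) = real n ^ n * x ^ n * cmod (?g 0)"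
    unfolding norm_mult norm_power using z xi by (auto simp: norm_mult)
  finally have "x ^ n * cmod (?g n) \<le> real n ^ n * x ^ n * cmod (?g 0) + Venergy * x ^ (n - 1) * real n ^ n * (\<Sum>j<n. cmod (?g j) / real n ^ j)"
    unfolding norm_mult norm_power z by simp
  moreover have "x ^ n = x * x ^ (n - 1)" using n by (simp flip: power_Suc)
  moreover have "(x * X) * (N * (g0 + (W / x) * S)) = N * (x * X) * g0 + W * X * N * S" for X N g0 W S :: real
    using x by (simp add: field_simps)
  ultimately have "(x * x ^ (n - 1)) * cmod (?g n) \<le> (x * x ^ (n - 1)) * (real n ^ n * (cmod (?g 0) + (Venergy / x) * (\<Sum>j<n. cmod (?g j) / real n ^ j)))"
    by (simp only:)
  hence "cmod (?g n) \<le> real n ^ n * (cmod (?g 0) + (Venergy / x) * (\<Sum>j<n. cmod (?g j) / real n ^ j))"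
    using x by (subst (asm) mult_le_cancel_left_pos) auto
  thus ?thesis using n0 by (simp add: pos_divide_le_eq mult.commute)
qed

definition energy :: "real \<Rightarrow> real" where
  "energy x = (\<Sum>j<n. (cmod (gder j x) / real n ^ j)\<^sup>2)"

text \<open>The derivative pairs neighbouring weighted components with a factor n, and the n-th is
  led back to the zeroth. The cyclic estimate then bounds the logarithmic derivative from below by
  -2n - O(1/x).\<close>

lemma energy_derivative:
  assumes x: "x \<ge> 1"
  shows "\<exists>D. (energy has_real_derivative D) (at x) \<and> D \<ge> - (2 * real n * (1 + real n * (Venergy / x))) * energy x"
proof -
  let ?a = "\<lambda>j. cmod (gder j x) / real n ^ j"
  define D where "D = (\<Sum>j<n. 2 * Re (cnj (gder j x) * (\<i> * \<xi> * gder (Suc j) x)) / (real n ^ j)\<^sup>2)"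
  have n0: "real n > 0" using n by simp
  have d: "((\<lambda>x. (cmod (gder j x) / real n ^ j)\<^sup>2) has_real_derivative 2 * Re (cnj (gder j x) * (\<i> * \<xi> * gder (Suc j) x)) / (real n ^ j)\<^sup>2) (at x)" for j
  proof -
    let ?d = "\<i> * \<xi> * gder (Suc j) x"
    have v: "(gder j has_vector_derivative ?d) (at x)" using x by (intro gder_derivative) auto
    have "((\<lambda>x. Re (gder j x)) has_real_derivative Re ?d) (at x)" "((\<lambda>x. Im (gder j x)) has_real_derivative Im ?d) (at x)"
      using bounded_linear.has_vector_derivative[OF bounded_linear_Re v] bounded_linear.has_vector_derivative[OF bounded_linear_Im v]
      by (simp_all only: has_real_derivative_iff_has_vector_derivative)
    from DERIV_cdivide[OF DERIV_add[OF DERIV_power[OF this(1), of 2] DERIV_power[OF this(2), of 2]], of "(real n ^ j)\<^sup>2"]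
    show ?thesis unfolding power_divide cmod_power2 by (simp add: algebra_simps)
  qed
  have "(energy has_real_derivative D) (at x)"
    unfolding energy_def[abs_def] D_def by (rule DERIV_sum) (rule d)
  moreover have "D \<ge> - (2 * real n * (1 + real n * (Venergy / x))) * energy x"
  proof -
    have "- D = (\<Sum>j<n. - (2 * Re (cnj (gder j x) * (\<i> * \<xi> * gder (Suc j) x)) / (real n ^ j)\<^sup>2))"
      by (simp add: D_def sum_negf)
    also have "\<dots> \<le> (\<Sum>j<n. 2 * real n * (?a j * ?a (Suc j)))"
    proof (rule sum_mono)
      fix j
      let ?w = "cnj (gder j x) * (\<i> * \<xi> * gder (Suc j) x)"
      have "- Re ?w \<le> cmod ?w" using abs_Re_le_cmod[of ?w] by linarith
      also have "\<dots> = cmod (gder j x) * cmod (gder (Suc j) x)" using xi by (auto simp: norm_mult)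
      finally have "2 * (- Re ?w) / (real n ^ j)\<^sup>2 \<le> 2 * (cmod (gder j x) * cmod (gder (Suc j) x)) / (real n ^ j)\<^sup>2"
        by (intro divide_right_mono mult_left_mono) auto
      also have "\<dots> = 2 * real n * (?a j * ?a (Suc j))" using n0 by (simp add: power2_eq_square)
      finally show "- (2 * Re ?w / (real n ^ j)\<^sup>2) \<le> 2 * real n * (?a j * ?a (Suc j))"
        by (simp only: mult_minus_right minus_divide_left)
    qed
    also have "\<dots> = 2 * real n * (\<Sum>j<n. ?a j * ?a (Suc j))" by (simp add: sum_distrib_left)
    also have "(\<Sum>j<n. ?a j * ?a (Suc j)) \<le> (1 + real n * (Venergy / x)) * (\<Sum>j<n. (?a j)\<^sup>2)"
    proof -
      obtain m where m: "n = Suc m" using n by (cases n) auto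
      have "(\<Sum>j<Suc m. ?a j * ?a (Suc j)) \<le> (1 + real (Suc m) * (Venergy / x)) * (\<Sum>j<Suc m. (?a j)\<^sup>2)"
        using gder_n_bound[OF x] x unfolding m[symmetric]
        by (intro cyclic_sum_bound[of ?a "Venergy / x" m, folded m]) (auto simp: Venergy_def sum_nonneg)
      thus ?thesis unfolding m .
    qed
    finally have "- D \<le> 2 * real n * ((1 + real n * (Venergy / x)) * energy x)"
      by (simp add: energy_def mult_left_mono)
    thus ?thesis by (simp add: mult_ac)
  qed
  ultimately show ?thesis by blast
qed

text \<open>By the differential inequality the energy times e^(2nx) x^E is nondecreasing, yet decay
  beyond every power makes it tend to 0. Being nonnegative, it vanishes.\<close>

lemma energy_zero:
  assumes x: "x \<ge> 1"
  shows "energy x = 0"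
proof -
  define E where "E = 2 * real n * (real n * Venergy)"
  define F where "F = (\<lambda>x. energy x * (exp (2 * real n * x) * x powr E))"
  have mono: "F x \<le> F y" if "x \<le> y" for y
  proof (rule DERIV_nonneg_imp_nondecreasing[OF that])
    fix t assume t: "x \<le> t" "t \<le> y"
    hence t1: "t \<ge> 1" using x by simp
    obtain D where D: "(energy has_real_derivative D) (at t)" "D \<ge> - (2 * real n * (1 + real n * (Venergy / t))) * energy t"
      using energy_derivative[OF t1] by blast
    have w: "((\<lambda>x. exp (2 * real n * x) * x powr E) has_real_derivative exp (2 * real n * t) * t powr E * (2 * real n + E / t)) (at t)"
      using t1 by (auto intro!: derivative_eq_intros simp: powr_diff field_simps)
    have "(F has_real_derivative D * (exp (2 * real n * t) * t powr E) + exp (2 * real n * t) * t powr E * (2 * real n + E / t) * energy t) (at t)"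
      unfolding F_def by (rule DERIV_mult[OF D(1) w])
    moreover have "D * (exp (2 * real n * t) * t powr E) + exp (2 * real n * t) * t powr E * (2 * real n + E / t) * energy t
      = (exp (2 * real n * t) * t powr E) * (D + (2 * real n + E / t) * energy t)" by (simp add: algebra_simps)
    moreover have "2 * real n + E / t = 2 * real n * (1 + real n * (Venergy / t))" by (simp add: E_def algebra_simps)
    hence "D + (2 * real n + E / t) * energy t \<ge> 0" using D(2) by simp
    ultimately show "\<exists>y. (F has_real_derivative y) (at t) \<and> 0 \<le> y" by (metis exp_ge_zero mult_nonneg_nonneg powr_ge_zero)
  qed
  \<comment> \<open>The squared decay x^(-2M) has to beat the weight x^E with one power to
    spare.\<close>
  obtain M :: nat where M: "E + 1 \<le> 2 * real M" using real_arch_simple[of "E + 1"] by (metis mult_2 of_nat_0_le_iff add_increasing2 order_trans)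
  have "\<exists>K R. \<forall>j. K j \<ge> 0 \<and> R j \<ge> 1 \<and> (\<forall>x\<ge>R j. cmod (gder j x) \<le> K j * exp (- real n * x) * x powr (- real M))"
    using gder_decay[of _ M] by metis
  then obtain K R where KR: "\<And>j. K j \<ge> 0" "\<And>j. R j \<ge> (1::real)"
    "\<And>j x. x \<ge> R j \<Longrightarrow> cmod (gder j x) \<le> K j * exp (- real n * x) * x powr (- real M)" by metis
  define R' where "R' = (\<Sum>j<n. R j) + x + 1"
  have R': "R' \<ge> R j" if "j < n" for j
  proof -
    have "R j \<le> (\<Sum>j<n. R j)" using that KR(2) by (intro member_le_sum) (auto intro: order_trans[OF zero_le_one])
    thus ?thesis using x by (simp add: R'_def)
  qed
  have Rpos: "(\<Sum>j<n. R j) \<ge> 0" using KR(2) by (intro sum_nonneg) (auto intro: order_trans[OF zero_le_one])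
  define C where "C = (\<Sum>j<n. (K j)\<^sup>2)"
  have Fle: "F y \<le> C * y powr (- 1)" if y: "y \<ge> R'" for y
  proof -
    have y1: "y \<ge> 1" using y x Rpos by (simp add: R'_def)
    have "energy y \<le> (\<Sum>j<n. (K j * exp (- real n * y) * y powr (- real M))\<^sup>2)"
      unfolding energy_def
    proof (intro sum_mono power_mono)
      fix j assume "j \<in> {..<n}"
      hence "cmod (gder j y) \<le> K j * exp (- real n * y) * y powr (- real M)" using R' y by (intro KR(3)) force
      moreover have "cmod (gder j y) / real n ^ j \<le> cmod (gder j y)" using divide_left_mono[of 1 "real n ^ j" "cmod (gder j y)"] one_le_power[of "real n" j] n by simp
      ultimately show "cmod (gder j y) / real n ^ j \<le> K j * exp (- real n * y) * y powr (- real M)" by linarith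
    qed auto
    also have "\<dots> = C * (exp (- 2 * real n * y) * y powr (- 2 * real M))"
      unfolding C_def sum_distrib_right power_mult_distrib
      by (intro sum.cong refl) (simp add: power2_eq_square flip: exp_add powr_add)
    finally have "F y \<le> C * (exp (- 2 * real n * y) * y powr (- 2 * real M)) * (exp (2 * real n * y) * y powr E)"
      unfolding F_def by (intro mult_right_mono) auto
    also have "\<dots> = C * (exp (- 2 * real n * y) * exp (2 * real n * y)) * (y powr (- 2 * real M) * y powr E)" by (simp only: mult_ac)
    also have "\<dots> = C * y powr (E - 2 * real M)" by (simp flip: exp_add powr_add)
    also have "\<dots> \<le> C * y powr (- 1)" using M y1 by (intro mult_left_mono powr_mono) (auto simp: C_def sum_nonneg)
    finally show ?thesis .
  qed
  have "F x \<le> 0"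
  proof (rule tendsto_lowerbound)
    show "((\<lambda>y. C * y powr (- 1)) \<longlongrightarrow> 0) at_top" by real_asymp
    show "\<forall>\<^sub>F y in at_top. F x \<le> C * y powr - 1"
      using eventually_ge_at_top[of R']
    proof eventually_elim
      case (elim y)
      moreover have "x \<le> y" using elim Rpos by (simp add: R'_def)
      ultimately show ?case using mono[of y] Fle[of y] by linarith
    qed
  qed simp
  moreover have "exp (2 * real n * x) * x powr E > 0" using x by simp
  ultimately have "energy x \<le> 0" unfolding F_def by (metis mult_pos_pos not_le)
  moreover have "energy x \<ge> 0" by (auto simp: energy_def intro!: sum_nonneg)
  ultimately show ?thesis by simp
qed

lemma recessive_solution_zero: "u \<zeta> = 0"
proof (rule analytic_continuation[OF u_hol open_UNIV connected_UNIV, of "ray ` {1..}" "ray 1"])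
  show "u z = 0" if z: "z \<in> ray ` {1..}" for z
  proof -
    obtain x where x: "z = ray x" "x \<ge> 1" using z by auto
    have "(cmod (gder 0 x) / real n ^ 0)\<^sup>2 \<le> energy x"
      unfolding energy_def using n by (intro member_le_sum[of 0]) auto
    thus ?thesis using energy_zero[OF x(2)] x(1) by (simp add: gder_def)
  qed
  show "ray 1 islimpt ray ` {1..}"
    unfolding islimpt_sequential
  proof (intro exI[of _ "\<lambda>k. ray (1 + 1 / real (Suc k))"] conjI allI)
    have "ln (1 + 1 / real (Suc k)) > 0" for k by (rule ln_gt_zero) simp
    from less_imp_neq[OF this] show "ray (1 + 1 / real (Suc k)) \<in> ray ` {1..} - {ray 1}" for k
      by (auto simp: ray_def intro!: image_eqI[of _ _ "1 + 1 / (1 + real k)"])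
    have "(\<lambda>k. 1 + 1 / real (Suc k)) \<longlonglongrightarrow> 1" by real_asymp
    hence "(\<lambda>k. Complex (ln (1 + 1 / real (Suc k))) \<theta>) \<longlonglongrightarrow> Complex (ln 1) \<theta>"
      by (intro tendsto_Complex tendsto_ln tendsto_const) auto
    thus "(\<lambda>k. ray (1 + 1 / real (Suc k))) \<longlonglongrightarrow> ray 1" by (simp add: ray_def)
  qed
qed auto

end

lemma exp_i_theta: "\<xi> \<in> {1, - 1} \<Longrightarrow> exp (\<i> * of_real (pi / 2 - Arg \<xi>)) = \<i> * \<xi>"
proof -
  assume "\<xi> \<in> {1, - 1}"
  moreover have "Arg (- 1) = pi" using Arg_of_real[of "- 1"] by simp
  ultimately have "pi / 2 - Arg \<xi> = pi / 2 \<and> \<xi> = 1 \<or> pi / 2 - Arg \<xi> = - (pi / 2) \<and> \<xi> = - 1" by auto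
  moreover have "exp (\<i> * of_real (pi / 2)) = \<i>" "exp (\<i> * of_real (- (pi / 2))) = - \<i>"
    unfolding cis_conv_exp[symmetric] by (simp_all add: cis.ctr complex_eq_iff)
  ultimately show ?thesis by auto
qed

text \<open>The threshold R bounds |z| on one side and ln |z| on the other; the step
  \<open>ex\<close> converts between them.\<close>

lemma has_asymptotic_expansion_iff_strip_bound:
  "has_asymptotic_expansion w c \<alpha> b \<theta> \<rho> \<longleftrightarrow>
     (\<forall>M. strip_bound \<theta> \<rho> (real M) (\<lambda>\<zeta>. w \<zeta> * exp (- (c * exp \<zeta> + \<alpha> * \<zeta>)) - (\<Sum>m<M. b m * exp (- of_real (real m) * \<zeta>))))"
proof -
  have 1: "w \<zeta> / (exp (c * cover_proj \<zeta>) * upow \<zeta> \<alpha>) - (\<Sum>m<M. b m * upow \<zeta> (- of_nat m)) =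
     w \<zeta> * exp (- (c * exp \<zeta> + \<alpha> * \<zeta>)) - (\<Sum>m<M. b m * exp (- of_real (real m) * \<zeta>))" for M \<zeta>
    by (simp add: cover_proj_def upow_def exp_minus exp_diff exp_add divide_inverse)
  have 2: "uabs \<zeta> powr (- real M) = exp (- real M * Re \<zeta>)" for M \<zeta>
    by (simp add: uabs_def powr_def)
  have ex: "(\<exists>K R. \<forall>\<zeta>. \<bar>Im \<zeta> - \<theta>\<bar> \<le> r \<and> R \<le> exp (Re \<zeta>) \<longrightarrow> P K \<zeta>) \<longleftrightarrow> (\<exists>K R. \<forall>\<zeta>. \<bar>Im \<zeta> - \<theta>\<bar> \<le> r \<and> R \<le> Re \<zeta> \<longrightarrow> P K \<zeta>)" for r :: real and P :: "real \<Rightarrow> complex \<Rightarrow> bool"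
  proof
    assume "\<exists>K R. \<forall>\<zeta>. \<bar>Im \<zeta> - \<theta>\<bar> \<le> r \<and> R \<le> exp (Re \<zeta>) \<longrightarrow> P K \<zeta>"
    then obtain K R where *: "\<And>\<zeta>. \<bar>Im \<zeta> - \<theta>\<bar> \<le> r \<Longrightarrow> R \<le> exp (Re \<zeta>) \<Longrightarrow> P K \<zeta>" by blast
    have "R \<le> exp y" if "ln (max R 1) \<le> y" for y
      using that by (smt (verit) exp_le_cancel_iff exp_ln max.cobounded1 max.cobounded2)
    thus "\<exists>K R. \<forall>\<zeta>. \<bar>Im \<zeta> - \<theta>\<bar> \<le> r \<and> R \<le> Re \<zeta> \<longrightarrow> P K \<zeta>" using * by blast
  next
    assume "\<exists>K R. \<forall>\<zeta>. \<bar>Im \<zeta> - \<theta>\<bar> \<le> r \<and> R \<le> Re \<zeta> \<longrightarrow> P K \<zeta>"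
    then obtain K R where *: "\<And>\<zeta>. \<bar>Im \<zeta> - \<theta>\<bar> \<le> r \<Longrightarrow> R \<le> Re \<zeta> \<Longrightarrow> P K \<zeta>" by blast
    have "\<forall>\<zeta>. \<bar>Im \<zeta> - \<theta>\<bar> \<le> r \<and> exp R \<le> exp (Re \<zeta>) \<longrightarrow> P K \<zeta>" using * by simp
    thus "\<exists>K R. \<forall>\<zeta>. \<bar>Im \<zeta> - \<theta>\<bar> \<le> r \<and> R \<le> exp (Re \<zeta>) \<longrightarrow> P K \<zeta>" by blast
  qed
  show ?thesis
    unfolding has_asymptotic_expansion_def strip_bound_def 1 2 unfolding uarg_def uabs_def ex by blast
qed

text \<open>The common partial sums cancel in the difference, which is therefore smaller than every
  power of z relative to its exponential factor, the situation of the energy estimate.\<close>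

theorem Bessel_solution_unique:
  assumes n: "n \<ge> 1" and xi: "\<xi> \<in> {1, - 1}"
    and s1: "Bessel_solution n (\<xi> ^ n) lam w1" and s2: "Bessel_solution n (\<xi> ^ n) lam w2"
    and a1: "has_asymptotic_expansion w1 (\<i> * of_nat n * \<xi>) (Bessel_alpha n) b (pi / 2 - Arg \<xi>) (pi / real n)"
    and a2: "has_asymptotic_expansion w2 (\<i> * of_nat n * \<xi>) (Bessel_alpha n) b (pi / 2 - Arg \<xi>) (pi / real n)"
  shows "w1 = w2"
proof
  fix \<zeta>
  define u where "u = (\<lambda>\<zeta>. w1 \<zeta> + (- 1) * w2 \<zeta>)"
  have h: "w1 holomorphic_on UNIV" "w2 holomorphic_on UNIV" using s1 s2 by (auto simp: Bessel_solution_def)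
  have "Bessel_solution n (\<xi> ^ n) lam u"
    unfolding Bessel_solution_iff
  proof (intro conjI allI)
    show "u holomorphic_on UNIV" unfolding u_def by (intro holomorphic_intros h)
    fix \<zeta> show "DP deriv (char_poly n lam) u \<zeta> = \<xi> ^ n * (\<i> * of_nat n) ^ n * exp (of_nat n * \<zeta>) * u \<zeta>"
      unfolding u_def DP_deriv_add[OF h] using s1 s2 by (simp add: Bessel_solution_iff algebra_simps)
  qed
  moreover have "strip_bound (pi / 2 - Arg \<xi>) (pi / real n) (real M) (\<lambda>\<zeta>. u \<zeta> * exp (- (\<i> * of_nat n * \<xi> * exp \<zeta> + Bessel_alpha n * \<zeta>)))" for M
  proof -
    have "strip_bound (pi / 2 - Arg \<xi>) (pi / real n) (real M) (\<lambda>\<zeta>.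
       (w1 \<zeta> * exp (- (\<i> * of_nat n * \<xi> * exp \<zeta> + Bessel_alpha n * \<zeta>)) - (\<Sum>m<M. b m * exp (- of_real (real m) * \<zeta>))) +
       (- 1) * (w2 \<zeta> * exp (- (\<i> * of_nat n * \<xi> * exp \<zeta> + Bessel_alpha n * \<zeta>)) - (\<Sum>m<M. b m * exp (- of_real (real m) * \<zeta>))))"
      using a1 a2 unfolding has_asymptotic_expansion_iff_strip_bound by (intro strip_bound_add strip_bound_cmult) auto
    thus ?thesis by (simp add: u_def algebra_simps)
  qed
  ultimately have "u \<zeta> = 0"
    using recessive_solution_zero[OF n xi _ exp_i_theta[OF xi], of lam u "pi / real n"] n by simp
  thus "w1 \<zeta> = w2 \<zeta>" by (simp add: u_def)
qed

section \<open>Mellin integrals along vertical lines\<close>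

text \<open>Local domination of f also controls its derivative: Cauchy's estimate on half the disc
  bounds it by 2g/r. Difference quotients along sequences then converge by dominated
  convergence.\<close>

lemma holomorphic_integral:
  fixes f :: "complex \<Rightarrow> real \<Rightarrow> complex"
  assumes U: "open U"
    and meas: "\<And>w. w \<in> U \<Longrightarrow> f w \<in> borel_measurable lborel"
    and hol: "\<And>x. (\<lambda>w. f w x) holomorphic_on U"
    and dom: "\<And>w0. w0 \<in> U \<Longrightarrow> \<exists>r>0. \<exists>g. ball w0 r \<subseteq> U \<and> integrable lborel g \<and> (\<forall>w\<in>ball w0 r. \<forall>x. cmod (f w x) \<le> g x)"
    and w: "w \<in> U"
  shows "((\<lambda>w. \<integral>x. f w x \<partial>lborel) has_field_derivative (\<integral>x. deriv (\<lambda>w. f w x) w \<partial>lborel)) (at w)"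
    and "integrable lborel (f w)" and "integrable lborel (\<lambda>x. deriv (\<lambda>w. f w x) w)"
proof -
  obtain r g where r: "r > 0" "ball w r \<subseteq> U" "integrable lborel g" "\<And>v x. v \<in> ball w r \<Longrightarrow> cmod (f v x) \<le> g x"
    using dom[OF w] by metis
  have int: "integrable lborel (f v)" if "v \<in> ball w r" for v
  proof (rule Bochner_Integration.integrable_bound[OF r(3)])
    show "f v \<in> borel_measurable lborel" using that r(2) by (intro meas) auto
    show "AE x in lborel. norm (f v x) \<le> norm (g x)"
      using r(4)[OF that] by (auto intro!: AE_I2 intro: order_trans[OF _ abs_ge_self])
  qed
  show intw: "integrable lborel (f w)" using int r(1) by auto
  have der: "((\<lambda>w. f w x) has_field_derivative deriv (\<lambda>w. f w x) v) (at v)" if "v \<in> U" for v x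
    using hol[of x] U that by (rule holomorphic_derivI)
  have dbound: "cmod (deriv (\<lambda>w. f w x) v) \<le> 2 * g x / r" if v: "v \<in> ball w (r / 2)" for v x
  proof -
    have sub: "cball v (r / 2) \<subseteq> ball w r"
    proof
      fix y assume "y \<in> cball v (r / 2)"
      hence "dist w y \<le> dist w v + r / 2" using dist_triangle[of w y v] by auto
      thus "y \<in> ball w r" using v by auto
    qed
    have h: "(\<lambda>w. f w x) holomorphic_on ball w r" using hol r(2) holomorphic_on_subset by blast
    have "cmod ((deriv ^^ 1) (\<lambda>w. f w x) v) \<le> fact 1 * g x / (r / 2) ^ 1"
    proof (rule Cauchy_inequality)
      show "(\<lambda>w. f w x) holomorphic_on ball v (r / 2)"
        using sub ball_subset_cball by (blast intro: holomorphic_on_subset[OF h])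
      show "continuous_on (cball v (r / 2)) (\<lambda>w. f w x)"
        using sub h by (meson continuous_on_subset holomorphic_on_imp_continuous_on)
      show "cmod (f y x) \<le> g x" if "cmod (v - y) = r / 2" for y
        using sub that by (intro r(4)) (auto simp: dist_norm)
    qed (use r in auto)
    thus ?thesis by (simp add: mult.commute)
  qed
  have lim: "(\<lambda>i. \<integral>x. (f (X i) x - f w x) / (X i - w) \<partial>lborel) \<longlonglongrightarrow> (\<integral>x. deriv (\<lambda>w. f w x) w \<partial>lborel)
     \<and> integrable lborel (\<lambda>x. deriv (\<lambda>w. f w x) w)"
    if X: "\<And>i. X i \<in> ball w (r / 2) - {w}" "X \<longlonglongrightarrow> w" for X
  proof -
    have m: "(\<lambda>x. (f (X i) x - f w x) / (X i - w)) \<in> borel_measurable lborel" for i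
      using borel_measurable_integrable[OF int[of "X i"]] borel_measurable_integrable[OF intw] X(1)[of i] r(1) by simp
    have pt: "(\<lambda>i. (f (X i) x - f w x) / (X i - w)) \<longlonglongrightarrow> deriv (\<lambda>w. f w x) w" for x
    proof -
      have "((\<lambda>v. (f v x - f w x) / (v - w)) \<longlongrightarrow> deriv (\<lambda>w. f w x) w) (at w)"
        using der[OF w, of x] by (simp add: has_field_derivative_iff)
      thus ?thesis using X unfolding tendsto_at_iff_sequentially by (auto simp: o_def)
    qed
    have dm: "(\<lambda>x. deriv (\<lambda>w. f w x) w) \<in> borel_measurable lborel"
      by (rule borel_measurable_LIMSEQ_metric[OF m pt])
    have bd: "norm ((f (X i) x - f w x) / (X i - w)) \<le> 2 * g x / r" for i x
    proof -
      have "norm (f (X i) x - f w x) \<le> (2 * g x / r) * norm (X i - w)"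
      proof (rule field_differentiable_bound[of "ball w (r / 2)"])
        show "((\<lambda>w. f w x) has_field_derivative deriv (\<lambda>w. f w x) v) (at v within ball w (r / 2))" if "v \<in> ball w (r / 2)" for v
          using that r(1,2) by (intro has_field_derivative_at_within[OF der]) auto
      qed (use X(1)[of i] r(1) in \<open>simp_all add: dbound\<close>)
      moreover have "X i \<noteq> w" using X(1)[of i] by auto
      ultimately show ?thesis by (simp add: norm_divide divide_le_eq)
    qed
    have gi: "integrable lborel (\<lambda>x. 2 * g x / r)" using r(3) by simp
    show ?thesis
      using integral_dominated_convergence[OF dm m gi AE_I2[OF pt] AE_I2[OF bd]]
        integrable_dominated_convergence[OF dm m gi AE_I2[OF pt] AE_I2[OF bd]] by blast
  qed
  \<comment> \<open>One concrete sequence, from which \<open>lim\<close> yields integrability of the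
    derivative.\<close>
  define X0 where "X0 = (\<lambda>i. w + of_real (r / 4 / real (Suc i)))"
  have "X0 i \<in> ball w (r / 2) - {w}" for i
  proof -
    have "r / 4 / real (Suc i) \<le> r / 4 / 1" using r(1) by (intro divide_left_mono) auto
    moreover define u where "u = r / 4 / real (Suc i)"
    ultimately have u: "0 < u" "u < r / 2" using r(1) by auto
    have "w + of_real u \<in> ball w (r / 2) - {w}" using u by (auto simp: dist_norm)
    thus ?thesis by (simp only: X0_def u_def)
  qed
  moreover have "X0 \<longlonglongrightarrow> w"
  proof -
    have "(\<lambda>i. r / 4 / real (Suc i)) \<longlonglongrightarrow> 0" by real_asymp
    from tendsto_add[OF tendsto_const tendsto_of_real[OF this], of w] show ?thesis by (simp add: X0_def[abs_def])
  qed
  ultimately show "integrable lborel (\<lambda>x. deriv (\<lambda>w. f w x) w)" using lim by blast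
  have "((\<lambda>w. \<integral>x. f w x \<partial>lborel) has_field_derivative (\<integral>x. deriv (\<lambda>w. f w x) w \<partial>lborel)) (at w within ball w (r / 2))"
    unfolding has_field_derivative_iff tendsto_at_iff_sequentially
  proof (intro allI impI)
    fix X assume X: "\<forall>i. X i \<in> ball w (r / 2) - {w}" "X \<longlonglongrightarrow> w"
    have "(\<integral>x. (f (X i) x - f w x) / (X i - w) \<partial>lborel) = ((\<integral>x. f (X i) x \<partial>lborel) - (\<integral>x. f w x \<partial>lborel)) / (X i - w)" for i
    proof -
      have "X i \<in> ball w r" using X(1) r(1) by (auto dest!: spec[of _ i])
      thus ?thesis using int[of "X i"] intw by simp
    qed
    thus "((\<lambda>v. ((\<integral>x. f v x \<partial>lborel) - (\<integral>x. f w x \<partial>lborel)) / (v - w)) \<circ> X) \<longlonglongrightarrow> (\<integral>x. deriv (\<lambda>w. f w x) w \<partial>lborel)"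
      using lim[of X] X by (simp add: o_def)
  qed
  thus "((\<lambda>w. \<integral>x. f w x \<partial>lborel) has_field_derivative (\<integral>x. deriv (\<lambda>w. f w x) w \<partial>lborel)) (at w)"
    using r(1) by (simp add: at_within_open[of w "ball w (r / 2)"])
qed

lemma integrable_exp_abs:
  assumes "\<delta> > (0::real)"
  shows "integrable lborel (\<lambda>t. exp (- \<delta> * \<bar>t\<bar>))"
proof -
  have i: "(\<lambda>x. exp (- \<delta> * x)) integrable_on {0..}" using integrable_on_exp_minus_to_infinity[OF assms, of 0] by simp
  hence "set_integrable lebesgue {0..} (\<lambda>x. exp (- \<delta> * x))"
    by (intro nonnegative_absolutely_integrable_1) auto
  hence "integrable lborel (\<lambda>x. indicator {0..} x *\<^sub>R exp (- \<delta> * x))"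
    unfolding set_integrable_def by (subst (asm) integrable_completion) auto
  note 1 = this
  have 2: "integrable lborel (\<lambda>x. indicator {0..} (- x) *\<^sub>R exp (- \<delta> * (- x)))"
    using lborel_integrable_real_affine[OF 1, of "- 1" 0] by simp
  show ?thesis
  proof (rule Bochner_Integration.integrable_bound[OF Bochner_Integration.integrable_add[OF 1 2]])
    show "AE x in lborel. norm (exp (- \<delta> * \<bar>x\<bar>)) \<le> norm (indicator {0..} x *\<^sub>R exp (- \<delta> * x) + indicator {0..} (- x) *\<^sub>R exp (- \<delta> * (- x)))"
      by (intro AE_I2) (auto simp: indicator_def)
  qed simp
qed

text \<open>Bridge between Lebesgue integrals over the line and the gauge integrals that contour
  integrals produce.\<close>

lemma integral_symmetric_limit:
  fixes f :: "real \<Rightarrow> complex"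
  assumes "integrable lborel f"
  shows "((\<lambda>T. integral {- T..T} f) \<longlongrightarrow> (\<integral>x. f x \<partial>lborel)) at_top"
proof -
  have "set_integrable lborel {- T..T} f" for T
    unfolding set_integrable_def using assms by (intro integrable_mult_indicator) auto
  hence eq: "integral {- T..T} f = (\<integral>x. indicator {- T..T} x *\<^sub>R f x \<partial>lborel)" for T
    using set_borel_integral_eq_integral(2)[of "{- T..T}" f] by (simp add: set_lebesgue_integral_def)
  have "((\<lambda>T. \<integral>x. indicator {- T..T} x *\<^sub>R f x \<partial>lborel) \<longlongrightarrow> (\<integral>x. f x \<partial>lborel)) at_top"
  proof (rule integral_dominated_convergence_at_top[where w = "\<lambda>x. norm (f x)"])
    show "AE x in lborel. ((\<lambda>T. indicator {- T..T} x *\<^sub>R f x) \<longlongrightarrow> f x) at_top"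
    proof (rule AE_I2)
      fix x
      have "\<forall>\<^sub>F T in at_top. indicator {- T..T} x *\<^sub>R f x = f x"
        using eventually_ge_at_top[of "\<bar>x\<bar>"] by eventually_elim (auto simp: indicator_def)
      thus "((\<lambda>T. indicator {- T..T} x *\<^sub>R f x) \<longlongrightarrow> f x) at_top" by (rule tendsto_eventually)
    qed
    show "\<forall>\<^sub>F T in at_top. AE x in lborel. norm (indicator {- T..T} x *\<^sub>R f x) \<le> norm (f x)"
      by (intro always_eventually allI AE_I2) (auto simp: indicator_def)
  qed (use assms in auto)
  thus ?thesis by (simp add: eq)
qed

text \<open>The value v is a parameter so that both Cauchy's theorem (v = 0) and a pole with residue
  1 (v = 2 pi i) are covered. Accordingly continuity is asked only on the two lines and for |Im s|
  >= 1, and a pole may sit inside.\<close>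

lemma rectangle_limit:
  fixes q :: "complex \<Rightarrow> complex"
  assumes ab: "a < b" and ia: "integrable lborel (\<lambda>t. q (Complex a t))" and ib: "integrable lborel (\<lambda>t. q (Complex b t))"
    and cont: "continuous_on {s. a \<le> Re s \<and> Re s \<le> b \<and> (Re s = a \<or> Re s = b \<or> \<bar>Im s\<bar> \<ge> 1)} q"
    and bound: "\<And>s. a \<le> Re s \<Longrightarrow> Re s \<le> b \<Longrightarrow> \<bar>Im s\<bar> \<ge> 1 \<Longrightarrow> cmod (q s) \<le> C * exp (- \<delta> * \<bar>Im s\<bar>)" and \<delta>: "\<delta> > 0"
    and val: "\<And>T. T \<ge> 1 \<Longrightarrow> (q has_contour_integral v) (rectpath (Complex a (- T)) (Complex b T))"
  shows "v = \<i> * ((\<integral>t. q (Complex b t) \<partial>lborel) - (\<integral>t. q (Complex a t) \<partial>lborel))"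
proof -
  define h where "h = (\<lambda>T. v - \<i> * (integral {- T..T} (\<lambda>t. q (Complex b t)) - integral {- T..T} (\<lambda>t. q (Complex a t))))"
  have C0: "C \<ge> 0"
  proof -
    have "0 \<le> cmod (q (Complex a 1))" by simp
    also have "\<dots> \<le> C * exp (- \<delta> * 1)" using bound[of "Complex a 1"] ab by simp
    finally show ?thesis by (simp add: zero_le_mult_iff)
  qed
  have hb: "cmod (h T) \<le> 2 * (C * exp (- \<delta> * T) * (b - a))" if T: "T \<ge> 1" for T
  proof -
    let ?a1 = "Complex a (- T)" and ?a2 = "Complex b (- T)" and ?a3 = "Complex b T" and ?a4 = "Complex a T"
    have seg: "closed_segment ?a1 ?a2 \<subseteq> {s. a \<le> Re s \<and> Re s \<le> b \<and> Im s = - T}"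
        "closed_segment ?a3 ?a4 \<subseteq> {s. a \<le> Re s \<and> Re s \<le> b \<and> Im s = T}"
        "closed_segment ?a2 ?a3 \<subseteq> {s. Re s = b}" "closed_segment ?a4 ?a1 \<subseteq> {s. Re s = a}"
      using ab by (auto simp: closed_segment_same_Im closed_segment_same_Re closed_segment_eq_real_ivl)
    let ?S = "{s. a \<le> Re s \<and> Re s \<le> b \<and> (Re s = a \<or> Re s = b \<or> \<bar>Im s\<bar> \<ge> 1)}"
    have sub: "closed_segment ?a1 ?a2 \<subseteq> ?S" "closed_segment ?a2 ?a3 \<subseteq> ?S" "closed_segment ?a3 ?a4 \<subseteq> ?S" "closed_segment ?a4 ?a1 \<subseteq> ?S"
      by (rule order_trans[OF seg(1)], use T in force, rule order_trans[OF seg(3)], use ab in force,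
          rule order_trans[OF seg(2)], use T in force, rule order_trans[OF seg(4)], use ab in force)
    note ci = contour_integrable_continuous_linepath[OF continuous_on_subset[OF cont sub(1)]]
      contour_integrable_continuous_linepath[OF continuous_on_subset[OF cont sub(2)]]
      contour_integrable_continuous_linepath[OF continuous_on_subset[OF cont sub(3)]]
      contour_integrable_continuous_linepath[OF continuous_on_subset[OF cont sub(4)]]
    have "v = contour_integral (rectpath ?a1 ?a3) q" using contour_integral_unique[OF val[OF T]] by simp
    also have "\<dots> = contour_integral (linepath ?a1 ?a2) q + (contour_integral (linepath ?a2 ?a3) q +
        (contour_integral (linepath ?a3 ?a4) q + contour_integral (linepath ?a4 ?a1) q))"
      using ci by (simp add: rectpath_def Let_def)
    also have "contour_integral (linepath ?a2 ?a3) q = \<i> * integral {- T..T} (\<lambda>t. q (Complex b t))"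
      using T by (intro contour_integral_linepath_same_Re) auto
    also have "contour_integral (linepath ?a4 ?a1) q = - contour_integral (linepath ?a1 ?a4) q"
      by (intro contour_integral_reverse_linepath continuous_on_subset[OF cont] sub(4))
    also have "contour_integral (linepath ?a1 ?a4) q = \<i> * integral {- T..T} (\<lambda>t. q (Complex a t))"
      using T by (intro contour_integral_linepath_same_Re) auto
    finally have "h T = contour_integral (linepath ?a1 ?a2) q + contour_integral (linepath ?a3 ?a4) q"
      by (simp add: h_def algebra_simps)
    also have "cmod \<dots> \<le> cmod (contour_integral (linepath ?a1 ?a2) q) + cmod (contour_integral (linepath ?a3 ?a4) q)"
      by (rule norm_triangle_ineq)
    also have "cmod (contour_integral (linepath ?a1 ?a2) q) \<le> C * exp (- \<delta> * T) * cmod (?a2 - ?a1)"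
    proof (rule contour_integral_bound_linepath[OF ci(1)])
      show "cmod (q x) \<le> C * exp (- \<delta> * T)" if "x \<in> closed_segment ?a1 ?a2" for x
        using seg(1) that bound[of x] T by auto
    qed (use C0 in auto)
    also have "cmod (contour_integral (linepath ?a3 ?a4) q) \<le> C * exp (- \<delta> * T) * cmod (?a4 - ?a3)"
    proof (rule contour_integral_bound_linepath[OF ci(3)])
      show "cmod (q x) \<le> C * exp (- \<delta> * T)" if "x \<in> closed_segment ?a3 ?a4" for x
        using seg(2) that bound[of x] T by auto
    qed (use C0 in auto)
    also have "cmod (?a2 - ?a1) = b - a" using ab by (simp add: cmod_def)
    also have "cmod (?a4 - ?a3) = b - a" using ab by (simp add: cmod_def)
    finally show ?thesis by (simp add: mult_ac)
  qed
  have "(h \<longlongrightarrow> 0) at_top"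
  proof (rule Lim_null_comparison)
    show "\<forall>\<^sub>F T in at_top. norm (h T) \<le> 2 * (C * exp (- \<delta> * T) * (b - a))"
      using eventually_ge_at_top[of 1] by eventually_elim (rule hb)
    show "((\<lambda>T. 2 * (C * exp (- \<delta> * T) * (b - a))) \<longlongrightarrow> 0) at_top" using \<delta> by real_asymp
  qed
  moreover have "(h \<longlongrightarrow> v - \<i> * ((\<integral>t. q (Complex b t) \<partial>lborel) - (\<integral>t. q (Complex a t) \<partial>lborel))) at_top"
    unfolding h_def by (intro tendsto_intros integral_symmetric_limit ia ib)
  ultimately have "v - \<i> * ((\<integral>t. q (Complex b t) \<partial>lborel) - (\<integral>t. q (Complex a t) \<partial>lborel)) = 0"
    by (intro tendsto_unique[of at_top h]) auto
  thus ?thesis by simp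
qed

text \<open>\<open>vline\<close> is the inverse Mellin transform of \<open>h\<close> at \<open>exp \<eta>\<close> along \<open>Re s = c\<close>.\<close>

definition vline :: "real \<Rightarrow> (complex \<Rightarrow> complex) \<Rightarrow> complex \<Rightarrow> complex" where
  "vline c h \<eta> = (\<integral>t. h (Complex c t) * exp (- (Complex c t * \<eta>)) \<partial>lborel) / (2 * of_real pi)"

text \<open>The loss epsilon absorbs powers of |Im s|, which makes the class stable under
  multiplication by s and hence \<open>vline\<close> differentiable to any order.\<close>

definition vdecay :: "real \<Rightarrow> real \<Rightarrow> real \<Rightarrow> (complex \<Rightarrow> complex) \<Rightarrow> bool" where
  "vdecay a b \<alpha> h \<longleftrightarrow> continuous_on {s. a \<le> Re s \<and> Re s \<le> b} h \<and>
     (\<forall>\<epsilon>>0. \<exists>C. \<forall>s. a \<le> Re s \<and> Re s \<le> b \<longrightarrow> cmod (h s) \<le> C * exp (- (\<alpha> - \<epsilon>) * \<bar>Im s\<bar>))"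

text \<open>Half of the gap between alpha and beta pays for epsilon in \<open>vdecay\<close>; the
  other half is left as decay, uniform over |Im eta| <= beta.\<close>

lemma vdecay_bound:
  assumes "vdecay a b \<alpha> h" "\<beta> < \<alpha>" "a \<le> b" "0 \<le> \<beta>"
  shows "\<exists>C\<ge>0. \<forall>s \<eta>. a \<le> Re s \<and> Re s \<le> b \<and> \<bar>Im \<eta>\<bar> \<le> \<beta> \<longrightarrow>
     cmod (h s * exp (- (s * \<eta>))) \<le> C * exp (- (Re s * Re \<eta>)) * exp (- ((\<alpha> - \<beta>) / 2) * \<bar>Im s\<bar>)"
proof -
  obtain C where C: "\<And>s. a \<le> Re s \<Longrightarrow> Re s \<le> b \<Longrightarrow> cmod (h s) \<le> C * exp (- (\<alpha> - (\<alpha> - \<beta>) / 2) * \<bar>Im s\<bar>)"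
    using assms(1,2) unfolding vdecay_def by (metis half_gt_zero diff_gt_0_iff_gt)
  have C0: "C \<ge> 0"
  proof -
    have "0 \<le> cmod (h (of_real a))" by simp
    also have "\<dots> \<le> C" using C[of "of_real a"] assms by simp
    finally show ?thesis .
  qed
  show ?thesis
  proof (rule exI[of _ C], intro conjI allI impI C0)
    fix s \<eta> :: complex assume "a \<le> Re s \<and> Re s \<le> b \<and> \<bar>Im \<eta>\<bar> \<le> \<beta>"
    hence s: "a \<le> Re s" "Re s \<le> b" and e: "\<bar>Im \<eta>\<bar> \<le> \<beta>" by auto
    have "Im s * Im \<eta> \<le> \<bar>Im s\<bar> * \<bar>Im \<eta>\<bar>" by (metis abs_ge_self abs_mult)
    also have "\<dots> \<le> \<bar>Im s\<bar> * \<beta>" using e by (intro mult_left_mono) auto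
    finally have i: "Im s * Im \<eta> \<le> \<bar>Im s\<bar> * \<beta>" .
    have "cmod (h s * exp (- (s * \<eta>))) = cmod (h s) * (exp (- (Re s * Re \<eta>)) * exp (Im s * Im \<eta>))"
      by (simp add: norm_mult flip: exp_add)
    also have "\<dots> \<le> (C * exp (- (\<alpha> - (\<alpha> - \<beta>) / 2) * \<bar>Im s\<bar>)) * (exp (- (Re s * Re \<eta>)) * exp (\<bar>Im s\<bar> * \<beta>))"
      using s i C0 by (intro mult_mono C) auto
    also have "\<dots> = C * exp (- (Re s * Re \<eta>)) * (exp (- (\<alpha> - (\<alpha> - \<beta>) / 2) * \<bar>Im s\<bar>) * exp (\<bar>Im s\<bar> * \<beta>))" by (simp only: mult_ac)
    also have "exp (- (\<alpha> - (\<alpha> - \<beta>) / 2) * \<bar>Im s\<bar>) * exp (\<bar>Im s\<bar> * \<beta>) = exp (- ((\<alpha> - \<beta>) / 2) * \<bar>Im s\<bar>)"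
      by (simp add: field_simps flip: exp_add)
    finally show "cmod (h s * exp (- (s * \<eta>))) \<le> C * exp (- (Re s * Re \<eta>)) * exp (- ((\<alpha> - \<beta>) / 2) * \<bar>Im s\<bar>)" .
  qed
qed

lemma vdecay_line_measurable:
  assumes "vdecay a b \<alpha> h" "a \<le> c" "c \<le> b"
  shows "(\<lambda>t. h (Complex c t)) \<in> borel_measurable borel"
proof -
  have "continuous_on UNIV (h \<circ> (\<lambda>t. Complex c t))"
  proof (rule continuous_on_compose)
    show "continuous_on UNIV (\<lambda>t. Complex c t)" unfolding Complex_eq by (intro continuous_intros)
    show "continuous_on (range (\<lambda>t. Complex c t)) h"
      using assms by (auto simp: vdecay_def elim!: continuous_on_subset)
  qed
  hence "continuous_on UNIV (\<lambda>t. h (Complex c t))" by (simp add: o_def)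
  thus ?thesis by (rule borel_measurable_continuous_onI)
qed

lemma borel_measurable_Complex_line [measurable]: "(\<lambda>t. Complex c t) \<in> borel_measurable borel"
  by (intro borel_measurable_continuous_onI) (simp add: Complex_eq continuous_intros)

lemma vdecay_cmult_id:
  assumes "vdecay a b \<alpha> h"
  shows "vdecay a b \<alpha> (\<lambda>s. s * h s)"
  unfolding vdecay_def
proof (intro conjI allI impI)
  show "continuous_on {s. a \<le> Re s \<and> Re s \<le> b} (\<lambda>s. s * h s)"
    using assms by (auto simp: vdecay_def intro!: continuous_intros)
  fix \<epsilon> :: real assume e: "\<epsilon> > 0"
  obtain C where C: "\<And>s. a \<le> Re s \<Longrightarrow> Re s \<le> b \<Longrightarrow> cmod (h s) \<le> C * exp (- (\<alpha> - \<epsilon> / 2) * \<bar>Im s\<bar>)"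
    using assms e unfolding vdecay_def by (metis half_gt_zero)
  \<comment> \<open>|Im s| is at most 2/epsilon times exp(epsilon |Im s| / 2), and Re s is bounded
    on the strip.\<close>
  define D where "D = \<bar>a\<bar> + \<bar>b\<bar> + 2 / \<epsilon>"
  have "cmod (s * h s) \<le> (D * \<bar>C\<bar>) * exp (- (\<alpha> - \<epsilon>) * \<bar>Im s\<bar>)" if s: "a \<le> Re s" "Re s \<le> b" for s
  proof -
    have "\<epsilon> / 2 * \<bar>Im s\<bar> \<le> exp (\<epsilon> / 2 * \<bar>Im s\<bar>)" using exp_ge_add_one_self[of "\<epsilon> / 2 * \<bar>Im s\<bar>"] by linarith
    hence "\<bar>Im s\<bar> \<le> 2 / \<epsilon> * exp (\<epsilon> / 2 * \<bar>Im s\<bar>)" using e by (simp add: field_simps)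
    moreover have "\<bar>Re s\<bar> \<le> (\<bar>a\<bar> + \<bar>b\<bar>) * 1" unfolding mult_1_right using s by linarith
    hence "\<bar>Re s\<bar> \<le> (\<bar>a\<bar> + \<bar>b\<bar>) * exp (\<epsilon> / 2 * \<bar>Im s\<bar>)"
      by (rule order_trans) (use e in \<open>intro mult_left_mono; simp\<close>)
    ultimately have "cmod s \<le> D * exp (\<epsilon> / 2 * \<bar>Im s\<bar>)"
      using cmod_le[of s] by (simp add: D_def distrib_right)
    moreover have "cmod (h s) \<le> \<bar>C\<bar> * exp (- (\<alpha> - \<epsilon> / 2) * \<bar>Im s\<bar>)"
      using C[OF s] by (rule order_trans) (intro mult_right_mono; simp)
    ultimately have "cmod (s * h s) \<le> (D * exp (\<epsilon> / 2 * \<bar>Im s\<bar>)) * (\<bar>C\<bar> * exp (- (\<alpha> - \<epsilon> / 2) * \<bar>Im s\<bar>))"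
      unfolding norm_mult using e by (intro mult_mono) (auto simp: D_def)
    also have "\<dots> = D * \<bar>C\<bar> * (exp (\<epsilon> / 2 * \<bar>Im s\<bar>) * exp (- (\<alpha> - \<epsilon> / 2) * \<bar>Im s\<bar>))" by (simp only: mult_ac)
    also have "exp (\<epsilon> / 2 * \<bar>Im s\<bar>) * exp (- (\<alpha> - \<epsilon> / 2) * \<bar>Im s\<bar>) = exp (- (\<alpha> - \<epsilon>) * \<bar>Im s\<bar>)"
      by (simp add: field_simps flip: exp_add)
    finally show ?thesis .
  qed
  thus "\<exists>C. \<forall>s. a \<le> Re s \<and> Re s \<le> b \<longrightarrow> cmod (s * h s) \<le> C * exp (- (\<alpha> - \<epsilon>) * \<bar>Im s\<bar>)" by blast
qed

text \<open>|Im eta| < alpha leaves exponential decay on the line, locally uniform in eta;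
  differentiation under the integral multiplies the transform by -s.\<close>

lemma vline_facts:
  assumes "vdecay a b \<alpha> h" "a \<le> c" "c \<le> b" "\<bar>Im \<eta>\<bar> < \<alpha>"
  shows "integrable lborel (\<lambda>t. h (Complex c t) * exp (- (Complex c t * \<eta>)))"
    and "(vline c h has_field_derivative vline c (\<lambda>s. - s * h s) \<eta>) (at \<eta>)"
proof -
  define f where "f = (\<lambda>\<eta> t. h (Complex c t) * exp (- (Complex c t * \<eta>)))"
  define U where "U = {\<eta>::complex. \<bar>Im \<eta>\<bar> < \<alpha>}"
  have U: "open U" unfolding U_def by (intro open_Collect_less continuous_intros)
  have e: "\<eta> \<in> U" using assms by (simp add: U_def)
  have m: "f w \<in> borel_measurable lborel" for w
    unfolding f_def using vdecay_line_measurable[OF assms(1-3)] by simp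
  have hol: "(\<lambda>w. f w t) holomorphic_on U" for t unfolding f_def by (intro holomorphic_intros)
  have dom: "\<exists>r>0. \<exists>g. ball w0 r \<subseteq> U \<and> integrable lborel g \<and> (\<forall>w\<in>ball w0 r. \<forall>x. cmod (f w x) \<le> g x)" if w0: "w0 \<in> U" for w0
  proof -
    define r where "r = (\<alpha> - \<bar>Im w0\<bar>) / 2"
    define \<beta> where "\<beta> = \<bar>Im w0\<bar> + r"
    have r: "r > 0" "\<beta> < \<alpha>" "0 \<le> \<beta>" using w0 by (auto simp: r_def \<beta>_def U_def field_simps)
    have "\<exists>C\<ge>0. \<forall>s \<eta>. a \<le> Re s \<and> Re s \<le> b \<and> \<bar>Im \<eta>\<bar> \<le> \<beta> \<longrightarrow>
       cmod (h s * exp (- (s * \<eta>))) \<le> C * exp (- (Re s * Re \<eta>)) * exp (- ((\<alpha> - \<beta>) / 2) * \<bar>Im s\<bar>)"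
      by (rule vdecay_bound[OF assms(1) r(2) order_trans[OF assms(2,3)] r(3)])
    then obtain C where C: "C \<ge> 0" "\<forall>s \<eta>. a \<le> Re s \<and> Re s \<le> b \<and> \<bar>Im \<eta>\<bar> \<le> \<beta> \<longrightarrow>
       cmod (h s * exp (- (s * \<eta>))) \<le> C * exp (- (Re s * Re \<eta>)) * exp (- ((\<alpha> - \<beta>) / 2) * \<bar>Im s\<bar>)"
      by (elim exE conjE)
    define g where "g = (\<lambda>t. C * exp (\<bar>c\<bar> * (\<bar>Re w0\<bar> + r)) * exp (- ((\<alpha> - \<beta>) / 2) * \<bar>t\<bar>))"
    have bw: "\<bar>Im w\<bar> \<le> \<beta>" "\<bar>Re w\<bar> \<le> \<bar>Re w0\<bar> + r" if "w \<in> ball w0 r" for w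
      using that abs_Im_le_cmod[of "w0 - w"] abs_Re_le_cmod[of "w0 - w"] by (auto simp: \<beta>_def dist_norm)
    have "cmod (f w t) \<le> g t" if w: "w \<in> ball w0 r" for w t
    proof -
      have "- (c * Re w) \<le> \<bar>c\<bar> * (\<bar>Re w0\<bar> + r)"
      proof -
        have "- (c * Re w) \<le> \<bar>c\<bar> * \<bar>Re w\<bar>" by (metis abs_ge_minus_self abs_mult)
        also have "\<dots> \<le> \<bar>c\<bar> * (\<bar>Re w0\<bar> + r)" using bw(2)[OF w] by (intro mult_left_mono) auto
        finally show ?thesis .
      qed
      hence "C * exp (- (c * Re w)) * exp (- ((\<alpha> - \<beta>) / 2) * \<bar>t\<bar>) \<le> g t"
        unfolding g_def using C(1) by (intro mult_right_mono mult_left_mono) auto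
      moreover have "cmod (f w t) \<le> C * exp (- (c * Re w)) * exp (- ((\<alpha> - \<beta>) / 2) * \<bar>t\<bar>)"
        using C(2)[rule_format, of "Complex c t" w] bw(1)[OF w] assms(2,3) unfolding f_def complex.sel by blast
      ultimately show ?thesis by linarith
    qed
    moreover have "integrable lborel g" unfolding g_def using r by (intro integrable_mult_right integrable_exp_abs) auto
    moreover have "ball w0 r \<subseteq> U" using bw(1) r by (force simp: U_def)
    ultimately show ?thesis using r(1) by blast
  qed
  note H = holomorphic_integral[OF U m hol dom e]
  show "integrable lborel (\<lambda>t. h (Complex c t) * exp (- (Complex c t * \<eta>)))" using H(2) by (simp add: f_def)
  have "deriv (\<lambda>w. f w t) \<eta> = (- Complex c t * h (Complex c t)) * exp (- (Complex c t * \<eta>))" for t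
    unfolding f_def by (rule DERIV_imp_deriv) (auto intro!: derivative_eq_intros)
  with H(1) have "((\<lambda>w. \<integral>x. f w x \<partial>lborel) has_field_derivative (\<integral>t. (- Complex c t * h (Complex c t)) * exp (- (Complex c t * \<eta>)) \<partial>lborel)) (at \<eta>)"
    by simp
  from DERIV_cdivide[OF this, of "2 * of_real pi"]
  show "(vline c h has_field_derivative vline c (\<lambda>s. - s * h s) \<eta>) (at \<eta>)"
    unfolding vline_def[abs_def] f_def .
qed

text \<open>Cauchy's theorem on tall rectangles, whose horizontal sides die out by
  \<open>vdecay\<close>.\<close>

lemma vline_contour_shift:
  assumes h: "vdecay a b \<alpha> h" "a < b" and hol: "h holomorphic_on S" "open S" "convex S" "{s. a \<le> Re s \<and> Re s \<le> b} \<subseteq> S"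
    and e: "\<bar>Im \<eta>\<bar> < \<alpha>"
  shows "vline a h \<eta> = vline b h \<eta>"
proof -
  define q where "q = (\<lambda>s. h s * exp (- (s * \<eta>)))"
  have "\<exists>C\<ge>0. \<forall>s \<eta>'. a \<le> Re s \<and> Re s \<le> b \<and> \<bar>Im \<eta>'\<bar> \<le> \<bar>Im \<eta>\<bar> \<longrightarrow>
     cmod (h s * exp (- (s * \<eta>'))) \<le> C * exp (- (Re s * Re \<eta>')) * exp (- ((\<alpha> - \<bar>Im \<eta>\<bar>) / 2) * \<bar>Im s\<bar>)"
    by (rule vdecay_bound[OF h(1) e]) (use h(2) in auto)
  then obtain C where C: "C \<ge> 0" "\<forall>s \<eta>'. a \<le> Re s \<and> Re s \<le> b \<and> \<bar>Im \<eta>'\<bar> \<le> \<bar>Im \<eta>\<bar> \<longrightarrow>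
     cmod (h s * exp (- (s * \<eta>'))) \<le> C * exp (- (Re s * Re \<eta>')) * exp (- ((\<alpha> - \<bar>Im \<eta>\<bar>) / 2) * \<bar>Im s\<bar>)"
    by (elim exE conjE)
  define M where "M = exp (\<bar>a * Re \<eta>\<bar> + \<bar>b * Re \<eta>\<bar>)"
  have "0 = \<i> * ((\<integral>t. q (Complex b t) \<partial>lborel) - (\<integral>t. q (Complex a t) \<partial>lborel))"
  proof (rule rectangle_limit[OF h(2)])
    show "integrable lborel (\<lambda>t. q (Complex a t))" "integrable lborel (\<lambda>t. q (Complex b t))"
      unfolding q_def using vline_facts(1)[OF h(1) _ _ e] h(2) by auto
    show "continuous_on {s. a \<le> Re s \<and> Re s \<le> b \<and> (Re s = a \<or> Re s = b \<or> \<bar>Im s\<bar> \<ge> 1)} q"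
      unfolding q_def using h(1) by (intro continuous_intros) (auto simp: vdecay_def elim: continuous_on_subset)
    show "cmod (q s) \<le> (C * M) * exp (- ((\<alpha> - \<bar>Im \<eta>\<bar>) / 2) * \<bar>Im s\<bar>)" if s: "a \<le> Re s" "Re s \<le> b" for s
    proof -
      have "- (Re s * Re \<eta>) \<le> \<bar>a * Re \<eta>\<bar> + \<bar>b * Re \<eta>\<bar>"
      proof (cases "Re \<eta> \<ge> 0")
        case True
        thus ?thesis using mult_right_mono[OF s(1) True] by linarith
      next
        case False
        thus ?thesis using mult_right_mono_neg[OF s(2), of "Re \<eta>"] by linarith
      qed
      hence "C * exp (- (Re s * Re \<eta>)) * exp (- ((\<alpha> - \<bar>Im \<eta>\<bar>) / 2) * \<bar>Im s\<bar>) \<le> (C * M) * exp (- ((\<alpha> - \<bar>Im \<eta>\<bar>) / 2) * \<bar>Im s\<bar>)"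
        unfolding M_def using C(1) by (intro mult_right_mono mult_left_mono) auto
      moreover have "cmod (q s) \<le> C * exp (- (Re s * Re \<eta>)) * exp (- ((\<alpha> - \<bar>Im \<eta>\<bar>) / 2) * \<bar>Im s\<bar>)"
        using C(2)[rule_format, of s \<eta>] s unfolding q_def by blast
      ultimately show ?thesis by linarith
    qed
    show "(\<alpha> - \<bar>Im \<eta>\<bar>) / 2 > 0" using e by simp
    show "(q has_contour_integral 0) (rectpath (Complex a (- T)) (Complex b T))" if T: "T \<ge> 1" for T
    proof (rule Cauchy_theorem_convex_simple[of _ S])
      show "q holomorphic_on S" unfolding q_def by (intro holomorphic_intros hol)
      have "path_image (rectpath (Complex a (- T)) (Complex b T)) \<subseteq> cbox (Complex a (- T)) (Complex b T)"
        using h(2) T by (intro path_image_rectpath_subset_cbox) auto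
      also have "\<dots> \<subseteq> S" using hol(4) by (auto simp: in_cbox_complex_iff)
      finally show "path_image (rectpath (Complex a (- T)) (Complex b T)) \<subseteq> S" .
    qed (use hol in auto)
  qed
  thus ?thesis by (simp add: vline_def q_def)
qed

section \<open>The Cahen--Mellin integral and its convolutions\<close>

definition Gamma_prod :: "nat \<Rightarrow> (nat \<Rightarrow> complex) \<Rightarrow> complex \<Rightarrow> complex" where
  "Gamma_prod m lam s = (\<Prod>l=1..m. Gamma (s - lam l))"

lemma Gamma_prod_holomorphic:
  assumes "\<And>l. l \<in> {1..m} \<Longrightarrow> Re (lam l) \<le> c0"
  shows "Gamma_prod m lam holomorphic_on {s. c0 < Re s}"
  unfolding Gamma_prod_def[abs_def]
proof (intro holomorphic_on_prod)
  fix l assume l: "l \<in> {1..m}"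
  show "(\<lambda>s. Gamma (s - lam l)) holomorphic_on {s. c0 < Re s}"
  proof (rule holomorphic_on_compose_gen[of "\<lambda>s. s - lam l" _ Gamma "{s. 0 < Re s}", unfolded o_def])
    show "Gamma holomorphic_on {s. 0 < Re s}"
      by (intro holomorphic_Gamma) (auto elim!: nonpos_Ints_cases)
    show "(\<lambda>s. s - lam l) ` {s. c0 < Re s} \<subseteq> {s. 0 < Re s}" using assms[OF l] by auto
  qed (intro holomorphic_intros)
qed

lemma vdecay_Gamma_prod:
  assumes lam: "\<And>l. l \<in> {1..m} \<Longrightarrow> Re (lam l) < a" and ab: "a \<le> b"
  shows "vdecay a b (real m * pi / 2) (Gamma_prod m lam)"
  unfolding vdecay_def
proof (intro conjI allI impI)
  \<comment> \<open>A margin below a gives an open half-plane of holomorphy around the closed strip;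
    m = 0 is treated apart because \<open>Max\<close> of the empty set carries no
    information.\<close>
  have "\<exists>c0<a. \<forall>l\<in>{1..m}. Re (lam l) \<le> c0"
  proof (cases "m = 0")
    case True thus ?thesis by (intro exI[of _ "a - 1"]) auto
  next
    case False
    hence "Max ((\<lambda>l. Re (lam l)) ` {1..m}) < a" using lam by (subst Max_less_iff) auto
    thus ?thesis by (intro exI[of _ "Max ((\<lambda>l. Re (lam l)) ` {1..m})"]) auto
  qed
  then obtain c0 where c0: "c0 < a" "\<And>l. l \<in> {1..m} \<Longrightarrow> Re (lam l) \<le> c0" by blast
  from holomorphic_on_imp_continuous_on[OF Gamma_prod_holomorphic[OF c0(2)]]
  show cont: "continuous_on {s. a \<le> Re s \<and> Re s \<le> b} (Gamma_prod m lam)"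
    by (rule continuous_on_subset) (use c0 in auto)
  fix \<epsilon> :: real assume e: "\<epsilon> > 0"
  define B where "B = \<bar>a\<bar> + \<bar>b\<bar>"
  define \<Sigma> where "\<Sigma> = (\<Sum>l=1..m. Re (lam l))"
  define P where "P = real m * (B + 1/2) + \<bar>\<Sigma>\<bar>"
  obtain C T where C: "C > 0" "T \<ge> 1" "\<forall>s. \<bar>Re s\<bar> \<le> B \<and> \<bar>Im s\<bar> \<ge> T \<longrightarrow>
     cmod (\<Prod>l=1..m. Gamma (s - lam l)) \<le>
       C * \<bar>Im s\<bar> powr (real m * (Re s - 1/2) - \<Sigma>) * exp (- real m * pi * \<bar>Im s\<bar> / 2)"
    using Gamma_prod_bound[where B=B and m=m and lam=lam] unfolding \<Sigma>_def by blast
  have "eventually (\<lambda>t. t powr P \<le> exp (\<epsilon> * t)) at_top" using e by real_asymp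
  then obtain T2 where T2: "\<And>t. t \<ge> T2 \<Longrightarrow> t powr P \<le> exp (\<epsilon> * t)" by (auto simp: eventually_at_top_linorder)
  define T3 where "T3 = max T T2"
  define \<alpha> where "\<alpha> = real m * pi / 2"
  have big: "cmod (Gamma_prod m lam s) \<le> C * exp (- (\<alpha> - \<epsilon>) * \<bar>Im s\<bar>)" if s: "a \<le> Re s" "Re s \<le> b" "\<bar>Im s\<bar> \<ge> T3" for s
  proof -
    have rs: "\<bar>Re s\<bar> \<le> B" using s by (auto simp: B_def)
    have "real m * (Re s - 1/2) \<le> real m * (B + 1/2)" using rs by (intro mult_left_mono) auto
    hence "real m * (Re s - 1/2) - \<Sigma> \<le> P" unfolding P_def by linarith
    hence "\<bar>Im s\<bar> powr (real m * (Re s - 1/2) - \<Sigma>) \<le> \<bar>Im s\<bar> powr P"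
      using s C(2) by (intro powr_mono) (auto simp: T3_def)
    also have "\<dots> \<le> exp (\<epsilon> * \<bar>Im s\<bar>)" using s by (intro T2) (auto simp: T3_def)
    finally have p: "\<bar>Im s\<bar> powr (real m * (Re s - 1/2) - \<Sigma>) \<le> exp (\<epsilon> * \<bar>Im s\<bar>)" .
    have "cmod (Gamma_prod m lam s) \<le> C * \<bar>Im s\<bar> powr (real m * (Re s - 1/2) - \<Sigma>) * exp (- real m * pi * \<bar>Im s\<bar> / 2)"
      unfolding Gamma_prod_def using rs s C(3) by (simp add: T3_def)
    also have "\<dots> \<le> C * exp (\<epsilon> * \<bar>Im s\<bar>) * exp (- real m * pi * \<bar>Im s\<bar> / 2)"
      using p C(1) by (intro mult_right_mono mult_left_mono) auto
    also have "\<dots> = C * (exp (\<epsilon> * \<bar>Im s\<bar>) * exp (- real m * pi * \<bar>Im s\<bar> / 2))" by (simp only: mult.assoc)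
    also have "exp (\<epsilon> * \<bar>Im s\<bar>) * exp (- real m * pi * \<bar>Im s\<bar> / 2) = exp (- (\<alpha> - \<epsilon>) * \<bar>Im s\<bar>)"
      by (simp add: \<alpha>_def algebra_simps flip: exp_add)
    finally show ?thesis .
  qed
  have "compact (cbox (Complex a (- T3)) (Complex b T3))" by simp
  moreover have "continuous_on (cbox (Complex a (- T3)) (Complex b T3)) (Gamma_prod m lam)"
    by (rule continuous_on_subset[OF cont]) (auto simp: in_cbox_complex_iff)
  ultimately have "bounded (Gamma_prod m lam ` cbox (Complex a (- T3)) (Complex b T3))"
    by (intro compact_imp_bounded compact_continuous_image)
  then obtain K where K: "K > 0" "\<And>s. s \<in> cbox (Complex a (- T3)) (Complex b T3) \<Longrightarrow> cmod (Gamma_prod m lam s) \<le> K"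
    unfolding bounded_pos by auto
  define D where "D = C + K * exp (\<bar>\<alpha> - \<epsilon>\<bar> * T3)"
  have "cmod (Gamma_prod m lam s) \<le> D * exp (- (\<alpha> - \<epsilon>) * \<bar>Im s\<bar>)" if s: "a \<le> Re s" "Re s \<le> b" for s
  proof (cases "\<bar>Im s\<bar> \<ge> T3")
    case True
    have "C \<le> D" using K by (simp add: D_def)
    hence "C * exp (- (\<alpha> - \<epsilon>) * \<bar>Im s\<bar>) \<le> D * exp (- (\<alpha> - \<epsilon>) * \<bar>Im s\<bar>)" by (intro mult_right_mono) auto
    with big[OF s True] show ?thesis by linarith
  next
    case False
    have "(\<alpha> - \<epsilon>) * \<bar>Im s\<bar> \<le> \<bar>\<alpha> - \<epsilon>\<bar> * T3" using False by (intro mult_mono) auto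
    hence "exp 0 \<le> exp (\<bar>\<alpha> - \<epsilon>\<bar> * T3 + - ((\<alpha> - \<epsilon>) * \<bar>Im s\<bar>))" unfolding exp_le_cancel_iff by linarith
    hence "1 \<le> exp (\<bar>\<alpha> - \<epsilon>\<bar> * T3) * exp (- (\<alpha> - \<epsilon>) * \<bar>Im s\<bar>)" unfolding exp_add mult_minus_left exp_zero .
    hence "K * 1 \<le> K * (exp (\<bar>\<alpha> - \<epsilon>\<bar> * T3) * exp (- (\<alpha> - \<epsilon>) * \<bar>Im s\<bar>))" using K(1) by (intro mult_left_mono) auto
    moreover have "cmod (Gamma_prod m lam s) \<le> K" using s False by (intro K(2)) (auto simp: in_cbox_complex_iff)
    moreover have "0 \<le> C * exp (- (\<alpha> - \<epsilon>) * \<bar>Im s\<bar>)" using C(1) by simp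
    ultimately show ?thesis unfolding D_def distrib_right by linarith
  qed
  thus "\<exists>C. \<forall>s. a \<le> Re s \<and> Re s \<le> b \<longrightarrow> cmod (Gamma_prod m lam s) \<le> C * exp (- (real m * pi / 2 - \<epsilon>) * \<bar>Im s\<bar>)"
    unfolding \<alpha>_def by blast
qed

section \<open>Euler's integral on rotated rays\<close>

lemma integrable_exp_minus_exp:
  assumes x: "x > (0::real)"
  shows "integrable lborel (\<lambda>v::real. exp (x * v - exp v))"
proof -
  define \<delta> where "\<delta> = min x 1"
  define C where "C = exp ((x + 1)\<^sup>2 / 2)"
  have d: "\<delta> > 0" using x by (simp add: \<delta>_def)
  show ?thesis
  proof (rule Bochner_Integration.integrable_bound)
    show "integrable lborel (\<lambda>v. C * exp (- \<delta> * \<bar>v\<bar>))" by (intro integrable_mult_right integrable_exp_abs d)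
    have "exp (x * v - exp v) \<le> C * exp (- \<delta> * \<bar>v\<bar>)" for v
    proof (cases "v \<ge> 0")
      case True
      have "exp v \<ge> 1 + v + v\<^sup>2 / 2" by (rule exp_lower_Taylor_quadratic[OF True])
      moreover have "(x + 1) * v \<le> (x + 1)\<^sup>2 / 2 + v\<^sup>2 / 2" using sum_squares_bound[of "x + 1" v] by linarith
      moreover have "\<delta> * v \<le> 1 * v" using True by (intro mult_right_mono) (auto simp: \<delta>_def)
      ultimately have "x * v - exp v \<le> (x + 1)\<^sup>2 / 2 + - \<delta> * \<bar>v\<bar>" using True by (simp add: distrib_right)
      thus ?thesis unfolding C_def exp_add[symmetric] by simp
    next
      case False
      have "x * v \<le> \<delta> * v" using False by (intro mult_right_mono_neg) (auto simp: \<delta>_def)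
      hence "x * v - exp v \<le> (x + 1)\<^sup>2 / 2 + - \<delta> * \<bar>v\<bar>"
      proof -
        have "- \<delta> * \<bar>v\<bar> = \<delta> * v" using False by simp
        moreover have "0 \<le> (x + 1)\<^sup>2 / 2" by simp
        ultimately show ?thesis using \<open>x * v \<le> \<delta> * v\<close> exp_gt_zero[of v] by linarith
      qed
      thus ?thesis unfolding C_def exp_add[symmetric] by simp
    qed
    thus "AE v in lborel. norm (exp (x * v - exp v)) \<le> norm (C * exp (- \<delta> * \<bar>v\<bar>))"
      by (intro AE_I2) (simp add: C_def)
  qed simp
qed

text \<open>Euler's integral after u = e^v: the substitution is made on bounded intervals, and both
  sides pass to the limit.\<close>

lemma Gamma_real_line_integral:
  assumes z: "Re z > 0"
  shows "integrable lborel (\<lambda>v::real. exp (z * of_real v - of_real (exp v)))"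
    and "(\<integral>v. exp (z * of_real v - of_real (exp v)) \<partial>lborel) = Gamma z"
proof -
  let ?F = "\<lambda>v::real. exp (z * of_real v - of_real (exp v)) :: complex"
  show int: "integrable lborel ?F"
  proof (rule Bochner_Integration.integrable_bound[OF integrable_exp_minus_exp[OF z]])
    show "AE x in lborel. norm (?F x) \<le> norm (exp (Re z * x - exp x))" by (intro AE_I2) simp
  qed simp
  define f where "f = (\<lambda>u::real. of_real u powr (z - 1) / of_real (exp u) :: complex)"
  have fi: "set_integrable lebesgue {0<..} f" unfolding f_def using absolutely_integrable_Gamma_integral'[OF z] .
  have fc: "continuous_on {0<..} f" unfolding f_def by (intro continuous_intros) auto
  have sub: "integral {- N..N} ?F = integral {exp (- N)..exp N} f" if "N \<ge> 0" for N
  proof -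
    have "((\<lambda>x. exp x *\<^sub>R f (exp x)) has_integral integral {exp (- N)..exp N} f) {- N..N}"
    proof (rule has_integral_substitution)
      show "continuous_on {exp (- N)..exp N} f"
        by (rule continuous_on_subset[OF fc]) (auto intro: less_le_trans[OF exp_gt_zero])
    qed (use that in \<open>auto intro!: derivative_eq_intros\<close>)
    moreover have "exp x *\<^sub>R f (exp x) = ?F x" for x
    proof -
      have "(of_real (exp x) :: complex) powr (z - 1) = exp ((z - 1) * of_real x)"
        by (simp add: powr_def Ln_of_real)
      hence "exp x *\<^sub>R f (exp x) = exp (of_real x) * exp ((z - 1) * of_real x) * exp (- of_real (exp x))"
        by (simp add: f_def scaleR_conv_of_real exp_minus divide_inverse exp_of_real)
      also have "\<dots> = ?F x" by (simp add: algebra_simps flip: exp_add)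
      finally show ?thesis .
    qed
    ultimately have "(?F has_integral integral {exp (- N)..exp N} f) {- N..N}" by simp
    thus ?thesis by (rule integral_unique)
  qed
  have "((\<lambda>N. integral {exp (- N)..exp N} f) \<longlongrightarrow> integral {0<..} f) at_top"
  proof -
    have si: "set_integrable lebesgue {exp (- N)..exp N} f" for N
      by (rule set_integrable_subset[OF fi]) (auto intro: less_le_trans[OF exp_gt_zero])
    have e1: "integral {exp (- N)..exp N} f = (\<integral>u. indicator {exp (- N)..exp N} u *\<^sub>R f u \<partial>lebesgue)" for N
      using set_lebesgue_integral_eq_integral(2)[OF si[of N]] by (simp add: set_lebesgue_integral_def)
    have e2: "integral {0<..} f = (\<integral>u. indicator {0<..} u *\<^sub>R f u \<partial>lebesgue)"
      using set_lebesgue_integral_eq_integral(2)[OF fi] by (simp add: set_lebesgue_integral_def)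
    show ?thesis unfolding e1 e2
    proof (rule integral_dominated_convergence_at_top[where w = "\<lambda>u. norm (indicator {0<..} u *\<^sub>R f u)"])
      show "AE u in lebesgue. ((\<lambda>N. indicator {exp (- N)..exp N} u *\<^sub>R f u) \<longlongrightarrow> indicator {0<..} u *\<^sub>R f u) at_top"
      proof (rule AE_I2)
        fix u :: real
        have "\<forall>\<^sub>F N in at_top. indicator {exp (- N)..exp N} u *\<^sub>R f u = indicator {0<..} u *\<^sub>R f u"
          using eventually_ge_at_top[of "\<bar>ln u\<bar>"]
        proof eventually_elim
          case (elim N)
          show ?case
          proof (cases "u > 0")
            case True
            hence "exp (- N) \<le> u" "u \<le> exp N" using elim ln_ge_iff[OF True, of "- N"] exp_le_cancel_iff[of "ln u" N] by auto
            thus ?thesis using True by simp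
          next
            case False
            hence "u \<notin> {exp (- N)..exp N}" using exp_gt_zero[of "- N"] by (auto simp del: exp_gt_zero)
            thus ?thesis using False by (simp add: indicator_def)
          qed
        qed
        thus "((\<lambda>N. indicator {exp (- N)..exp N} u *\<^sub>R f u) \<longlongrightarrow> indicator {0<..} u *\<^sub>R f u) at_top"
          by (rule tendsto_eventually)
      qed
      show "\<forall>\<^sub>F N in at_top. AE u in lebesgue. norm (indicator {exp (- N)..exp N} u *\<^sub>R f u) \<le> norm (indicator {0<..} u *\<^sub>R f u)"
        by (intro always_eventually allI AE_I2) (auto simp: indicator_def dest: less_le_trans[OF exp_gt_zero])
      show "(\<lambda>u. indicator {exp (- N)..exp N} u *\<^sub>R f u) \<in> borel_measurable lebesgue" for N
        using si[of N] unfolding set_integrable_def by (rule borel_measurable_integrable)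
      show "(\<lambda>u. indicator {0<..} u *\<^sub>R f u) \<in> borel_measurable lebesgue"
        using fi unfolding set_integrable_def by (rule borel_measurable_integrable)
      show "integrable lebesgue (\<lambda>u. norm (indicator {0<..} u *\<^sub>R f u))"
        using fi unfolding set_integrable_def by (rule integrable_norm)
    qed
  qed
  moreover have "integral {0<..} f = Gamma z"
    unfolding f_def using Gamma_integral_complex'[OF z] by (rule integral_unique)
  ultimately have "((\<lambda>N. integral {- N..N} ?F) \<longlongrightarrow> Gamma z) at_top"
    using Lim_transform_eventually[of "\<lambda>N. integral {exp (- N)..exp N} f" "Gamma z" at_top "\<lambda>N. integral {- N..N} ?F"]
      eventually_mono[OF eventually_ge_at_top[of 0], of "\<lambda>N. integral {exp (- N)..exp N} f = integral {- N..N} ?F"] sub by simp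
  with integral_symmetric_limit[OF int] show "(\<integral>v. ?F v \<partial>lborel) = Gamma z"
    by (intro tendsto_unique[of at_top "\<lambda>N. integral {- N..N} ?F"]) auto
qed

lemma open_hstrip: "open {\<omega>::complex. \<bar>Im \<omega>\<bar> < \<alpha>}"
  by (intro open_Collect_less continuous_intros)

lemma convex_hstrip: "convex {\<omega>::complex. \<bar>Im \<omega>\<bar> < \<alpha>}"
proof -
  have "{\<omega>::complex. \<bar>Im \<omega>\<bar> < \<alpha>} = {\<omega>. Im \<omega> < \<alpha>} \<inter> {\<omega>. Im \<omega> > - \<alpha>}" by auto
  thus ?thesis by (simp add: convex_Int convex_halfspace_Im_lt convex_halfspace_Im_gt)
qed

lemma islimpt_range_of_real: "0 islimpt range complex_of_real"
  unfolding islimpt_sequential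
proof (intro exI[of _ "\<lambda>k. of_real (1 / real (Suc k))"] conjI allI)
  have "(\<lambda>k. 1 / real (Suc k)) \<longlonglongrightarrow> 0" by real_asymp
  from tendsto_of_real[OF this] show "(\<lambda>k. complex_of_real (1 / real (Suc k))) \<longlonglongrightarrow> 0" by (simp only: of_real_0)
  show "complex_of_real (1 / real (Suc k)) \<in> range of_real - {0}" for k
    unfolding Diff_iff singleton_iff of_real_eq_0_iff by (intro conjI rangeI) simp
qed

text \<open>Both sides are holomorphic in omega where Re e^omega > 0. For real omega the identity is
  a translation of the integration variable, and the identity theorem extends it.\<close>

lemma Gamma_strip_integral:
  assumes z: "Re z > 0" and w: "\<bar>Im \<omega>\<bar> < pi / 2"
  shows "integrable lborel (\<lambda>b::real. exp (z * of_real b - exp (\<omega> + of_real b)))"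
    and "(\<integral>b. exp (z * of_real b - exp (\<omega> + of_real b)) \<partial>lborel) = Gamma z * exp (- (z * \<omega>))"
proof -
  define f where "f = (\<lambda>\<omega> b::real. exp (z * of_real b - exp (\<omega> + of_real b)) :: complex)"
  define U where "U = {\<omega>::complex. \<bar>Im \<omega>\<bar> < pi / 2}"
  have U: "open U" "convex U" unfolding U_def by (rule open_hstrip, rule convex_hstrip)
  have wU: "\<omega> \<in> U" using w by (simp add: U_def)
  have m: "f w \<in> borel_measurable lborel" for w unfolding f_def by simp
  have hol: "(\<lambda>w. f w b) holomorphic_on U" for b unfolding f_def by (intro holomorphic_intros)
  have dom: "\<exists>r>0. \<exists>g. ball w0 r \<subseteq> U \<and> integrable lborel g \<and> (\<forall>w\<in>ball w0 r. \<forall>x. cmod (f w x) \<le> g x)" if w0: "w0 \<in> U" for w0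
  proof -
    define r where "r = (pi / 2 - \<bar>Im w0\<bar>) / 2"
    have r: "r > 0" "\<bar>Im w0\<bar> + r < pi / 2" using w0 by (auto simp: r_def U_def field_simps)
    \<comment> \<open>A lower bound for Re e^w on the disc, used as damping rate in the dominating
      function.\<close>
    define k where "k = exp (Re w0 - r) * cos (\<bar>Im w0\<bar> + r)"
    have k: "k > 0" unfolding k_def using r by (intro mult_pos_pos cos_gt_zero_pi) auto
    define g where "g = (\<lambda>b::real. exp (Re z * b - k * exp b))"
    have "integrable lborel (\<lambda>v. exp (- (Re z * ln k)) * exp (Re z * (ln k + 1 * v) - exp (ln k + 1 * v)))"
      by (intro integrable_mult_right lborel_integrable_real_affine[OF integrable_exp_minus_exp[OF z]]) auto
    also have "(\<lambda>v. exp (- (Re z * ln k)) * exp (Re z * (ln k + 1 * v) - exp (ln k + 1 * v))) = g"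
      unfolding g_def using k by (intro ext) (simp add: exp_add exp_diff exp_minus distrib_left)
    finally have "integrable lborel g" .
    moreover have bw: "\<bar>Im w\<bar> \<le> \<bar>Im w0\<bar> + r" "Re w \<ge> Re w0 - r" if "w \<in> ball w0 r" for w
      using that abs_Im_le_cmod[of "w0 - w"] abs_Re_le_cmod[of "w0 - w"] by (auto simp: dist_norm)
    moreover have "cmod (f w b) \<le> g b" if "w \<in> ball w0 r" for w b
    proof -
      have "cos (\<bar>Im w0\<bar> + r) \<le> cos \<bar>Im w\<bar>" using bw[OF that] r by (intro cos_monotone_0_pi_le) auto
      hence "exp (Re w0 - r) * cos (\<bar>Im w0\<bar> + r) \<le> exp (Re w) * cos \<bar>Im w\<bar>"
        using bw[OF that] r by (intro mult_mono) (auto intro!: less_imp_le[OF cos_gt_zero_pi])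
      hence "k * exp b \<le> exp (Re w) * cos (Im w) * exp b" unfolding k_def by (intro mult_right_mono) auto
      also have "\<dots> = Re (exp (w + of_real b))" unfolding Re_exp by (simp add: exp_add)
      finally show ?thesis by (simp add: f_def g_def)
    qed
    moreover have "ball w0 r \<subseteq> U" using bw(1) r by (force simp: U_def)
    ultimately show ?thesis using r(1) by blast
  qed
  note Hw = holomorphic_integral(2)[where f = f, OF U(1) m hol dom wU]
  show "integrable lborel (\<lambda>b::real. exp (z * of_real b - exp (\<omega> + of_real b)))"
    using Hw by (simp add: f_def)
  define D where "D = (\<lambda>\<omega>. (\<integral>b. f \<omega> b \<partial>lborel) - Gamma z * exp (- (z * \<omega>)))"
  have "D holomorphic_on U"
    unfolding D_def
  proof (intro holomorphic_intros)
    show "(\<lambda>\<omega>. \<integral>b. f \<omega> b \<partial>lborel) holomorphic_on U"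
      unfolding holomorphic_on_open[OF U(1)] using holomorphic_integral(1)[where f = f, OF U(1) m hol dom] by blast
  qed
  moreover have "D \<omega> = 0" if "\<omega> \<in> range of_real" for \<omega>
  proof -
    from that obtain x where x: "\<omega> = of_real x" by (rule rangeE)
    have "Gamma z = (\<integral>v. exp (z * of_real v - of_real (exp v)) \<partial>lborel)"
      by (rule Gamma_real_line_integral(2)[OF z, symmetric])
    also have "\<dots> = (\<integral>v. exp (z * of_real (x + 1 * v) - of_real (exp (x + 1 * v))) \<partial>lborel)"
      by (subst lborel_integral_real_affine[of 1 _ x]) auto
    also have "\<dots> = (\<integral>v. exp (z * of_real x) * f \<omega> v \<partial>lborel)"
      unfolding f_def x by (intro Bochner_Integration.integral_cong refl) (simp add: algebra_simps flip: exp_add exp_of_real)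
    also have "\<dots> = exp (z * \<omega>) * (\<integral>v. f \<omega> v \<partial>lborel)" by (simp add: x)
    finally show ?thesis by (simp add: D_def x mult_ac exp_minus)
  qed
  moreover have "0 islimpt range complex_of_real" by (rule islimpt_range_of_real)
  ultimately have "D \<omega> = 0"
    using U wU by (intro analytic_continuation[of D U "range of_real" 0 \<omega>] convex_connected) (auto simp: U_def)
  thus "(\<integral>b. exp (z * of_real b - exp (\<omega> + of_real b)) \<partial>lborel) = Gamma z * exp (- (z * \<omega>))"
    by (simp add: D_def f_def)
qed

section \<open>The inverse Mellin transform of Gamma products\<close>

lemma Gamma_plus1_right: "Re s > 0 \<Longrightarrow> Gamma (s + 1) = s * Gamma s"
  by (rule Gamma_plus1) (auto elim!: nonpos_Ints_cases)

lemma vline_translate: "vline c (\<lambda>s. h (s + 1)) \<eta> = exp \<eta> * vline (c + 1) h \<eta>"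
proof -
  have "h (Complex c t + 1) * exp (- (Complex c t * \<eta>)) = exp \<eta> * (h (Complex (c + 1) t) * exp (- (Complex (c + 1) t * \<eta>)))" for t
  proof -
    have 1: "Complex c t + 1 = Complex (c + 1) t" by (simp add: complex_eq_iff)
    have "- (Complex c t * \<eta>) = \<eta> + - (Complex (c + 1) t * \<eta>)" unfolding 1[symmetric] by (simp add: algebra_simps)
    hence "exp (- (Complex c t * \<eta>)) = exp \<eta> * exp (- (Complex (c + 1) t * \<eta>))" by (simp only: exp_add)
    thus ?thesis unfolding 1 by simp
  qed
  thus ?thesis unfolding vline_def by simp
qed

lemma vline_cong: "(\<And>t. h (Complex c t) = k (Complex c t)) \<Longrightarrow> vline c h \<eta> = vline c k \<eta>"
  by (simp add: vline_def)

lemma vdecay_Gamma: "0 < a \<Longrightarrow> a \<le> b \<Longrightarrow> vdecay a b (pi / 2) Gamma"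
  using vdecay_Gamma_prod[of 1 "\<lambda>_. 0" a b] by (simp add: Gamma_prod_def[abs_def])

lemma Gamma_holomorphic_right: "Gamma holomorphic_on {s. 0 < Re s}"
  using Gamma_prod_holomorphic[of 1 "\<lambda>_. 0" 0] by (simp add: Gamma_prod_def[abs_def])

text \<open>Gamma(s) = Gamma(s+1)/s with numerator regular for Re s > -1, so moving the line across
  0 collects the residue Gamma(1) = 1.\<close>

lemma Cahen_Mellin_residue:
  assumes e: "\<bar>Im \<eta>\<bar> < pi / 2"
  shows "integrable lborel (\<lambda>t. Gamma (Complex (- 1/2) t + 1) / Complex (- 1/2) t * exp (- (Complex (- 1/2) t * \<eta>)))"
    and "vline (1/2) Gamma \<eta> = 1 + vline (- 1/2) (\<lambda>s. Gamma (s + 1) / s) \<eta>"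
proof -
  define h where "h = (\<lambda>s. Gamma (s + 1) :: complex)"
  define q where "q = (\<lambda>s. h s / s * exp (- (s * \<eta>)))"
  have hd: "vdecay (- 1/2) (1/2) (pi / 2) h"
    using vdecay_Gamma_prod[of 1 "\<lambda>_. - 1" "- 1/2" "1/2"] by (simp add: Gamma_prod_def[abs_def] h_def)
  have hh: "h holomorphic_on {s. - 1 < Re s}"
    using Gamma_prod_holomorphic[of 1 "\<lambda>_. - 1" "- 1"] by (simp add: Gamma_prod_def[abs_def] h_def)
  have li: "integrable lborel (\<lambda>t. q (Complex c t))" if c: "c = - 1/2 \<or> c = 1/2" for c
  proof (rule Bochner_Integration.integrable_bound)
    have hi: "integrable lborel (\<lambda>t. h (Complex c t) * exp (- (Complex c t * \<eta>)))"
      using vline_facts(1)[OF hd _ _ e] c by auto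
    thus "integrable lborel (\<lambda>t. 2 * (h (Complex c t) * exp (- (Complex c t * \<eta>))))" by simp
    have "(\<lambda>t. (h (Complex c t) * exp (- (Complex c t * \<eta>))) / Complex c t) \<in> borel_measurable lborel"
      using borel_measurable_integrable[OF hi] by simp
    thus "(\<lambda>t. q (Complex c t)) \<in> borel_measurable lborel" by (simp add: q_def)
    have "norm (q (Complex c t)) \<le> norm (2 * (h (Complex c t) * exp (- (Complex c t * \<eta>))))" for t
    proof -
      have "1/2 \<le> cmod (Complex c t)" using abs_Re_le_cmod[of "Complex c t"] c by auto
      hence "1 / cmod (Complex c t) \<le> 1 / (1/2)" by (intro divide_left_mono) auto
      hence "(cmod (h (Complex c t)) * cmod (exp (- (Complex c t * \<eta>)))) * (1 / cmod (Complex c t)) \<le> (cmod (h (Complex c t)) * cmod (exp (- (Complex c t * \<eta>)))) * 2"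
        by (intro mult_left_mono) auto
      thus ?thesis by (simp add: q_def norm_mult norm_divide mult_ac)
    qed
    thus "AE t in lborel. norm (q (Complex c t)) \<le> norm (2 * (h (Complex c t) * exp (- (Complex c t * \<eta>))))" by simp
  qed
  show "integrable lborel (\<lambda>t. Gamma (Complex (- 1/2) t + 1) / Complex (- 1/2) t * exp (- (Complex (- 1/2) t * \<eta>)))"
    using li[of "- 1/2"] by (simp add: q_def h_def)
  obtain C where C: "C \<ge> 0" "\<forall>s \<eta>'. - 1/2 \<le> Re s \<and> Re s \<le> 1/2 \<and> \<bar>Im \<eta>'\<bar> \<le> \<bar>Im \<eta>\<bar> \<longrightarrow>
     cmod (h s * exp (- (s * \<eta>'))) \<le> C * exp (- (Re s * Re \<eta>')) * exp (- ((pi / 2 - \<bar>Im \<eta>\<bar>) / 2) * \<bar>Im s\<bar>)"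
    using vdecay_bound[OF hd e] by auto
  have "2 * of_real pi * \<i> = \<i> * ((\<integral>t. q (Complex (1/2) t) \<partial>lborel) - (\<integral>t. q (Complex (- 1/2) t) \<partial>lborel))"
  proof (rule rectangle_limit)
    show "continuous_on {s. - 1/2 \<le> Re s \<and> Re s \<le> 1/2 \<and> (Re s = - 1/2 \<or> Re s = 1/2 \<or> \<bar>Im s\<bar> \<ge> 1)} q"
      unfolding q_def using hd by (intro continuous_intros) (auto simp: vdecay_def elim: continuous_on_subset)
    show "cmod (q s) \<le> (C * exp \<bar>Re \<eta>\<bar>) * exp (- ((pi / 2 - \<bar>Im \<eta>\<bar>) / 2) * \<bar>Im s\<bar>)"
      if s: "- 1/2 \<le> Re s" "Re s \<le> 1/2" "\<bar>Im s\<bar> \<ge> 1" for s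
    proof -
      have s1: "1 \<le> cmod s" using s(3) abs_Im_le_cmod[of s] by linarith
      have "\<bar>Re s * Re \<eta>\<bar> \<le> 1 * \<bar>Re \<eta>\<bar>" unfolding abs_mult using s by (intro mult_right_mono) auto
      hence "- (Re s * Re \<eta>) \<le> \<bar>Re \<eta>\<bar>" by linarith
      hence "C * exp (- (Re s * Re \<eta>)) * exp (- ((pi / 2 - \<bar>Im \<eta>\<bar>) / 2) * \<bar>Im s\<bar>) \<le> (C * exp \<bar>Re \<eta>\<bar>) * exp (- ((pi / 2 - \<bar>Im \<eta>\<bar>) / 2) * \<bar>Im s\<bar>)"
        using C(1) by (intro mult_right_mono mult_left_mono) auto
      moreover have "cmod (h s * exp (- (s * \<eta>))) \<le> C * exp (- (Re s * Re \<eta>)) * exp (- ((pi / 2 - \<bar>Im \<eta>\<bar>) / 2) * \<bar>Im s\<bar>)"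
        using C(2)[rule_format, of s \<eta>] s by blast
      moreover have "cmod (q s) \<le> cmod (h s * exp (- (s * \<eta>)))"
      proof -
        have "cmod (q s) = cmod (h s * exp (- (s * \<eta>))) / cmod s" by (simp add: q_def norm_mult norm_divide)
        also have "\<dots> \<le> cmod (h s * exp (- (s * \<eta>))) / 1" using s1 by (intro divide_left_mono) auto
        finally show ?thesis by simp
      qed
      ultimately show ?thesis by linarith
    qed
    show "(pi / 2 - \<bar>Im \<eta>\<bar>) / 2 > 0" using e by simp
    show "(q has_contour_integral 2 * of_real pi * \<i>) (rectpath (Complex (- 1/2) (- T)) (Complex (1/2) T))" if T: "T \<ge> 1" for T
    proof -
      let ?\<gamma> = "rectpath (Complex (- 1/2) (- T)) (Complex (1/2) T)" and ?S = "{s. - 1 < Re s}"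
      have "((\<lambda>w. (h w * exp (- (w * \<eta>))) / (w - 0)) has_contour_integral complex_of_real (2 * pi) * \<i> * winding_number ?\<gamma> 0 * (h 0 * exp (- (0 * \<eta>)))) ?\<gamma>"
      proof (rule Cauchy_integral_formula_convex_simple[of ?S])
        show "convex ?S" by (rule convex_halfspace_Re_gt)
        show "(\<lambda>w. h w * exp (- (w * \<eta>))) holomorphic_on ?S" by (intro holomorphic_intros hh)
        show "0 \<in> interior ?S" by (subst interior_open) (auto simp: open_halfspace_Re_gt)
        show "path_image ?\<gamma> \<subseteq> ?S - {0}"
          using T by (subst path_image_rectpath_cbox_minus_box) (auto simp: in_cbox_complex_iff in_box_complex_iff)
      qed auto
      moreover have "winding_number ?\<gamma> 0 = 1" using T by (intro winding_number_rectpath) (auto simp: in_box_complex_iff)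
      moreover have "h 0 = 1" by (simp add: h_def)
      ultimately show ?thesis by (simp add: q_def[abs_def])
    qed
  qed (use li in auto)
  hence "\<i> * (\<integral>t. q (Complex (1/2) t) \<partial>lborel) = \<i> * (2 * of_real pi + (\<integral>t. q (Complex (- 1/2) t) \<partial>lborel))"
    by (simp add: algebra_simps)
  hence "(\<integral>t. q (Complex (1/2) t) \<partial>lborel) = 2 * of_real pi + (\<integral>t. q (Complex (- 1/2) t) \<partial>lborel)"
    by (simp only: mult_cancel_left) simp
  moreover have "vline (1/2) Gamma \<eta> = vline (1/2) (\<lambda>s. Gamma (s + 1) / s) \<eta>"
    by (rule vline_cong) (subst Gamma_plus1_right; simp add: Complex_eq_0)
  ultimately show "vline (1/2) Gamma \<eta> = 1 + vline (- 1/2) (\<lambda>s. Gamma (s + 1) / s) \<eta>"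
    by (simp add: vline_def q_def h_def add_divide_distrib)
qed

lemma vline_Gamma_shift_line:
  assumes "0 < a" "0 < b" "\<bar>Im \<eta>\<bar> < pi / 2"
  shows "vline a Gamma \<eta> = vline b Gamma \<eta>"
proof -
  have S: "vline a Gamma \<eta> = vline b Gamma \<eta>" if ab: "0 < a" "a < b" for a b
  proof (rule vline_contour_shift[OF _ ab(2) Gamma_holomorphic_right open_halfspace_Re_gt convex_halfspace_Re_gt _ assms(3)])
    show "vdecay a b (pi / 2) Gamma" using ab by (intro vdecay_Gamma) auto
    show "{s. a \<le> Re s \<and> Re s \<le> b} \<subseteq> {s. 0 < Re s}" using ab by auto
  qed
  consider "a < b" | "b < a" | "a = b" by linarith
  thus ?thesis
  proof cases
    assume "a < b"
    from S[OF assms(1) this] show ?thesis .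
  next
    assume "b < a"
    from S[OF assms(2) this] show ?thesis by (rule sym)
  next
    assume "a = b"
    thus ?thesis by (rule arg_cong[of a b "\<lambda>a. vline a Gamma \<eta>"])
  qed
qed

text \<open>The functional equation gives f' = -e^eta f, hence f is a multiple of exp(-e^eta). The
  multiple is read off as eta tends to minus infinity, where the line Re s = -1/2 contributes
  O(e^(eta/2)) beside the residue 1.\<close>

lemma Cahen_Mellin:
  assumes e: "\<bar>Im \<eta>\<bar> < pi / 2" and c: "c > 0"
  shows "vline c Gamma \<eta> = exp (- exp \<eta>)"
proof -
  note shift = vline_Gamma_shift_line
  define U where "U = {\<eta>::complex. \<bar>Im \<eta>\<bar> < pi / 2}"
  define f where "f = vline 1 Gamma"
  have df: "(f has_field_derivative - exp \<eta> * f \<eta>) (at \<eta>)" if "\<eta> \<in> U" for \<eta>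
  proof -
    have e: "\<bar>Im \<eta>\<bar> < pi / 2" using that by (simp add: U_def)
    have D: "(f has_field_derivative vline 1 (\<lambda>s. - s * Gamma s) \<eta>) (at \<eta>)"
      unfolding f_def by (rule vline_facts(2)[OF vdecay_Gamma[of 1 1] _ _ e]) auto
    have "vline 1 (\<lambda>s. - s * Gamma s) \<eta> = vline 1 (\<lambda>s. - Gamma (s + 1)) \<eta>"
      by (rule vline_cong) (subst Gamma_plus1_right; simp add: Complex_eq_0)
    also have "\<dots> = - vline 1 (\<lambda>s. Gamma (s + 1)) \<eta>" by (simp add: vline_def)
    also have "\<dots> = - exp \<eta> * f \<eta>" unfolding vline_translate f_def using shift[of 2 1 \<eta>] e by simp
    finally show ?thesis using D by (simp only:)
  qed
  have "\<exists>K. \<forall>\<eta>\<in>U. f \<eta> * exp (exp \<eta>) = K"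
  proof (rule has_field_derivative_zero_constant)
    show "convex U" unfolding U_def by (rule convex_hstrip)
    fix \<eta> assume "\<eta> \<in> U"
    have E: "((\<lambda>\<eta>. exp (exp \<eta>)) has_field_derivative exp (exp \<eta>) * exp \<eta>) (at \<eta>)"
      by (auto intro!: derivative_eq_intros)
    have "- exp \<eta> * f \<eta> * exp (exp \<eta>) + exp (exp \<eta>) * exp \<eta> * f \<eta> = 0" by simp
    with DERIV_mult[OF df[OF \<open>\<eta> \<in> U\<close>] E] show "((\<lambda>\<eta>. f \<eta> * exp (exp \<eta>)) has_field_derivative 0) (at \<eta> within U)"
      by (metis has_field_derivative_at_within)
  qed
  then obtain K where "\<forall>\<eta>\<in>U. f \<eta> * exp (exp \<eta>) = K" by (elim exE)
  hence K: "f \<eta> * exp (exp \<eta>) = K" if "\<eta> \<in> U" for \<eta> using that by (rule bspec)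
  define k where "k = (\<lambda>s. Gamma (s + 1) / s :: complex)"
  define I where "I = (\<integral>t. cmod (k (Complex (- 1/2) t)) \<partial>lborel) / (2 * pi)"
  have small: "cmod (vline (- 1/2) k (of_real x)) \<le> I * exp (x / 2)" for x :: real
  proof -
    have "cmod (\<integral>t. k (Complex (- 1/2) t) * exp (- (Complex (- 1/2) t * of_real x)) \<partial>lborel) \<le>
       (\<integral>t. cmod (k (Complex (- 1/2) t) * exp (- (Complex (- 1/2) t * of_real x))) \<partial>lborel)"
      by (rule integral_norm_bound)
    also have "\<dots> = (\<integral>t. exp (x / 2) * cmod (k (Complex (- 1/2) t)) \<partial>lborel)"
      by (intro Bochner_Integration.integral_cong refl) (simp add: norm_mult)
    also have "\<dots> = I * exp (x / 2) * (2 * pi)" by (simp add: I_def)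
    finally show ?thesis by (simp add: vline_def norm_divide norm_mult divide_le_eq)
  qed
  have "((\<lambda>x. f (of_real x)) \<longlongrightarrow> 1) at_bot"
  proof -
    have "((\<lambda>x. f (of_real x) - 1) \<longlongrightarrow> 0) at_bot"
    proof (rule Lim_null_comparison)
      show "\<forall>\<^sub>F x in at_bot. norm (f (of_real x) - 1) \<le> I * exp (x / 2)"
      proof (rule always_eventually, rule allI)
        fix x :: real
        have "f (of_real x) = 1 + vline (- 1/2) k (of_real x)"
          unfolding f_def k_def using shift[of 1 "1/2" "of_real x"] Cahen_Mellin_residue(2)[of "of_real x"] by simp
        thus "norm (f (of_real x) - 1) \<le> I * exp (x / 2)" using small[of x] by simp
      qed
      show "((\<lambda>x. I * exp (x / 2)) \<longlongrightarrow> 0) at_bot" by real_asymp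
    qed
    from tendsto_add[OF this tendsto_const[of 1]] show ?thesis by simp
  qed
  moreover have "((\<lambda>x. complex_of_real (exp (exp x))) \<longlongrightarrow> of_real 1) at_bot"
    by (intro tendsto_of_real) real_asymp
  ultimately have "((\<lambda>x. f (of_real x) * of_real (exp (exp x))) \<longlongrightarrow> 1 * of_real 1) at_bot"
    by (intro tendsto_mult)
  moreover have "f (of_real x) * of_real (exp (exp x)) = K" for x
    using K[of "of_real x"] by (simp add: U_def exp_of_real)
  ultimately have "K = 1" by (simp add: tendsto_const_iff)
  thus ?thesis using K[of \<eta>] e shift[of c 1 \<eta>] c by (simp add: U_def f_def exp_minus field_simps)
qed

lemma vline_Gamma_shift:
  assumes e: "\<bar>Im \<eta>\<bar> < pi / 2" and c: "c > Re l"
  shows "vline c (\<lambda>s. Gamma (s - l)) \<eta> = exp (- exp \<eta> - l * \<eta>)"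
proof -
  have C: "Complex c (Im l + 1 * t) = l + Complex (c - Re l) t" for t by (simp add: complex_eq_iff)
  have "vline c (\<lambda>s. Gamma (s - l)) \<eta> = (\<integral>t. Gamma (Complex c (Im l + 1 * t) - l) * exp (- (Complex c (Im l + 1 * t) * \<eta>)) \<partial>lborel) / (2 * of_real pi)"
    unfolding vline_def by (subst lborel_integral_real_affine[of 1 _ "Im l"]) auto
  also have "\<dots> = (\<integral>t. exp (- (l * \<eta>)) * (Gamma (Complex (c - Re l) t) * exp (- (Complex (c - Re l) t * \<eta>))) \<partial>lborel) / (2 * of_real pi)"
    unfolding C by (intro arg_cong2[of _ _ _ _ "(/)"] Bochner_Integration.integral_cong refl) (simp add: algebra_simps exp_add exp_diff exp_minus divide_inverse)
  also have "\<dots> = exp (- (l * \<eta>)) * vline (c - Re l) Gamma \<eta>" by (simp add: vline_def)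
  also have "vline (c - Re l) Gamma \<eta> = exp (- exp \<eta>)" using e c by (intro Cahen_Mellin) auto
  finally show ?thesis by (simp add: algebra_simps flip: exp_add)
qed

text \<open>The last Gamma factor times e^(-s omega) is replaced by its integral over b from
  \<open>Gamma_strip_integral\<close>, and Fubini exchanges the integrals. On the line |e^(sb)| is
  independent of Im s, so the b-integral of the moduli is a constant J.\<close>

lemma vline_Gamma_prod_convolution:
  assumes lam: "\<And>l. l \<in> {1..Suc m} \<Longrightarrow> Re (lam l) < c"
    and e: "\<bar>Im \<eta>\<bar> < real m * pi / 2" and w: "\<bar>Im \<omega>\<bar> < pi / 2"
  shows "vline c (Gamma_prod (Suc m) lam) (\<eta> + \<omega>) =
    (\<integral>b. vline c (Gamma_prod m lam) (\<eta> - of_real b) * exp (- exp (\<omega> + of_real b) - lam (Suc m) * (\<omega> + of_real b)) \<partial>lborel)"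
proof -
  let ?l = "lam (Suc m)"
  define g where "g = (\<lambda>b::real. exp (- exp (\<omega> + of_real b) - ?l * (\<omega> + of_real b)))"
  define P where "P = (\<lambda>t. Gamma_prod m lam (Complex c t) * exp (- (Complex c t * \<eta>)))"
  define F where "F = (\<lambda>t (b::real). P t * (exp (Complex c t * of_real b) * g b))"
  have vd: "vdecay c c (real m * pi / 2) (Gamma_prod m lam)" using lam by (intro vdecay_Gamma_prod) auto
  have Pi: "integrable lborel P" unfolding P_def by (rule vline_facts(1)[OF vd _ _ e]) auto
  have Re: "Re (Complex c t - ?l) > 0" for t using lam[of "Suc m"] by simp
  have split: "exp (Complex c t * of_real b) * g b = exp (- (?l * \<omega>)) * exp ((Complex c t - ?l) * of_real b - exp (\<omega> + of_real b))" for t b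
    unfolding g_def by (simp add: algebra_simps flip: exp_add)
  have gi: "integrable lborel (\<lambda>b. exp (Complex c t * of_real b) * g b)" for t
    unfolding split by (intro integrable_mult_right Gamma_strip_integral(1) Re w)
  have gv: "(\<integral>b. exp (Complex c t * of_real b) * g b \<partial>lborel) = Gamma (Complex c t - ?l) * exp (- (Complex c t * \<omega>))" for t
  proof -
    have "(\<integral>b. exp (Complex c t * of_real b) * g b \<partial>lborel) = exp (- (?l * \<omega>)) * (Gamma (Complex c t - ?l) * exp (- ((Complex c t - ?l) * \<omega>)))"
      unfolding split using Gamma_strip_integral(2)[OF Re w, of t] by simp
    thus ?thesis by (simp add: algebra_simps exp_add exp_diff exp_minus divide_inverse)
  qed
  have norm_exp: "cmod (exp (Complex c t * of_real b) * g b) = cmod (exp (Complex c 0 * of_real b) * g b)" for t b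
    by (simp add: norm_mult)
  define J where "J = (\<integral>b. cmod (exp (Complex c 0 * of_real b) * g b) \<partial>lborel)"
  have Pm [measurable]: "P \<in> borel_measurable borel" using borel_measurable_integrable[OF Pi] by simp
  have gm [measurable]: "g \<in> borel_measurable borel" unfolding g_def by measurable
  have "integrable (lborel \<Otimes>\<^sub>M lborel) (case_prod F)"
  proof (rule lborel_pair.Fubini_integrable)
    have "case_prod F \<in> borel_measurable (borel \<Otimes>\<^sub>M borel)"
      unfolding F_def case_prod_beta'
    proof (intro borel_measurable_times)
      show "(\<lambda>p. P (fst p)) \<in> borel_measurable (borel \<Otimes>\<^sub>M borel)" by (rule measurable_compose[OF measurable_fst Pm])
      show "(\<lambda>p. g (snd p)) \<in> borel_measurable (borel \<Otimes>\<^sub>M borel)" by (rule measurable_compose[OF measurable_snd gm])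
      show "(\<lambda>p. exp (Complex c (fst p) * of_real (snd p))) \<in> borel_measurable (borel \<Otimes>\<^sub>M borel)"
        unfolding borel_prod Complex_eq by (intro borel_measurable_continuous_onI continuous_intros)
    qed
    thus "case_prod F \<in> borel_measurable (lborel \<Otimes>\<^sub>M lborel)"
      by (subst measurable_cong_sets[OF sets_pair_measure_cong[OF sets_lborel sets_lborel] refl])
    have "(\<lambda>t. \<integral>b. norm (case_prod F (t, b)) \<partial>lborel) = (\<lambda>t. norm (P t) * J)"
    proof
      fix t
      have "norm (case_prod F (t, b)) = norm (P t) * cmod (exp (Complex c 0 * of_real b) * g b)" for b
        unfolding F_def case_prod_conv norm_mult[of "P t"] norm_exp[of t] ..
      thus "(\<integral>b. norm (case_prod F (t, b)) \<partial>lborel) = norm (P t) * J" unfolding J_def by simp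
    qed
    thus "integrable lborel (\<lambda>t. \<integral>b. norm (case_prod F (t, b)) \<partial>lborel)" using Pi by simp
    show "AE t in lborel. integrable lborel (\<lambda>b. case_prod F (t, b))"
      unfolding F_def using gi by simp
  qed
  from lborel_pair.Fubini_integral[OF this]
  have sw: "(\<integral>b. (\<integral>t. F t b \<partial>lborel) \<partial>lborel) = (\<integral>t. (\<integral>b. F t b \<partial>lborel) \<partial>lborel)" .
  have L: "(\<integral>t. F t b \<partial>lborel) = 2 * of_real pi * (vline c (Gamma_prod m lam) (\<eta> - of_real b) * g b)" for b
  proof -
    have "F t b = (Gamma_prod m lam (Complex c t) * exp (- (Complex c t * (\<eta> - of_real b)))) * g b" for t
      unfolding F_def P_def by (simp add: algebra_simps exp_add exp_diff exp_minus divide_inverse)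
    hence "(\<integral>t. F t b \<partial>lborel) = (\<integral>t. (Gamma_prod m lam (Complex c t) * exp (- (Complex c t * (\<eta> - of_real b)))) * g b \<partial>lborel)" by simp
    thus ?thesis by (simp add: vline_def)
  qed
  have R: "(\<integral>b. F t b \<partial>lborel) = Gamma_prod (Suc m) lam (Complex c t) * exp (- (Complex c t * (\<eta> + \<omega>)))" for t
    unfolding F_def integral_mult_right_zero gv
    by (simp add: P_def Gamma_prod_def algebra_simps exp_add exp_diff exp_minus divide_inverse)
  show ?thesis using sw unfolding L R by (simp add: vline_def g_def)
qed

section \<open>The saddle point\<close>

text \<open>A function that is not integrable has integral 0 by convention, so the bound holds in
  that case too.\<close>

lemma integral_norm_le:
  fixes f :: "real \<Rightarrow> complex"
  assumes "integrable M g" "\<And>x. cmod (f x) \<le> g x"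
  shows "cmod (\<integral>x. f x \<partial>M) \<le> (\<integral>x. g x \<partial>M)"
proof (cases "integrable M f")
  case True
  show ?thesis by (rule Bochner_Integration.integral_norm_bound_integral[OF True assms(1)]) (rule assms(2))
next
  case False
  have "0 \<le> (\<integral>x. g x \<partial>M)"
    by (intro Bochner_Integration.integral_nonneg) (auto intro: order_trans[OF norm_ge_zero assms(2)])
  thus ?thesis using False by (simp add: not_integrable_integral_eq)
qed

text \<open>On the negative side e^b - 1 - b grows only linearly, which the denominator 2 + |b|
  allows for.\<close>

lemma exp_remainder_lower:
  fixes b :: real
  shows "b\<^sup>2 / (2 + \<bar>b\<bar>) \<le> exp b - 1 - b"
proof (cases "b \<ge> 0")
  case True
  have "b\<^sup>2 / (2 + \<bar>b\<bar>) \<le> b\<^sup>2 / 2" by (intro divide_left_mono) auto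
  also have "\<dots> \<le> exp b - 1 - b" using exp_lower_Taylor_quadratic[OF True] by simp
  finally show ?thesis .
next
  case False
  define f where "f = (\<lambda>t::real. (2 + t) * exp (- t) + t)"
  have "f 0 \<le> f (- b)"
  proof (rule DERIV_nonneg_imp_nondecreasing[of 0 "- b" f])
    fix t :: real assume t: "0 \<le> t"
    have "(f has_real_derivative 1 - (1 + t) * exp (- t)) (at t)"
      unfolding f_def by (auto intro!: derivative_eq_intros simp: algebra_simps)
    moreover have "(1 + t) * exp (- t) \<le> 1"
      using exp_ge_add_one_self[of t] by (simp add: exp_minus field_simps)
    ultimately show "\<exists>y. (f has_real_derivative y) (at t) \<and> 0 \<le> y" by (intro exI conjI) auto
  qed (use False in auto)
  hence "2 \<le> (2 - b) * exp b - b" by (simp add: f_def)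
  hence "b\<^sup>2 \<le> (exp b - 1 - b) * (2 - b)" by (simp add: algebra_simps power2_eq_square)
  thus ?thesis using False by (simp add: divide_le_eq)
qed

text \<open>With X = v|b| the previous bound gives at least X^2/(2 + X), and (X - 2)(X + 2) <= X^2.
  Decay in v|b| uniform over v >= 1 is what domination after b = x/v requires.\<close>

lemma exp_remainder_scaled:
  fixes b v :: real
  assumes v: "v \<ge> 1"
  shows "v * \<bar>b\<bar> - 2 \<le> v\<^sup>2 * (exp b - 1 - b)"
proof -
  have bv: "\<bar>b\<bar> \<le> v * \<bar>b\<bar>" using mult_right_mono[OF v, of "\<bar>b\<bar>"] by simp
  have "(v * \<bar>b\<bar> - 2) * (2 + v * \<bar>b\<bar>) \<le> (v * b)\<^sup>2" by (simp add: algebra_simps power2_eq_square)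
  hence "v * \<bar>b\<bar> - 2 \<le> (v * b)\<^sup>2 / (2 + v * \<bar>b\<bar>)" using v by (subst pos_le_divide_eq) (auto intro: add_pos_nonneg)
  also have "\<dots> \<le> (v * b)\<^sup>2 / (2 + \<bar>b\<bar>)" using bv v by (intro divide_left_mono mult_pos_pos) (auto intro: add_pos_nonneg)
  also have "\<dots> = v\<^sup>2 * (b\<^sup>2 / (2 + \<bar>b\<bar>))" by (simp add: power_mult_distrib)
  also have "\<dots> \<le> v\<^sup>2 * (exp b - 1 - b)" by (intro mult_left_mono exp_remainder_lower) auto
  finally show ?thesis .
qed

text \<open>The factor exp(-exp(omega + b) - l(omega + b)) divided by its value at b = 0 and by the
  linear part exp(-b e^omega) of its phase.\<close>

definition saddle_kernel :: "complex \<Rightarrow> complex \<Rightarrow> real \<Rightarrow> complex" where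
  "saddle_kernel l \<omega> b = exp (- exp \<omega> * of_real (exp b - 1 - b) - l * of_real b)"

lemma saddle_kernel_bound:
  assumes "Re (exp \<omega>) = v\<^sup>2" "v \<ge> 1" "\<bar>Re l\<bar> \<le> v / 2"
  shows "cmod (saddle_kernel l \<omega> b) \<le> exp 2 * exp (- (v / 2) * \<bar>b\<bar>)"
proof -
  have "\<bar>Re l * b\<bar> \<le> v / 2 * \<bar>b\<bar>" unfolding abs_mult using assms(3) by (intro mult_right_mono) auto
  hence "- (v\<^sup>2 * (exp b - 1 - b)) - Re l * b \<le> 2 + - (v / 2) * \<bar>b\<bar>"
    using exp_remainder_scaled[OF assms(2), of b] by linarith
  moreover have "cmod (saddle_kernel l \<omega> b) = exp (- (v\<^sup>2 * (exp b - 1 - b)) - Re l * b)"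
    unfolding saddle_kernel_def norm_exp_eq_Re assms(1)[symmetric] by simp
  ultimately show ?thesis unfolding exp_add[symmetric] by simp
qed

text \<open>The m-fold convolution in the normalisation of \<open>saddle_kernel\<close>. The
  exponents removed are additive in m and a, so profiles convolve with kernels without further
  factors.\<close>

definition saddle_profile :: "real \<Rightarrow> (nat \<Rightarrow> complex) \<Rightarrow> nat \<Rightarrow> complex \<Rightarrow> real \<Rightarrow> complex" where
  "saddle_profile c lam m \<omega> a = vline c (Gamma_prod m lam) (of_nat m * \<omega> + of_real a)
     * exp (exp \<omega> * (of_nat m + of_real a) + (\<Sum>l=1..m. lam l) * \<omega>)"

lemma saddle_profile_1:
  assumes "\<bar>Im \<omega>\<bar> < pi / 2" "Re (lam 1) < c"
  shows "saddle_profile c lam 1 \<omega> a = saddle_kernel (lam 1) \<omega> a"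
proof -
  have "vline c (Gamma_prod 1 lam) (\<omega> + of_real a) = exp (- exp (\<omega> + of_real a) - lam 1 * (\<omega> + of_real a))"
    using vline_Gamma_shift[of "\<omega> + of_real a" "lam 1" c] assms by (simp add: Gamma_prod_def[abs_def])
  thus ?thesis
    unfolding saddle_profile_def saddle_kernel_def
    by (simp add: algebra_simps exp_add flip: exp_of_real) (simp add: algebra_simps flip: exp_add)
qed

lemma saddle_profile_Suc:
  assumes w: "\<bar>Im \<omega>\<bar> < pi / 2" and lam: "\<And>l. l \<in> {1..Suc m} \<Longrightarrow> Re (lam l) < c" and m: "m \<ge> 1"
  shows "saddle_profile c lam (Suc m) \<omega> a = (\<integral>b. saddle_profile c lam m \<omega> (a - b) * saddle_kernel (lam (Suc m)) \<omega> b \<partial>lborel)"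
proof -
  have e: "\<bar>Im (of_nat m * \<omega> + of_real a)\<bar> < real m * pi / 2"
    using mult_strict_left_mono[OF w, of "real m"] m by (simp add: abs_mult)
  define E where "E = exp (exp \<omega> * (of_nat (Suc m) + of_real a) + (\<Sum>l=1..Suc m. lam l) * \<omega>)"
  have eq: "E * (vline c (Gamma_prod m lam) (of_nat m * \<omega> + of_real a - of_real b) *
       exp (- exp (\<omega> + of_real b) - lam (Suc m) * (\<omega> + of_real b))) =
     saddle_profile c lam m \<omega> (a - b) * saddle_kernel (lam (Suc m)) \<omega> b" for b
  proof -
    have s: "(\<Sum>l=1..Suc m. lam l) = (\<Sum>l=1..m. lam l) + lam (Suc m)" by simp
    have "(exp \<omega> * (of_nat (Suc m) + of_real a) + (\<Sum>l=1..Suc m. lam l) * \<omega>) + (- exp (\<omega> + of_real b) - lam (Suc m) * (\<omega> + of_real b)) =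
      (exp \<omega> * (of_nat m + of_real (a - b)) + (\<Sum>l=1..m. lam l) * \<omega>) + (- exp \<omega> * of_real (exp b - 1 - b) - lam (Suc m) * of_real b)"
      unfolding s by (simp add: algebra_simps exp_add flip: exp_of_real)
    hence "E * exp (- exp (\<omega> + of_real b) - lam (Suc m) * (\<omega> + of_real b)) =
      exp (exp \<omega> * (of_nat m + of_real (a - b)) + (\<Sum>l=1..m. lam l) * \<omega>) * saddle_kernel (lam (Suc m)) \<omega> b"
      unfolding E_def saddle_kernel_def exp_add[symmetric] by (rule arg_cong)
    hence "vline c (Gamma_prod m lam) (of_nat m * \<omega> + of_real (a - b)) * (E * exp (- exp (\<omega> + of_real b) - lam (Suc m) * (\<omega> + of_real b))) =
      vline c (Gamma_prod m lam) (of_nat m * \<omega> + of_real (a - b)) *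
      (exp (exp \<omega> * (of_nat m + of_real (a - b)) + (\<Sum>l=1..m. lam l) * \<omega>) * saddle_kernel (lam (Suc m)) \<omega> b)"
      by (rule arg_cong)
    moreover have "of_nat m * \<omega> + of_real a - of_real b = of_nat m * \<omega> + of_real (a - b)" by simp
    ultimately show ?thesis unfolding saddle_profile_def by (simp only: mult.assoc mult.left_commute[of E])
  qed
  have "of_nat (Suc m) * \<omega> + of_real a = (of_nat m * \<omega> + of_real a) + \<omega>" by (simp add: algebra_simps)
  hence "saddle_profile c lam (Suc m) \<omega> a = vline c (Gamma_prod (Suc m) lam) ((of_nat m * \<omega> + of_real a) + \<omega>) * E"
    unfolding saddle_profile_def E_def by (simp only:)
  also have "\<dots> = E * (\<integral>b. vline c (Gamma_prod m lam) (of_nat m * \<omega> + of_real a - of_real b) *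
       exp (- exp (\<omega> + of_real b) - lam (Suc m) * (\<omega> + of_real b)) \<partial>lborel)"
    using vline_Gamma_prod_convolution[OF lam e w] by simp
  also have "\<dots> = (\<integral>b. E * (vline c (Gamma_prod m lam) (of_nat m * \<omega> + of_real a - of_real b) *
       exp (- exp (\<omega> + of_real b) - lam (Suc m) * (\<omega> + of_real b))) \<partial>lborel)"
    by (rule integral_mult_right_zero[symmetric])
  finally show ?thesis unfolding eq .
qed

lemma saddle_profile_continuous:
  assumes w: "\<bar>Im \<omega>\<bar> < pi / 2" and lam: "\<And>l. l \<in> {1..m} \<Longrightarrow> Re (lam l) < c" and m: "m \<ge> 1"
  shows "continuous_on UNIV (saddle_profile c lam m \<omega>)"
proof -
  have vd: "vdecay c c (real m * pi / 2) (Gamma_prod m lam)" using lam by (intro vdecay_Gamma_prod) auto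
  have "isCont (\<lambda>a. vline c (Gamma_prod m lam) (of_nat m * \<omega> + of_real a)) x" for x
  proof (rule isCont_o2[where g = "vline c (Gamma_prod m lam)"])
    have "\<bar>Im (of_nat m * \<omega> + of_real x)\<bar> < real m * pi / 2"
      using mult_strict_left_mono[OF w, of "real m"] m by (simp add: abs_mult)
    from vline_facts(2)[OF vd _ _ this]
    show "isCont (vline c (Gamma_prod m lam)) (of_nat m * \<omega> + of_real x)" by (auto intro: DERIV_isCont)
  qed (intro continuous_intros)
  hence "continuous_on UNIV (\<lambda>a. vline c (Gamma_prod m lam) (of_nat m * \<omega> + of_real a))"
    by (simp add: continuous_on_eq_continuous_at)
  thus ?thesis unfolding saddle_profile_def[abs_def] by (intro continuous_intros)
qed

abbreviation "laplace_mass \<equiv> (\<integral>t. exp (- (1/2) * \<bar>t::real\<bar>) \<partial>lborel)"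

lemma laplace_mass_scaled:
  assumes "v > 0"
  shows "(\<integral>b. exp (- (v / 2) * \<bar>b::real\<bar>) \<partial>lborel) = laplace_mass / v"
  using lborel_integral_real_affine[of v "\<lambda>t. exp (- (1/2) * \<bar>t::real\<bar>)" 0] assms by (simp add: abs_mult)

text \<open>A sup bound for the first kernel; every further convolution then multiplies by the mass
  of the bound on the kernel, of order 1/v. As v^2 is comparable to |z|, this is the factor
  |z|^(-(n-1)/2) of the expansion.\<close>

lemma saddle_profile_bound:
  assumes w: "\<bar>Im \<omega>\<bar> < pi / 2" and v: "Re (exp \<omega>) = v\<^sup>2" "v \<ge> 1"
    and lam: "\<And>l. l \<in> {1..Suc m} \<Longrightarrow> Re (lam l) < c \<and> \<bar>Re (lam l)\<bar> \<le> v / 2"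
  shows "cmod (saddle_profile c lam (Suc m) \<omega> a) \<le> exp 2 * (exp 2 * laplace_mass / v) ^ m"
  using lam
proof (induction m arbitrary: a)
  case 0
  have "cmod (saddle_kernel (lam 1) \<omega> a) \<le> exp 2 * exp (- (v / 2) * \<bar>a\<bar>)"
    using 0[of 1] by (intro saddle_kernel_bound v) auto
  also have "\<dots> \<le> exp 2 * 1" using v(2) by (intro mult_left_mono) auto
  finally have "cmod (saddle_profile c lam 1 \<omega> a) \<le> exp 2 * 1"
    using saddle_profile_1[OF w, of lam c a] 0[of 1] by simp
  thus ?case by simp
next
  case (Suc m)
  define S where "S = exp 2 * (exp 2 * laplace_mass / v) ^ m"
  have IH: "cmod (saddle_profile c lam (Suc m) \<omega> a) \<le> S" for a
    unfolding S_def using Suc.prems by (intro Suc.IH) auto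
  have S0: "0 \<le> S" using order_trans[OF norm_ge_zero IH[of 0]] .
  have "saddle_profile c lam (Suc (Suc m)) \<omega> a = (\<integral>b. saddle_profile c lam (Suc m) \<omega> (a - b) * saddle_kernel (lam (Suc (Suc m))) \<omega> b \<partial>lborel)"
    using Suc.prems by (intro saddle_profile_Suc w) auto
  also have "cmod \<dots> \<le> (\<integral>b. S * (exp 2 * exp (- (v / 2) * \<bar>b\<bar>)) \<partial>lborel)"
  proof (rule integral_norm_le)
    show "integrable lborel (\<lambda>b. S * (exp 2 * exp (- (v / 2) * \<bar>b\<bar>)))"
      using v(2) by (intro integrable_mult_right integrable_exp_abs) auto
    show "cmod (saddle_profile c lam (Suc m) \<omega> (a - b) * saddle_kernel (lam (Suc (Suc m))) \<omega> b) \<le> S * (exp 2 * exp (- (v / 2) * \<bar>b\<bar>))" for b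
      unfolding norm_mult using Suc.prems[of "Suc (Suc m)"] by (intro mult_mono IH saddle_kernel_bound v S0) auto
  qed
  also have "\<dots> = S * (exp 2 * (\<integral>b. exp (- (v / 2) * \<bar>b\<bar>) \<partial>lborel))" by (simp only: integral_mult_right_zero)
  also have "\<dots> = exp 2 * (exp 2 * laplace_mass / v) ^ Suc m"
    using v(2) laplace_mass_scaled[of v] by (simp add: S_def)
  finally show ?case .
qed

lemma exp_remainder_scaled_limit:
  fixes x :: real
  shows "((\<lambda>v. v\<^sup>2 * (exp (x / v) - 1 - x / v)) \<longlongrightarrow> x\<^sup>2 / 2) at_top"
proof (cases x "0::real" rule: linorder_cases)
  case less
  hence "((\<lambda>v. v\<^sup>2 * (exp (x / v) - 1 - x / v)) \<longlongrightarrow> x * x / 2) at_top" by real_asymp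
  thus ?thesis by (simp only: power2_eq_square)
next
  case greater
  hence "((\<lambda>v. v\<^sup>2 * (exp (x / v) - 1 - x / v)) \<longlongrightarrow> x * x / 2) at_top" by real_asymp
  thus ?thesis by (simp only: power2_eq_square)
qed simp

text \<open>The choice omega = 2 ln v makes e^omega = v^2, so the rescaled exponent tends to -x^2/2
  and the factor with l to 1.\<close>

lemma saddle_kernel_limit:
  "((\<lambda>v. saddle_kernel l (of_real (2 * ln v)) (x / v)) \<longlongrightarrow> of_real (sqrt (2 * pi) * normal_density 0 1 x)) at_top"
proof -
  have lim: "((\<lambda>v. exp (- of_real (v\<^sup>2 * (exp (x / v) - 1 - x / v)) - l * of_real (x / v))) \<longlongrightarrow> exp (- of_real (x\<^sup>2 / 2) - l * of_real 0)) at_top"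
  proof (intro tendsto_exp tendsto_diff tendsto_minus tendsto_of_real tendsto_mult tendsto_const)
    show "((\<lambda>v. v\<^sup>2 * (exp (x / v) - 1 - x / v)) \<longlongrightarrow> x\<^sup>2 / 2) at_top" by (rule exp_remainder_scaled_limit)
    show "((\<lambda>v. x / v) \<longlongrightarrow> 0) at_top" by real_asymp
  qed
  have val: "exp (- of_real (x\<^sup>2 / 2) - l * of_real 0) = complex_of_real (sqrt (2 * pi) * normal_density 0 1 x)"
    by (simp add: normal_density_def exp_of_real[symmetric])
  have ev: "\<forall>\<^sub>F v in at_top. exp (- of_real (v\<^sup>2 * (exp (x / v) - 1 - x / v)) - l * of_real (x / v)) = saddle_kernel l (of_real (2 * ln v)) (x / v)"
    using eventually_gt_at_top[of 0]
  proof eventually_elim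
    case (elim v)
    have "exp (2 * ln v) = v\<^sup>2" using elim by (simp add: exp_double)
    hence "exp (complex_of_real (2 * ln v)) = of_real (v\<^sup>2)" by (simp only: exp_of_real)
    thus ?case by (simp add: saddle_kernel_def)
  qed
  show ?thesis using Lim_transform_eventually[OF lim ev] unfolding val .
qed

lemma normal_density_convolution:
  "m > 0 \<Longrightarrow> (\<integral>x. normal_density 0 (sqrt (real m)) (y - x) * normal_density 0 1 x \<partial>lborel) = normal_density 0 (sqrt (real (Suc m))) y"
  using fun_cong[OF conv_normal_density_zero_mean[of "sqrt (real m)" 1], of y]
  by (subst integral_eq_nn_integral) (auto simp: add.commute)

text \<open>Rescaling b = x/v keeps the convolution form, with one factor 1/v per step absorbed by
  v^m. The factors tend to multiples of normal densities, whose variances add up to m + 1.\<close>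

lemma saddle_profile_limit:
  assumes lam: "\<And>l. l \<in> {1..Suc m} \<Longrightarrow> Re (lam l) < c"
  shows "((\<lambda>v. saddle_profile c lam (Suc m) (of_real (2 * ln v)) (y / v) * of_real (v ^ m)) \<longlongrightarrow>
    of_real (sqrt (2 * pi) ^ Suc m * normal_density 0 (sqrt (real (Suc m))) y)) at_top"
  using lam
proof (induction m arbitrary: y)
  case 0
  have "saddle_profile c lam (Suc 0) (of_real (2 * ln v)) (y / v) = saddle_kernel (lam 1) (of_real (2 * ln v)) (y / v)" for v
    using saddle_profile_1[of "of_real (2 * ln v)" lam c] 0[of 1] by simp
  thus ?case using saddle_kernel_limit[of "lam 1" y] by simp
next
  case (Suc m)
  let ?l = "lam (Suc (Suc m))"
  define P where "P = (\<lambda>v x. saddle_profile c lam (Suc m) (of_real (2 * ln v)) ((y - x) / v) * of_real (v ^ m))"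
  define k where "k = (\<lambda>v x. saddle_kernel ?l (of_real (2 * ln v)) (x / v))"
  define g where "g = (\<lambda>y. sqrt (2 * pi) ^ Suc m * normal_density 0 (sqrt (real (Suc m))) y)"
  define \<rho> where "\<rho> = (\<Sum>l=1..Suc (Suc m). \<bar>Re (lam l)\<bar>)"
  have \<rho>: "\<bar>Re (lam l)\<bar> \<le> \<rho>" if "l \<in> {1..Suc (Suc m)}" for l
    unfolding \<rho>_def using that by (intro member_le_sum) auto
  have step: "saddle_profile c lam (Suc (Suc m)) (of_real (2 * ln v)) (y / v) * of_real (v ^ Suc m) = (\<integral>x. P v x * k v x \<partial>lborel)"
    if v: "v > 0" for v
  proof -
    let ?\<omega> = "complex_of_real (2 * ln v)"
    have "saddle_profile c lam (Suc (Suc m)) ?\<omega> (y / v) = (\<integral>b. saddle_profile c lam (Suc m) ?\<omega> (y / v - b) * saddle_kernel ?l ?\<omega> b \<partial>lborel)"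
      using Suc.prems by (intro saddle_profile_Suc) auto
    hence "saddle_profile c lam (Suc (Suc m)) ?\<omega> (y / v) * of_real (v ^ Suc m) = of_real (v ^ m) * (\<integral>x. saddle_profile c lam (Suc m) ?\<omega> (y / v - (0 + 1 / v * x)) * saddle_kernel ?l ?\<omega> (0 + 1 / v * x) \<partial>lborel)"
      using lborel_integral_real_affine[of "1 / v" "\<lambda>b. saddle_profile c lam (Suc m) ?\<omega> (y / v - b) * saddle_kernel ?l ?\<omega> b" 0] v
      by (simp add: scaleR_conv_of_real)
    also have "\<dots> = (\<integral>x. of_real (v ^ m) * (saddle_profile c lam (Suc m) ?\<omega> (y / v - (0 + 1 / v * x)) * saddle_kernel ?l ?\<omega> (0 + 1 / v * x)) \<partial>lborel)"
      by (rule integral_mult_right_zero[symmetric])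
    also have "\<dots> = (\<integral>x. P v x * k v x \<partial>lborel)"
      by (intro Bochner_Integration.integral_cong refl) (simp add: P_def k_def diff_divide_distrib)
    finally show ?thesis .
  qed
  have "((\<lambda>v. \<integral>x. P v x * k v x \<partial>lborel) \<longlongrightarrow> (\<integral>x. of_real (g (y - x)) * of_real (sqrt (2 * pi) * normal_density 0 1 x) \<partial>lborel)) at_top"
  proof (rule integral_dominated_convergence_at_top[where w = "\<lambda>x. exp 2 * (exp 2 * laplace_mass) ^ m * (exp 2 * exp (- (1 / 2) * \<bar>x\<bar>))"])
    show "AE x in lborel. ((\<lambda>v. P v x * k v x) \<longlongrightarrow> of_real (g (y - x)) * of_real (sqrt (2 * pi) * normal_density 0 1 x)) at_top"
    proof (intro AE_I2 tendsto_mult)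
      fix x
      show "((\<lambda>v. P v x) \<longlongrightarrow> of_real (g (y - x))) at_top"
        unfolding P_def g_def using Suc.prems by (intro Suc.IH) auto
      show "((\<lambda>v. k v x) \<longlongrightarrow> of_real (sqrt (2 * pi) * normal_density 0 1 x)) at_top"
        unfolding k_def by (rule saddle_kernel_limit)
    qed
    show "\<forall>\<^sub>F v in at_top. AE x in lborel. norm (P v x * k v x) \<le> exp 2 * (exp 2 * laplace_mass) ^ m * (exp 2 * exp (- (1 / 2) * \<bar>x\<bar>))"
      \<comment> \<open>v >= 2 rho gives |Re lambda_l| <= v/2, as the uniform bounds demand.\<close>
      using eventually_ge_at_top[of "max 1 (2 * \<rho>)"]
    proof eventually_elim
      case (elim v)
      have v: "v \<ge> 1" and r: "\<bar>Re (lam l)\<bar> \<le> v / 2" if "l \<in> {1..Suc (Suc m)}" for l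
        using elim \<rho>[of l] that by auto
      have v1: "v \<ge> 1" using elim by simp
      have "exp (2 * ln v) = v\<^sup>2" using v1 by (simp add: exp_double)
      hence ev: "Re (exp (complex_of_real (2 * ln v))) = v\<^sup>2" by (simp only: exp_of_real Re_complex_of_real)
      show ?case
      proof (rule AE_I2)
        fix x
        have "cmod (P v x) \<le> exp 2 * (exp 2 * laplace_mass / v) ^ m * v ^ m"
          unfolding P_def norm_mult using v1 Suc.prems r
          by (intro mult_mono saddle_profile_bound ev) (auto simp: norm_power)
        also have "\<dots> = exp 2 * (exp 2 * laplace_mass) ^ m" using v1 by (simp add: power_divide)
        finally have 1: "cmod (P v x) \<le> exp 2 * (exp 2 * laplace_mass) ^ m" .
        have "cmod (k v x) \<le> exp 2 * exp (- (v / 2) * \<bar>x / v\<bar>)"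
          unfolding k_def by (intro saddle_kernel_bound ev v1 r) auto
        hence 2: "cmod (k v x) \<le> exp 2 * exp (- (1 / 2) * \<bar>x\<bar>)" using v1 by simp
        show "norm (P v x * k v x) \<le> exp 2 * (exp 2 * laplace_mass) ^ m * (exp 2 * exp (- (1 / 2) * \<bar>x\<bar>))"
          unfolding norm_mult by (intro mult_mono 1 2) (auto intro: order_trans[OF norm_ge_zero 1])
      qed
    qed
    show "integrable lborel (\<lambda>x. exp 2 * (exp 2 * laplace_mass) ^ m * (exp 2 * exp (- (1 / 2) * \<bar>x\<bar>)))"
      by (intro integrable_mult_right integrable_exp_abs) auto
    show "(\<lambda>x. P v x * k v x) \<in> borel_measurable lborel" for v
    proof (cases "v = 0")
      case True
      thus ?thesis unfolding P_def k_def by simp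
    next
      case False
      have c: "continuous_on UNIV (saddle_profile c lam (Suc m) (of_real (2 * ln v)))"
        using Suc.prems by (intro saddle_profile_continuous) auto
      have "continuous_on UNIV (\<lambda>x. saddle_profile c lam (Suc m) (of_real (2 * ln v)) ((y - x) / v))"
        by (rule continuous_on_compose2[OF c]) (use False in \<open>auto intro!: continuous_intros\<close>)
      hence "continuous_on UNIV (\<lambda>x. P v x * k v x)"
        unfolding P_def k_def saddle_kernel_def using False by (intro continuous_intros) auto
      thus ?thesis by (simp add: borel_measurable_continuous_onI)
    qed
    show "(\<lambda>x. complex_of_real (g (y - x)) * complex_of_real (sqrt (2 * pi) * normal_density 0 1 x)) \<in> borel_measurable lborel"
      unfolding g_def by measurable
  qed
  moreover have "(\<integral>x. complex_of_real (g (y - x)) * of_real (sqrt (2 * pi) * normal_density 0 1 x) \<partial>lborel) =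
     of_real (sqrt (2 * pi) ^ Suc (Suc m) * normal_density 0 (sqrt (real (Suc (Suc m)))) y)"
  proof -
    have "complex_of_real (g (y - x)) * of_real (sqrt (2 * pi) * normal_density 0 1 x) =
      of_real (sqrt (2 * pi) ^ Suc (Suc m) * (normal_density 0 (sqrt (real (Suc m))) (y - x) * normal_density 0 1 x))" for x
      by (simp add: g_def)
    thus ?thesis using normal_density_convolution[of "Suc m" y]
      by (simp only: integral_complex_of_real integral_mult_right_zero zero_less_Suc)
  qed
  moreover have "\<forall>\<^sub>F v in at_top. (\<integral>x. P v x * k v x \<partial>lborel) =
      saddle_profile c lam (Suc (Suc m)) (of_real (2 * ln v)) (y / v) * of_real (v ^ Suc m)"
    using eventually_gt_at_top[of 0] by eventually_elim (rule step[symmetric])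
  ultimately show ?case by (simp only:) (rule Lim_transform_eventually)
qed

section \<open>Entire extension of solutions\<close>

lemma fps_deriv_funpow_nth: "(fps_deriv ^^ i) F $ k * fact k = fact (k + i) * (F $ (k + i) :: complex)"
  using fps_0th_higher_deriv[of k "(fps_deriv ^^ i) F"] fps_0th_higher_deriv[of "k + i" F]
  by (simp add: funpow_add mult.commute)

lemma has_fps_expansion_deriv_funpow:
  "(f :: complex \<Rightarrow> complex) has_fps_expansion F \<Longrightarrow> (deriv ^^ i) f has_fps_expansion (fps_deriv ^^ i) F"
  by (induction i) (auto intro: has_fps_expansion_deriv)

lemma has_fps_expansion_sum':
  fixes f :: "'i \<Rightarrow> complex \<Rightarrow> complex"
  shows "(\<And>i. i \<in> A \<Longrightarrow> f i has_fps_expansion F i) \<Longrightarrow> (\<lambda>x. \<Sum>i\<in>A. f i x) has_fps_expansion (\<Sum>i\<in>A. F i)"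
  by (induction A rule: infinite_finite_induct) (auto intro!: has_fps_expansion_add)

text \<open>
  The Taylor coefficients are compared with those of \<open>1 / (1 - r \<zeta>)\<close>: the leading coefficient of the equation
  gains a factor of order \<open>k\<close> in the recursion, which beats \<open>r ^ N\<close> for every \<open>r\<close>.
\<close>

lemma ode_coeff_bound:
  fixes c :: "nat \<Rightarrow> complex" and p :: "nat \<Rightarrow> complex"
  assumes N: "N \<ge> 1" and r: "r \<ge> (1::real)"
    and rec: "\<And>k. c (k + N) = - (\<Sum>i<N. p i * c (k + i)) + \<kappa> * (\<Sum>j\<le>k. of_nat (k choose j) * q ^ j * c (k - j))"
  shows "\<exists>M. \<forall>k. cmod (c k) \<le> M * fact k / r ^ k"
proof -
  define A where "A = (\<Sum>i<N. cmod (p i)) + cmod \<kappa> * exp (cmod q * r)"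
  have A0: "A \<ge> 0" by (auto simp: A_def intro!: add_nonneg_nonneg sum_nonneg)
  \<comment> \<open>From this index on, the factor k gained from the leading derivative exceeds A
    r^N; M below takes care of the finitely many earlier coefficients.\<close>
  obtain k0 where k0: "A * r ^ N \<le> real k0" using real_arch_simple by blast
  define M where "M = (\<Sum>j<k0 + N. cmod (c j) * r ^ j / fact j)"
  have M0: "M \<ge> 0" using r by (auto simp: M_def intro!: sum_nonneg)
  have "cmod (c k) \<le> M * fact k / r ^ k" for k
  proof (induction k rule: less_induct)
    case (less k)
    show ?case
    proof (cases "k < k0 + N")
      case True
      have "cmod (c k) * r ^ k / fact k \<le> M"
        unfolding M_def using True r by (intro member_le_sum) auto
      thus ?thesis using r by (simp add: field_simps)
    next
      case False
      define m where "m = k - N"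
      have k: "k = m + N" and m: "m \<ge> k0" using False by (auto simp: m_def)
      define X where "X = M * fact (m + N - 1) / r ^ m"
      have X0: "X \<ge> 0" using M0 r by (simp add: X_def)
      have c1: "cmod (c (m + i)) \<le> X" if "i < N" for i
      proof -
        have "cmod (c (m + i)) \<le> M * fact (m + i) / r ^ (m + i)" using that k by (intro less) auto
        also have "\<dots> \<le> M * fact (m + N - 1) / r ^ m"
          using that M0 r by (intro frac_le mult_left_mono mult_nonneg_nonneg fact_mono power_increasing) auto
        finally show ?thesis by (simp add: X_def)
      qed
      have c2: "cmod (of_nat (m choose j) * q ^ j * c (m - j)) \<le> X * ((cmod q * r) ^ j / fact j)" if "j \<le> m" for j
      proof -
        have "cmod (c (m - j)) \<le> M * fact (m - j) / r ^ (m - j)" using that k N by (intro less) auto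
        hence "real (m choose j) * cmod q ^ j * cmod (c (m - j)) \<le> real (m choose j) * cmod q ^ j * (M * fact (m - j) / r ^ (m - j))"
          by (intro mult_left_mono) auto
        also have "\<dots> = M * fact m / r ^ m * ((cmod q * r) ^ j / fact j)"
          using that r by (simp add: binomial_fact power_diff power_mult_distrib field_simps)
        also have "\<dots> \<le> X * ((cmod q * r) ^ j / fact j)"
          unfolding X_def using M0 r N by (intro mult_right_mono divide_right_mono mult_left_mono fact_mono) auto
        finally show ?thesis by (simp add: norm_mult norm_power)
      qed
      have e: "(\<Sum>j\<le>m. (cmod q * r) ^ j / fact j) \<le> exp (cmod q * r)"
      proof -
        have "(\<Sum>j\<le>m. (cmod q * r) ^ j /\<^sub>R fact j) \<le> exp (cmod q * r)"
          unfolding exp_def using r by (intro sum_le_suminf summable_exp_generic) auto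
        thus ?thesis by (simp add: divide_inverse mult.commute)
      qed
      have "cmod (c k) \<le> cmod (\<Sum>i<N. p i * c (m + i)) + cmod (\<kappa> * (\<Sum>j\<le>m. of_nat (m choose j) * q ^ j * c (m - j)))"
        unfolding k rec[of m] by (rule order_trans[OF norm_triangle_ineq]) simp
      also have "cmod (\<Sum>i<N. p i * c (m + i)) \<le> (\<Sum>i<N. cmod (p i) * X)"
        using c1 by (intro order_trans[OF norm_sum] sum_mono) (auto simp: norm_mult intro: mult_left_mono)
      also have "\<dots> = (\<Sum>i<N. cmod (p i)) * X" by (rule sum_distrib_right[symmetric])
      also have "cmod (\<kappa> * (\<Sum>j\<le>m. of_nat (m choose j) * q ^ j * c (m - j))) \<le> cmod \<kappa> * (X * exp (cmod q * r))"
      proof -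
        have "cmod (\<Sum>j\<le>m. of_nat (m choose j) * q ^ j * c (m - j)) \<le> (\<Sum>j\<le>m. X * ((cmod q * r) ^ j / fact j))"
          by (intro order_trans[OF norm_sum] sum_mono c2) auto
        also have "\<dots> \<le> X * exp (cmod q * r)"
          unfolding sum_distrib_left[symmetric] using e X0 by (intro mult_left_mono)
        finally show ?thesis by (simp add: norm_mult mult_left_mono)
      qed
      finally have "cmod (c k) \<le> A * X" by (simp add: A_def algebra_simps)
      also have "\<dots> = (A * r ^ N) * (M * fact (m + N - 1) / r ^ k)"
        using r by (simp add: X_def k power_add)
      also have "\<dots> \<le> real k * (M * fact (m + N - 1) / r ^ k)"
      proof (intro mult_right_mono)
        show "A * r ^ N \<le> real k" using k0 m k by simp
      qed (use M0 r in auto)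
      also have "\<dots> = M * fact k / r ^ k"
        using fact_reduce[of k, where 'a = real] k N by simp
      finally show ?thesis .
    qed
  qed
  thus ?thesis by blast
qed

text \<open>Comparing Taylor coefficients at 0 in the equation gives the recursion of
  \<open>ode_coeff_bound\<close> for the derivatives k! G_k, so the series converges everywhere; the
  identity theorem carries the equation along.\<close>

lemma entire_solution_extension:
  assumes S: "open S" "connected S" "0 \<in> S" and f: "f holomorphic_on S"
    and P: "degree P = N" "coeff P N = 1" "N \<ge> 1"
    and ode: "\<And>\<omega>. \<omega> \<in> S \<Longrightarrow> DP deriv P f \<omega> = \<kappa> * exp (q * \<omega>) * f \<omega>"
  obtains F where "F holomorphic_on UNIV" "\<forall>\<omega>\<in>S. F \<omega> = f \<omega>" "\<forall>\<omega>. DP deriv P F \<omega> = \<kappa> * exp (q * \<omega>) * F \<omega>"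
proof -
  define G where "G = fps_expansion f 0"
  define c where "c = (\<lambda>k. fact k * G $ k)"
  have fG: "f has_fps_expansion G" unfolding G_def using S(1,3) f by (rule has_fps_expansion_fps_expansion)
  have E: "(\<Sum>i\<le>N. fps_const (coeff P i) * (fps_deriv ^^ i) G) = fps_const \<kappa> * (fps_exp q * G)"
  proof (rule fps_expansion_unique_complex)
    have "(\<lambda>\<omega>. \<Sum>i\<le>N. coeff P i * (deriv ^^ i) f \<omega>) has_fps_expansion (\<Sum>i\<le>N. fps_const (coeff P i) * (fps_deriv ^^ i) G)"
      by (intro has_fps_expansion_sum' has_fps_expansion_cmult_left has_fps_expansion_deriv_funpow fG)
    thus "DP deriv P f has_fps_expansion (\<Sum>i\<le>N. fps_const (coeff P i) * (fps_deriv ^^ i) G)"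
      by (simp add: DP_def[abs_def] P(1))
    have "(\<lambda>\<omega>. \<kappa> * (exp (q * \<omega>) * f \<omega>)) has_fps_expansion fps_const \<kappa> * (fps_exp q * G)"
      by (intro has_fps_expansion_cmult_left has_fps_expansion_mult has_fps_expansion_exp fG)
    moreover have "\<forall>\<^sub>F \<omega> in nhds 0. \<kappa> * (exp (q * \<omega>) * f \<omega>) = DP deriv P f \<omega>"
      using eventually_nhds_in_open[OF S(1,3)] by eventually_elim (simp add: ode)
    ultimately show "DP deriv P f has_fps_expansion fps_const \<kappa> * (fps_exp q * G)"
      by (rule has_fps_expansion_cong[THEN iffD1, rotated 2, OF _ _ refl])
  qed
  have rec: "c (k + N) = - (\<Sum>i<N. coeff P i * c (k + i)) + \<kappa> * (\<Sum>j\<le>k. of_nat (k choose j) * q ^ j * c (k - j))" for k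
  proof -
    have "(\<Sum>i\<le>N. fps_const (coeff P i) * (fps_deriv ^^ i) G) $ k * fact k = (fps_const \<kappa> * (fps_exp q * G)) $ k * fact k"
      unfolding E ..
    moreover have "(\<Sum>i\<le>N. fps_const (coeff P i) * (fps_deriv ^^ i) G) $ k * fact k = (\<Sum>i\<le>N. coeff P i * c (k + i))"
      unfolding fps_sum_nth fps_mult_left_const_nth sum_distrib_right mult.assoc fps_deriv_funpow_nth c_def ..
    moreover have "(\<Sum>i\<le>N. coeff P i * c (k + i)) = (\<Sum>i<N. coeff P i * c (k + i)) + c (k + N)"
      using P(2) by (simp add: lessThan_Suc_atMost[symmetric])
    moreover have "(fps_const \<kappa> * (fps_exp q * G)) $ k * fact k = \<kappa> * (\<Sum>j\<le>k. q ^ j / fact j * G $ (k - j) * fact k)"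
      unfolding fps_mult_left_const_nth unfolding fps_mult_nth atMost_atLeast0 fps_exp_nth mult.assoc[of \<kappa>] sum_distrib_right by simp
    moreover have "(\<Sum>j\<le>k. q ^ j / fact j * G $ (k - j) * fact k) = (\<Sum>j\<le>k. of_nat (k choose j) * q ^ j * c (k - j))"
      by (intro sum.cong refl) (simp add: c_def binomial_fact)
    ultimately show ?thesis by (simp add: eq_neg_iff_add_eq_0 algebra_simps)
  qed
  have R: "fps_conv_radius G = \<infinity>"
  proof -
    have "summable (\<lambda>k. G $ k * z ^ k)" for z
    proof -
      \<comment> \<open>r/2 exceeds |z|, so the terms are dominated by a geometric series of ratio
        1/2.\<close>
      define r where "r = 2 * cmod z + 1"
      have r: "r \<ge> 1" by (simp add: r_def)
      obtain M where M: "\<And>k. cmod (c k) \<le> M * fact k / r ^ k"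
        using ode_coeff_bound[of N r c "coeff P" \<kappa> q, OF P(3) r rec] by blast
      have "norm (G $ k * z ^ k) \<le> M * (1/2) ^ k" for k
      proof -
        have "cmod (c k) = fact k * cmod (G $ k)" by (simp add: c_def norm_mult)
        hence "fact k * cmod (G $ k) \<le> fact k * (M / r ^ k)" using M[of k] by (simp add: mult.commute)
        hence "cmod (G $ k) \<le> M / r ^ k" by (rule mult_left_le_imp_le) simp
        moreover have M0: "0 \<le> M / r ^ k" by (rule order_trans[OF norm_ge_zero calculation])
        moreover have "cmod z ^ k \<le> (r / 2) ^ k" by (intro power_mono) (auto simp: r_def)
        ultimately have "cmod (G $ k) * cmod z ^ k \<le> M / r ^ k * (r / 2) ^ k" by (intro mult_mono) auto
        thus ?thesis using r by (simp add: norm_mult norm_power power_divide)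
      qed
      moreover have "summable (\<lambda>k. M * (1/2) ^ k)" by (rule summable_mult, rule summable_geometric) simp
      ultimately show ?thesis by (rule summable_comparison_test'[of _ 0, rotated])
    qed
    thus ?thesis unfolding fps_conv_radius_def by (intro conv_radius_inftyI'')
  qed
  define F where "F = eval_fps G"
  have Fh: "F holomorphic_on UNIV" unfolding F_def by (intro holomorphic_on_eval_fps) (simp add: R)
  obtain s where s: "open s" "0 \<in> s" "\<And>z. z \<in> s \<Longrightarrow> f z = eval_fps G z"
    using has_fps_expansion_imp_holomorphic[OF fG] by metis
  have FS: "F \<omega> = f \<omega>" if "\<omega> \<in> S" for \<omega>
  proof (rule analytic_continuation_open[of "s \<inter> S" S F f])
    show "s \<inter> S \<noteq> {}" using s S by auto
    show "F z = f z" if "z \<in> s \<inter> S" for z using s(3) that by (simp add: F_def)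
  qed (use s S f that Fh in \<open>auto intro: holomorphic_on_subset\<close>)
  have "DP deriv P F \<omega> = \<kappa> * exp (q * \<omega>) * F \<omega>" for \<omega>
  proof (rule analytic_continuation_open[of S UNIV "DP deriv P F" "\<lambda>\<omega>. \<kappa> * exp (q * \<omega>) * F \<omega>"])
    show "S \<noteq> {}" using S by auto
    show "DP deriv P F holomorphic_on UNIV" by (rule DP_deriv_holomorphic[OF Fh open_UNIV])
    show "(\<lambda>\<omega>. \<kappa> * exp (q * \<omega>) * F \<omega>) holomorphic_on UNIV" using Fh by (intro holomorphic_intros)
    show "DP deriv P F z = \<kappa> * exp (q * z) * F z" if z: "z \<in> S" for z
    proof -
      have ev: "\<forall>\<^sub>F x in nhds z. F x = f x"
        using eventually_nhds_in_open[OF S(1) z] by eventually_elim (rule FS)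
      have "(deriv ^^ i) F z = (deriv ^^ i) f z" for i
        by (rule higher_deriv_cong_ev[OF ev refl])
      hence "DP deriv P F z = DP deriv P f z" by (simp add: DP_def)
      thus ?thesis using ode[OF z] FS[OF z] by simp
    qed
  qed (use S in auto)
  with Fh FS that show ?thesis by blast
qed

section \<open>The Bessel equation for the Mellin-Barnes integral\<close>

lemma vdecay_cmult: "vdecay a b \<alpha> h \<Longrightarrow> vdecay a b \<alpha> (\<lambda>s. k * h s)"
  unfolding vdecay_def
proof (intro conjI allI impI; elim conjE)
  fix \<epsilon> :: real
  assume "\<forall>\<epsilon>>0. \<exists>C. \<forall>s. a \<le> Re s \<and> Re s \<le> b \<longrightarrow> cmod (h s) \<le> C * exp (- (\<alpha> - \<epsilon>) * \<bar>Im s\<bar>)" "\<epsilon> > 0"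
  then obtain C where C: "\<forall>s. a \<le> Re s \<and> Re s \<le> b \<longrightarrow> cmod (h s) \<le> C * exp (- (\<alpha> - \<epsilon>) * \<bar>Im s\<bar>)" by blast
  have "cmod (k * h s) \<le> (cmod k * C) * exp (- (\<alpha> - \<epsilon>) * \<bar>Im s\<bar>)" if "a \<le> Re s \<and> Re s \<le> b" for s
    unfolding norm_mult mult.assoc using C that by (intro mult_left_mono) auto
  thus "\<exists>C. \<forall>s. a \<le> Re s \<and> Re s \<le> b \<longrightarrow> cmod (k * h s) \<le> C * exp (- (\<alpha> - \<epsilon>) * \<bar>Im s\<bar>)" by blast
qed (auto intro: continuous_intros)

lemma vdecay_power: "vdecay a b \<alpha> h \<Longrightarrow> vdecay a b \<alpha> (\<lambda>s. (k * s) ^ i * h s)"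
proof (induction i)
  case (Suc i)
  from vdecay_cmult[OF vdecay_cmult_id[OF Suc.IH[OF Suc.prems]], of k] show ?case by (simp add: mult_ac)
qed simp

lemma vline_deriv_funpow:
  assumes h: "vdecay c c \<alpha> h" and \<omega>: "\<omega> \<in> {\<omega>. real n * \<bar>Im \<omega>\<bar> < \<alpha>}"
  shows "(deriv ^^ i) (\<lambda>\<omega>. vline c h (of_nat n * \<omega>)) \<omega> = vline c (\<lambda>s. (- of_nat n * s) ^ i * h s) (of_nat n * \<omega>)"
  using \<omega>
proof (induction i arbitrary: \<omega>)
  case (Suc i)
  define S where "S = {\<omega>::complex. real n * \<bar>Im \<omega>\<bar> < \<alpha>}"
  have S: "open S" unfolding S_def by (intro open_Collect_less continuous_intros)
  have "\<forall>\<^sub>F x in nhds \<omega>. (deriv ^^ i) (\<lambda>\<omega>. vline c h (of_nat n * \<omega>)) x = vline c (\<lambda>s. (- of_nat n * s) ^ i * h s) (of_nat n * x)"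
  proof (rule eventually_mono)
    show "\<forall>\<^sub>F x in nhds \<omega>. x \<in> S" using Suc.prems by (intro eventually_nhds_in_open S) (simp add: S_def)
  qed (rule Suc.IH, simp only: S_def)
  hence "(deriv ^^ Suc i) (\<lambda>\<omega>. vline c h (of_nat n * \<omega>)) \<omega> = deriv (\<lambda>x. vline c (\<lambda>s. (- of_nat n * s) ^ i * h s) (of_nat n * x)) \<omega>"
    by (simp add: deriv_cong_ev)
  also have "\<dots> = vline c (\<lambda>s. - s * ((- of_nat n * s) ^ i * h s)) (of_nat n * \<omega>) * of_nat n"
  proof (rule DERIV_imp_deriv, rule DERIV_chain2[where f = "vline c (\<lambda>s. (- of_nat n * s) ^ i * h s)"])
    show "(vline c (\<lambda>s. (- of_nat n * s) ^ i * h s) has_field_derivative vline c (\<lambda>s. - s * ((- of_nat n * s) ^ i * h s)) (of_nat n * \<omega>)) (at (of_nat n * \<omega>))"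
      using Suc.prems by (intro vline_facts(2)[OF vdecay_power[OF h]]) (auto simp: abs_mult)
  qed (auto intro!: derivative_eq_intros)
  also have "\<dots> = vline c (\<lambda>s. (- of_nat n * s) ^ Suc i * h s) (of_nat n * \<omega>)"
  proof -
    have "(- of_nat n * s) ^ Suc i * h s * exp (- (s * (of_nat n * \<omega>))) = of_nat n * (- s * ((- of_nat n * s) ^ i * h s) * exp (- (s * (of_nat n * \<omega>))))" for s
      by (simp add: mult_ac)
    note eq = this
    show ?thesis unfolding vline_def eq integral_mult_right_zero by simp
  qed
  finally show ?case .
qed simp

lemma DP_vline:
  assumes h: "vdecay c c \<alpha> h" and \<omega>: "real n * \<bar>Im \<omega>\<bar> < \<alpha>"
  shows "DP deriv P (\<lambda>\<omega>. vline c h (of_nat n * \<omega>)) \<omega> = vline c (\<lambda>s. poly P (- of_nat n * s) * h s) (of_nat n * \<omega>)"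
proof -
  let ?\<eta> = "of_nat n * \<omega>"
  have e: "\<bar>Im ?\<eta>\<bar> < \<alpha>" using \<omega> by (simp add: abs_mult)
  have i: "integrable lborel (\<lambda>t. ((- of_nat n * Complex c t) ^ i * h (Complex c t)) * exp (- (Complex c t * ?\<eta>)))" for i
    using vline_facts(1)[OF vdecay_power[OF h, of "- of_nat n" i] order_refl order_refl e] .
  have "vline c (\<lambda>s. poly P (- of_nat n * s) * h s) ?\<eta> =
    (\<integral>t. (\<Sum>i\<le>degree P. coeff P i * (((- of_nat n * Complex c t) ^ i * h (Complex c t)) * exp (- (Complex c t * ?\<eta>)))) \<partial>lborel) / (2 * of_real pi)"
    unfolding vline_def poly_altdef by (simp add: sum_distrib_right mult.assoc)
  also have "\<dots> = (\<Sum>i\<le>degree P. coeff P i * vline c (\<lambda>s. (- of_nat n * s) ^ i * h s) ?\<eta>)"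
    using i by (subst Bochner_Integration.integral_sum) (auto simp: vline_def sum_divide_distrib)
  finally show ?thesis unfolding DP_def using vline_deriv_funpow[OF h, of \<omega> n] \<omega> by simp
qed

lemma poly_char_poly: "poly (char_poly n lam) (- of_nat n * s) = (- of_nat n) ^ n * (\<Prod>l=1..n. s - lam l)"
proof -
  have "poly (char_poly n lam) (- of_nat n * s) = (\<Prod>l=1..n. - of_nat n * (s - lam l))"
    unfolding char_poly_def poly_prod by (intro prod.cong refl) (simp add: algebra_simps)
  thus ?thesis unfolding prod.distrib by simp
qed

lemma Gamma_prod_shift:
  assumes "\<And>l. l \<in> {1..n} \<Longrightarrow> Re (lam l) < Re s"
  shows "Gamma_prod n lam (s + 1) = (\<Prod>l=1..n. s - lam l) * Gamma_prod n lam s"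
  unfolding Gamma_prod_def prod.distrib[symmetric]
proof (intro prod.cong refl)
  fix l assume "l \<in> {1..n}"
  thus "Gamma (s + 1 - lam l) = (s - lam l) * Gamma (s - lam l)"
    using Gamma_plus1_right[of "s - lam l"] assms[of l] by (simp add: diff_add_eq)
qed

text \<open>Under the integral the operator multiplies by (-n)^n times the product of the s -
  lambda_l, which the functional equation turns into the shift s to s + 1. Translating the line by 1
  produces e^(n omega), and no pole is crossed when it is moved back.\<close>

lemma vline_Gamma_prod_ode:
  assumes lam: "\<And>l. l \<in> {1..n} \<Longrightarrow> Re (lam l) < c" and n: "n \<ge> 1" and \<omega>: "\<bar>Im \<omega>\<bar> < pi / 2"
  shows "DP deriv (char_poly n lam) (\<lambda>\<omega>. vline c (Gamma_prod n lam) (of_nat n * \<omega>)) \<omega> =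
    (- of_nat n) ^ n * exp (of_nat n * \<omega>) * vline c (Gamma_prod n lam) (of_nat n * \<omega>)"
proof -
  let ?\<eta> = "of_nat n * \<omega>"
  have e: "real n * \<bar>Im \<omega>\<bar> < real n * pi / 2" using mult_strict_left_mono[OF \<omega>, of "real n"] n by simp
  hence e': "\<bar>Im ?\<eta>\<bar> < real n * pi / 2" by (simp add: abs_mult)
  have vd: "vdecay c c' (real n * pi / 2) (Gamma_prod n lam)" if "c \<le> c'" for c'
    using lam that by (intro vdecay_Gamma_prod)
  obtain c0 where c0: "c0 < c" "\<And>l. l \<in> {1..n} \<Longrightarrow> Re (lam l) \<le> c0"
  proof
    show "Max ((\<lambda>l. Re (lam l)) ` {1..n}) < c" using lam n by (subst Max_less_iff) auto
  qed auto
  have "DP deriv (char_poly n lam) (\<lambda>\<omega>. vline c (Gamma_prod n lam) (of_nat n * \<omega>)) \<omega> =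
     vline c (\<lambda>s. poly (char_poly n lam) (- of_nat n * s) * Gamma_prod n lam s) ?\<eta>"
    by (rule DP_vline[OF vd[OF order_refl] e])
  also have "\<dots> = vline c (\<lambda>s. (- of_nat n) ^ n * Gamma_prod n lam (s + 1)) ?\<eta>"
  proof (rule vline_cong)
    show "poly (char_poly n lam) (- of_nat n * Complex c t) * Gamma_prod n lam (Complex c t) = (- of_nat n) ^ n * Gamma_prod n lam (Complex c t + 1)" for t
      unfolding poly_char_poly mult.assoc using Gamma_prod_shift[of n lam "Complex c t"] lam by simp
  qed
  also have "\<dots> = (- of_nat n) ^ n * vline c (\<lambda>s. Gamma_prod n lam (s + 1)) ?\<eta>"
    by (simp add: vline_def mult.assoc)
  also have "\<dots> = (- of_nat n) ^ n * (exp ?\<eta> * vline (c + 1) (Gamma_prod n lam) ?\<eta>)"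
    unfolding vline_translate ..
  also have "vline (c + 1) (Gamma_prod n lam) ?\<eta> = vline c (Gamma_prod n lam) ?\<eta>"
    using c0 by (intro vline_contour_shift[OF vd _ Gamma_prod_holomorphic[OF c0(2)] open_halfspace_Re_gt convex_halfspace_Re_gt _ e', symmetric]) auto
  finally show ?thesis by (simp only: mult.assoc)
qed

lemma vline_Gamma_prod_entire_extension:
  assumes lam: "\<And>l. l \<in> {1..n} \<Longrightarrow> Re (lam l) < c" and n: "n \<ge> 1"
  obtains F where "F holomorphic_on UNIV"
    "\<forall>\<omega>. \<bar>Im \<omega>\<bar> < pi / 2 \<longrightarrow> F \<omega> = vline c (Gamma_prod n lam) (of_nat n * \<omega>)"
    "\<forall>\<omega>. DP deriv (char_poly n lam) F \<omega> = (- of_nat n) ^ n * exp (of_nat n * \<omega>) * F \<omega>"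
proof -
  define S where "S = {\<omega>::complex. \<bar>Im \<omega>\<bar> < pi / 2}"
  have S: "open S" "connected S" "0 \<in> S"
    unfolding S_def by (rule open_hstrip, rule convex_connected[OF convex_hstrip], simp)
  have vd: "vdecay c c (real n * pi / 2) (Gamma_prod n lam)" using lam by (intro vdecay_Gamma_prod) auto
  have hol: "(\<lambda>\<omega>. vline c (Gamma_prod n lam) (of_nat n * \<omega>)) holomorphic_on S"
    unfolding holomorphic_on_open[OF S(1)]
  proof
    fix \<omega> assume "\<omega> \<in> S"
    hence "\<bar>Im (of_nat n * \<omega>)\<bar> < real n * pi / 2" using mult_strict_left_mono[of "\<bar>Im \<omega>\<bar>" "pi / 2" "real n"] n by (simp add: S_def abs_mult)
    note D = vline_facts(2)[OF vd order_refl order_refl this]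
    show "\<exists>f'. ((\<lambda>\<omega>. vline c (Gamma_prod n lam) (of_nat n * \<omega>)) has_field_derivative f') (at \<omega>)"
      by (rule exI, rule DERIV_chain2[where f = "vline c (Gamma_prod n lam)" and g = "\<lambda>\<omega>. of_nat n * \<omega>", OF D]) (rule DERIV_cmult_Id)
  qed
  show ?thesis
  proof (rule entire_solution_extension[OF S hol degree_char_poly n])
    show "DP deriv (char_poly n lam) (\<lambda>\<omega>. vline c (Gamma_prod n lam) (of_nat n * \<omega>)) \<omega> =
       (- of_nat n) ^ n * exp (of_nat n * \<omega>) * vline c (Gamma_prod n lam) (of_nat n * \<omega>)" if "\<omega> \<in> S" for \<omega>
      using that by (intro vline_Gamma_prod_ode lam n) (auto simp: S_def)
  qed (use that in \<open>auto simp: S_def\<close>)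
qed

section \<open>Deformation of the contour\<close>

definition gamma_dom :: "nat \<Rightarrow> (nat \<Rightarrow> complex) \<Rightarrow> complex set" where
  "gamma_dom n lam = {s. \<forall>l\<in>{1..n}. s - lam l \<notin> \<int>\<^sub>\<le>\<^sub>0}"

lemma open_gamma_dom: "open (gamma_dom n lam)"
proof -
  have "gamma_dom n lam = (\<Inter>l\<in>{1..n}. (\<lambda>s. s - lam l) -` (- \<int>\<^sub>\<le>\<^sub>0))" by (auto simp: gamma_dom_def)
  moreover have "open ((\<lambda>s. s - lam l) -` (- \<int>\<^sub>\<le>\<^sub>0))" for l
    by (intro open_vimage continuous_intros) auto
  ultimately show ?thesis by (auto intro!: open_INT)
qed

lemma Gamma_prod_holomorphic_dom: "Gamma_prod n lam holomorphic_on gamma_dom n lam"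
  unfolding Gamma_prod_def[abs_def]
proof (intro holomorphic_on_prod)
  fix l assume l: "l \<in> {1..n}"
  show "(\<lambda>s. Gamma (s - lam l)) holomorphic_on gamma_dom n lam"
    by (rule holomorphic_on_compose_gen[of "\<lambda>s. s - lam l" _ Gamma "- \<int>\<^sub>\<le>\<^sub>0", unfolded o_def])
      (use l in \<open>auto simp: gamma_dom_def intro!: holomorphic_intros holomorphic_Gamma\<close>)
qed

lemma not_gamma_dom: "w \<notin> gamma_dom n lam \<longleftrightarrow> (\<exists>l\<in>{1..n}. \<exists>k::nat. w = lam l - of_nat k)"
proof -
  have "w - lam l \<in> \<int>\<^sub>\<le>\<^sub>0 \<longleftrightarrow> (\<exists>k::nat. w = lam l - of_nat k)" for l
  proof
    assume "w - lam l \<in> \<int>\<^sub>\<le>\<^sub>0"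
    then obtain k where "w - lam l = - of_nat k" by (auto elim: nonpos_Ints_cases')
    thus "\<exists>k::nat. w = lam l - of_nat k" by (intro exI[of _ k]) (simp add: algebra_simps)
  next
    assume "\<exists>k::nat. w = lam l - of_nat k"
    thus "w - lam l \<in> \<int>\<^sub>\<le>\<^sub>0" by auto
  qed
  thus ?thesis by (auto simp: gamma_dom_def)
qed

lemma finite_poles_right: "finite {p. p \<notin> gamma_dom n lam \<and> - B \<le> Re p}"
proof (rule finite_subset)
  define K where "K = nat \<lceil>(\<Sum>l=1..n. \<bar>Re (lam l)\<bar>) + B\<rceil>"
  show "finite ((\<lambda>(l, k). lam l - of_nat k) ` ({1..n} \<times> {..K}))" by auto
  show "{p. p \<notin> gamma_dom n lam \<and> - B \<le> Re p} \<subseteq> (\<lambda>(l, k). lam l - of_nat k) ` ({1..n} \<times> {..K})"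
  proof
    fix p assume "p \<in> {p. p \<notin> gamma_dom n lam \<and> - B \<le> Re p}"
    then obtain l k where lk: "l \<in> {1..n}" "p = lam l - of_nat k" "- B \<le> Re p" by (auto simp: not_gamma_dom)
    have "real k \<le> Re (lam l) + B" using lk by simp
    moreover have "\<bar>Re (lam l)\<bar> \<le> (\<Sum>l=1..n. \<bar>Re (lam l)\<bar>)" using lk(1) by (intro member_le_sum) auto
    ultimately have "k \<le> K" unfolding K_def by linarith
    thus "p \<in> (\<lambda>(l, k). lam l - of_nat k) ` ({1..n} \<times> {..K})" using lk by auto
  qed
qed

lemma closed_vertical_rays: "closed (vertical_rays \<sigma> T)"
  unfolding vertical_rays_def by (intro closed_Collect_conj closed_Collect_eq closed_Collect_le continuous_intros)

text \<open>In the open complement of C connected and path components agree, so the point is joined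
  to the far left by a path image, which is compact.\<close>

lemma left_of_connected:
  assumes "closed C" "left_of C p"
  obtains K where "compact K" "connected K" "K \<inter> C = {}" "p \<in> K" "\<exists>s\<in>K. Re s < B"
proof -
  obtain R where R: "\<And>r. r < R \<Longrightarrow> connected_component (- C) p (of_real r)"
    using assms(2) by (auto simp: left_of_def)
  define r where "r = min R B - 1"
  have "connected_component (- C) p (of_real r)" by (intro R) (auto simp: r_def)
  hence "path_component (- C) p (of_real r)" using assms(1) by (simp add: open_path_connected_component open_Compl)
  then obtain \<pi> where \<pi>: "path \<pi>" "path_image \<pi> \<subseteq> - C" "pathstart \<pi> = p" "pathfinish \<pi> = of_real r"
    unfolding path_component_def by blast
  have "p \<in> path_image \<pi>" "of_real r \<in> path_image \<pi>"
    using pathstart_in_path_image[of \<pi>] pathfinish_in_path_image[of \<pi>] \<pi> by auto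
  moreover have "Re (of_real r :: complex) < B" by (simp add: r_def)
  ultimately show ?thesis using \<pi> that[of "path_image \<pi>"] compact_path_image[OF \<pi>(1)] connected_path_image[OF \<pi>(1)] by blast
qed

text \<open>Only finitely many poles have Re >= -B, and \<open>left_of\<close> joins each of them to
  the half-plane Re < -B by a compact connected set off C. Once T' and N exceed all these sets, a
  loop made of parts of C and of far lines misses them, so the winding number about such a pole
  equals that about a point left of the loop, which is 0. This takes the place of Jordan curve
  arguments about the sides of a contour.\<close>

lemma winding_number_left_zero:
  assumes C: "closed C" and left: "\<And>w. w \<notin> gamma_dom n lam \<Longrightarrow> left_of C w"
  shows "\<exists>M. \<forall>\<gamma> T' N w. M \<le> T' \<longrightarrow> M \<le> N \<longrightarrow> path \<gamma> \<longrightarrow> pathfinish \<gamma> = pathstart \<gamma> \<longrightarrow>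
     path_image \<gamma> \<subseteq> C \<union> {s. \<bar>Im s\<bar> = T'} \<union> {s. Re s = N} \<longrightarrow> path_image \<gamma> \<subseteq> {s. - B \<le> Re s} \<longrightarrow>
     w \<notin> gamma_dom n lam \<longrightarrow> w \<notin> path_image \<gamma> \<and> winding_number \<gamma> w = 0"
proof -
  define F where "F = {p. p \<notin> gamma_dom n lam \<and> - B \<le> Re p}"
  have fin: "finite F" unfolding F_def by (rule finite_poles_right)
  have "\<exists>K. compact K \<and> connected K \<and> K \<inter> C = {} \<and> p \<in> K \<and> (\<exists>s\<in>K. Re s < - B)" if "p \<in> F" for p
    using left_of_connected[OF C left[of p], of "- B"] that unfolding F_def by (metis (no_types, lifting) mem_Collect_eq)
  then obtain K where K: "\<forall>p\<in>F. compact (K p) \<and> connected (K p) \<and> K p \<inter> C = {} \<and> p \<in> K p \<and> (\<exists>s\<in>K p. Re s < - B)"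
    by metis
  have "bounded (\<Union>p\<in>F. K p)" using fin K by (intro bounded_UN) (auto intro: compact_imp_bounded)
  then obtain M0 where M0: "\<forall>s\<in>(\<Union>p\<in>F. K p). cmod s \<le> M0" unfolding bounded_iff by blast
  have half: "winding_number \<gamma> s = 0" if "path \<gamma>" "pathfinish \<gamma> = pathstart \<gamma>" "path_image \<gamma> \<subseteq> {s. - B \<le> Re s}" "Re s < - B" for \<gamma> s
    by (rule winding_number_zero_outside[OF that(1) convex_halfspace_Re_ge[of "- B"] that(2) _ that(3)]) (use that(4) in auto)
  have "w \<notin> path_image \<gamma> \<and> winding_number \<gamma> w = 0"
    if M: "M0 + 1 \<le> T'" "M0 + 1 \<le> N" and g: "path \<gamma>" "pathfinish \<gamma> = pathstart \<gamma>"
      "path_image \<gamma> \<subseteq> C \<union> {s. \<bar>Im s\<bar> = T'} \<union> {s. Re s = N}" "path_image \<gamma> \<subseteq> {s. - B \<le> Re s}" and w: "w \<notin> gamma_dom n lam"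
    for \<gamma> T' N w
  proof (cases "Re w < - B")
    case True
    thus ?thesis using half[OF g(1,2,4) True] g(4) by auto
  next
    case False
    hence wF: "w \<in> F" using w by (simp add: F_def)
    then obtain s where s: "s \<in> K w" "Re s < - B" using K by blast
    have disj: "K w \<inter> path_image \<gamma> = {}"
    proof -
      have "u \<notin> path_image \<gamma>" if u: "u \<in> K w" for u
      proof
        assume "u \<in> path_image \<gamma>"
        moreover have "u \<notin> C" using K wF u by blast
        ultimately have "\<bar>Im u\<bar> = T' \<or> Re u = N" using g(3) by auto
        moreover have "cmod u \<le> M0" using M0 wF u by blast
        ultimately show False using M abs_Im_le_cmod[of u] abs_Re_le_cmod[of u] by linarith
      qed
      thus ?thesis by blast
    qed
    have "winding_number \<gamma> w = winding_number \<gamma> s"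
      by (rule winding_number_eq[OF g(1,2) _ s(1) _ disj]) (use K wF in auto)
    thus ?thesis using half[OF g(1,2,4) s(2)] disj K wF by auto
  qed
  thus ?thesis by blast
qed

lemma linepath_same_Re_image: "path_image (linepath (Complex c a) (Complex c b)) \<subseteq> {s. Re s = c \<and> min a b \<le> Im s \<and> Im s \<le> max a b}"
  by (auto simp: closed_segment_same_Re closed_segment_eq_real_ivl split: if_splits)

lemma linepath_same_Im_image: "path_image (linepath (Complex a c) (Complex b c)) \<subseteq> {s. Im s = c \<and> min a b \<le> Re s \<and> Re s \<le> max a b}"
  by (auto simp: closed_segment_same_Im closed_segment_eq_real_ivl split: if_splits)

text \<open>The contour is closed on the right by a tall rectangle. All poles have winding number 0,
  so the homological Cauchy theorem applies on \<open>gamma_dom\<close>. M does not depend on q, so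
  it serves all omega at once.\<close>

lemma H_contour_deform:
  assumes H: "H_contour n lam \<sigma> T g"
  shows "\<exists>M. \<forall>T' N q. M \<le> T' \<longrightarrow> M \<le> N \<longrightarrow> q holomorphic_on gamma_dom n lam \<longrightarrow>
    contour_integral g q + \<i> * integral {- T'..- T} (\<lambda>t. q (Complex \<sigma> t)) + \<i> * integral {T..T'} (\<lambda>t. q (Complex \<sigma> t)) =
      contour_integral (linepath (Complex \<sigma> (- T')) (Complex N (- T'))) q + \<i> * integral {- T'..T'} (\<lambda>t. q (Complex N t))
      - contour_integral (linepath (Complex \<sigma> T') (Complex N T')) q"
proof -
  define C where "C = path_image g \<union> vertical_rays \<sigma> T"
  have g: "valid_path g" "pathstart g = Complex \<sigma> (- T)" "pathfinish g = Complex \<sigma> T" "T > 0"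
    using H by (auto simp: H_contour_def)
  have C: "closed C" unfolding C_def
    by (intro closed_Un closed_vertical_rays compact_imp_closed compact_path_image valid_path_imp_path g)
  have left: "left_of C w" if "w \<notin> gamma_dom n lam" for w
    using that H unfolding not_gamma_dom H_contour_def C_def by blast
  have "bounded (path_image g)" by (intro compact_imp_bounded compact_path_image valid_path_imp_path g)
  then obtain B0 where B0: "\<And>s. s \<in> path_image g \<Longrightarrow> cmod s \<le> B0" unfolding bounded_iff by blast
  \<comment> \<open>-B lies left of g and of both rays, hence of the whole closed loop.\<close>
  define B where "B = max B0 \<bar>\<sigma>\<bar>"
  have "\<exists>M. \<forall>\<gamma> T' N w. M \<le> T' \<longrightarrow> M \<le> N \<longrightarrow> path \<gamma> \<longrightarrow> pathfinish \<gamma> = pathstart \<gamma> \<longrightarrow>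
     path_image \<gamma> \<subseteq> C \<union> {s. \<bar>Im s\<bar> = T'} \<union> {s. Re s = N} \<longrightarrow> path_image \<gamma> \<subseteq> {s. - B \<le> Re s} \<longrightarrow>
     w \<notin> gamma_dom n lam \<longrightarrow> w \<notin> path_image \<gamma> \<and> winding_number \<gamma> w = 0"
    by (rule winding_number_left_zero[OF C]) (rule left)
  then obtain M0 where M0: "\<forall>\<gamma> T' N w. M0 \<le> T' \<longrightarrow> M0 \<le> N \<longrightarrow> path \<gamma> \<longrightarrow> pathfinish \<gamma> = pathstart \<gamma> \<longrightarrow>
     path_image \<gamma> \<subseteq> C \<union> {s. \<bar>Im s\<bar> = T'} \<union> {s. Re s = N} \<longrightarrow> path_image \<gamma> \<subseteq> {s. - B \<le> Re s} \<longrightarrow>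
     w \<notin> gamma_dom n lam \<longrightarrow> w \<notin> path_image \<gamma> \<and> winding_number \<gamma> w = 0"
    by (elim exE)
  define M where "M = max M0 (max (T + 1) (\<bar>\<sigma>\<bar> + 1))"
  have "contour_integral g q + \<i> * integral {- T'..- T} (\<lambda>t. q (Complex \<sigma> t)) + \<i> * integral {T..T'} (\<lambda>t. q (Complex \<sigma> t)) =
      contour_integral (linepath (Complex \<sigma> (- T')) (Complex N (- T'))) q + \<i> * integral {- T'..T'} (\<lambda>t. q (Complex N t))
      - contour_integral (linepath (Complex \<sigma> T') (Complex N T')) q"
    if M: "M \<le> T'" "M \<le> N" and q: "q holomorphic_on gamma_dom n lam" for T' N q
  proof -
    have b: "M0 \<le> T'" "M0 \<le> N" "T < T'" "\<sigma> < N" "- B \<le> \<sigma>" "0 < T'" using M g(4) by (auto simp: M_def B_def)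
    define l1 where "l1 = linepath (Complex \<sigma> T) (Complex \<sigma> T')"
    define l2 where "l2 = linepath (Complex \<sigma> T') (Complex N T')"
    define l3 where "l3 = linepath (Complex N T') (Complex N (- T'))"
    define l4 where "l4 = linepath (Complex N (- T')) (Complex \<sigma> (- T'))"
    define l5 where "l5 = linepath (Complex \<sigma> (- T')) (Complex \<sigma> (- T))"
    note ld = l1_def l2_def l3_def l4_def l5_def
    define \<gamma> where "\<gamma> = g +++ (l1 +++ (l2 +++ (l3 +++ (l4 +++ l5))))"
    have vp: "valid_path \<gamma>" unfolding \<gamma>_def ld using g by (intro valid_path_join) (auto)
    have pi: "path_image \<gamma> = path_image g \<union> (path_image l1 \<union> (path_image l2 \<union> (path_image l3 \<union> (path_image l4 \<union> path_image l5))))"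
      unfolding \<gamma>_def using g by (simp add: path_image_join ld del: path_image_linepath)
    have loop: "pathfinish \<gamma> = pathstart \<gamma>" unfolding \<gamma>_def using g by (simp add: ld)
    have im: "path_image l1 \<subseteq> {s. Re s = \<sigma> \<and> T \<le> Im s}" "path_image l2 \<subseteq> {s. Im s = T' \<and> \<sigma> \<le> Re s}"
      "path_image l3 \<subseteq> {s. Re s = N}" "path_image l4 \<subseteq> {s. Im s = - T' \<and> \<sigma> \<le> Re s}" "path_image l5 \<subseteq> {s. Re s = \<sigma> \<and> Im s \<le> - T}"
      unfolding ld
      by (rule order_trans[OF linepath_same_Re_image], use b in force,
          rule order_trans[OF linepath_same_Im_image], use b in force,
          rule order_trans[OF linepath_same_Re_image], use b in force,
          rule order_trans[OF linepath_same_Im_image], use b in force,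
          rule order_trans[OF linepath_same_Re_image], use b in force)
    have p1: "path_image \<gamma> \<subseteq> C \<union> {s. \<bar>Im s\<bar> = T'} \<union> {s. Re s = N}"
      unfolding pi C_def vertical_rays_def using im b(6) by fastforce
    have "- B \<le> Re s" if "s \<in> path_image g" for s
      using B0[OF that] abs_Re_le_cmod[of s] by (simp add: B_def)
    hence p2: "path_image \<gamma> \<subseteq> {s. - B \<le> Re s}" unfolding pi using im b by fastforce
    note W = M0[rule_format, OF b(1,2) valid_path_imp_path[OF vp] loop p1 p2]
    have sub: "path_image \<gamma> \<subseteq> gamma_dom n lam" using W by blast
    have "(q has_contour_integral 0) \<gamma>"
      by (rule Cauchy_theorem_global[OF open_gamma_dom q vp loop sub]) (use W in blast)
    hence z: "contour_integral \<gamma> q = 0" by (rule contour_integral_unique)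
    have ci: "q contour_integrable_on g" "q contour_integrable_on l1" "q contour_integrable_on l2"
      "q contour_integrable_on l3" "q contour_integrable_on l4" "q contour_integrable_on l5"
      by (rule contour_integrable_holomorphic_simple[OF q open_gamma_dom]; use sub pi g in \<open>auto simp: ld\<close>)+
    have "contour_integral \<gamma> q = contour_integral g q + (contour_integral l1 q + (contour_integral l2 q +
        (contour_integral l3 q + (contour_integral l4 q + contour_integral l5 q))))"
    proof -
      have v: "valid_path l1" "valid_path l2" "valid_path l3" "valid_path l4" "valid_path l5" by (simp_all add: ld)
      have e: "pathfinish l1 = pathstart l2" "pathfinish l2 = pathstart l3" "pathfinish l3 = pathstart l4" "pathfinish l4 = pathstart l5"
        by (simp_all add: ld)
      have i45: "q contour_integrable_on (l4 +++ l5)" using ci v by (simp add: contour_integrable_joinI)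
      have i35: "q contour_integrable_on (l3 +++ (l4 +++ l5))" using ci v i45 e by (intro contour_integrable_joinI) auto
      have i25: "q contour_integrable_on (l2 +++ (l3 +++ (l4 +++ l5)))" using ci v i35 e by (intro contour_integrable_joinI) auto
      have i15: "q contour_integrable_on (l1 +++ (l2 +++ (l3 +++ (l4 +++ l5))))" using ci v i25 e by (intro contour_integrable_joinI) auto
      show ?thesis unfolding \<gamma>_def using ci v e i45 i35 i25 i15 g(1) by simp
    qed
    moreover have "contour_integral l1 q = \<i> * integral {T..T'} (\<lambda>t. q (Complex \<sigma> t))"
      unfolding l1_def using b by (intro contour_integral_linepath_same_Re) auto
    moreover have "contour_integral l5 q = \<i> * integral {- T'..- T} (\<lambda>t. q (Complex \<sigma> t))"
      unfolding l5_def using b by (intro contour_integral_linepath_same_Re) auto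
    moreover have "contour_integral l3 q = - (\<i> * integral {- T'..T'} (\<lambda>t. q (Complex N t)))"
    proof -
      have "continuous_on (path_image l3) q"
        using sub pi by (intro continuous_on_subset[OF holomorphic_on_imp_continuous_on[OF q]]) auto
      hence "contour_integral l3 q = - contour_integral (linepath (Complex N (- T')) (Complex N T')) q"
        unfolding l3_def by (intro contour_integral_reverse_linepath) simp
      also have "contour_integral (linepath (Complex N (- T')) (Complex N T')) q = \<i> * integral {- T'..T'} (\<lambda>t. q (Complex N t))"
        using b by (intro contour_integral_linepath_same_Re) auto
      finally show ?thesis .
    qed
    moreover have "contour_integral l4 q = - contour_integral (linepath (Complex \<sigma> (- T')) (Complex N (- T'))) q"
    proof -
      have "continuous_on (path_image l4) q"
        using sub pi by (intro continuous_on_subset[OF holomorphic_on_imp_continuous_on[OF q]]) auto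
      thus ?thesis unfolding l4_def by (intro contour_integral_reverse_linepath) simp
    qed
    ultimately show ?thesis using z unfolding l2_def by (simp add: algebra_simps add_eq_0_iff)
  qed
  thus ?thesis by blast
qed

text \<open>Without a contour the description in \<open>H_Bessel_pos\<close> would fix no value. The
  witness is a rectangular detour at heights +-T above all |Im lambda_l| and to the right of all
  poles; the convex region A inside it contains every pole and the far negative axis, which gives
  \<open>left_of\<close>.\<close>

lemma H_contour_exists:
  assumes n: "n \<ge> 1"
  shows "\<exists>\<sigma> T g. H_contour n lam \<sigma> T g"
proof -
  define \<sigma> where "\<sigma> = (1 / 2 + (Re (\<Sum>l=1..n. lam l) - 1) / real n) - 1"
  define T where "T = (\<Sum>l=1..n. \<bar>Im (lam l)\<bar>) + 1"
  define N where "N = max \<sigma> (\<Sum>l=1..n. \<bar>Re (lam l)\<bar>) + 1"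
  have T0: "T > 0" by (auto simp: T_def intro!: add_nonneg_pos sum_nonneg)
  have sN: "\<sigma> < N" by (simp add: N_def)
  have lam: "\<bar>Im (lam l)\<bar> < T" "Re (lam l) < N" if "l \<in> {1..n}" for l
  proof -
    have "\<bar>Im (lam l)\<bar> \<le> (\<Sum>l=1..n. \<bar>Im (lam l)\<bar>)" "\<bar>Re (lam l)\<bar> \<le> (\<Sum>l=1..n. \<bar>Re (lam l)\<bar>)"
      using that by (intro member_le_sum; auto)+
    thus "\<bar>Im (lam l)\<bar> < T" "Re (lam l) < N" unfolding T_def N_def by linarith+
  qed
  define l1 where "l1 = linepath (Complex \<sigma> (- T)) (Complex N (- T))"
  define l2 where "l2 = linepath (Complex N (- T)) (Complex N T)"
  define l3 where "l3 = linepath (Complex N T) (Complex \<sigma> T)"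
  note ld = l1_def l2_def l3_def
  define g where "g = l1 +++ (l2 +++ l3)"
  have pi: "path_image g = path_image l1 \<union> (path_image l2 \<union> path_image l3)"
    unfolding g_def by (simp add: path_image_join ld del: path_image_linepath)
  have im: "path_image l1 \<subseteq> {s. Im s = - T \<and> \<sigma> \<le> Re s \<and> Re s \<le> N}" "path_image l2 \<subseteq> {s. Re s = N}"
    "path_image l3 \<subseteq> {s. Im s = T \<and> \<sigma> \<le> Re s \<and> Re s \<le> N}"
    unfolding ld
    by (rule order_trans[OF linepath_same_Im_image], use sN in force,
        rule order_trans[OF linepath_same_Re_image], use sN in force,
        rule order_trans[OF linepath_same_Im_image], use sN in force)
  have ne: "Complex \<sigma> (- T) \<noteq> Complex N (- T)" "Complex N (- T) \<noteq> Complex N T" "Complex N T \<noteq> Complex \<sigma> T" using sN T0 by auto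
  have a23: "arc (l2 +++ l3)"
    using ne im T0 by (intro arc_join) (auto simp: ld complex_eq_iff simp del: path_image_linepath)
  have "arc g" unfolding g_def
  proof (rule arc_join[OF _ a23])
    show "path_image l1 \<inter> path_image (l2 +++ l3) \<subseteq> {pathstart (l2 +++ l3)}"
    proof -
      have "path_image l1 \<inter> path_image l3 = {}" using im(1,3) T0 by fastforce
      hence "path_image l1 \<inter> path_image (l2 +++ l3) = path_image l1 \<inter> path_image l2"
        by (subst path_image_join) (auto simp: l2_def l3_def simp del: path_image_linepath)
      thus ?thesis using im(1,2) by (auto simp: ld complex_eq_iff simp del: path_image_linepath)
    qed
  qed (use ne in \<open>auto simp: ld\<close>)
  moreover have vp: "valid_path g" unfolding g_def ld by (intro valid_path_join) auto
  moreover have ends: "pathstart g = Complex \<sigma> (- T)" "pathfinish g = Complex \<sigma> T" by (auto simp: g_def ld)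
  moreover have "path_image g \<inter> vertical_rays \<sigma> T = {pathstart g, pathfinish g}"
  proof
    show "path_image g \<inter> vertical_rays \<sigma> T \<subseteq> {pathstart g, pathfinish g}"
      unfolding pi ends using im sN T0 by (auto simp: vertical_rays_def complex_eq_iff simp del: path_image_linepath)
    show "{pathstart g, pathfinish g} \<subseteq> path_image g \<inter> vertical_rays \<sigma> T"
      using pathstart_in_path_image[of g] pathfinish_in_path_image[of g] T0 by (auto simp: ends vertical_rays_def)
  qed
  moreover have "left_of (path_image g \<union> vertical_rays \<sigma> T) (lam l - of_nat k)" if l: "l \<in> {1..n}" for l k
  proof -
    define A where "A = {s::complex. Im s < T} \<inter> {s. Im s > - T} \<inter> {s. Re s < N}"
    have "convex A" unfolding A_def by (intro convex_Int convex_halfspace_Im_lt convex_halfspace_Im_gt convex_halfspace_Re_lt)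
    hence cA: "connected A" by (rule convex_connected)
    have sub: "A \<subseteq> - (path_image g \<union> vertical_rays \<sigma> T)"
      unfolding pi A_def vertical_rays_def using im by fastforce
    have "lam l - of_nat k \<in> A" using lam[OF l] by (auto simp: A_def)
    moreover have "of_real r \<in> A" if "r < N" for r using that T0 by (simp add: A_def)
    ultimately show ?thesis unfolding left_of_def connected_component_def using cA sub by blast
  qed
  ultimately have "H_contour n lam \<sigma> T g" unfolding H_contour_def using T0 by (auto simp: \<sigma>_def)
  thus ?thesis by blast
qed

section \<open>The H-Bessel function\<close>

definition mellin_integrand :: "nat \<Rightarrow> (nat \<Rightarrow> complex) \<Rightarrow> complex \<Rightarrow> complex \<Rightarrow> complex" where
  "mellin_integrand n lam \<omega> s = Gamma_prod n lam s * exp (- (s * (of_nat n * \<omega>)))"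

text \<open>As the lambda_l sum to 0, the exponential factors multiply to e^(i xi pi n s / 2), which
  is the rotation of log x by -i xi pi/2.\<close>

lemma H_integrand_eq_mellin:
  assumes lam: "(\<Sum>l=1..n. lam l) = 0" and x: "x > 0"
  shows "H_integrand \<xi> n lam x = mellin_integrand n lam (of_real (ln x) - \<i> * \<xi> * of_real (pi / 2))"
proof
  fix s
  have "(\<Prod>l=1..n. e (\<xi> * ((s - lam l) / 4))) = exp (\<Sum>l=1..n. 2 * of_real pi * \<i> * (\<xi> * ((s - lam l) / 4)))"
    unfolding e_def by (rule exp_sum[symmetric]) simp
  also have "(\<Sum>l=1..n. 2 * of_real pi * \<i> * (\<xi> * ((s - lam l) / 4))) = (of_real pi / 2 * \<i> * \<xi>) * (\<Sum>l=1..n. s - lam l)"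
    unfolding sum_distrib_left by (intro sum.cong refl) (simp add: field_simps)
  also have "(\<Sum>l=1..n. s - lam l) = of_nat n * s" using lam by (simp add: sum_subtractf)
  finally have E: "(\<Prod>l=1..n. e (\<xi> * ((s - lam l) / 4))) = exp (of_real pi / 2 * \<i> * \<xi> * (of_nat n * s))" .
  have P: "of_real x powr (- (of_nat n * s)) = exp (- (of_nat n * s) * of_real (ln x))"
    using x by (simp add: powr_def Ln_of_real)
  have "exp (of_real pi / 2 * \<i> * \<xi> * (of_nat n * s)) * exp (- (of_nat n * s) * of_real (ln x)) =
     exp (- (s * (of_nat n * (of_real (ln x) - \<i> * \<xi> * of_real (pi / 2)))))"
    unfolding exp_add[symmetric] by (rule arg_cong[of _ _ exp]) (simp add: algebra_simps)
  thus "H_integrand \<xi> n lam x s = mellin_integrand n lam (of_real (ln x) - \<i> * \<xi> * of_real (pi / 2)) s"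
    unfolding H_integrand_def prod.distrib E P mellin_integrand_def Gamma_prod_def by (simp only: mult.assoc)
qed

lemma mellin_integrand_holomorphic: "mellin_integrand n lam \<omega> holomorphic_on gamma_dom n lam"
  unfolding mellin_integrand_def[abs_def] by (intro holomorphic_intros Gamma_prod_holomorphic_dom)

lemma mellin_integral_continuous:
  assumes "continuous_on {a..b::real} \<gamma>" "\<gamma> ` {a..b} \<subseteq> gamma_dom n lam"
  shows "continuous_on UNIV (\<lambda>\<omega>. integral {a..b} (\<lambda>t. mellin_integrand n lam \<omega> (\<gamma> t)))"
proof -
  have G: "continuous_on {a..b} (\<lambda>t. Gamma_prod n lam (\<gamma> t))"
    by (rule continuous_on_compose2[OF holomorphic_on_imp_continuous_on[OF Gamma_prod_holomorphic_dom] assms])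
  have "continuous_on (UNIV \<times> {a..b}) (\<lambda>p. Gamma_prod n lam (\<gamma> (snd p)) * exp (- (\<gamma> (snd p) * (of_nat n * fst p))))"
    by (intro continuous_intros continuous_on_compose2[OF G] continuous_on_compose2[OF assms(1)]) auto
  hence "continuous_on (UNIV \<times> cbox a b) (\<lambda>(\<omega>, t). mellin_integrand n lam \<omega> (\<gamma> t))"
    by (simp add: case_prod_beta' mellin_integrand_def)
  thus ?thesis using integral_continuous_on_param by fastforce
qed

lemma gamma_dom_Im: "(\<Sum>l=1..n. \<bar>Im (lam l)\<bar>) < \<bar>Im s\<bar> \<Longrightarrow> s \<in> gamma_dom n lam"
proof (rule ccontr)
  assume b: "(\<Sum>l=1..n. \<bar>Im (lam l)\<bar>) < \<bar>Im s\<bar>" and "s \<notin> gamma_dom n lam"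
  then obtain l k where "l \<in> {1..n}" "s = lam l - of_nat k" by (auto simp: not_gamma_dom)
  moreover from this(1) have "\<bar>Im (lam l)\<bar> \<le> (\<Sum>l=1..n. \<bar>Im (lam l)\<bar>)" by (intro member_le_sum) auto
  ultimately show False using b by simp
qed

lemma gamma_dom_Re: "(\<And>l. l \<in> {1..n} \<Longrightarrow> Re (lam l) < Re s) \<Longrightarrow> s \<in> gamma_dom n lam"
  by (rule ccontr) (auto simp: not_gamma_dom, smt (verit) of_nat_0_le_iff)

lemma norm_mellin_exp: "cmod (exp (- (s * (of_nat n * \<omega>)))) = exp (real n * (Im s * Im \<omega> - Re s * Re \<omega>))"
  by (simp add: algebra_simps)

lemma integrable_abs_powr_tail:
  assumes T: "T > 0" and p: "p < (- 1 :: real)"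
  shows "integrable lborel (\<lambda>t. indicator {t. T \<le> \<bar>t\<bar>} t *\<^sub>R (\<bar>t\<bar> powr p))"
proof -
  have i: "(\<lambda>x. x powr p) integrable_on {T..}" using has_integral_powr_to_inf[OF p T] by (rule has_integral_integrable)
  hence "set_integrable lebesgue {T..} (\<lambda>x. x powr p)"
    using T by (intro nonnegative_absolutely_integrable_1) auto
  hence "integrable lborel (\<lambda>x. indicator {T..} x *\<^sub>R (x powr p))"
    unfolding set_integrable_def by (subst (asm) integrable_completion) auto
  note 1 = this
  have 2: "integrable lborel (\<lambda>x. indicator {T..} (- x) *\<^sub>R ((- x) powr p))"
    using lborel_integrable_real_affine[OF 1, of "- 1" 0] by simp
  show ?thesis
  proof (rule Bochner_Integration.integrable_bound[OF Bochner_Integration.integrable_add[OF 1 2]])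
    show "AE x in lborel. norm (indicator {t. T \<le> \<bar>t\<bar>} x *\<^sub>R (\<bar>x\<bar> powr p)) \<le> norm (indicator {T..} x *\<^sub>R (x powr p) + indicator {T..} (- x) *\<^sub>R ((- x) powr p))"
      using T by (intro AE_I2) (auto simp: indicator_def abs_if)
  qed simp
qed

section \<open>The contour integral on the closed strip\<close>

context
  fixes n :: nat and lam :: "nat \<Rightarrow> complex" and \<sigma> T :: real and g :: "real \<Rightarrow> complex"
  assumes n: "n \<ge> 2" and lam: "(\<Sum>l=1..n. lam l) = 0" and H: "H_contour n lam \<sigma> T g"
begin

text \<open>With zero sum of the lambda_l, the condition on sigma is exactly integrability at
  infinity of |t|^(n(sigma - 1/2)).\<close>

lemma H_contour_T: "T > 0" and H_contour_sigma: "real n * (\<sigma> - 1/2) < - 1"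
proof -
  show "T > 0" using H by (simp add: H_contour_def)
  have "\<sigma> < 1 / 2 + (Re (\<Sum>l=1..n. lam l) - 1) / real n" using H unfolding H_contour_def by blast
  hence "\<sigma> < 1/2 + - 1 / real n" unfolding lam by simp
  hence "real n * (\<sigma> - 1/2) < real n * (- 1 / real n)" using n by (intro mult_strict_left_mono) auto
  thus "real n * (\<sigma> - 1/2) < - 1" using n by simp
qed

lemma H_contour_gamma_dom: "path_image g \<union> vertical_rays \<sigma> T \<subseteq> gamma_dom n lam"
proof
  fix s assume s: "s \<in> path_image g \<union> vertical_rays \<sigma> T"
  show "s \<in> gamma_dom n lam"
  proof (rule ccontr)
    assume "s \<notin> gamma_dom n lam"
    hence "left_of (path_image g \<union> vertical_rays \<sigma> T) s" using H unfolding not_gamma_dom H_contour_def by blast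
    then obtain R where R: "\<forall>r<R. connected_component (- (path_image g \<union> vertical_rays \<sigma> T)) s (of_real r)"
      unfolding left_of_def by blast
    have "R - 1 < R" by simp
    with R have "connected_component (- (path_image g \<union> vertical_rays \<sigma> T)) s (of_real (R - 1))" by blast
    thus False using s connected_component_in by blast
  qed
qed

lemma ray_gamma_dom: "T \<le> \<bar>t\<bar> \<Longrightarrow> Complex \<sigma> t \<in> gamma_dom n lam"
  using H_contour_gamma_dom by (auto simp: vertical_rays_def)

text \<open>The growth e^(n pi |t| / 2) allowed at |Im omega| = pi/2 is offset by the decay of the
  Gamma product, and the integrable power |t|^p remains. One dominating function for the closed
  strip, with Re omega bounded, is what the passage to the boundary needs.\<close>

lemma ray_bound:
  "\<exists>D. integrable lborel D \<and> (\<forall>\<omega> t. \<bar>Im \<omega>\<bar> \<le> pi / 2 \<and> \<bar>Re \<omega>\<bar> \<le> r \<longrightarrow>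
     cmod (indicator {t. T \<le> \<bar>t\<bar>} t *\<^sub>R mellin_integrand n lam \<omega> (Complex \<sigma> t)) \<le> D t)"
proof -
  define p where "p = real n * (\<sigma> - 1/2)"
  have p: "p < - 1" unfolding p_def by (rule H_contour_sigma)
  have sl: "(\<Sum>l=1..n. Re (lam l)) = 0" using arg_cong[OF lam, of Re] by simp
  obtain C T1 where C: "C > 0" "T1 \<ge> 1" "\<forall>s. \<bar>Re s\<bar> \<le> \<bar>\<sigma>\<bar> \<and> \<bar>Im s\<bar> \<ge> T1 \<longrightarrow>
     cmod (\<Prod>l=1..n. Gamma (s - lam l)) \<le>
       C * \<bar>Im s\<bar> powr (real n * (Re s - 1/2) - (\<Sum>l=1..n. Re (lam l))) * exp (- real n * pi * \<bar>Im s\<bar> / 2)"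
    using Gamma_prod_bound[where B = "\<bar>\<sigma>\<bar>" and m = n and lam = lam] by blast
  define X where "X = exp (real n * (\<bar>\<sigma>\<bar> * r))"
  define Y where "Y = (\<lambda>t::real. exp (real n * pi * \<bar>t\<bar> / 2))"
  have E: "cmod (exp (- (Complex \<sigma> t * (of_nat n * \<omega>)))) \<le> X * Y t" if "\<bar>Im \<omega>\<bar> \<le> pi / 2" "\<bar>Re \<omega>\<bar> \<le> r" for \<omega> t
  proof -
    have "\<bar>t * Im \<omega>\<bar> \<le> \<bar>t\<bar> * (pi / 2)" unfolding abs_mult using that(1) by (intro mult_left_mono) auto
    moreover have "\<bar>\<sigma> * Re \<omega>\<bar> \<le> \<bar>\<sigma>\<bar> * r" unfolding abs_mult using that(2) by (intro mult_left_mono) auto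
    ultimately have "t * Im \<omega> - \<sigma> * Re \<omega> \<le> \<bar>\<sigma>\<bar> * r + \<bar>t\<bar> * (pi / 2)" by linarith
    hence "real n * (t * Im \<omega> - \<sigma> * Re \<omega>) \<le> real n * (\<bar>\<sigma>\<bar> * r + \<bar>t\<bar> * (pi / 2))" by (intro mult_left_mono) auto
    also have "\<dots> = real n * (\<bar>\<sigma>\<bar> * r) + real n * pi * \<bar>t\<bar> / 2" by (simp add: algebra_simps)
    finally show ?thesis unfolding norm_mellin_exp X_def Y_def exp_add[symmetric] by simp
  qed
  have "compact {t. T \<le> \<bar>t\<bar> \<and> \<bar>t\<bar> \<le> T1}"
  proof -
    have "{t. T \<le> \<bar>t\<bar> \<and> \<bar>t\<bar> \<le> T1} = {t. T \<le> \<bar>t\<bar>} \<inter> {- T1..T1}" by (auto simp: abs_le_iff)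
    moreover have "closed {t::real. T \<le> \<bar>t\<bar>}" by (intro closed_Collect_le continuous_intros)
    ultimately show ?thesis by (auto intro: closed_Int_compact)
  qed
  moreover have cont: "continuous_on {t. T \<le> \<bar>t\<bar>} (\<lambda>t. Gamma_prod n lam (Complex \<sigma> t))"
    by (rule continuous_on_compose2[OF holomorphic_on_imp_continuous_on[OF Gamma_prod_holomorphic_dom]])
      (use ray_gamma_dom in \<open>auto intro!: continuous_intros simp: Complex_eq\<close>)
  ultimately have "bounded ((\<lambda>t. Gamma_prod n lam (Complex \<sigma> t)) ` {t. T \<le> \<bar>t\<bar> \<and> \<bar>t\<bar> \<le> T1})"
    by (intro compact_imp_bounded compact_continuous_image continuous_on_subset[OF cont]) auto
  then obtain K where K: "K > 0" "\<forall>s\<in>(\<lambda>t. Gamma_prod n lam (Complex \<sigma> t)) ` {t. T \<le> \<bar>t\<bar> \<and> \<bar>t\<bar> \<le> T1}. cmod s \<le> K"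
    unfolding bounded_pos by blast
  \<comment> \<open>The second summand covers the compact range T <= |t| <= T1 below the reach of
    \<open>Gamma_prod_bound\<close>; since p < 0, the factor T1^(-p) compensates |t|^p
    there.\<close>
  define A where "A = X * (C + K * Y T1 * T1 powr (- p))"
  define D where "D = (\<lambda>t. A * (indicator {t. T \<le> \<bar>t\<bar>} t *\<^sub>R (\<bar>t\<bar> powr p)))"
  have "integrable lborel D" unfolding D_def by (intro integrable_mult_right integrable_abs_powr_tail H_contour_T p)
  moreover have "cmod (indicator {t. T \<le> \<bar>t\<bar>} t *\<^sub>R mellin_integrand n lam \<omega> (Complex \<sigma> t)) \<le> D t"
    if \<omega>: "\<bar>Im \<omega>\<bar> \<le> pi / 2" "\<bar>Re \<omega>\<bar> \<le> r" for \<omega> t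
  proof (cases "T \<le> \<bar>t\<bar>")
    case True
    have X0: "X > 0" "Y t > 0" "Y T1 > 0" by (auto simp: X_def Y_def)
    have "cmod (mellin_integrand n lam \<omega> (Complex \<sigma> t)) \<le> cmod (Gamma_prod n lam (Complex \<sigma> t)) * (X * Y t)"
      unfolding mellin_integrand_def norm_mult[of "Gamma_prod _ _ _"] using E[OF \<omega>] by (intro mult_left_mono) auto
    also have "\<dots> \<le> A * \<bar>t\<bar> powr p"
    proof (cases "T1 \<le> \<bar>t\<bar>")
      case T1: True
      have "cmod (Gamma_prod n lam (Complex \<sigma> t)) \<le> C * \<bar>t\<bar> powr p * inverse (Y t)"
        using C(3)[rule_format, of "Complex \<sigma> t"] T1 unfolding Gamma_prod_def p_def Y_def exp_minus[symmetric] sl by simp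
      hence "cmod (Gamma_prod n lam (Complex \<sigma> t)) * (X * Y t) \<le> C * \<bar>t\<bar> powr p * inverse (Y t) * (X * Y t)"
        using X0 by (intro mult_right_mono) auto
      also have "\<dots> = X * C * \<bar>t\<bar> powr p" using X0 by simp
      also have "\<dots> \<le> A * \<bar>t\<bar> powr p" unfolding A_def using X0 K(1) by (intro mult_right_mono mult_left_mono) auto
      finally show ?thesis .
    next
      case False
      have "cmod (Gamma_prod n lam (Complex \<sigma> t)) \<le> K" using K(2) True False by auto
      moreover have "Y t \<le> Y T1" using False n by (simp add: Y_def)
      ultimately have "cmod (Gamma_prod n lam (Complex \<sigma> t)) * (X * Y t) \<le> K * (X * Y T1)"
        using X0 K(1) by (intro mult_mono) auto
      also have "\<dots> = X * (K * Y T1 * T1 powr (- p)) * T1 powr p"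
        using C(2) by (simp add: powr_minus field_simps)
      also have "\<dots> \<le> X * (K * Y T1 * T1 powr (- p)) * \<bar>t\<bar> powr p"
        using X0 K(1) p False True H_contour_T by (intro mult_left_mono powr_mono2') auto
      also have "\<dots> \<le> A * \<bar>t\<bar> powr p" unfolding A_def using X0 C(1) by (intro mult_right_mono mult_left_mono) auto
      finally show ?thesis .
    qed
    finally show ?thesis using True by (simp add: D_def)
  qed (simp add: D_def)
  ultimately show ?thesis by blast
qed

lemma ray_measurable: "(\<lambda>t. indicator {t. T \<le> \<bar>t\<bar>} t *\<^sub>R mellin_integrand n lam \<omega> (Complex \<sigma> t)) \<in> borel_measurable lborel"
proof -
  have "continuous_on {t. T \<le> \<bar>t\<bar>} (\<lambda>t. mellin_integrand n lam \<omega> (Complex \<sigma> t))"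
    by (rule continuous_on_compose2[OF holomorphic_on_imp_continuous_on[OF mellin_integrand_holomorphic]])
      (use ray_gamma_dom in \<open>auto intro!: continuous_intros simp: Complex_eq\<close>)
  moreover have "closed {t::real. T \<le> \<bar>t\<bar>}" by (intro closed_Collect_le continuous_intros)
  ultimately show ?thesis using borel_measurable_continuous_on_indicator[OF borel_closed] by simp
qed

lemma ray_integrable:
  assumes "\<bar>Im \<omega>\<bar> \<le> pi / 2" and A: "A \<in> sets borel" "A \<subseteq> {t. T \<le> \<bar>t\<bar>}"
  shows "set_integrable lborel A (\<lambda>t. mellin_integrand n lam \<omega> (Complex \<sigma> t))"
proof -
  obtain D where D: "integrable lborel D" "\<forall>\<omega>' t. \<bar>Im \<omega>'\<bar> \<le> pi / 2 \<and> \<bar>Re \<omega>'\<bar> \<le> \<bar>Re \<omega>\<bar> \<longrightarrow>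
     cmod (indicator {t. T \<le> \<bar>t\<bar>} t *\<^sub>R mellin_integrand n lam \<omega>' (Complex \<sigma> t)) \<le> D t"
    using ray_bound[of "\<bar>Re \<omega>\<bar>"] by blast
  have "set_integrable lborel {t. T \<le> \<bar>t\<bar>} (\<lambda>t. mellin_integrand n lam \<omega> (Complex \<sigma> t))"
    unfolding set_integrable_def
  proof (rule Bochner_Integration.integrable_bound[OF D(1) ray_measurable], rule AE_I2)
    show "norm (indicator {t. T \<le> \<bar>t\<bar>} t *\<^sub>R mellin_integrand n lam \<omega> (Complex \<sigma> t)) \<le> norm (D t)" for t
      unfolding real_norm_def using assms(1) by (intro order_trans[OF D(2)[rule_format, of \<omega> t] abs_ge_self]) auto
  qed
  thus ?thesis by (rule set_integrable_subset) (use A in auto)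
qed

definition "ray_int \<omega> = set_lebesgue_integral lborel {..- T} (\<lambda>t. mellin_integrand n lam \<omega> (Complex \<sigma> t))
   + set_lebesgue_integral lborel {T..} (\<lambda>t. mellin_integrand n lam \<omega> (Complex \<sigma> t))"

lemma contour_line_integral_eq:
  "contour_line_integral \<sigma> T g (mellin_integrand n lam \<omega>) = \<i> * ray_int \<omega> + contour_integral g (mellin_integrand n lam \<omega>)"
  unfolding contour_line_integral_def ray_int_def set_integral_mult_left by (simp add: algebra_simps)

lemma ray_int_eq:
  assumes "\<bar>Im \<omega>\<bar> \<le> pi / 2"
  shows "ray_int \<omega> = (\<integral>t. indicator {t. T \<le> \<bar>t\<bar>} t *\<^sub>R mellin_integrand n lam \<omega> (Complex \<sigma> t) \<partial>lborel)"
proof -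
  have "indicator {..- T} t *\<^sub>R f + indicator {T..} t *\<^sub>R f = indicator {t. T \<le> \<bar>t\<bar>} t *\<^sub>R f" for t and f :: complex
    using H_contour_T by (auto simp: indicator_def)
  note eq = this
  have sub: "{..- T} \<subseteq> {t. T \<le> \<bar>t\<bar>}" "{T..} \<subseteq> {t. T \<le> \<bar>t\<bar>}" by auto
  have 1: "integrable lborel (\<lambda>t. indicator {..- T} t *\<^sub>R mellin_integrand n lam \<omega> (Complex \<sigma> t))"
    using ray_integrable[OF assms _ sub(1)] by (simp add: set_integrable_def)
  have 2: "integrable lborel (\<lambda>t. indicator {T..} t *\<^sub>R mellin_integrand n lam \<omega> (Complex \<sigma> t))"
    using ray_integrable[OF assms _ sub(2)] by (simp add: set_integrable_def)
  show ?thesis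
    unfolding ray_int_def set_lebesgue_integral_def Bochner_Integration.integral_add[OF 1 2, symmetric] eq ..
qed

lemma ray_int_limit:
  assumes "\<bar>Im \<omega>\<bar> \<le> pi / 2"
  shows "((\<lambda>T'. integral {- T'..- T} (\<lambda>t. mellin_integrand n lam \<omega> (Complex \<sigma> t)) + integral {T..T'} (\<lambda>t. mellin_integrand n lam \<omega> (Complex \<sigma> t))) \<longlongrightarrow> ray_int \<omega>) at_top"
proof -
  let ?q = "\<lambda>t. mellin_integrand n lam \<omega> (Complex \<sigma> t)"
  have lim: "((\<lambda>T'. integral (A \<inter> {- T'..T'}) ?q) \<longlongrightarrow> set_lebesgue_integral lborel A ?q) at_top"
    if A: "A \<in> sets borel" "A \<subseteq> {t. T \<le> \<bar>t\<bar>}" for A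
  proof -
    have "integral {- T'..T'} (\<lambda>t. indicator A t *\<^sub>R ?q t) = integral (A \<inter> {- T'..T'}) ?q" for T'
      unfolding integral_restrict_Int[symmetric] by (intro integral_cong) (auto simp: indicator_def)
    thus ?thesis
      using integral_symmetric_limit[of "\<lambda>t. indicator A t *\<^sub>R ?q t"] ray_integrable[OF assms A]
      by (simp add: set_integrable_def set_lebesgue_integral_def)
  qed
  have "((\<lambda>T'. integral ({..- T} \<inter> {- T'..T'}) ?q + integral ({T..} \<inter> {- T'..T'}) ?q) \<longlongrightarrow> ray_int \<omega>) at_top"
    unfolding ray_int_def using H_contour_T by (intro tendsto_add lim) auto
  moreover have "\<forall>\<^sub>F T' in at_top. integral ({..- T} \<inter> {- T'..T'}) ?q + integral ({T..} \<inter> {- T'..T'}) ?q = integral {- T'..- T} ?q + integral {T..T'} ?q"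
    using eventually_ge_at_top[of T]
  proof eventually_elim
    case (elim T')
    have "{..- T} \<inter> {- T'..T'} = {- T'..- T}" "{T..} \<inter> {- T'..T'} = {T..T'}" using elim H_contour_T by auto
    thus ?case by (simp only:)
  qed
  ultimately show ?thesis by (rule Lim_transform_eventually)
qed

text \<open>In the open strip a rate delta > 0 of exponential decay remains and beats every power of
  T'; s = +-1 treats both horizontal sides together.\<close>

lemma horizontal_limit:
  assumes \<omega>: "\<bar>Im \<omega>\<bar> < pi / 2" and N: "\<sigma> < N" and s: "s \<in> {1, - 1}"
  shows "((\<lambda>T'. contour_integral (linepath (Complex \<sigma> (s * T')) (Complex N (s * T'))) (mellin_integrand n lam \<omega>)) \<longlongrightarrow> 0) at_top"
proof -
  define B where "B = \<bar>\<sigma>\<bar> + \<bar>N\<bar>"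
  define P where "P = real n * (B + 1/2)"
  define \<delta> where "\<delta> = real n * (pi / 2 - \<bar>Im \<omega>\<bar>)"
  have d: "\<delta> > 0" using \<omega> n by (simp add: \<delta>_def)
  have sl: "(\<Sum>l=1..n. Re (lam l)) = 0" using arg_cong[OF lam, of Re] by simp
  obtain C T1 where C: "C > 0" "T1 \<ge> 1" "\<forall>s. \<bar>Re s\<bar> \<le> B \<and> \<bar>Im s\<bar> \<ge> T1 \<longrightarrow>
     cmod (\<Prod>l=1..n. Gamma (s - lam l)) \<le>
       C * \<bar>Im s\<bar> powr (real n * (Re s - 1/2) - (\<Sum>l=1..n. Re (lam l))) * exp (- real n * pi * \<bar>Im s\<bar> / 2)"
    using Gamma_prod_bound[where B = B and m = n and lam = lam] by blast
  define X where "X = exp (real n * (B * \<bar>Re \<omega>\<bar>))"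
  have bound: "cmod (mellin_integrand n lam \<omega> u) \<le> C * X * (T' powr P * exp (- \<delta> * T'))"
    if u: "\<bar>Re u\<bar> \<le> B" "\<bar>Im u\<bar> = T'" and T': "T1 \<le> T'" for u T'
  proof -
    have "cmod (Gamma_prod n lam u) \<le> C * T' powr (real n * (Re u - 1/2)) * exp (- real n * pi * T' / 2)"
      using C(3)[rule_format, of u] u T' unfolding Gamma_prod_def sl by simp
    also have "\<dots> \<le> C * T' powr P * exp (- real n * pi * T' / 2)"
      unfolding P_def using C u T' by (intro mult_right_mono mult_left_mono powr_mono) auto
    finally have 1: "cmod (Gamma_prod n lam u) \<le> C * T' powr P * exp (- real n * pi * T' / 2)" .
    have "Im u * Im \<omega> \<le> T' * \<bar>Im \<omega>\<bar>" unfolding u(2)[symmetric] abs_mult[symmetric] by (rule abs_ge_self)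
    moreover have "- (Re u * Re \<omega>) \<le> B * \<bar>Re \<omega>\<bar>"
      using mult_right_mono[OF u(1), of "\<bar>Re \<omega>\<bar>"] abs_ge_minus_self[of "Re u * Re \<omega>"] by (simp add: abs_mult)
    ultimately have "Im u * Im \<omega> - Re u * Re \<omega> \<le> B * \<bar>Re \<omega>\<bar> + T' * \<bar>Im \<omega>\<bar>" by linarith
    hence "real n * (Im u * Im \<omega> - Re u * Re \<omega>) \<le> real n * (B * \<bar>Re \<omega>\<bar> + T' * \<bar>Im \<omega>\<bar>)" by (intro mult_left_mono) auto
    hence 2: "cmod (exp (- (u * (of_nat n * \<omega>)))) \<le> X * exp (real n * (T' * \<bar>Im \<omega>\<bar>))"
      unfolding norm_mellin_exp X_def exp_add[symmetric] by (simp add: distrib_left)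
    have "cmod (mellin_integrand n lam \<omega> u) \<le> (C * T' powr P * exp (- real n * pi * T' / 2)) * (X * exp (real n * (T' * \<bar>Im \<omega>\<bar>)))"
      unfolding mellin_integrand_def norm_mult[of "Gamma_prod _ _ _"] using 1 2 C(1) by (intro mult_mono) auto
    also have "\<dots> = C * X * (T' powr P * (exp (- real n * pi * T' / 2) * exp (real n * (T' * \<bar>Im \<omega>\<bar>))))" by (simp only: mult_ac)
    also have "exp (- real n * pi * T' / 2) * exp (real n * (T' * \<bar>Im \<omega>\<bar>)) = exp (- \<delta> * T')"
      unfolding exp_add[symmetric] by (rule arg_cong[of _ _ exp]) (simp add: \<delta>_def algebra_simps)
    finally show ?thesis .
  qed
  show ?thesis
  proof (rule Lim_null_comparison)
    show "\<forall>\<^sub>F T' in at_top. norm (contour_integral (linepath (Complex \<sigma> (s * T')) (Complex N (s * T'))) (mellin_integrand n lam \<omega>)) \<le> C * X * (T' powr P * exp (- \<delta> * T')) * (N - \<sigma>)"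
      using eventually_ge_at_top[of "T1 + (\<Sum>l=1..n. \<bar>Im (lam l)\<bar>)"]
    proof eventually_elim
      case (elim T')
      have "0 \<le> (\<Sum>l=1..n. \<bar>Im (lam l)\<bar>)" by (intro sum_nonneg) auto
      hence T': "T1 \<le> T'" "(\<Sum>l=1..n. \<bar>Im (lam l)\<bar>) < T'" "0 < T'" using elim C(2) by linarith+
      have seg: "closed_segment (Complex \<sigma> (s * T')) (Complex N (s * T')) \<subseteq> {u. \<bar>Re u\<bar> \<le> B \<and> \<bar>Im u\<bar> = T'}"
        using linepath_same_Im_image[of \<sigma> "s * T'" N] N s T'(3) by (auto simp: B_def abs_mult)
      have dom: "{u. \<bar>Re u\<bar> \<le> B \<and> \<bar>Im u\<bar> = T'} \<subseteq> gamma_dom n lam"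
        using T'(2) by (auto intro: gamma_dom_Im)
      have "cmod (contour_integral (linepath (Complex \<sigma> (s * T')) (Complex N (s * T'))) (mellin_integrand n lam \<omega>)) \<le>
         C * X * (T' powr P * exp (- \<delta> * T')) * cmod (Complex N (s * T') - Complex \<sigma> (s * T'))"
      proof (rule contour_integral_bound_linepath)
        show "mellin_integrand n lam \<omega> contour_integrable_on linepath (Complex \<sigma> (s * T')) (Complex N (s * T'))"
          using seg dom by (intro contour_integrable_holomorphic_simple[OF mellin_integrand_holomorphic open_gamma_dom]) auto
        show "0 \<le> C * X * (T' powr P * exp (- \<delta> * T'))" using C(1) by (simp add: X_def)
        show "cmod (mellin_integrand n lam \<omega> x) \<le> C * X * (T' powr P * exp (- \<delta> * T'))"
          if "x \<in> closed_segment (Complex \<sigma> (s * T')) (Complex N (s * T'))" for x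
          using that seg T'(1) by (intro bound) auto
      qed
      moreover have "cmod (Complex N (s * T') - Complex \<sigma> (s * T')) = N - \<sigma>" using N by (simp add: cmod_def)
      ultimately show ?case by simp
    qed
    have "((\<lambda>T'. T' powr P * exp (- \<delta> * T')) \<longlongrightarrow> 0) at_top" using d by real_asymp
    from tendsto_mult[OF tendsto_mult[OF tendsto_const[of "C * X"] this] tendsto_const[of "N - \<sigma>"]]
    show "((\<lambda>T'. C * X * (T' powr P * exp (- \<delta> * T')) * (N - \<sigma>)) \<longlongrightarrow> 0) at_top" by simp
  qed
qed

text \<open>\<open>H_contour_deform\<close> as T' tends to infinity: the horizontal sides vanish and
  leave the line Re s = N, which is then moved to c.\<close>

lemma H_contour_integral_inside:
  assumes \<omega>: "\<bar>Im \<omega>\<bar> < pi / 2" and c: "\<And>l. l \<in> {1..n} \<Longrightarrow> Re (lam l) < c"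
  shows "contour_line_integral \<sigma> T g (mellin_integrand n lam \<omega>) = 2 * of_real pi * \<i> * vline c (Gamma_prod n lam) (of_nat n * \<omega>)"
proof -
  let ?q = "mellin_integrand n lam \<omega>"
  obtain M where M: "\<forall>T' N q. M \<le> T' \<longrightarrow> M \<le> N \<longrightarrow> q holomorphic_on gamma_dom n lam \<longrightarrow>
    contour_integral g q + \<i> * integral {- T'..- T} (\<lambda>t. q (Complex \<sigma> t)) + \<i> * integral {T..T'} (\<lambda>t. q (Complex \<sigma> t)) =
      contour_integral (linepath (Complex \<sigma> (- T')) (Complex N (- T'))) q + \<i> * integral {- T'..T'} (\<lambda>t. q (Complex N t))
      - contour_integral (linepath (Complex \<sigma> T') (Complex N T')) q"
    using H_contour_deform[OF H] by (elim exE)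
  define N where "N = max M (max (\<bar>\<sigma>\<bar> + 1) (c + 1))"
  have N: "M \<le> N" "\<sigma> < N" "c < N" by (auto simp: N_def)
  have e: "\<bar>Im (of_nat n * \<omega>)\<bar> < real n * pi / 2"
    using mult_strict_left_mono[OF \<omega>, of "real n"] n by (simp add: abs_mult)
  have vd: "vdecay c N (real n * pi / 2) (Gamma_prod n lam)" using c N by (intro vdecay_Gamma_prod) auto
  have iN: "integrable lborel (\<lambda>t. ?q (Complex N t))"
    using vline_facts(1)[OF vd _ _ e, of N] N by (simp add: mellin_integrand_def)
  have L: "((\<lambda>T'. contour_integral g ?q + \<i> * (integral {- T'..- T} (\<lambda>t. ?q (Complex \<sigma> t)) + integral {T..T'} (\<lambda>t. ?q (Complex \<sigma> t)))) \<longlongrightarrow>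
     contour_integral g ?q + \<i> * ray_int \<omega>) at_top"
    using \<omega> by (intro tendsto_add tendsto_mult tendsto_const ray_int_limit) auto
  have R: "((\<lambda>T'. contour_integral (linepath (Complex \<sigma> (- 1 * T')) (Complex N (- 1 * T'))) ?q + \<i> * integral {- T'..T'} (\<lambda>t. ?q (Complex N t))
      - contour_integral (linepath (Complex \<sigma> (1 * T')) (Complex N (1 * T'))) ?q) \<longlongrightarrow> 0 + \<i> * (\<integral>t. ?q (Complex N t) \<partial>lborel) - 0) at_top"
    by (intro tendsto_add tendsto_diff tendsto_mult tendsto_const horizontal_limit[OF \<omega> N(2)] integral_symmetric_limit iN) auto
  have "contour_integral g ?q + \<i> * ray_int \<omega> = 0 + \<i> * (\<integral>t. ?q (Complex N t) \<partial>lborel) - 0"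
  proof (rule tendsto_unique[OF _ L])
    have "\<forall>\<^sub>F T' in at_top. contour_integral (linepath (Complex \<sigma> (- 1 * T')) (Complex N (- 1 * T'))) ?q + \<i> * integral {- T'..T'} (\<lambda>t. ?q (Complex N t))
      - contour_integral (linepath (Complex \<sigma> (1 * T')) (Complex N (1 * T'))) ?q =
      contour_integral g ?q + \<i> * (integral {- T'..- T} (\<lambda>t. ?q (Complex \<sigma> t)) + integral {T..T'} (\<lambda>t. ?q (Complex \<sigma> t)))"
      using eventually_ge_at_top[of M]
    proof eventually_elim
      case (elim T')
      show ?case using M[rule_format, OF elim N(1) mellin_integrand_holomorphic, of \<omega>] by (simp add: algebra_simps)
    qed
    from Lim_transform_eventually[OF R this]
    show "((\<lambda>T'. contour_integral g ?q + \<i> * (integral {- T'..- T} (\<lambda>t. ?q (Complex \<sigma> t)) + integral {T..T'} (\<lambda>t. ?q (Complex \<sigma> t)))) \<longlongrightarrow> 0 + \<i> * (\<integral>t. ?q (Complex N t) \<partial>lborel) - 0) at_top" .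
  qed simp
  moreover have "(\<integral>t. ?q (Complex N t) \<partial>lborel) = 2 * of_real pi * vline N (Gamma_prod n lam) (of_nat n * \<omega>)"
    by (simp add: vline_def mellin_integrand_def)
  moreover have "vline c (Gamma_prod n lam) (of_nat n * \<omega>) = vline N (Gamma_prod n lam) (of_nat n * \<omega>)"
  proof (rule vline_contour_shift[OF vd N(3) Gamma_prod_holomorphic[of n lam "Max ((\<lambda>l. Re (lam l)) ` {1..n})"] open_halfspace_Re_gt convex_halfspace_Re_gt _ e])
    have "Max ((\<lambda>l. Re (lam l)) ` {1..n}) < c" using c n by (subst Max_less_iff) auto
    thus "{s. c \<le> Re s \<and> Re s \<le> N} \<subseteq> {s. Max ((\<lambda>l. Re (lam l)) ` {1..n}) < Re s}" by auto
  qed auto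
  ultimately show ?thesis unfolding contour_line_integral_eq by (simp add: algebra_simps)
qed

text \<open>\<open>H_contour_deform\<close> with fixed T' and N rewrites the integral over g through
  straight segments inside \<open>gamma_dom\<close>, where continuity of parameter integrals
  applies.\<close>

lemma contour_integral_mellin_continuous:
  "continuous_on UNIV (\<lambda>\<omega>. contour_integral g (mellin_integrand n lam \<omega>))"
proof -
  obtain M where M: "\<forall>T' N q. M \<le> T' \<longrightarrow> M \<le> N \<longrightarrow> q holomorphic_on gamma_dom n lam \<longrightarrow>
    contour_integral g q + \<i> * integral {- T'..- T} (\<lambda>t. q (Complex \<sigma> t)) + \<i> * integral {T..T'} (\<lambda>t. q (Complex \<sigma> t)) =
      contour_integral (linepath (Complex \<sigma> (- T')) (Complex N (- T'))) q + \<i> * integral {- T'..T'} (\<lambda>t. q (Complex N t))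
      - contour_integral (linepath (Complex \<sigma> T') (Complex N T')) q"
    using H_contour_deform[OF H] by (elim exE)
  have S0: "0 \<le> (\<Sum>l=1..n. \<bar>Im (lam l)\<bar>)" "0 \<le> (\<Sum>l=1..n. \<bar>Re (lam l)\<bar>)" by (auto intro: sum_nonneg)
  define T' where "T' = max M (\<Sum>l=1..n. \<bar>Im (lam l)\<bar>) + 1"
  define N where "N = max M (\<bar>\<sigma>\<bar> + (\<Sum>l=1..n. \<bar>Re (lam l)\<bar>)) + 1"
  have b: "M \<le> T'" "M \<le> N" "(\<Sum>l=1..n. \<bar>Im (lam l)\<bar>) < T'" "(\<Sum>l=1..n. \<bar>Re (lam l)\<bar>) < N" "\<sigma> < N"
    using S0 abs_ge_self[of \<sigma>] abs_ge_zero[of \<sigma>] max.cobounded1[of M "\<bar>\<sigma>\<bar> + (\<Sum>l=1..n. \<bar>Re (lam l)\<bar>)"]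
      max.cobounded2[of "\<bar>\<sigma>\<bar> + (\<Sum>l=1..n. \<bar>Re (lam l)\<bar>)" M] max.cobounded1[of M "\<Sum>l=1..n. \<bar>Im (lam l)\<bar>"]
      max.cobounded2[of "\<Sum>l=1..n. \<bar>Im (lam l)\<bar>" M] unfolding T'_def N_def by linarith+
  have Nd: "Complex N t \<in> gamma_dom n lam" for t
  proof (rule gamma_dom_Re)
    fix l assume "l \<in> {1..n}"
    hence "\<bar>Re (lam l)\<bar> \<le> (\<Sum>l=1..n. \<bar>Re (lam l)\<bar>)" by (intro member_le_sum) auto
    thus "Re (lam l) < Re (Complex N t)" using b(4) by simp
  qed
  have hd: "Complex x T' \<in> gamma_dom n lam" "Complex x (- T') \<in> gamma_dom n lam" for x
    using b(3) S0(1) by (auto intro!: gamma_dom_Im)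
  have sub: "closed_segment (Complex \<sigma> y) (Complex N y) \<subseteq> gamma_dom n lam" if "y = T' \<or> y = - T'" for y
  proof
    fix s assume "s \<in> closed_segment (Complex \<sigma> y) (Complex N y)"
    hence "Im s = y" using linepath_same_Im_image[of \<sigma> y N] by auto
    hence "s = Complex (Re s) y" by (simp add: complex_eq_iff)
    thus "s \<in> gamma_dom n lam" using hd that by metis
  qed
  have lp: "continuous_on UNIV (\<lambda>\<omega>. contour_integral (linepath (Complex \<sigma> y) (Complex N y)) (mellin_integrand n lam \<omega>))"
    if y: "y = T' \<or> y = - T'" for y
  proof -
    let ?l = "linepath (Complex \<sigma> y) (Complex N y)"
    have "contour_integral ?l (mellin_integrand n lam \<omega>) = integral {0..1} (\<lambda>t. mellin_integrand n lam \<omega> (?l t)) * (Complex N y - Complex \<sigma> y)" for \<omega>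
    proof -
      have "mellin_integrand n lam \<omega> contour_integrable_on ?l"
        using sub[OF y] by (intro contour_integrable_holomorphic_simple[OF mellin_integrand_holomorphic open_gamma_dom]) auto
      from integral_unique[OF has_contour_integral_linepath[THEN iffD1, OF has_contour_integral_integral[OF this]]]
      show ?thesis by simp
    qed
    moreover have "continuous_on UNIV (\<lambda>\<omega>. integral {0..1} (\<lambda>t. mellin_integrand n lam \<omega> (?l t)) * (Complex N y - Complex \<sigma> y))"
    proof (intro continuous_intros mellin_integral_continuous)
      show "?l ` {0..1} \<subseteq> gamma_dom n lam" using sub[OF y] path_image_linepath[of "Complex \<sigma> y" "Complex N y"] by (simp add: path_image_def)
    qed
    ultimately show ?thesis by simp
  qed
  have vl: "continuous_on UNIV (\<lambda>\<omega>. integral {a..b} (\<lambda>t. mellin_integrand n lam \<omega> (Complex c t)))"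
    if "\<And>t. t \<in> {a..b} \<Longrightarrow> Complex c t \<in> gamma_dom n lam" for a b c
    using that by (intro mellin_integral_continuous) (auto intro!: continuous_intros simp: Complex_eq)
  have rd: "Complex \<sigma> t \<in> gamma_dom n lam" if "t \<in> {- T'..- T} \<or> t \<in> {T..T'}" for t
    using that H_contour_T by (intro ray_gamma_dom) auto
  have "contour_integral g (mellin_integrand n lam \<omega>) =
     contour_integral (linepath (Complex \<sigma> (- T')) (Complex N (- T'))) (mellin_integrand n lam \<omega>) + \<i> * integral {- T'..T'} (\<lambda>t. mellin_integrand n lam \<omega> (Complex N t))
     - contour_integral (linepath (Complex \<sigma> T') (Complex N T')) (mellin_integrand n lam \<omega>)
     - \<i> * integral {- T'..- T} (\<lambda>t. mellin_integrand n lam \<omega> (Complex \<sigma> t)) - \<i> * integral {T..T'} (\<lambda>t. mellin_integrand n lam \<omega> (Complex \<sigma> t))" for \<omega>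
    using M[rule_format, OF b(1,2) mellin_integrand_holomorphic, of \<omega>] by (simp add: algebra_simps)
  moreover have "continuous_on UNIV (\<lambda>\<omega>. contour_integral (linepath (Complex \<sigma> (- T')) (Complex N (- T'))) (mellin_integrand n lam \<omega>) + \<i> * integral {- T'..T'} (\<lambda>t. mellin_integrand n lam \<omega> (Complex N t))
     - contour_integral (linepath (Complex \<sigma> T') (Complex N T')) (mellin_integrand n lam \<omega>)
     - \<i> * integral {- T'..- T} (\<lambda>t. mellin_integrand n lam \<omega> (Complex \<sigma> t)) - \<i> * integral {T..T'} (\<lambda>t. mellin_integrand n lam \<omega> (Complex \<sigma> t)))"
    by (intro continuous_on_add continuous_on_diff continuous_on_mult continuous_on_const lp vl Nd rd) auto
  ultimately show ?thesis by simp
qed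

text \<open>The boundary point is approached by contracting its imaginary part: the rays converge by
  dominated convergence, the finite part and F by continuity.\<close>

lemma H_contour_integral_boundary:
  assumes \<omega>: "\<bar>Im \<omega>\<bar> = pi / 2" and c: "\<And>l. l \<in> {1..n} \<Longrightarrow> Re (lam l) < c"
    and F: "continuous_on UNIV F" "\<And>\<omega>. \<bar>Im \<omega>\<bar> < pi / 2 \<Longrightarrow> F \<omega> = vline c (Gamma_prod n lam) (of_nat n * \<omega>)"
  shows "contour_line_integral \<sigma> T g (mellin_integrand n lam \<omega>) = 2 * of_real pi * \<i> * F \<omega>"
proof -
  define \<omega>s where "\<omega>s = (\<lambda>k. Complex (Re \<omega>) (Im \<omega> * (1 - 1 / real (Suc k))))"
  have im: "\<bar>Im (\<omega>s k)\<bar> < pi / 2" "Re (\<omega>s k) = Re \<omega>" for k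
  proof -
    have "\<bar>Im (\<omega>s k)\<bar> = pi / 2 * (1 - 1 / real (Suc k))" using \<omega> by (simp add: \<omega>s_def abs_mult)
    also have "\<dots> < pi / 2 * 1" by (intro mult_strict_left_mono) auto
    finally show "\<bar>Im (\<omega>s k)\<bar> < pi / 2" by simp
  qed (simp add: \<omega>s_def)
  have lim: "\<omega>s \<longlonglongrightarrow> \<omega>"
  proof -
    have "(\<lambda>k. Im \<omega> * (1 - 1 / real (Suc k))) \<longlonglongrightarrow> Im \<omega> * (1 - 0)"
      by (intro tendsto_mult tendsto_diff tendsto_const) real_asymp
    from tendsto_Complex[OF tendsto_const[of "Re \<omega>"] this] show ?thesis by (simp add: \<omega>s_def[abs_def])
  qed
  obtain D where D: "integrable lborel D" "\<forall>\<omega>' t. \<bar>Im \<omega>'\<bar> \<le> pi / 2 \<and> \<bar>Re \<omega>'\<bar> \<le> \<bar>Re \<omega>\<bar> \<longrightarrow>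
     cmod (indicator {t. T \<le> \<bar>t\<bar>} t *\<^sub>R mellin_integrand n lam \<omega>' (Complex \<sigma> t)) \<le> D t"
    using ray_bound[of "\<bar>Re \<omega>\<bar>"] by blast
  have "(\<lambda>k. \<integral>t. indicator {t. T \<le> \<bar>t\<bar>} t *\<^sub>R mellin_integrand n lam (\<omega>s k) (Complex \<sigma> t) \<partial>lborel) \<longlonglongrightarrow>
      (\<integral>t. indicator {t. T \<le> \<bar>t\<bar>} t *\<^sub>R mellin_integrand n lam \<omega> (Complex \<sigma> t) \<partial>lborel)"
  proof (rule integral_dominated_convergence[OF ray_measurable ray_measurable D(1)])
    show "AE t in lborel. (\<lambda>k. indicator {t. T \<le> \<bar>t\<bar>} t *\<^sub>R mellin_integrand n lam (\<omega>s k) (Complex \<sigma> t)) \<longlonglongrightarrow>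
       indicator {t. T \<le> \<bar>t\<bar>} t *\<^sub>R mellin_integrand n lam \<omega> (Complex \<sigma> t)"
      unfolding mellin_integrand_def by (intro AE_I2 tendsto_intros lim)
    show "AE t in lborel. norm (indicator {t. T \<le> \<bar>t\<bar>} t *\<^sub>R mellin_integrand n lam (\<omega>s k) (Complex \<sigma> t)) \<le> D t" for k
      using D(2)[rule_format, of "\<omega>s k"] im[of k] by (intro AE_I2) auto
  qed
  hence R: "(\<lambda>k. ray_int (\<omega>s k)) \<longlonglongrightarrow> ray_int \<omega>"
    using im \<omega> by (simp add: ray_int_eq less_imp_le)
  have cc: "(\<lambda>k. f (\<omega>s k)) \<longlonglongrightarrow> f \<omega>" if "continuous_on UNIV f" for f :: "complex \<Rightarrow> complex"
    using continuous_on_tendsto_compose[OF that lim] by simp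
  have L: "(\<lambda>k. contour_line_integral \<sigma> T g (mellin_integrand n lam (\<omega>s k))) \<longlonglongrightarrow> contour_line_integral \<sigma> T g (mellin_integrand n lam \<omega>)"
    unfolding contour_line_integral_eq
    by (intro tendsto_add tendsto_mult tendsto_const R cc[OF contour_integral_mellin_continuous])
  have "contour_line_integral \<sigma> T g (mellin_integrand n lam (\<omega>s k)) = 2 * of_real pi * \<i> * F (\<omega>s k)" for k
    using H_contour_integral_inside[OF im(1) c] F(2)[OF im(1)] by simp
  hence "(\<lambda>k. contour_line_integral \<sigma> T g (mellin_integrand n lam (\<omega>s k))) \<longlonglongrightarrow> 2 * of_real pi * \<i> * F \<omega>"
    using tendsto_mult[OF tendsto_const[of "2 * of_real pi * \<i>"] cc[OF F(1)]] by simp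
  with L show ?thesis by (rule LIMSEQ_unique)
qed

end

text \<open>Both descriptions are resolved. For real z every contour gives the value of F on the
  edge of the strip, and the existence of one contour pins it down; the identity theorem makes the
  entire extension unique.\<close>

lemma H_Bessel_eq:
  assumes n: "n \<ge> 2" and lam: "(\<Sum>l=1..n. lam l) = 0" and \<xi>: "\<xi> \<in> {1, - 1}" and c: "\<And>l. l \<in> {1..n} \<Longrightarrow> Re (lam l) < c"
    and F: "F holomorphic_on UNIV" "\<And>\<omega>. \<bar>Im \<omega>\<bar> < pi / 2 \<Longrightarrow> F \<omega> = vline c (Gamma_prod n lam) (of_nat n * \<omega>)"
  shows "H_Bessel \<xi> n lam \<zeta> = F (\<zeta> - \<i> * \<xi> * of_real (pi / 2))"
proof -
  define s where "s = \<i> * \<xi> * of_real (pi / 2)"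
  have pos: "H_Bessel_pos \<xi> n lam x = F (of_real (ln x) - s)" if x: "x > 0" for x
    unfolding H_Bessel_pos_def H_integrand_eq_mellin[OF lam x]
  proof (rule the_equality)
    have im: "\<bar>Im (of_real (ln x) - s)\<bar> = pi / 2" using \<xi> by (auto simp: s_def)
    have val: "F (of_real (ln x) - s) = 1 / (2 * of_real pi * \<i>) * contour_line_integral \<sigma> T g (mellin_integrand n lam (of_real (ln x) - s))"
      if "H_contour n lam \<sigma> T g" for \<sigma> T g
      using H_contour_integral_boundary[OF n lam that im c holomorphic_on_imp_continuous_on[OF F(1)] F(2)] by simp
    thus "\<forall>\<sigma> T g. H_contour n lam \<sigma> T g \<longrightarrow> F (of_real (ln x) - s) =
       1 / (2 * of_real pi * \<i>) * contour_line_integral \<sigma> T g (mellin_integrand n lam (of_real (ln x) - \<i> * \<xi> * of_real (pi / 2)))"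
      unfolding s_def by blast
    fix h assume h: "\<forall>\<sigma> T g. H_contour n lam \<sigma> T g \<longrightarrow> h =
       1 / (2 * of_real pi * \<i>) * contour_line_integral \<sigma> T g (mellin_integrand n lam (of_real (ln x) - \<i> * \<xi> * of_real (pi / 2)))"
    obtain \<sigma> T g where "H_contour n lam \<sigma> T g" using H_contour_exists[of n lam] n by auto
    with h val show "h = F (of_real (ln x) - s)" unfolding s_def by metis
  qed
  have "H_Bessel \<xi> n lam = (\<lambda>\<zeta>. F (\<zeta> - s))"
    unfolding H_Bessel_def
  proof (rule the_equality)
    have hol: "(\<lambda>\<zeta>. F (\<zeta> - s)) holomorphic_on UNIV"
      by (rule holomorphic_on_compose_gen[OF _ F(1), unfolded o_def]) (auto intro!: holomorphic_intros)
    show *: "(\<lambda>\<zeta>. F (\<zeta> - s)) holomorphic_on UNIV \<and> (\<forall>x>0. F (ureal x - s) = H_Bessel_pos \<xi> n lam x)"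
      using hol pos by (simp add: ureal_def)
    fix G assume G: "G holomorphic_on UNIV \<and> (\<forall>x>0. G (ureal x) = H_Bessel_pos \<xi> n lam x)"
    show "G = (\<lambda>\<zeta>. F (\<zeta> - s))"
    proof
      fix \<zeta>
      define D where "D = (\<lambda>\<zeta>. G \<zeta> - F (\<zeta> - s))"
      have "D \<zeta> = 0"
      proof (rule analytic_continuation[of D UNIV "range of_real" 0])
        show "D holomorphic_on UNIV" unfolding D_def using G hol by (intro holomorphic_intros) auto
        show "0 islimpt range complex_of_real"
          by (rule islimpt_range_of_real)
        show "D z = 0" if "z \<in> range of_real" for z
        proof -
          from that obtain y where y: "z = of_real y" by (rule rangeE)
          have "ureal (exp y) = z" by (simp add: ureal_def y)
          moreover have "G (ureal (exp y)) = F (ureal (exp y) - s)" using G * by simp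
          ultimately show ?thesis by (simp add: D_def)
        qed
      qed auto
      thus "G \<zeta> = F (\<zeta> - s)" by (simp add: D_def)
    qed
  qed
  thus ?thesis by (simp add: s_def)
qed

section \<open>Identification of the two functions\<close>

lemma DP_deriv_shift:
  assumes F: "F holomorphic_on UNIV"
  shows "DP deriv P (\<lambda>\<zeta>. a * F (\<zeta> - s)) \<zeta> = a * DP deriv P F (\<zeta> - s)"
proof -
  have "(deriv ^^ i) (\<lambda>\<zeta>. a * F (\<zeta> - s)) = (\<lambda>\<zeta>. a * (deriv ^^ i) F (\<zeta> - s))" for i
  proof (induction i)
    case (Suc i)
    have "((deriv ^^ i) F has_field_derivative (deriv ^^ Suc i) F z) (at z)" for z
      using holomorphic_derivI[OF holomorphic_higher_deriv[OF F open_UNIV, of i] open_UNIV, of z] by simp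
    note D = DERIV_chain2[where f = "(deriv ^^ i) F" and g = "\<lambda>\<zeta>. \<zeta> - s", OF this]
    have "((\<lambda>\<zeta>. a * (deriv ^^ i) F (\<zeta> - s)) has_field_derivative a * ((deriv ^^ Suc i) F (\<zeta> - s) * 1)) (at \<zeta>)" for \<zeta>
      by (intro DERIV_cmult D) (auto intro!: derivative_eq_intros)
    hence "deriv (\<lambda>\<zeta>. a * (deriv ^^ i) F (\<zeta> - s)) = (\<lambda>\<zeta>. a * (deriv ^^ Suc i) F (\<zeta> - s))"
      by (intro ext) (simp add: DERIV_imp_deriv)
    thus ?case using Suc.IH by simp
  qed simp
  thus ?thesis unfolding DP_def sum_distrib_left by (simp add: mult.left_commute)
qed

text \<open>With A the claimed constant, F/A in the rotated variable meets both conditions that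
  describe \<open>J_Bessel\<close>: the equation by rotating that of F, the expansion by the
  bootstrap.\<close>

lemma J_Bessel_eq:
  assumes n: "n \<ge> 2" and lam: "(\<Sum>l=1..n. lam l) = 0" and \<xi>: "\<xi> \<in> {1, - 1}"
    and c: "\<And>l. l \<in> {1..n} \<Longrightarrow> Re (lam l) < c"
    and F: "F holomorphic_on UNIV" "\<And>\<omega>. \<bar>Im \<omega>\<bar> < pi / 2 \<Longrightarrow> F \<omega> = vline c (Gamma_prod n lam) (of_nat n * \<omega>)"
      "\<And>\<omega>. DP deriv (char_poly n lam) F \<omega> = (- of_nat n) ^ n * exp (of_nat n * \<omega>) * F \<omega>"
  shows "F (\<zeta> - \<i> * \<xi> * of_real (pi / 2)) =
    of_real (real n powr (- 1 / 2)) * two_pi_i_pow \<xi> ((real n - 1) / 2) * J_Bessel n lam \<xi> \<zeta>"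
proof -
  obtain m where m: "n = Suc m" using n by (cases n) auto
  define \<theta> where "\<theta> = pi / 2 - Arg \<xi>"
  have \<theta>: "complex_of_real \<theta> = \<xi> * of_real (pi / 2)" using \<xi> Arg_eq_pi[of "- 1"] by (auto simp: \<theta>_def)
  define s where "s = \<i> * of_real \<theta>"
  have s: "s = \<i> * \<xi> * of_real (pi / 2)" unfolding s_def \<theta> by simp
  define c1 where "c1 = \<i> * of_nat n * \<xi>"
  have exps: "exp (- s) = - \<i> * \<xi>"
  proof -
    have "exp (- s) = cis (- \<theta>)" by (simp add: s_def cis_conv_exp)
    moreover have "(\<xi> = 1 \<and> \<theta> = pi / 2) \<or> (\<xi> = - 1 \<and> \<theta> = - (pi / 2))"
      using \<xi> Arg_eq_pi[of "- 1"] by (auto simp: \<theta>_def)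
    moreover have "cis (- (pi / 2)) = - \<i>" "cis (pi / 2) = \<i>" by (simp_all add: complex_eq_iff)
    ultimately show ?thesis by (elim disjE conjE) (simp_all only: minus_minus mult_1_right mult_minus_right mult_minus_left)
  qed
  have expw: "of_nat n * exp (\<zeta> - s) = - (c1 * exp \<zeta>)" for \<zeta>
    using exps by (simp add: c1_def exp_diff exp_minus divide_inverse)
  \<comment> \<open>The limit in \<open>saddle_profile_limit\<close> at y = 0, namely (2 pi)^(n/2)
    times the density of N(0, n) at 0.\<close>
  define b0 where "b0 = sqrt (2 * pi) ^ n * normal_density 0 (sqrt (real n)) 0"
  have b0: "b0 = real n powr (- 1 / 2) * (2 * pi) powr ((real n - 1) / 2)"
  proof -
    have "b0 = sqrt (2 * pi) ^ m / sqrt (real n)"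
      using n by (simp add: b0_def m normal_density_def real_sqrt_mult)
    also have "sqrt (2 * pi) ^ m = (2 * pi) powr ((real n - 1) / 2)"
    proof -
      have "sqrt (2 * pi) ^ m = sqrt (2 * pi) powr real m" by (simp add: powr_realpow)
      also have "\<dots> = ((2 * pi) powr (1 / 2)) powr real m" by (simp add: powr_half_sqrt)
      finally show ?thesis by (simp add: powr_powr m)
    qed
    moreover have "real n powr (- 1 / 2) = 1 / sqrt (real n)"
      by (simp only: minus_divide_left[symmetric] powr_minus powr_half_sqrt of_nat_0_le_iff inverse_eq_divide)
    ultimately show ?thesis by simp
  qed
  have b0_pos: "b0 > 0" unfolding b0_def using n by (intro mult_pos_pos normal_density_pos zero_less_power) auto
  define A where "A = of_real (real n powr (- 1 / 2)) * two_pi_i_pow \<xi> ((real n - 1) / 2)"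
  have A: "A = of_real b0 * exp (- (Bessel_alpha n * s))"
  proof -
    have "\<xi> * of_real (pi * ((real n - 1) / 2) / 2) * \<i> = - (Bessel_alpha n * s)"
      unfolding s Bessel_alpha_def by (simp add: field_simps)
    thus ?thesis unfolding A_def two_pi_i_pow_def b0 by (simp only: of_real_mult mult.assoc)
  qed
  have A0: "A \<noteq> 0" using b0_pos by (simp add: A)
  \<comment> \<open>F stripped of exp(-n e^omega) and of e^(alpha omega), normalised to have limit
    1.\<close>
  define k where "k = (\<lambda>\<omega>. F \<omega> * exp (of_nat n * exp \<omega>) * exp (- Bessel_alpha n * \<omega>) / of_real b0)"
  define h where "h = (\<lambda>\<zeta>. k (\<zeta> - s))"
  define J where "J = (\<lambda>\<zeta>. 1 / A * F (\<zeta> - s))"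
  have Jh: "J = (\<lambda>\<zeta>. exp (c1 * exp \<zeta> + Bessel_alpha n * \<zeta>) * h \<zeta>)"
  proof
    fix \<zeta>
    have "exp (c1 * exp \<zeta> + Bessel_alpha n * \<zeta>) * (exp (of_nat n * exp (\<zeta> - s)) * exp (- Bessel_alpha n * (\<zeta> - s))) = exp (Bessel_alpha n * s)"
      unfolding expw exp_add[symmetric] by (rule arg_cong[of _ _ exp]) (simp add: algebra_simps)
    hence "exp (c1 * exp \<zeta> + Bessel_alpha n * \<zeta>) * h \<zeta> = F (\<zeta> - s) * exp (Bessel_alpha n * s) / of_real b0"
      unfolding h_def k_def by (simp add: mult_ac)
    also have "\<dots> = J \<zeta>" unfolding J_def A using b0_pos by (simp add: exp_minus field_simps)
    finally show "J \<zeta> = exp (c1 * exp \<zeta> + Bessel_alpha n * \<zeta>) * h \<zeta>" by simp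
  qed
  have hJ: "J \<zeta> * exp (- (c1 * exp \<zeta> + Bessel_alpha n * \<zeta>)) = h \<zeta>" for \<zeta>
  proof -
    have "exp X * y * exp (- X) = y" for X y :: complex by (simp add: exp_minus)
    thus ?thesis unfolding Jh .
  qed
  have h_hol: "h holomorphic_on UNIV"
  proof -
    have "k holomorphic_on UNIV" unfolding k_def using F(1) b0_pos by (intro holomorphic_intros) auto
    hence "(k \<circ> (\<lambda>\<zeta>. \<zeta> - s)) holomorphic_on UNIV" by (intro holomorphic_on_compose_gen[of _ _ k UNIV] holomorphic_intros) auto
    thus ?thesis by (simp add: h_def o_def)
  qed
  have J_hol: "J holomorphic_on UNIV" unfolding Jh by (intro holomorphic_intros h_hol)
  have ode: "DP deriv (char_poly n lam) J \<zeta> = c1 ^ n * exp (of_nat n * \<zeta>) * J \<zeta>" for \<zeta>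
  proof -
    \<comment> \<open>The rotation turns (-n)^n into (-n e^(-s))^n, which is c1^n.\<close>
    have "of_nat n * (\<zeta> - s) = of_nat n * (- s) + of_nat n * \<zeta>" by (simp add: algebra_simps)
    hence "exp (of_nat n * (\<zeta> - s)) = exp (- s) ^ n * exp (of_nat n * \<zeta>)" by (simp only: exp_add exp_of_nat_mult)
    hence "(- of_nat n) ^ n * exp (of_nat n * (\<zeta> - s)) = (- of_nat n * exp (- s)) ^ n * exp (of_nat n * \<zeta>)"
      by (simp only: power_mult_distrib mult.assoc)
    also have "- of_nat n * exp (- s) = c1" by (simp add: exps c1_def)
    finally show ?thesis unfolding J_def DP_deriv_shift[OF F(1)] F(3) by (simp add: mult.left_commute)
  qed
  have sol: "Bessel_solution n (\<xi> ^ n) lam J"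
    unfolding Bessel_solution_iff
  proof (intro conjI allI J_hol)
    have "c1 ^ n = \<xi> ^ n * (\<i> * of_nat n) ^ n" by (simp add: c1_def power_mult_distrib)
    thus "DP deriv (char_poly n lam) J \<zeta> = \<xi> ^ n * (\<i> * of_nat n) ^ n * exp (of_nat n * \<zeta>) * J \<zeta>" for \<zeta>
      using ode[of \<zeta>] by (simp only:)
  qed
  have prof: "saddle_profile c lam n \<omega> 0 = F \<omega> * exp (of_nat n * exp \<omega>)" if "\<bar>Im \<omega>\<bar> < pi / 2" for \<omega>
    unfolding saddle_profile_def lam using F(2)[OF that] by (simp add: mult.commute)
  have bnd: "strip_bound \<theta> (pi / real n) 0 h"
  proof (rule strip_boundI)
    fix \<rho>' assume \<rho>': "0 < \<rho>'" "\<rho>' < pi / real n"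
    \<comment> \<open>n >= 2 places the sector of the expansion inside the strip of the saddle point
      estimates.\<close>
    have "pi / real n \<le> pi / 2" using n by (intro divide_left_mono) auto
    hence r2: "\<rho>' < pi / 2" using \<rho>' by linarith
    define q where "q = cos \<rho>'"
    have q: "q > 0" unfolding q_def using r2 \<rho>' by (intro cos_gt_zero) auto
    \<comment> \<open>From Re zeta >= R on, v = sqrt(Re e^omega) is at least V, hence at least 1 and
      at least twice every |Re lambda_l|.\<close>
    define V where "V = max 1 (2 * (\<Sum>l=1..n. \<bar>Re (lam l)\<bar>))"
    define R where "R = ln (V\<^sup>2 / q)"
    define L where "L = exp 2 * (exp 2 * laplace_mass / sqrt q) ^ m"
    have bound: "cmod (h \<zeta>) \<le> (L / b0) * exp (- 0 * Re \<zeta>)" if z: "\<bar>Im \<zeta> - \<theta>\<bar> \<le> \<rho>'" "Re \<zeta> \<ge> R" for \<zeta>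
    proof -
      define \<omega> where "\<omega> = \<zeta> - s"
      have w: "\<bar>Im \<omega>\<bar> \<le> \<rho>'" "Re \<omega> = Re \<zeta>" using z by (simp_all add: \<omega>_def s_def)
      hence w2: "\<bar>Im \<omega>\<bar> < pi / 2" using r2 by linarith
      define v where "v = sqrt (Re (exp \<omega>))"
      have cosw: "q \<le> cos (Im \<omega>)"
        using cos_monotone_0_pi_le[of "\<bar>Im \<omega>\<bar>" \<rho>'] w(1) r2 by (simp add: q_def)
      hence lower: "exp (Re \<omega>) * q \<le> Re (exp \<omega>)" unfolding Re_exp by (intro mult_left_mono) auto
      have V: "V \<ge> 1" by (simp add: V_def)
      have "V\<^sup>2 / q \<le> exp (Re \<omega>)"
      proof -
        have "V\<^sup>2 / q = exp R" unfolding R_def using V q by (subst exp_ln) auto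
        thus ?thesis using z(2) w(2) by simp
      qed
      hence "V\<^sup>2 \<le> exp (Re \<omega>) * q" using q by (simp add: divide_le_eq)
      hence "V\<^sup>2 \<le> Re (exp \<omega>)" using lower by linarith
      hence vV: "V \<le> v" unfolding v_def by (rule real_le_rsqrt)
      hence v1: "v \<ge> 1" using V by linarith
      have v2: "Re (exp \<omega>) = v\<^sup>2"
      proof -
        have "0 \<le> exp (Re \<omega>) * q" using q by simp
        hence "0 \<le> Re (exp \<omega>)" using lower by linarith
        thus ?thesis by (simp only: v_def real_sqrt_pow2)
      qed
      have lamv: "Re (lam l) < c \<and> \<bar>Re (lam l)\<bar> \<le> v / 2" if l: "l \<in> {1..n}" for l
      proof -
        have "\<bar>Re (lam l)\<bar> \<le> (\<Sum>l=1..n. \<bar>Re (lam l)\<bar>)" using l by (intro member_le_sum) auto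
        hence "2 * \<bar>Re (lam l)\<bar> \<le> V" unfolding V_def by linarith
        thus ?thesis using vV c[OF l] by linarith
      qed
      have "cmod (saddle_profile c lam (Suc m) \<omega> 0) \<le> exp 2 * (exp 2 * laplace_mass / v) ^ m"
        using lamv unfolding m by (intro saddle_profile_bound[OF w2 v2 v1])
      hence 1: "cmod (F \<omega> * exp (of_nat n * exp \<omega>)) \<le> exp 2 * (exp 2 * laplace_mass / v) ^ m"
        using prof[OF w2] by (simp only: m)
      \<comment> \<open>-alpha = m/2, so this factor is what compensates v^(-m).\<close>
      have "- Bessel_alpha n * \<omega> = of_nat m * (\<omega> / 2)" unfolding Bessel_alpha_def m by simp
      hence 2: "cmod (exp (- Bessel_alpha n * \<omega>)) = exp (Re \<omega> / 2) ^ m"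
        by (simp only: exp_of_nat_mult norm_power) simp
      have "sqrt (exp (Re \<omega>) * q) \<le> v" unfolding v_def using lower by (rule real_sqrt_le_mono)
      moreover have "sqrt (exp (Re \<omega>)) = exp (Re \<omega> / 2)"
        by (rule real_sqrt_unique) (auto simp: exp_double[symmetric])
      ultimately have vq: "exp (Re \<omega> / 2) * sqrt q \<le> v" by (simp add: real_sqrt_mult)
      have I0: "laplace_mass \<ge> 0" by (intro Bochner_Integration.integral_nonneg) auto
      have "cmod (k \<omega>) = cmod (F \<omega> * exp (of_nat n * exp \<omega>)) * exp (Re \<omega> / 2) ^ m / b0"
        unfolding k_def norm_divide norm_mult[of "F \<omega> * _"] 2 using b0_pos by simp
      also have "\<dots> \<le> exp 2 * (exp 2 * laplace_mass / v) ^ m * exp (Re \<omega> / 2) ^ m / b0"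
        using 1 b0_pos by (intro divide_right_mono mult_right_mono) auto
      also have "\<dots> = exp 2 * (exp 2 * laplace_mass * (exp (Re \<omega> / 2) / v)) ^ m / b0"
        by (simp add: power_mult_distrib[symmetric] mult.assoc)
      also have "\<dots> \<le> exp 2 * (exp 2 * laplace_mass * (1 / sqrt q)) ^ m / b0"
      proof -
        have "exp (Re \<omega> / 2) \<le> v / sqrt q" using vq q by (subst pos_le_divide_eq) auto
        hence "exp (Re \<omega> / 2) / v \<le> (v / sqrt q) / v" using v1 by (intro divide_right_mono) auto
        hence le: "exp (Re \<omega> / 2) / v \<le> 1 / sqrt q" using v1 by simp
        have nn: "0 \<le> exp 2 * laplace_mass" using I0 by (intro mult_nonneg_nonneg exp_ge_zero)
        have "0 \<le> exp 2 * laplace_mass * (exp (Re \<omega> / 2) / v)"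
          using v1 by (intro mult_nonneg_nonneg[OF nn] divide_nonneg_nonneg exp_ge_zero) auto
        hence "(exp 2 * laplace_mass * (exp (Re \<omega> / 2) / v)) ^ m \<le> (exp 2 * laplace_mass * (1 / sqrt q)) ^ m"
          by (rule power_mono[OF mult_left_mono[OF le nn]])
        thus ?thesis using b0_pos by (intro divide_right_mono mult_left_mono) (auto simp only: exp_ge_zero less_imp_le)
      qed
      finally show ?thesis by (simp add: h_def \<omega>_def L_def)
    qed
    show "\<exists>K R. \<forall>\<zeta>. \<bar>Im \<zeta> - \<theta>\<bar> \<le> \<rho>' \<and> R \<le> Re \<zeta> \<longrightarrow> cmod (h \<zeta>) \<le> K * exp (- 0 * Re \<zeta>)"
    proof (rule exI[of _ "L / b0"], rule exI[of _ R], intro allI impI)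
      fix \<zeta> assume "\<bar>Im \<zeta> - \<theta>\<bar> \<le> \<rho>' \<and> R \<le> Re \<zeta>"
      thus "cmod (h \<zeta>) \<le> (L / b0) * exp (- 0 * Re \<zeta>)" by (intro bound) (elim conjE, assumption)+
    qed
  qed
  have lim: "((\<lambda>x. h (Complex x \<theta>)) \<longlongrightarrow> 1) at_top"
  proof -
    have "((\<lambda>v. saddle_profile c lam (Suc m) (of_real (2 * ln v)) (0 / v) * of_real (v ^ m)) \<longlongrightarrow> of_real b0) at_top"
      using saddle_profile_limit[of m lam c 0] c unfolding b0_def m by blast
    \<comment> \<open>Substitution v = e^(x/2), so that omega = 2 ln v is x.\<close>
    moreover have "filterlim (\<lambda>x::real. exp (x / 2)) at_top at_top" by real_asymp
    ultimately have "((\<lambda>x. saddle_profile c lam (Suc m) (of_real (2 * ln (exp (x / 2)))) (0 / exp (x / 2)) * of_real (exp (x / 2) ^ m)) \<longlongrightarrow> of_real b0) at_top"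
      by (rule filterlim_compose)
    from tendsto_divide[OF this tendsto_const[of "of_real b0"]]
    have L: "((\<lambda>x. saddle_profile c lam n (of_real x) 0 * of_real (exp (x / 2) ^ m) / of_real b0) \<longlongrightarrow> 1) at_top"
      using b0_pos by (simp add: m)
    have "saddle_profile c lam n (of_real x) 0 * of_real (exp (x / 2) ^ m) / of_real b0 = h (Complex x \<theta>)" for x
    proof -
      have "Complex x \<theta> - s = of_real x" by (simp add: s_def complex_eq_iff)
      moreover have "exp (- Bessel_alpha n * of_real x) = of_real (exp (x / 2) ^ m)"
      proof -
        have "- Bessel_alpha n * of_real x = of_nat m * of_real (x / 2)" unfolding Bessel_alpha_def m by simp
        thus ?thesis by (simp only: exp_of_nat_mult exp_of_real of_real_power)
      qed
      ultimately show ?thesis using prof[of "of_real x"] by (simp add: h_def k_def)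
    qed
    with L show ?thesis by simp
  qed
  have c0: "c1 \<noteq> 0" using n \<xi> by (auto simp: c1_def)
  have n1: "n \<ge> 1" using n by simp
  have exp_J: "has_asymptotic_expansion J (\<i> * of_nat n * \<xi>) (Bessel_alpha n) (B_asym n lam \<xi>) (pi / 2 - Arg \<xi>) (pi / real n)"
    unfolding has_asymptotic_expansion_iff_strip_bound c1_def[symmetric] hJ \<theta>_def[symmetric] B_asym_eq_B_rec[OF n1 lam \<xi>]
  proof
    fix M
    show "strip_bound \<theta> (pi / real n) (real M) (\<lambda>\<zeta>. h \<zeta> - (\<Sum>m<M. B_rec n c1 m lam * exp (- of_real (real m) * \<zeta>)))"
      using ode n by (intro bessel_asymptotic_bootstrap[OF n1 c0 lam h_hol _ bnd _ lim]) (auto simp: Jh)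
  qed
  have "J_Bessel n lam \<xi> = J"
    unfolding J_Bessel_def Bessel_alpha_def[symmetric]
  proof (rule the_equality)
    fix w assume "Bessel_solution n (\<xi> ^ n) lam w \<and>
      has_asymptotic_expansion w (\<i> * of_nat n * \<xi>) (Bessel_alpha n) (B_asym n lam \<xi>) (pi / 2 - Arg \<xi>) (pi / real n)"
    thus "w = J" using Bessel_solution_unique[OF n1 \<xi> _ sol _ exp_J] by blast
  qed (use sol exp_J in blast)
  thus ?thesis using A0 unfolding A_def[symmetric] by (simp add: J_def s)
qed

theorem theorem12p1:
  fixes n :: nat and lam :: "nat \<Rightarrow> complex" and \<xi> :: complex
  assumes "n \<ge> 2"
    and "(\<Sum>l=1..n. lam l) = 0"
    and "\<xi> \<in> {1, - 1}"
  shows "(\<forall>\<zeta> :: ucover. H_Bessel \<xi> n lam \<zeta> =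
            of_real (real n powr (- 1 / 2)) * two_pi_i_pow \<xi> ((real n - 1) / 2) * J_Bessel n lam \<xi> \<zeta>)
       \<and> (\<forall>m. B_asym n lam \<xi> m = (\<xi> * \<i>) powi (- int m) * B_poly n lam m)"
proof (intro conjI allI)
  note n = assms(1) and lam = assms(2) and \<xi> = assms(3)
  \<comment> \<open>An abscissa to the right of all poles.\<close>
  define c where "c = (\<Sum>l=1..n. \<bar>Re (lam l)\<bar>) + 1"
  have c: "Re (lam l) < c" if "l \<in> {1..n}" for l
  proof -
    have "\<bar>Re (lam l)\<bar> \<le> (\<Sum>l=1..n. \<bar>Re (lam l)\<bar>)" using that by (intro member_le_sum) auto
    thus ?thesis unfolding c_def by linarith
  qed
  have n1: "n \<ge> 1" using n by simp
  obtain F where F: "F holomorphic_on UNIV"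
    "\<forall>\<omega>. \<bar>Im \<omega>\<bar> < pi / 2 \<longrightarrow> F \<omega> = vline c (Gamma_prod n lam) (of_nat n * \<omega>)"
    "\<forall>\<omega>. DP deriv (char_poly n lam) F \<omega> = (- of_nat n) ^ n * exp (of_nat n * \<omega>) * F \<omega>"
    by (rule vline_Gamma_prod_entire_extension[where lam = lam and c = c, OF _ n1]) (rule c)
  show "H_Bessel \<xi> n lam \<zeta> =
      of_real (real n powr (- 1 / 2)) * two_pi_i_pow \<xi> ((real n - 1) / 2) * J_Bessel n lam \<xi> \<zeta>" for \<zeta>
  proof -
    have "H_Bessel \<xi> n lam \<zeta> = F (\<zeta> - \<i> * \<xi> * of_real (pi / 2))"
      by (rule H_Bessel_eq[where c = c, OF n lam \<xi> _ F(1)]) (use c F(2) in blast)+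
    also have "\<dots> = of_real (real n powr (- 1 / 2)) * two_pi_i_pow \<xi> ((real n - 1) / 2) * J_Bessel n lam \<xi> \<zeta>"
      by (rule J_Bessel_eq[where c = c, OF n lam \<xi> _ F(1)]) (use c F(2,3) in blast)+
    finally show ?thesis .
  qed
  fix m
  have \<xi>2: "\<xi> * \<xi> = 1" using \<xi> by auto
  have "B_asym n lam \<xi> m = B_rec n (of_nat n * (\<i> * \<xi>)) m lam"
    unfolding B_asym_eq_B_rec[OF n1 lam \<xi>] by (simp add: mult.left_commute mult.assoc)
  also have "\<dots> = (- (\<i> * \<xi>)) ^ m * B_poly n lam m"
    using \<xi>2 by (intro B_rec_eq_B_poly n lam) (simp add: mult.left_commute mult.assoc)
  \<comment> \<open>xi^2 = 1 makes -i xi the reciprocal of xi i, which gives the power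
    (+-i)^(-m).\<close>
  also have "- (\<i> * \<xi>) = inverse (\<xi> * \<i>)"
    using \<xi>2 by (intro inverse_unique[symmetric]) (simp add: mult.left_commute mult.assoc)
  finally show "B_asym n lam \<xi> m = (\<xi> * \<i>) powi (- int m) * B_poly n lam m"
    by (simp only: power_int_minus power_int_of_nat power_inverse)
qed

end
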